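(* Let $A_N$ be a generalised Wigner matrix whose variance profile satisfies assumptions (L.1), (L.2), (L.3) below, and let $\Delta_N^0=\frac{1}{\sqrt N}(\Delta_N-\mathbb E\Delta_N)$ be its centered, scaled Laplacian. Then there exists a unique symmetric probability measure $\nu$ on $\mathbb R$ (uniquely determined by its moments) such that $$\lim_{N\to\infty}\mathrm{ESD}(\Delta_N^0)=\nu\quad\text{weakly in probability.}$$ Moreover, if there exists an open set $U\subseteq[0,1]^2$ such that $W>0$ on $U$ (where $W$ is the limiting graphon in (L.3)), then $\nu$ has unbounded support.
   Context: For each $N$, $\{X_{i,j}: 1\le i\le j\le N\}$ (depending on $N$) are independent real random variables with finite mean and variance, and $A_N=(X_{i\wedge j,i\vee j})_{i,j=1}^N$ is the corresponding symmetric $N\times N$ matrix (a "generalised Wigner matrix"). Its Laplacian is $\Delta_N(i,j)=A_N(i,j)$ for $i\neq j$ and $\Delta_N(i,i)=-\sum_{k\ne i}A_N(i,k)$. Put $\sigma_{i,j}^2=\mathrm{Var}(X_{i\wedge j,i\vee j})$. For a symmetric matrix $M$ with eigenvalues $\lambda_1,\dots,\lambda_N$, $\mathrm{ESD}(M)=\frac1N\sum_i\delta_{\lambda_i}$; "weakly in probability" means $\int g\,d\mathrm{ESD}\to\int g\,d\nu$ in probability for every bounded continuous $g$. A graphon is a measurable symmetric $W:[0,1]^2\to[0,1]$. For graphons $W_1,W_2$, $d_\Box(W_1,W_2)=\sup_{S,T}|\int_{S\times T}(W_1-W_2)|$ over measurable $S,T\subseteq[0,1]$, and $\delta_\Box(W_1,W_2)=\inf_{\sigma}d_\Box(W_1,W_2^\sigma)$,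 infimum over measure-preserving bijections $\sigma$ of $[0,1]$, $W_2^\sigma(x,y)=W_2(\sigma(x),\sigma(y))$. With $I_j=[\frac{j-1}{N},\frac jN)$ for $j<N$ and $I_N=[1-\frac1N,1]$, the empirical graphon of the variance profile is $W_N(x,y)=\sigma_{i,j}^2$ for $(x,y)\in I_i\times I_j$. Assumptions: (L.1) $\sigma_{i,j}^2\le 1$ for all $1\le i,j\le N$, $N\ge1$. (L.2) For every $\eta>0$, $\lim_{N\to\infty}\frac1{N^2}\sum_{1\le i,j\le N}\mathbb E\big[|X_{i,j}-\mathbb EX_{i,j}|^2\mathbf 1(|X_{i,j}-\mathbb EX_{i,j}|\ge\eta\sqrt N)\big]=0$. (L.3) There is a graphon $W$ with $\delta_\Box(W_N,W)\to0$. *)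

theory Defs
  imports "HOL-Probability.Probability" "Jordan_Normal_Form.Char_Poly"
begin

definition to_mat :: "nat \<Rightarrow> (nat \<Rightarrow> nat \<Rightarrow> real) \<Rightarrow> real Matrix.mat" where
  "to_mat N M = Matrix.mat N N (\<lambda>(i, j). M (Suc i) (Suc j))"

definition eigenvalues_mset :: "nat \<Rightarrow> (nat \<Rightarrow> nat \<Rightarrow> real) \<Rightarrow> real multiset" where
  "eigenvalues_mset N M = proots (char_poly (to_mat N M))"

definition ESD :: "nat \<Rightarrow> (nat \<Rightarrow> nat \<Rightarrow> real) \<Rightarrow> real measure" where
  "ESD N M = measure_pmf (pmf_of_multiset (eigenvalues_mset N M))"

text \<open>X N i j is the entry X_{i,j} of the N-th matrix (only used for i \<le> j).\<close>
definition wigner :: "(nat \<Rightarrow> nat \<Rightarrow> nat \<Rightarrow> 'a \<Rightarrow> real) \<Rightarrow> nat \<Rightarrow> 'a \<Rightarrow> nat \<Rightarrow> nat \<Rightarrow> real" where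
  "wigner X N \<omega> i j = X N (min i j) (max i j) \<omega>"

definition laplacian :: "nat \<Rightarrow> (nat \<Rightarrow> nat \<Rightarrow> real) \<Rightarrow> nat \<Rightarrow> nat \<Rightarrow> real" where
  "laplacian N A i j = (if i \<noteq> j then A i j else - (\<Sum>k\<in>{1..N} - {i}. A i k))"

definition exp_laplacian :: "'a measure \<Rightarrow> (nat \<Rightarrow> nat \<Rightarrow> nat \<Rightarrow> 'a \<Rightarrow> real) \<Rightarrow> nat \<Rightarrow> nat \<Rightarrow> nat \<Rightarrow> real" where
  "exp_laplacian P X N i j = (\<integral>\<omega>. laplacian N (wigner X N \<omega>) i j \<partial>P)"

definition centered_laplacian :: "'a measure \<Rightarrow> (nat \<Rightarrow> nat \<Rightarrow> nat \<Rightarrow> 'a \<Rightarrow> real) \<Rightarrow> nat \<Rightarrow> 'a \<Rightarrow> nat \<Rightarrow> nat \<Rightarrow> real" where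
  "centered_laplacian P X N \<omega> i j =
     (laplacian N (wigner X N \<omega>) i j - exp_laplacian P X N i j) / sqrt (real N)"

definition var_profile :: "'a measure \<Rightarrow> (nat \<Rightarrow> nat \<Rightarrow> nat \<Rightarrow> 'a \<Rightarrow> real) \<Rightarrow> nat \<Rightarrow> nat \<Rightarrow> nat \<Rightarrow> real" where
  "var_profile P X N i j = prob_space.variance P (X N (min i j) (max i j))"

definition unit_sq :: "(real \<times> real) set" where
  "unit_sq = {0..1} \<times> {0..1}"

definition graphon :: "(real \<times> real \<Rightarrow> real) \<Rightarrow> bool" where
  "graphon W \<longleftrightarrow> W \<in> borel_measurable borel \<and>
     (\<forall>x\<in>{0..1}. \<forall>y\<in>{0..1}. W (x, y) = W (y, x) \<and> 0 \<le> W (x, y) \<and> W (x, y) \<le> 1)"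

definition cut_norm_dist :: "(real \<times> real \<Rightarrow> real) \<Rightarrow> (real \<times> real \<Rightarrow> real) \<Rightarrow> real" where
  "cut_norm_dist W1 W2 =
     (SUP ST \<in> {(S, T). S \<in> sets borel \<and> S \<subseteq> {0..1} \<and> T \<in> sets borel \<and> T \<subseteq> {0..1}}.
        \<bar>LINT p:(fst ST \<times> snd ST)|lborel. W1 p - W2 p\<bar>)"

definition unit_interval_measure :: "real measure" where
  "unit_interval_measure = restrict_space lborel {0..1}"

definition mp_map :: "(real \<Rightarrow> real) \<Rightarrow> bool" where
  "mp_map f \<longleftrightarrow> f \<in> measurable unit_interval_measure unit_interval_measure \<and>
     distr unit_interval_measure unit_interval_measure f = unit_interval_measure"

definition mp_bij :: "(real \<Rightarrow> real) \<Rightarrow> bool" where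
  "mp_bij \<sigma> \<longleftrightarrow> bij_betw \<sigma> {0..1} {0..1} \<and> mp_map \<sigma> \<and> mp_map (inv_into {0..1} \<sigma>)"

definition cut_dist :: "(real \<times> real \<Rightarrow> real) \<Rightarrow> (real \<times> real \<Rightarrow> real) \<Rightarrow> real" where
  "cut_dist W1 W2 = (INF \<sigma> \<in> Collect mp_bij. cut_norm_dist W1 (\<lambda>(x, y). W2 (\<sigma> x, \<sigma> y)))"

text \<open>Index j with x \<in> I_j, where I_j = [(j-1)/N, j/N) for j < N and I_N = [1 - 1/N, 1].\<close>
definition block_index :: "nat \<Rightarrow> real \<Rightarrow> nat" where
  "block_index N x = (if x = 1 then N else nat \<lfloor>real N * x\<rfloor> + 1)"

definition empirical_graphon :: "nat \<Rightarrow> (nat \<Rightarrow> nat \<Rightarrow> real) \<Rightarrow> real \<times> real \<Rightarrow> real" where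
  "empirical_graphon N s = (\<lambda>(x, y). if x \<in> {0..1} \<and> y \<in> {0..1}
      then s (block_index N x) (block_index N y) else 0)"

definition symmetric_measure :: "real measure \<Rightarrow> bool" where
  "symmetric_measure \<nu> \<longleftrightarrow> distr \<nu> borel uminus = \<nu>"

definition moment_determinate :: "real measure \<Rightarrow> bool" where
  "moment_determinate \<nu> \<longleftrightarrow> (\<forall>k::nat. integrable \<nu> (\<lambda>x. x ^ k)) \<and>
     (\<forall>\<mu>. real_distribution \<mu> \<longrightarrow>
        (\<forall>k::nat. integrable \<mu> (\<lambda>x. x ^ k) \<and> (\<integral>x. x ^ k \<partial>\<mu>) = (\<integral>x. x ^ k \<partial>\<nu>)) \<longrightarrow> \<mu> = \<nu>)"

definition measure_support :: "real measure \<Rightarrow> real set" where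
  "measure_support \<nu> = {x. \<forall>e>0. emeasure \<nu> (ball x e) > 0}"

definition weakly_in_probability ::
  "(nat \<Rightarrow> 'a measure) \<Rightarrow> (nat \<Rightarrow> 'a \<Rightarrow> real measure) \<Rightarrow> real measure \<Rightarrow> bool" where
  "weakly_in_probability P \<mu> \<nu> \<longleftrightarrow>
     (\<forall>g::real \<Rightarrow> real. continuous_on UNIV g \<and> bounded (range g) \<longrightarrow>
       (\<forall>\<epsilon>>0.
          (\<forall>N. {\<omega> \<in> space (P N). \<bar>(\<integral>x. g x \<partial>\<mu> N \<omega>) - (\<integral>x. g x \<partial>\<nu>)\<bar> > \<epsilon>} \<in> sets (P N)) \<and>
          (\<lambda>N. measure (P N) {\<omega> \<in> space (P N). \<bar>(\<integral>x. g x \<partial>\<mu> N \<omega>) - (\<integral>x. g x \<partial>\<nu>)\<bar> > \<epsilon>})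
            \<longlonglongrightarrow> 0))"

end

(* Both the convergence and the shape of the limit are obtained from resolvents, without counting
   moments. A centered Laplacian is a sum of rank-one matrices y_e v_e v_e^T over pairs e, so that its
   resolvent trace is a bounded function of the y_e with explicit derivatives. A Lindeberg exchange
   replaces the entries by random signs with the same variances, and Efron-Stein gives concentration.
   For signs, the mean resolvent trace is Lipschitz in the cut norm of the variance profile: the part of
   the derivative that is not bilinear in the profile is small by a Poincare inequality on the cube.
   A profile that factors through K types may therefore be blown up to a larger vertex set, and two
   profiles close to the same graphon become comparable on a common blow-up. Hence the Stieltjes
   transforms form a Cauchy sequence. Exponential moment bounds identify the limit by its moments, and
   Peierls' inequality bounds exponential moments from below, which forces unbounded support. *)
theory Submission
  imports Defs "HOL-Combinatorics.Transposition"
begin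

text \<open>Two sizes N have no common vertex set, and the cut distance allows a rearrangement that
  changes with N, so traces cannot be compared entry by entry. Each vertex is therefore split
  fractionally among kap types, where the reference profile with kap types is a fixed member of the
  sequence itself. In the blow-up step, M disjoint copies of a model are joined into one model with
  the same row sums. Equal row sums cancel the term local to a vertex, and what is left pairs
  averages over the copies through a kernel with zero row and column sums. The copies are
  exchangeable, so only fluctuations enter, and this is where the Poincare inequality is used;
  off-diagonal resolvent entries are disposed of by their square summability along rows. Since kap
  is fixed, the loss (kap^2 + 1)/sqrt N is harmless. Signs are convenient because flipping one of
  them is an exact rank-one change, so integration by parts and moment recursions are finite
  identities. Coordinates are indexed by ordered pairs: the off-diagonal entry at {i, j} has
  variance t (i, j) + t (j, i), which explains the factors 1/2 in symmetric profiles.\<close>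

section \<open>Spectral theorem for real symmetric matrices on a finite index set\<close>

definition spectral :: "'i set => ('i => 'i => real) => ('i => real) => ('i => 'i => real) => bool" where
 "spectral I A lam u \<longleftrightarrow>
 (\<forall>k\<in>I. \<forall>l\<in>I. (\<Sum>i\<in>I. u k i * u l i) = of_bool (k = l)) \<and>
 (\<forall>i\<in>I. \<forall>j\<in>I. (\<Sum>k\<in>I. u k i * u k j) = of_bool (i = j)) \<and>
 (\<forall>k\<in>I. \<forall>i\<in>I. (\<Sum>j\<in>I. A i j * u k j) = lam k * u k i)"

text \<open>Partial eigenbasis for the induction behind \<open>spectral_exists\<close>: K grows
  inside I, which labels coordinates and eigenpairs alike, so that no ordering of the eigenvalues is
  ever chosen. The completeness relation of \<open>spectral\<close> is left out here and recovered
  by counting once K = I.\<close>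

definition orthonormal_eigen :: "'i set => ('i => 'i => real) => 'i set => ('i => real) => ('i => 'i => real) => bool" where
 "orthonormal_eigen I A K lam u \<longleftrightarrow>
 (\<forall>k\<in>K. \<forall>l\<in>K. (\<Sum>i\<in>I. u k i * u l i) = of_bool (k = l)) \<and>
 (\<forall>k\<in>K. \<forall>i\<in>I. (\<Sum>j\<in>I. A i j * u k j) = lam k * u k i)"

lemma sum_of_bool_mult_left:
 fixes f :: "'i => 'a :: semiring_1"
 assumes "finite I" "i : I"
 shows "(\<Sum>j\<in>I. of_bool (i = j) * f j) = f i" "(\<Sum>j\<in>I. of_bool (j = i) * f j) = f i"
 "(\<Sum>j\<in>I. f j * of_bool (i = j)) = f i" "(\<Sum>j\<in>I. f j * of_bool (j = i)) = f i"
proof -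
 have e: "of_bool (i = j) * f j = (if j = i then f j else 0)" "of_bool (j = i) * f j = (if j = i then f j else 0)"
 "f j * of_bool (i = j) = (if j = i then f j else 0)"  "f j * of_bool (j = i) = (if j = i then f j else 0)" for j
 by auto
 show "(\<Sum>j\<in>I. of_bool (i = j) * f j) = f i" "(\<Sum>j\<in>I. of_bool (j = i) * f j) = f i"
 "(\<Sum>j\<in>I. f j * of_bool (i = j)) = f i" "(\<Sum>j\<in>I. f j * of_bool (j = i)) = f i"
 unfolding e using assms by simp_all
qed

text \<open>\<open>x\<close> is what remains of the i-th standard basis vector after its projection
  onto the span of the \<open>u k\<close>. Its squared norm detects directions not yet reached: it
  is positive for some i while K is a proper subset, and zero for every i when K = I.\<close>

lemma bessel_residual:
 fixes u :: "'i => 'i => real"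
 assumes fin: "finite I" and K: "K \<subseteq> I" and i: "i : I"
 and on: "\<forall>k\<in>K. \<forall>l\<in>K. (\<Sum>i\<in>I. u k i * u l i) = of_bool (k = l)"
 defines "x \<equiv> %j. of_bool (i = j)-(\<Sum>k\<in>K. u k i * u k j)"
 shows "l : K ==> (\<Sum>j\<in>I. x j * u l j) = 0"
 and "(\<Sum>j\<in>I. (x j)^2) = 1-(\<Sum>k\<in>K. (u k i)^2)"
proof -
 have finK: "finite K" using fin K finite_subset by blast
 show orth: "(\<Sum>j\<in>I. x j * u l j) = 0" if l: "l : K" for l
 proof -
 have "(\<Sum>j\<in>I. x j * u l j) = (\<Sum>j\<in>I. of_bool (i = j) * u l j)-(\<Sum>j\<in>I. \<Sum>k\<in>K. u k i*(u k j * u l j))"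
 unfolding x_def by (simp add: left_diff_distrib sum_subtractf sum_distrib_right mult.assoc)
 also have "(\<Sum>j\<in>I. \<Sum>k\<in>K. u k i*(u k j * u l j)) = (\<Sum>k\<in>K. u k i*(\<Sum>j\<in>I. u k j * u l j))"
 by (subst sum.swap) (simp add: sum_distrib_left)
 also have "... = (\<Sum>k\<in>K. u k i * of_bool (k = l))" using on l by simp
 also have "... = u l i" using sum_of_bool_mult_left(4)[OF finK l] .
 also have "(\<Sum>j\<in>I. of_bool (i = j) * u l j) = u l i" using sum_of_bool_mult_left(1)[OF fin i] .
 finally show ?thesis by simp
 qed
 have "(\<Sum>j\<in>I. (x j)^2) = (\<Sum>j\<in>I. x j * of_bool (i = j))-(\<Sum>j\<in>I. \<Sum>k\<in>K. u k i*(x j * u k j))"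
 by (subst (1) x_def) (simp add: power2_eq_square x_def algebra_simps sum_subtractf sum_distrib_left sum.distrib)
 also have "(\<Sum>j\<in>I. \<Sum>k\<in>K. u k i*(x j * u k j)) = (\<Sum>k\<in>K. u k i*(\<Sum>j\<in>I. x j * u k j))"
 by (subst sum.swap) (simp add: sum_distrib_left)
 also have "... = 0" using orth by simp
 also have "(\<Sum>j\<in>I. x j * of_bool (i = j)) = x i" using sum_of_bool_mult_left(3)[OF fin i] .
 finally show "(\<Sum>j\<in>I. (x j)^2) = 1-(\<Sum>k\<in>K. (u k i)^2)" by (simp add: x_def power2_eq_square)
qed

text \<open>Tychonoff: these functions form a product of intervals and singletons. Working in a
  function space instead of a Euclidean space lets the index type stay arbitrary.\<close>

lemma compact_functions_on_finite:
 "compact {x :: 'i => real. (\<forall>i\<in>I. x i : {-1..1}) \<and> (\<forall>i. i \<notin> I \<longrightarrow> x i = 0)}" (is "compact ?C")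
proof -
 have "?C = Pi\<^sub>E UNIV (%i. if i : I then {-1..1} else {0})"
 by (auto simp: PiE_def Pi_def split: if_splits)
 moreover have "compactin (product_topology (%i. euclidean) UNIV) (Pi\<^sub>E UNIV (%i :: 'i. if i : I then {-1..1} else {0 :: real}))"
 by (auto simp: compactin_PiE compactin_euclidean_iff)
 ultimately show ?thesis by (simp add: euclidean_product_topology compactin_euclidean_iff)
qed

lemma quadratic_nonpos_imp_zero:
 fixes a c :: real
 assumes "!!t. 2 * t * a + t^2 * c <= 0" shows "a = 0"
proof (rule ccontr)
 assume a: "a ~= 0"
 \<comment> \<open>With this t the linear term equals 2 t^2 (|c| + 1), which exceeds t^2
   |c|.\<close>
 define t where "t = a/(\<bar>c\<bar>+1)"
 have "t^2 * c >=-(t^2*\<bar>c\<bar>)" by (metis abs_ge_minus_self abs_mult abs_power2 minus_le_iff)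
 moreover have "t * a = t^2*(\<bar>c\<bar>+1)"
 proof -
 have "a = t*(\<bar>c\<bar>+1)" by (simp add: t_def)
 then have "t * a = t * t*(\<bar>c\<bar>+1)" by (metis mult.assoc)
 then show ?thesis by (simp add: power2_eq_square)
 qed
 moreover have "t^2 > 0" using a by (simp add: t_def)
 ultimately have "2 * t * a + t^2 * c > 0" 
 using mult_nonneg_nonneg[of "t^2" "\<bar>c\<bar>"] unfolding distrib_left mult.assoc by linarith
 then show False using assms[of t] by simp
qed

text \<open>Variational argument: maximise the Rayleigh quotient over unit vectors orthogonal to the
  \<open>u k\<close>. At a maximiser w the defect r = A w - mu w is orthogonal to w and to all
  \<open>u k\<close>, so w + t r is an admissible competitor, and its first-order gain 2 t |r|^2 has
  to vanish.\<close>

lemma orthonormal_eigen_extend: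
 fixes A :: "'i => 'i => real"
 assumes fin: "finite I" and sym: "!!i j. i : I ==> j : I ==> A i j = A j i"
 and K: "K \<subset> I" and oe: "orthonormal_eigen I A K lam u"
 shows "\<exists>mu w. (\<Sum>i\<in>I. w i * w i) = 1 \<and> (\<forall>k\<in>K. (\<Sum>i\<in>I. w i * u k i) = 0) \<and>
 (\<forall>i\<in>I. (\<Sum>j\<in>I. A i j * w j) = mu * w i)"
proof -
 have finK: "finite K" using fin K finite_subset by blast
 define ip where "ip = (%x y :: 'i => real. \<Sum>i\<in>I. x i * y i)"
 define Av where "Av = (%x :: 'i => real. %i. if i : I then (\<Sum>j\<in>I. A i j * x j) else 0)"
 have on: "\<forall>k\<in>K. \<forall>l\<in>K. (\<Sum>i\<in>I. u k i * u l i) = of_bool (k = l)"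
 and ev: "!!k i. k : K ==> i : I ==> (\<Sum>j\<in>I. A i j * u k j) = lam k * u k i"
 using oe by (auto simp: orthonormal_eigen_def)
 have comm: "ip x y = ip y x" for x y by (simp add: ip_def mult.commute)
 have lin: "ip (%i. x i + t * y i) z = ip x z + t * ip y z" for x y z t
 by (simp add: ip_def algebra_simps sum.distrib sum_distrib_left)
 have lin2: "ip z (%i. x i + t * y i) = ip z x + t * ip z y" for x y z t
 using lin comm by metis
 have Alin: "Av (%i. x i + t * y i) = (%i. Av x i + t*Av y i)" for x y t
 by (rule ext) (simp add: Av_def algebra_simps sum.distrib sum_distrib_left)
 have Asym: "ip x (Av y) = ip (Av x) y" for x y
 proof -
 have "ip x (Av y) = (\<Sum>i\<in>I. \<Sum>j\<in>I. x i*(A i j * y j))" by (simp add: ip_def Av_def sum_distrib_left)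
 also have "... = (\<Sum>j\<in>I. \<Sum>i\<in>I. x i*(A i j * y j))" by (rule sum.swap)
 also have "... = (\<Sum>j\<in>I. \<Sum>i\<in>I. (A j i * x i) * y j)"
 by (intro sum.cong refl) (simp add: sym mult_ac)
 also have "... = ip (Av x) y" by (simp add: ip_def Av_def sum_distrib_right)
 finally show ?thesis .
 qed
 have Au: "ip (Av x) (u k) = lam k * ip x (u k)" if "k : K" for k x
 proof -
 have "ip (Av x) (u k) = ip x (Av (u k))" by (simp add: Asym)
 also have "... = (\<Sum>i\<in>I. x i*(lam k * u k i))" by (simp add: ip_def Av_def ev[OF that])
 finally show ?thesis by (simp add: ip_def sum_distrib_left mult_ac)
 qed
 define S where "S = {x. (\<forall>i. i \<notin> I \<longrightarrow> x i = 0) \<and> ip x x = 1 \<and> (\<forall>k\<in>K. ip x (u k) = 0)}"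
 have normalise: "\<exists>c>0. (%i. c * x i) : S \<and> c^2 * ip x x = 1"
 if "!!i. i \<notin> I ==> x i = 0" "ip x x > 0" "!!k. k : K ==> ip x (u k) = 0" for x
 proof (intro exI[of _ "1/sqrt (ip x x)"] conjI)
 have "ip (%i. c * x i) (%i. c * x i) = c^2 * ip x x" "ip (%i. c * x i) y = c * ip x y" for c y
 by (simp_all add: ip_def sum_distrib_left power2_eq_square mult_ac)
 note sc = this
 have "(1/sqrt (ip x x))^2 * ip x x = 1" using that(2) by (simp add: power_divide)
 then show "(%i. 1/sqrt (ip x x) * x i) : S"
 unfolding S_def mem_Collect_eq sc using that by auto
 qed (use that in \<open>auto simp: power_divide\<close>)
 have Sne: "S ~= {}"
 proof -
 \<comment> \<open>The projection onto the span has trace card K < card I, so some standard basis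
   vector is not contained in the span.\<close>
 have "(\<Sum>i\<in>I. \<Sum>k\<in>K. (u k i)^2) = (\<Sum>k\<in>K. \<Sum>i\<in>I. u k i * u k i)"
 by (subst sum.swap) (simp add: power2_eq_square)
 also have "... = real (card K)" using on by simp
 also have "... < real (card I)" using psubset_card_mono[OF fin K] by simp
 also have "... = (\<Sum>i\<in>I. 1)" by simp
 finally obtain i where i: "i : I" "(\<Sum>k\<in>K. (u k i)^2) < 1"
 using sum_mono[of I "%_. 1::real" "%i. \<Sum>k\<in>K. (u k i)^2"] by (meson not_le)
 define x where "x = (%j. of_bool (i = j)-(\<Sum>k\<in>K. u k i * u k j))"
 note br = bessel_residual[OF fin psubset_imp_subset[OF K] i(1) on, folded x_def]
 define x' where "x' = (%j. if j : I then x j else 0)"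
 have "ip x' y = (\<Sum>j\<in>I. x j * y j)" "ip x' x' = (\<Sum>j\<in>I. (x j)^2)" for y
 by (simp_all add: ip_def x'_def power2_eq_square)
 then have "\<exists>c>0. (%i. c * x' i) : S \<and> c^2 * ip x' x' = 1"
 using br i by (intro normalise) (auto simp: x'_def x_def)
 then show ?thesis by blast
 qed
 have contip: "continuous_on UNIV (%x. ip x y)" for y unfolding ip_def by (intro continuous_intros) simp_all
 have contip2: "continuous_on UNIV (%x. ip x x)" unfolding ip_def by (intro continuous_intros) simp_all
 have contA: "continuous_on UNIV (%x. ip x (Av x))"
 proof -
 have "(%x. ip x (Av x)) = (%x. \<Sum>i\<in>I. x i*(\<Sum>j\<in>I. A i j * x j))" by (auto simp: ip_def Av_def)
 then show ?thesis by (simp only:, intro continuous_intros) simp_all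
 qed
 have compS: "compact S"
 proof -
 let ?C = "{x :: 'i => real. (\<forall>i\<in>I. x i : {-1..1}) \<and> (\<forall>i. i \<notin> I \<longrightarrow> x i = 0)}"
 have "closed ({x. ip x x = 1} \<inter> (\<Inter>k\<in>K. {x. ip x (u k) = 0}))"
 using closed_Collect_eq[OF contip2 continuous_on_const] closed_Collect_eq[OF contip continuous_on_const]
 by (intro closed_Int closed_INT) auto
 then have "compact (?C \<inter> ({x. ip x x = 1} \<inter> (\<Inter>k\<in>K. {x. ip x (u k) = 0})))"
 using compact_functions_on_finite compact_Int_closed by blast
 moreover have "?C \<inter> ({x. ip x x = 1} \<inter> (\<Inter>k\<in>K. {x. ip x (u k) = 0})) = S"
 proof (intro subset_antisym subsetI)
 fix x assume x: "x : S"
 have "x i : {-1..1}" if "i : I" for i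
 proof -
 have "x i * x i <= ip x x" unfolding ip_def using that fin by (intro member_le_sum) auto
 then have "(x i)^2 <= 1" using x by (simp add: S_def power2_eq_square)
 then show ?thesis by (simp add: abs_square_le_1 abs_le_iff)
 qed
 then show "x : ?C \<inter> ({x. ip x x = 1} \<inter> (\<Inter>k\<in>K. {x. ip x (u k) = 0}))" using x by (auto simp: S_def)
 qed (auto simp: S_def)
 ultimately show ?thesis by simp
 qed
 obtain w where w: "w : S" and wmax: "!!x. x : S ==> ip x (Av x) <= ip w (Av w)"
 using continuous_attains_sup[OF compS Sne continuous_on_subset[OF contA subset_UNIV]] by blast
 define mu where "mu = ip w (Av w)"
 have w1: "ip w w = 1" and wu: "!!k. k : K ==> ip w (u k) = 0" and w0: "!!i. i \<notin> I ==> w i = 0"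
 using w by (auto simp: S_def)
 have rayleigh: "ip x (Av x) <= mu * ip x x" if xz: "!!i. i \<notin> I ==> x i = 0" "!!k. k : K ==> ip x (u k) = 0" for x
 proof (cases "ip x x > 0")
 case True
 obtain c where c: "c > 0" "(%i. c * x i) : S" "c^2 * ip x x = 1" using normalise[OF xz(1) True xz(2)] by blast
 have "ip (%i. c * x i) (Av (%i. c * x i)) = c^2 * ip x (Av x)"
 by (simp add: ip_def Av_def sum_distrib_left power2_eq_square mult_ac)
 then have "c^2 * ip x (Av x) <= mu" using wmax[OF c(2)] by (simp add: mu_def)
 moreover have "mu = c^2*(mu * ip x x)" by (metis c(3) mult.left_commute mult.right_neutral)
 ultimately have "c^2 * ip x (Av x) <= c^2*(mu * ip x x)" by linarith
 then show ?thesis using c(1) by simp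
 next
 case False
 moreover have "ip x x >= 0" unfolding ip_def by (intro sum_nonneg) auto
 ultimately have z: "ip x x = 0" by simp
 have "\<forall>i\<in>I. x i * x i = 0" using z unfolding ip_def by (subst (asm) sum_nonneg_eq_0_iff) (use fin in auto)
 then have "x i = 0" for i using xz(1) by (cases "i : I") auto
 then show ?thesis by (simp add: ip_def)
 qed
 define r where "r = (%i. Av w i+(- mu) * w i)"
 have r0: "r i = 0" if "i \<notin> I" for i using that w0 by (simp add: r_def Av_def)
 have ru: "ip r (u k) = 0" if "k : K" for k
 unfolding r_def lin using Au[OF that] wu[OF that] by simp
 have rw: "ip r w = 0" unfolding r_def lin using w1 by (simp add: mu_def comm)
 have wAr: "ip w (Av r) = ip r r"
 proof -
 have "ip r r = ip (Av w) r+(- mu) * ip w r" unfolding r_def by (simp only: lin)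
 moreover have "ip w r = 0" using rw comm[of w r] by simp
 ultimately show ?thesis using Asym[of w r] by simp
 qed
 have "2 * t * ip r r + t^2*(ip r (Av r)-mu * ip r r) <= 0" for t
 proof -
 let ?x = "%i. w i + t * r i"
 have "ip ?x (Av ?x) <= mu * ip ?x ?x" using r0 ru w0 wu by (intro rayleigh) (simp_all add: lin)
 moreover have "ip ?x (Av ?x) = mu+2 * t * ip r r + t^2 * ip r (Av r)"
 unfolding Alin lin lin2 using wAr Asym[of r w] Asym[of w r] comm[of r "Av w"] comm[of "Av r" w]
 by (simp add: mu_def power2_eq_square algebra_simps)
 moreover have "ip ?x ?x = 1 + t^2 * ip r r"
 unfolding lin lin2 using rw comm[of w r] w1 by (simp add: power2_eq_square algebra_simps)
 ultimately show ?thesis by (simp add: algebra_simps)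
 qed
 then have "ip r r = 0" by (rule quadratic_nonpos_imp_zero)
 then have "\<forall>i\<in>I. r i * r i = 0" unfolding ip_def by (subst (asm) sum_nonneg_eq_0_iff) (use fin in auto)
 then have "\<forall>i\<in>I. (\<Sum>j\<in>I. A i j * w j) = mu * w i" by (auto simp: r_def Av_def)
 then show ?thesis using w1 wu by (auto simp: ip_def)
qed

theorem spectral_exists:
 fixes A :: "'i => 'i => real"
 assumes fin: "finite I" and sym: "!!i j. i : I ==> j : I ==> A i j = A j i"
 shows "\<exists>lam u. spectral I A lam u"
proof -
 have "\<exists>lam u. orthonormal_eigen I A K lam u" if "finite K" "K \<subseteq> I" for K
 using that
 proof (induction K rule: finite_induct)
 case empty then show ?case by (simp add: orthonormal_eigen_def)
 next
 case (insert k K)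
 then obtain lam u where oe: "orthonormal_eigen I A K lam u" by auto
 have "K \<subset> I" using insert by auto
 from orthonormal_eigen_extend[OF fin sym this oe]
 obtain mu w where w: "(\<Sum>i\<in>I. w i * w i) = 1" "\<forall>k\<in>K. (\<Sum>i\<in>I. w i * u k i) = 0"
 "\<forall>i\<in>I. (\<Sum>j\<in>I. A i j * w j) = mu * w i" by auto
 have w': "\<forall>k\<in>K. (\<Sum>i\<in>I. u k i * w i) = 0" using w(2) by (simp add: mult.commute)
 have "orthonormal_eigen I A (insert k K) (lam(k := mu)) (u(k := w))"
 using oe w w' insert(2) unfolding orthonormal_eigen_def by (auto simp: fun_upd_apply)
 then show ?case by blast
 qed
 from this[OF fin subset_refl] obtain lam u where oe: "orthonormal_eigen I A I lam u" by auto
 then have on: "\<forall>k\<in>I. \<forall>l\<in>I. (\<Sum>i\<in>I. u k i * u l i) = of_bool (k = l)" by (simp add: orthonormal_eigen_def)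
 note br = bessel_residual[OF fin subset_refl _ on]
 have le: "(\<Sum>k\<in>I. (u k i)^2) <= 1" if "i : I" for i
 using br(2)[OF that] sum_nonneg[of I "%j. (of_bool (i = j)-(\<Sum>k\<in>I. u k i * u k j))^2"] by simp
 \<comment> \<open>The diagonal entries of the projection are at most 1 and add up to card I, so
   each of them equals 1 and every residual has norm zero.\<close>
 have "(\<Sum>i\<in>I. \<Sum>k\<in>I. (u k i)^2) = (\<Sum>k\<in>I. \<Sum>i\<in>I. u k i * u k i)"
 by (subst sum.swap) (simp add: power2_eq_square)
 also have "... = (\<Sum>i\<in>I. 1)" using on by simp
 finally have "(\<Sum>i\<in>I. 1-(\<Sum>k\<in>I. (u k i)^2)) = 0" by (simp add: sum_subtractf)
 then have "\<forall>i\<in>I. 1-(\<Sum>k\<in>I. (u k i)^2) = 0" using le fin by (subst (asm) sum_nonneg_eq_0_iff) auto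
 then have "(\<Sum>j\<in>I. (of_bool (i = j)-(\<Sum>k\<in>I. u k i * u k j))^2) = 0" if "i : I" for i
 using br(2)[OF that] that by simp
 then have "\<forall>i\<in>I. \<forall>j\<in>I. (\<Sum>k\<in>I. u k i * u k j) = of_bool (i = j)"
 using fin by (subst (asm) sum_nonneg_eq_0_iff) auto
 then show ?thesis using oe unfolding spectral_def orthonormal_eigen_def by blast
qed

section \<open>Chosen eigenpairs and functional calculus\<close>

definition sym_on :: "'i set => ('i => 'i => real) => bool" where
 "sym_on I A \<longleftrightarrow> (\<forall>i\<in>I. \<forall>j\<in>I. A i j = A j i)"

text \<open>One choice is split into values and vectors, so \<open>eigval\<close> and
  \<open>eigvec\<close> always form a matching pair. Nothing makes this choice measurable in A;
  measurability will go through symmetric functions of the eigenvalues.\<close>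

definition eigval :: "'i set => ('i => 'i => real) => 'i => real" where
 "eigval I A = fst (SOME p. spectral I A (fst p) (snd p))"

definition eigvec :: "'i set => ('i => 'i => real) => 'i => 'i => real" where
 "eigvec I A = snd (SOME p. spectral I A (fst p) (snd p))"

lemma spectral_eig: "finite I ==> sym_on I A ==> spectral I A (eigval I A) (eigvec I A)"
 using spectral_exists[of I A] someI_ex[of "%p. spectral I A (fst p) (snd p)"]
 unfolding eigval_def eigvec_def sym_on_def by auto

lemma spectral_cong:
 "spectral I A lam u ==> (!!i j. i : I ==> j : I ==> A i j = B i j) ==> spectral I B lam u"
 unfolding spectral_def by auto

text \<open>Both sides evaluate the form of A - B between an eigenvector of A and one of B. With B =
  A it says that eigenvectors of different eigenvalues are orthogonal; with a rank-one difference it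
  converts eigenvalue gaps into overlaps, which drives the moment recursion.\<close>

lemma spectral_difference:
 assumes A: "spectral I A lam u" and B: "spectral I B lam' u'" and sym: "sym_on I A"
 and k: "k : I" and l: "l : I"
 shows "(lam k-lam' l)*(\<Sum>i\<in>I. u k i * u' l i) = (\<Sum>i\<in>I. \<Sum>j\<in>I. u k i*(A i j-B i j) * u' l j)"
proof -
 have "(\<Sum>i\<in>I. \<Sum>j\<in>I. u k i*A i j * u' l j) = (\<Sum>j\<in>I. \<Sum>i\<in>I. u k i*A i j * u' l j)" by (rule sum.swap)
 also have "... = (\<Sum>j\<in>I. (\<Sum>i\<in>I. A j i * u k i) * u' l j)"
 using sym by (intro sum.cong refl, subst sum_distrib_right, intro sum.cong refl) (simp add: sym_on_def mult_ac)
 also have "... = (\<Sum>j\<in>I. lam k * u k j * u' l j)" using A k by (simp add: spectral_def)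
 finally have 1: "(\<Sum>i\<in>I. \<Sum>j\<in>I. u k i*A i j * u' l j) = lam k*(\<Sum>i\<in>I. u k i * u' l i)"
 by (simp add: sum_distrib_left mult.assoc)
 have "(\<Sum>i\<in>I. \<Sum>j\<in>I. u k i*B i j * u' l j) = (\<Sum>i\<in>I. u k i*(\<Sum>j\<in>I. B i j * u' l j))"
 by (simp add: sum_distrib_left mult.assoc)
 also have "... = (\<Sum>i\<in>I. u k i*(lam' l * u' l i))" using B l by (simp add: spectral_def)
 finally have 2: "(\<Sum>i\<in>I. \<Sum>j\<in>I. u k i*B i j * u' l j) = lam' l*(\<Sum>i\<in>I. u k i * u' l i)"
 by (simp add: sum_distrib_left mult_ac)
 show ?thesis using 1 2 by (simp add: left_diff_distrib right_diff_distrib sum_subtractf)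
qed

lemma spectral_expand:
 assumes fin: "finite I" and A: "spectral I A lam u" and i: "i : I"
 shows "(\<Sum>k\<in>I. (\<Sum>j\<in>I. x j * u k j) * u k i) = x i"
proof -
 have "(\<Sum>k\<in>I. (\<Sum>j\<in>I. x j * u k j) * u k i) = (\<Sum>j\<in>I. \<Sum>k\<in>I. x j*(u k j * u k i))"
 by (subst sum.swap) (simp add: sum_distrib_right mult.assoc)
 also have "... = (\<Sum>j\<in>I. x j * of_bool (j = i))"
 using A i by (simp add: spectral_def sum_distrib_left[symmetric])
 also have "... = x i" by (rule sum_of_bool_mult_left(4)[OF fin i])
 finally show ?thesis .
qed

lemma spectral_parseval:
 assumes fin: "finite I" and A: "spectral I A lam u"
 shows "(\<Sum>k\<in>I. (\<Sum>j\<in>I. x j * u k j)*(\<Sum>j\<in>I. y j * u k j)) = (\<Sum>i\<in>I. x i * y i)"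
proof -
 have "(\<Sum>k\<in>I. (\<Sum>j\<in>I. x j * u k j)*(\<Sum>j\<in>I. y j * u k j)) = (\<Sum>k\<in>I. \<Sum>i\<in>I. ((\<Sum>j\<in>I. x j * u k j) * u k i) * y i)"
 by (simp add: sum_distrib_left mult_ac)
 also have "... = (\<Sum>i\<in>I. (\<Sum>k\<in>I. (\<Sum>j\<in>I. x j * u k j) * u k i) * y i)"
 by (subst sum.swap) (simp add: sum_distrib_right)
 also have "... = (\<Sum>i\<in>I. x i * y i)" using spectral_expand[OF fin A] by simp
 finally show ?thesis .
qed

text \<open>The squared overlaps of two eigenbases form a doubly stochastic matrix that lives on
  pairs with equal eigenvalues; averaging f against it in both orders gives the two sums. Hence
  symmetric functions of the spectrum do not depend on the choice in \<open>eigval\<close>.\<close>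

lemma spectral_sum_unique:
 fixes f :: "real => 'b :: real_vector"
 assumes fin: "finite I" and A: "spectral I A lam u" and B: "spectral I A lam' u'" and sym: "sym_on I A"
 shows "(\<Sum>k\<in>I. f (lam k)) = (\<Sum>k\<in>I. f (lam' k))"
proof -
 define w where "w = (%k l. (\<Sum>i\<in>I. u k i * u' l i)^2)"
 have z: "w k l *\<^sub>R f (lam k) = w k l *\<^sub>R f (lam' l)" if "k : I" "l : I" for k l
 using spectral_difference[OF A B sym that] by (cases "lam k = lam' l") (auto simp: w_def)
 have r: "(\<Sum>l\<in>I. w k l) = 1" if "k : I" for k
 using spectral_parseval[OF fin B, of "u k" "u k"] A that by (simp add: w_def power2_eq_square spectral_def)
 have c: "(\<Sum>k\<in>I. w k l) = 1" if "l : I" for l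
 using spectral_parseval[OF fin A, of "u' l" "u' l"] B that
 by (simp add: w_def power2_eq_square spectral_def mult.commute)
 have "(\<Sum>k\<in>I. f (lam k)) = (\<Sum>k\<in>I. \<Sum>l\<in>I. w k l *\<^sub>R f (lam k))"
 using r by (simp add: scaleR_left.sum[symmetric])
 also have "... = (\<Sum>k\<in>I. \<Sum>l\<in>I. w k l *\<^sub>R f (lam' l))" by (intro sum.cong refl z)
 also have "... = (\<Sum>l\<in>I. (\<Sum>k\<in>I. w k l) *\<^sub>R f (lam' l))"
 by (subst sum.swap) (simp add: scaleR_left.sum)
 also have "... = (\<Sum>l\<in>I. f (lam' l))" using c by simp
 finally show ?thesis .
qed

definition fcalc :: "'i set => ('i => 'i => real) => (real => complex) => 'i => 'i => complex" where
 "fcalc I A f i j = (\<Sum>k\<in>I. f (eigval I A k) * of_real (eigvec I A k i * eigvec I A k j))"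

lemma fcalc_sym: "fcalc I A f i j = fcalc I A f j i"
 by (simp add: fcalc_def mult.commute)

context
 fixes I :: "'i set" and A :: "'i => 'i => real"
 assumes fin: "finite I" and sym: "sym_on I A"
begin

private lemma sp: "spectral I A (eigval I A) (eigvec I A)" using spectral_eig[OF fin sym] .

lemma fcalc_one: "i : I ==> j : I ==> fcalc I A (%_. 1) i j = of_bool (i = j)"
 using sp by (simp add: fcalc_def spectral_def of_real_sum[symmetric] del: of_real_mult of_real_sum)

lemma fcalc_mult: "(\<Sum>j\<in>I. fcalc I A f i j * fcalc I A g j l) = fcalc I A (%x. f x * g x) i l"
proof -
 let ?u = "eigvec I A" and ?l = "eigval I A"
 have "(\<Sum>j\<in>I. fcalc I A f i j * fcalc I A g j l) =
 (\<Sum>j\<in>I. \<Sum>k\<in>I. \<Sum>m\<in>I. (f (?l k) * g (?l m) * of_real (?u k i*?u m l)) * of_real (?u k j*?u m j))"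
 by (simp add: fcalc_def sum_product mult_ac)
 also have "... = (\<Sum>k\<in>I. \<Sum>m\<in>I. (f (?l k) * g (?l m) * of_real (?u k i*?u m l)) * of_real (\<Sum>j\<in>I. ?u k j*?u m j))"
 by (subst sum.swap, rule sum.cong[OF refl], subst sum.swap) (simp add: sum_distrib_left)
 also have "... = (\<Sum>k\<in>I. \<Sum>m\<in>I. (f (?l k) * g (?l m) * of_real (?u k i*?u m l)) * of_bool (k = m))"
 using sp by (intro sum.cong refl) (simp add: spectral_def del: of_real_mult of_real_sum)
 also have "... = (\<Sum>k\<in>I. f (?l k) * g (?l k) * of_real (?u k i*?u k l))"
 using sum_of_bool_mult_left(3)[OF fin] by (intro sum.cong refl)
 finally show ?thesis by (simp add: fcalc_def)
qed

lemma fcalc_mat: "i : I ==> (\<Sum>j\<in>I. of_real (A i j) * fcalc I A f j l) = fcalc I A (%x. of_real x * f x) i l"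
proof -
 assume i: "i : I"
 let ?u = "eigvec I A" and ?l = "eigval I A"
 have "(\<Sum>j\<in>I. of_real (A i j) * fcalc I A f j l) =
 (\<Sum>k\<in>I. f (?l k) * of_real (?u k l) * of_real (\<Sum>j\<in>I. A i j*?u k j))"
 by (simp add: fcalc_def sum_distrib_left mult_ac) (subst sum.swap, simp)
 also have "... = (\<Sum>k\<in>I. f (?l k) * of_real (?u k l) * of_real (?l k*?u k i))"
 using sp i by (intro sum.cong refl) (simp add: spectral_def del: of_real_mult of_real_sum)
 finally show ?thesis by (simp add: fcalc_def mult_ac)
qed

lemma fcalc_trace: "(\<Sum>i\<in>I. fcalc I A f i i) = (\<Sum>k\<in>I. f (eigval I A k))"
proof -
 have "(\<Sum>i\<in>I. fcalc I A f i i) = (\<Sum>k\<in>I. f (eigval I A k) * of_real (\<Sum>i\<in>I. eigvec I A k i * eigvec I A k i))"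
 by (simp add: fcalc_def sum_distrib_left) (subst sum.swap, simp)
 also have "... = (\<Sum>k\<in>I. f (eigval I A k))"
 using sp by (intro sum.cong refl) (simp add: spectral_def del: of_real_mult of_real_sum)
 finally show ?thesis .
qed

text \<open>The operator norm of f(A) is at most sup |f|. Since the eigenbasis is real, real and
  imaginary parts of the coefficients can be treated separately.\<close>

lemma fcalc_vec_norm:
 assumes B: "!!x. cmod (f x) <= B"
 shows "(\<Sum>i\<in>I. (cmod (\<Sum>j\<in>I. fcalc I A f i j * of_real (x j)))^2) <= B^2*(\<Sum>i\<in>I. (x i)^2)"
proof -
 let ?u = "eigvec I A" and ?l = "eigval I A"
 define c where "c = (%k. f (?l k) * of_real (\<Sum>j\<in>I. x j*?u k j))"
 have "B >= 0" using order_trans[OF norm_ge_zero B[of 0]] .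
 have e: "(\<Sum>j\<in>I. fcalc I A f i j * of_real (x j)) = (\<Sum>k\<in>I. c k * of_real (?u k i))" for i
 by (simp add: fcalc_def c_def sum_distrib_left sum_distrib_right mult_ac) (subst sum.swap, simp add: mult_ac)
 have par: "(\<Sum>i\<in>I. (\<Sum>k\<in>I. a k*?u k i)^2) = (\<Sum>k\<in>I. (a k)^2)" for a :: "'i => real"
 proof -
 have "(\<Sum>i\<in>I. (\<Sum>k\<in>I. a k*?u k i)^2) = (\<Sum>i\<in>I. \<Sum>k\<in>I. \<Sum>m\<in>I. (a k * a m)*(?u k i*?u m i))"
 by (simp add: power2_eq_square sum_product mult_ac)
 also have "... = (\<Sum>k\<in>I. \<Sum>m\<in>I. (a k * a m)*(\<Sum>i\<in>I. ?u k i*?u m i))"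
 by (subst sum.swap, rule sum.cong[OF refl], subst sum.swap) (simp add: sum_distrib_left)
 also have "... = (\<Sum>k\<in>I. \<Sum>m\<in>I. (a k * a m) * of_bool (k = m))"
 using sp by (intro sum.cong refl) (simp add: spectral_def)
 also have "... = (\<Sum>k\<in>I. (a k)^2)"
 using sum_of_bool_mult_left(3)[OF fin] by (intro sum.cong refl) (simp add: power2_eq_square)
 finally show ?thesis .
 qed
 have "(\<Sum>i\<in>I. (cmod (\<Sum>k\<in>I. c k * of_real (?u k i)))^2) =
 (\<Sum>i\<in>I. (\<Sum>k\<in>I. Re (c k)*?u k i)^2)+(\<Sum>i\<in>I. (\<Sum>k\<in>I. Im (c k)*?u k i)^2)"
 by (simp add: cmod_power2 sum.distrib)
 also have "... = (\<Sum>k\<in>I. (cmod (c k))^2)" unfolding par by (simp add: cmod_power2 sum.distrib)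
 also have "... <= (\<Sum>k\<in>I. B^2*(\<Sum>j\<in>I. x j*?u k j)^2)"
 unfolding c_def norm_mult power_mult_distrib norm_of_real power2_abs
 using B by (intro sum_mono mult_right_mono power_mono) auto
 also have "... = B^2*(\<Sum>i\<in>I. (x i)^2)"
 unfolding sum_distrib_left[symmetric] using spectral_parseval[OF fin sp, of x x] by (simp add: power2_eq_square)
 finally show ?thesis unfolding e .
qed

text \<open>Columns of f(A) are images of standard basis vectors, hence of Euclidean norm at most B.
  This square summability is what makes all off-diagonal resolvent entries negligible later.\<close>

lemma fcalc_row_norm:
 assumes B: "!!x. cmod (f x) <= B" and j: "j : I"
 shows "(\<Sum>i\<in>I. (cmod (fcalc I A f i j))^2) <= B^2"
proof -
 have e: "complex_of_real (of_bool b) = of_bool b" for b by (cases b) auto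
 have "(\<Sum>k\<in>I. fcalc I A f i k * of_real (of_bool (k = j))) = fcalc I A f i j" for i
 unfolding e by (rule sum_of_bool_mult_left(4)[OF fin j])
 moreover have "(\<Sum>i\<in>I. (of_bool (i = j) :: real)^2) = 1"
 using sum_of_bool_mult_left(4)[OF fin j, of "%i. (of_bool (i = j) :: real)"] by (simp add: power2_eq_square)
 ultimately show ?thesis using fcalc_vec_norm[of f B "%k. of_bool (k = j)", OF B] by simp
qed

lemma fcalc_norm_le:
 assumes B: "!!x. cmod (f x) <= B" and "i : I" "j : I"
 shows "cmod (fcalc I A f i j) <= B"
proof -
 have "(cmod (fcalc I A f i j))^2 <= (\<Sum>i\<in>I. (cmod (fcalc I A f i j))^2)"
 using fin assms by (intro member_le_sum) auto
 also have "... <= B^2" by (rule fcalc_row_norm[OF B assms(3)])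
 finally show ?thesis using order_trans[OF norm_ge_zero B[of 0]] by (simp add: power2_le_iff_abs_le)
qed

end

section \<open>Resolvents and rank-one perturbations\<close>

definition res :: "'i set => complex => ('i => 'i => real) => 'i => 'i => complex" where
 "res I z A = fcalc I A (%x. 1/(of_real x-z))"

text \<open>The square of the resolvent, kept as its own functional calculus so that the bound (1/Im
  z)^2 applies to it directly; it arises from differentiating the resolvent trace.\<close>

definition res2 :: "'i set => complex => ('i => 'i => real) => 'i => 'i => complex" where
 "res2 I z A = fcalc I A (%x. (1/(of_real x-z))*(1/(of_real x-z)))"

definition mv :: "'i set => ('i => 'i => complex) => ('i => real) => 'i => complex" where
 "mv I X x i = (\<Sum>j\<in>I. X i j * of_real (x j))"

definition qf :: "'i set => ('i => 'i => complex) => ('i => real) => complex" where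
 "qf I X x = (\<Sum>i\<in>I. of_real (x i) * mv I X x i)"

lemma res_sym: "res I z A i j = res I z A j i"
 unfolding res_def by (rule fcalc_sym)

lemma cmod_inverse_le: "Im z > 0 ==> cmod (1/(of_real x-z)) <= 1/Im z"
proof -
 assume z: "Im z > 0"
 have "Im z <= cmod (of_real x-z)" using abs_Im_le_cmod[of "of_real x-z"] z by simp
 then show ?thesis using z by (simp add: norm_divide frac_le)
qed

lemma cmod_inverse2_le: "Im z > 0 ==> cmod ((1/(of_real x-z))*(1/(of_real x-z))) <= (1/Im z)^2"
 unfolding norm_mult power2_eq_square using cmod_inverse_le[of z x] by (intro mult_mono) auto

lemma res_res_mult:
 assumes "finite I" "sym_on I A"
 shows "(\<Sum>j\<in>I. res I z A i j * res I z A j l) = res2 I z A i l"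
 unfolding res_def res2_def by (rule fcalc_mult[OF assms])

lemma res_inverse:
 assumes fin: "finite I" and sym: "sym_on I A" and z: "Im z > 0" and il: "i : I" "l : I"
 shows "(\<Sum>j\<in>I. (of_real (A i j)-z * of_bool (i = j)) * res I z A j l) = of_bool (i = l)"
proof -
 have nz: "of_real x-z ~= 0" for x using z by (metis Im_complex_of_real eq_iff_diff_eq_0 less_irrefl)
 have e: "(of_real x-z)*(1/(of_real x-z)) = 1" for x
 using nz[of x] by simp
 have "(\<Sum>j\<in>I. (of_real (A i j)-z * of_bool (i = j)) * res I z A j l)
 = fcalc I A (%x. of_real x*(1/(of_real x-z))) i l-z * res I z A i l"
 using fcalc_mat[OF fin sym il(1)] sum_of_bool_mult_left(1)[OF fin il(1), of "%j. res I z A j l"]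
 by (simp add: res_def left_diff_distrib sum_subtractf sum_distrib_left[symmetric] mult.assoc)
 also have "... = fcalc I A (%x. 1) i l"
 unfolding res_def fcalc_def sum_distrib_left sum_subtractf[symmetric]
 by (intro sum.cong refl) (simp only: mult.assoc[symmetric] left_diff_distrib[symmetric] e mult_1)
 also have "... = of_bool (i = l)" using fcalc_one[OF fin sym il] .
 finally show ?thesis .
qed

text \<open>A column that solves the linear system of the resolvent is the resolvent column, because
  the resolvent is also a left inverse by symmetry. This identifies resolvents of relabelled
  matrices and of direct sums without touching eigenvectors.\<close>

lemma res_unique:
 assumes fin: "finite I" and sym: "sym_on I A" and z: "Im z > 0" and il: "i : I" "l : I"
 and X: "!!i. i : I ==> (\<Sum>j\<in>I. (of_real (A i j)-z * of_bool (i = j))*X j) = of_bool (i = l)"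
 shows "X i = res I z A i l"
proof -
 have "(\<Sum>k\<in>I. res I z A i k*(\<Sum>j\<in>I. (of_real (A k j)-z * of_bool (k = j))*X j))
 = (\<Sum>k\<in>I. res I z A i k * of_bool (k = l))" using X by simp
 also have "... = res I z A i l" by (rule sum_of_bool_mult_left(4)[OF fin il(2)])
 finally have 1: "(\<Sum>k\<in>I. res I z A i k*(\<Sum>j\<in>I. (of_real (A k j)-z * of_bool (k = j))*X j)) = res I z A i l" .
 have "(\<Sum>k\<in>I. res I z A i k*(\<Sum>j\<in>I. (of_real (A k j)-z * of_bool (k = j))*X j))
 = (\<Sum>j\<in>I. (\<Sum>k\<in>I. (of_real (A j k)-z * of_bool (j = k)) * res I z A k i)*X j)"
 unfolding sum_distrib_left sum_distrib_right
 apply (subst sum.swap)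
 using sym by (intro sum.cong refl) (auto simp: sym_on_def res_sym[of I z A i])
 also have "... = (\<Sum>j\<in>I. of_bool (j = i)*X j)" using res_inverse[OF fin sym z _ il(1)] by simp
 also have "... = X i" by (rule sum_of_bool_mult_left(2)[OF fin il(1)])
 finally show ?thesis using 1 by simp
qed

lemma resolvent_identity:
 assumes fin: "finite I" and A: "sym_on I A" and B: "sym_on I B" and z: "Im z > 0" and il: "i : I" "l : I"
 shows "res I z A i l-res I z B i l = (\<Sum>j\<in>I. \<Sum>k\<in>I. res I z A i j * of_real (B j k-A j k) * res I z B k l)"
proof -
 have "(\<Sum>j\<in>I. \<Sum>k\<in>I. res I z A i j * of_real (B j k-A j k) * res I z B k l)
 = (\<Sum>j\<in>I. res I z A i j*(\<Sum>k\<in>I. (of_real (B j k)-z * of_bool (j = k)) * res I z B k l))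
 -(\<Sum>j\<in>I. \<Sum>k\<in>I. res I z A i j*(of_real (A j k)-z * of_bool (j = k)) * res I z B k l)"
 by (simp add: sum_distrib_left sum_subtractf[symmetric] algebra_simps)
 also have "(\<Sum>j\<in>I. res I z A i j*(\<Sum>k\<in>I. (of_real (B j k)-z * of_bool (j = k)) * res I z B k l))
 = (\<Sum>j\<in>I. res I z A i j * of_bool (j = l))" using res_inverse[OF fin B z _ il(2)] by simp
 also have "... = res I z A i l" by (rule sum_of_bool_mult_left(4)[OF fin il(2)])
 also have "(\<Sum>j\<in>I. \<Sum>k\<in>I. res I z A i j*(of_real (A j k)-z * of_bool (j = k)) * res I z B k l)
 = (\<Sum>k\<in>I. (\<Sum>j\<in>I. (of_real (A k j)-z * of_bool (k = j)) * res I z A j i) * res I z B k l)"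
 unfolding sum_distrib_right
 apply (subst sum.swap)
 using A by (intro sum.cong refl) (auto simp: sym_on_def res_sym[of I z A i])
 also have "... = (\<Sum>k\<in>I. of_bool (k = i) * res I z B k l)" using res_inverse[OF fin A z _ il(1)] by simp
 also have "... = res I z B i l" by (rule sum_of_bool_mult_left(2)[OF fin il(1)])
 finally show ?thesis by simp
qed

text \<open>For B = A + c v v^T the resolvent identity collapses to a single product, exact and with
  no smallness condition on c. The expansions in one coordinate are this identity applied once or
  twice.\<close>

lemma res_rank_one:
 assumes fin: "finite I" and A: "sym_on I A" and B: "sym_on I B" and z: "Im z > 0" and il: "i : I" "l : I"
 and d: "!!j k. j : I ==> k : I ==> B j k-A j k = c*(v j * v k)"
 shows "res I z A i l-res I z B i l = of_real c * mv I (res I z A) v i * mv I (res I z B) v l"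
proof -
 have sp: "mv I (res I z A) v i * mv I (res I z B) v l
 = (\<Sum>j\<in>I. \<Sum>k\<in>I. (res I z A i j * of_real (v j))*(res I z B l k * of_real (v k)))"
 unfolding mv_def by (rule sum_product)
 have "res I z A i l-res I z B i l = (\<Sum>j\<in>I. \<Sum>k\<in>I. res I z A i j * of_real (c*(v j * v k)) * res I z B k l)"
 unfolding resolvent_identity[OF fin A B z il] using d by (intro sum.cong refl) simp
 also have "... = of_real c*(mv I (res I z A) v i * mv I (res I z B) v l)"
 unfolding sp sum_distrib_left by (intro sum.cong refl) (simp add: res_sym[of I z B l] mult_ac)
 finally show ?thesis by (simp add: mult_ac)
qed

lemma mv_res2: 
 assumes "finite I" "sym_on I A"
 shows "(\<Sum>j\<in>I. res I z A i j * mv I (res I z A) v j) = mv I (res2 I z A) v i"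
 unfolding mv_def res_res_mult[OF assms, symmetric] sum_distrib_left sum_distrib_right
 by (subst sum.swap) (simp add: mult_ac)

text \<open>Product rule: R_A^2 - R_B^2 = R_A (R_A - R_B) + (R_A - R_B) R_B.\<close>

lemma res2_rank_one:
 assumes fin: "finite I" and A: "sym_on I A" and B: "sym_on I B" and z: "Im z > 0" and il: "i : I" "l : I"
 and d: "!!j k. j : I ==> k : I ==> B j k-A j k = c*(v j * v k)"
 shows "res2 I z A i l-res2 I z B i l = of_real c *
 (mv I (res2 I z A) v i * mv I (res I z B) v l + mv I (res I z A) v i * mv I (res2 I z B) v l)"
proof -
 note r1 = res_rank_one[OF fin A B z _ _ d]
 have "res2 I z A i l-res2 I z B i l =
 (\<Sum>j\<in>I. res I z A i j*(res I z A j l-res I z B j l))+(\<Sum>j\<in>I. (res I z A i j-res I z B i j) * res I z B j l)"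
 unfolding res_res_mult[OF fin A, symmetric] res_res_mult[OF fin B, symmetric]
 by (simp add: sum.distrib[symmetric] sum_subtractf[symmetric] algebra_simps)
 also have "(\<Sum>j\<in>I. res I z A i j*(res I z A j l-res I z B j l))
 = of_real c*(\<Sum>j\<in>I. res I z A i j * mv I (res I z A) v j) * mv I (res I z B) v l"
 using r1[OF _ il(2)] by (simp add: sum_distrib_left sum_distrib_right mult_ac)
 also have "(\<Sum>j\<in>I. (res I z A i j-res I z B i j) * res I z B j l)
 = of_real c * mv I (res I z A) v i*(\<Sum>j\<in>I. res I z B l j * mv I (res I z B) v j)"
 using r1[OF il(1)] by (simp add: sum_distrib_left sum_distrib_right mult_ac res_sym[of I z B l])
 finally show ?thesis unfolding mv_res2[OF fin A] mv_res2[OF fin B] by (simp add: algebra_simps)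
qed

section \<open>Averages over the sign cube and its Poincare inequality\<close>

text \<open>A sign vector in {-1, 1}^E is encoded by the set of its positive coordinates, so that
  the cube is \<open>Pow E\<close> and uniform expectations are plain finite sums.\<close>

definition sgnset :: "'e set => 'e => real" where
 "sgnset A e = (if e : A then 1 else-1)"

definition flip :: "'e => 'e set => 'e set" where
 "flip e A = (if e : A then A - {e} else insert e A)"

definition cavg :: "'e set => ('e set => 'b :: real_vector) => 'b" where
 "cavg E f = (1/2 ^ card E) *\<^sub>R (\<Sum>A\<in>Pow E. f A)"

lemma sgnset_square [simp]: "(sgnset A e)^2 = 1" "sgnset A e * sgnset A e = 1" "\<bar>sgnset A e\<bar> = 1"
 by (simp_all add: sgnset_def)

lemma flip_flip [simp]: "flip e (flip e A) = A" by (auto simp: flip_def)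

lemma sgnset_flip: "sgnset (flip e A) e =-sgnset A e" "e' ~= e ==> sgnset (flip e A) e' = sgnset A e'"
 by (auto simp: sgnset_def flip_def)

lemma flip_subset: "e : E ==> A \<subseteq> E ==> flip e A \<subseteq> E" by (auto simp: flip_def)

lemma cavg_cong: "(!!A. A \<subseteq> E ==> f A = g A) ==> cavg E f = cavg E g"
 by (simp add: cavg_def)

lemma cavg_add: "cavg E (%A. f A + g A) = cavg E f + cavg E g"
 by (simp add: cavg_def sum.distrib scaleR_add_right)

lemma cavg_diff: "cavg E (%A. f A-g A) = cavg E f-cavg E g"
 by (simp add: cavg_def sum_subtractf scaleR_diff_right)

lemma cavg_mult_left: "cavg E (%A. c * f A) = (c :: 'b :: real_algebra) * cavg E f"
 by (simp add: cavg_def sum_distrib_left[symmetric])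

lemma cavg_scaleR: "cavg E (%A. c *\<^sub>R f A) = c *\<^sub>R cavg E f"
 by (simp add: cavg_def scaleR_right.sum[symmetric])

lemma cavg_sum: "cavg E (%A. \<Sum>i\<in>I. f i A) = (\<Sum>i\<in>I. cavg E (f i))"
 unfolding cavg_def by (subst sum.swap) (simp add: scaleR_right.sum)

lemma cavg_const: "finite E ==> cavg E (%_. c) = c"
 by (simp add: cavg_def card_Pow scaleR_right.sum sum_constant_scaleR)

lemma cavg_mono: "(!!A. A \<subseteq> E ==> f A <= g A) ==> cavg E f <= (cavg E g :: real)"
 unfolding cavg_def by (auto intro!: divide_right_mono sum_mono)

lemma norm_cavg_le: "norm (cavg E f) <= cavg E (%A. norm (f A))"
 for f :: "'e set => 'b :: real_normed_vector"
 unfolding cavg_def by (simp add: divide_right_mono sum_norm_le)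

lemma cavg_bounded_linear: "bounded_linear h ==> h (cavg E f) = cavg E (%A. h (f A))"
proof -
 assume "bounded_linear h"
 then interpret bounded_linear h .
 show ?thesis by (simp add: cavg_def scaleR sum)
qed

lemma cavg_empty [simp]: "cavg {} f = f {}" by (simp add: cavg_def)

lemma cavg_insert:
 assumes fin: "finite E" and e: "e \<notin> E"
 shows "cavg (insert e E) f = (1/2) *\<^sub>R (cavg E f + cavg E (%A. f (insert e A)))"
proof -
 have inj: "inj_on (insert e) (Pow E)" using e by (auto simp: inj_on_def)
 have disj: "Pow E \<inter> insert e ` Pow E = {}" using e by auto
 have "(\<Sum>A\<in>Pow (insert e E). f A) = (\<Sum>A\<in>Pow E. f A)+(\<Sum>A\<in>Pow E. f (insert e A))"
 unfolding Pow_insert using fin disj inj by (simp add: sum.union_disjoint sum.reindex o_def)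
 then show ?thesis using fin e by (simp add: cavg_def scaleR_add_right)
qed

lemma cavg_reindex_bij:
 assumes "bij_betw h (Pow E) (Pow E')" "card E = card E'"
 shows "cavg E (%A. f (h A)) = cavg E' f"
 unfolding cavg_def assms(2) using sum.reindex_bij_betw[OF assms(1), of f] by simp

lemma cavg_flip: "e : E ==> cavg E (%A. f (flip e A)) = cavg E f"
 by (rule cavg_reindex_bij) (auto intro!: bij_betwI[where g = "flip e"] flip_subset dest: flip_subset)

lemma cavg_compl: "cavg E (%A. f (E-A)) = cavg E f"
 by (rule cavg_reindex_bij) (auto intro!: bij_betwI[where g = "%A. E-A"])

lemma cavg_image:
 assumes "bij_betw h E E'"
 shows "cavg E (%A. f (h ` A)) = cavg E' f"
 using assms by (intro cavg_reindex_bij bij_betw_Pow) (auto simp: bij_betw_same_card)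

lemma cavg_restrict:
 assumes "finite E" "E' \<subseteq> E" and "!!A. A \<subseteq> E ==> f A = f (A \<inter> E')"
 shows "cavg E f = cavg E' f"
proof -
 have fin': "finite E'" using assms finite_subset by blast
 have "cavg (E' \<union> F) f = cavg E' f" if "finite F" "F \<inter> E' = {}" "E' \<union> F \<subseteq> E" for F
 using that
 proof (induction F rule: finite_induct)
 case (insert x F)
 have "cavg (E' \<union> F) (%A. f (insert x A)) = cavg (E' \<union> F) f"
 proof (rule cavg_cong)
 fix A assume A: "A \<subseteq> E' \<union> F"
 have "f (insert x A) = f (insert x A \<inter> E')" "f A = f (A \<inter> E')" 
 using A insert assms(3)[of "insert x A"] assms(3)[of A] assms(2) by auto
 moreover have "insert x A \<inter> E' = A \<inter> E'" using insert by auto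
 ultimately show "f (insert x A) = f A" by simp
 qed
 moreover have "cavg (E' \<union> F) f = cavg E' f" using insert by auto
 ultimately show ?case using insert fin' by (simp add: cavg_insert scaleR_half_double)
 qed simp
 from this[of "E-E'"] show ?thesis using assms by (simp add: Un_absorb1 Diff_Int_distrib2)
qed

lemma insert_flip: "e' ~= e ==> insert e (flip e' A) = flip e' (insert e A)"
 by (auto simp: flip_def)

text \<open>Tensorisation by induction: split the two-point average over the new sign into its mean
  g and the half difference, and apply the hypothesis to g. Convexity of the square passes the flip
  differences of g back to f.\<close>

lemma cube_poincare_real:
 fixes f :: "'e set => real"
 assumes "finite E"
 shows "cavg E (%A. (f A)^2) <= (cavg E f)^2+(\<Sum>e\<in>E. cavg E (%A. (f A-f (flip e A))^2)/4)"
 using assms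
proof (induction E arbitrary: f rule: finite_induct)
 case empty then show ?case by simp
next
 case (insert e E)
 note ins = cavg_insert[OF insert(1,2)]
 define f1 where "f1 = (%A. f (insert e A))"
 define g where "g = (%A. (f A + f1 A)/2)"
 have g: "cavg (insert e E) f = cavg E g"
 unfolding ins g_def f1_def using cavg_mult_left[of E "1/2 :: real" "%A. f A + f (insert e A)"] by (simp add: cavg_add)
 have "cavg (insert e E) (%A. (f A)^2) = cavg E (%A. ((f A)^2+(f1 A)^2)/2)"
 unfolding ins f1_def using cavg_mult_left[of E "1/2" "%A. (f A)^2+(f1 A)^2"] by (simp add: cavg_add f1_def)
 also have "... = cavg E (%A. (g A)^2+(f A-f1 A)^2/4)"
 by (rule cavg_cong) (simp add: g_def power2_eq_square field_simps)
 also have "... = cavg E (%A. (g A)^2) + cavg E (%A. (f A-f1 A)^2)/4"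
 using cavg_mult_left[of E "1/4" "%A. (f A-f1 A)^2"] by (simp add: cavg_add)
 also have "cavg E (%A. (g A)^2) <= (cavg E g)^2+(\<Sum>e'\<in>E. cavg E (%A. (g A-g (flip e' A))^2)/4)"
 by (rule insert.IH)
 also have "(\<Sum>e'\<in>E. cavg E (%A. (g A-g (flip e' A))^2)/4)
 <= (\<Sum>e'\<in>E. cavg (insert e E) (%A. (f A-f (flip e' A))^2)/4)"
 proof (intro sum_mono divide_right_mono)
 fix e' assume e': "e' : E"
 have ne: "e' ~= e" using insert e' by auto
 have "cavg E (%A. (g A-g (flip e' A))^2) <= cavg E (%A. (1/2)*((f A-f (flip e' A))^2+(f1 A-f1 (flip e' A))^2))"
 proof (rule cavg_mono)
 fix A
 have eq: "g A-g (flip e' A) = ((f A-f (flip e' A))+(f1 A-f1 (flip e' A)))/2" by (simp add: g_def field_simps)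
 have ineq: "((a + b)/2)^2 <= (1/2)*(a^2 + b^2)" for a b :: real
 using sum_squares_bound[of a b] by (simp add: power2_eq_square field_simps)
 show "(g A-g (flip e' A))^2 <= (1/2)*((f A-f (flip e' A))^2+(f1 A-f1 (flip e' A))^2)"
 unfolding eq by (rule ineq)
 qed
 also have "... = cavg (insert e E) (%A. (f A-f (flip e' A))^2)"
 unfolding cavg_mult_left cavg_add ins by (simp add: f1_def insert_flip[OF ne])
 finally show "cavg E (%A. (g A-g (flip e' A))^2) <= cavg (insert e E) (%A. (f A-f (flip e' A))^2)" .
 qed simp
 also have "cavg E (%A. (f A-f1 A)^2) = cavg (insert e E) (%A. (f A-f (flip e A))^2)"
 proof -
 have "cavg E (%A. (f A-f (flip e A))^2) = cavg E (%A. (f A-f1 A)^2)"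
 using insert(2) by (intro cavg_cong) (auto simp: flip_def f1_def)
 moreover have "cavg E (%A. (f (insert e A)-f (flip e (insert e A)))^2) = cavg E (%A. (f A-f1 A)^2)"
 proof (rule cavg_cong)
 fix A assume "A \<subseteq> E"
 then have "flip e (insert e A) = A" using insert(2) by (auto simp: flip_def)
 then show "(f (insert e A)-f (flip e (insert e A)))^2 = (f A-f1 A)^2" by (simp add: f1_def power2_commute)
 qed
 ultimately show ?thesis unfolding ins by simp
 qed
 finally show ?case using insert(1,2) by (simp add: g)
qed

lemma cube_poincare:
 fixes f :: "'e set => complex"
 assumes fin: "finite E"
 shows "cavg E (%A. (cmod (f A-cavg E f))^2) <= (\<Sum>e\<in>E. cavg E (%A. (cmod (f A-f (flip e A)))^2))/4"
proof -
 have R: "cavg E (%A. (g A-cavg E g)^2) <= (\<Sum>e\<in>E. cavg E (%A. (g A-g (flip e A))^2))/4" for g :: "'e set => real"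
 proof -
 have "cavg E (%A. g A-cavg E g) = 0" by (simp add: cavg_diff cavg_const[OF fin])
 then show ?thesis using cube_poincare_real[OF fin, of "%A. g A-cavg E g"] by (simp add: sum_divide_distrib)
 qed
 have re: "Re (cavg E f) = cavg E (%A. Re (f A))" "Im (cavg E f) = cavg E (%A. Im (f A))"
 by (simp_all add: cavg_bounded_linear bounded_linear_Re bounded_linear_Im)
 show ?thesis
 using R[of "%A. Re (f A)"] R[of "%A. Im (f A)"]
 by (simp add: cmod_power2 cavg_add sum.distrib re add_divide_distrib)
qed

text \<open>Pairs each configuration with its flip at e; integration by parts in one sign starts
  from here.\<close>

lemma cavg_symmetrize: "e : E ==> cavg E f = (1/2) *\<^sub>R cavg E (%A. f A + f (flip e A))"
 by (simp add: cavg_add cavg_flip scaleR_half_double)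

section \<open>Laplacians as sums over ordered pairs\<close>

text \<open>The incidence vector of an ordered pair. A loop gives the zero vector, so its coordinate
  has no influence on \<open>Lap\<close>.\<close>

definition edge :: "'i \<times> 'i => 'i => real" where
 "edge e i = of_bool (fst e = i)-of_bool (snd e = i)"

text \<open>The minus sign matches the convention with A(i, j) off the diagonal: for i \<noteq> j
  the entry is y (i, j) + y (j, i), and all row sums vanish. Both orientations of a pair carry a
  coordinate of their own.\<close>

definition Lap :: "'i set => ('i \<times> 'i => real) => 'i => 'i => real" where
 "Lap I y i j =-(\<Sum>e\<in>I \<times> I. y e*(edge e i * edge e j))"

definition rademacher :: "('e => real) => 'e set => 'e => real" where
 "rademacher t A e = sqrt (t e) * sgnset A e"

definition mean_trace :: "'i set => complex => ('i \<times> 'i => real) => complex" where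
 "mean_trace I z t = cavg (I \<times> I) (%A. \<Sum>i\<in>I. res I z (Lap I (rademacher t A)) i i)"

lemma sym_on_Lap [simp]: "sym_on I (Lap I y)" by (simp add: sym_on_def Lap_def mult.commute)

lemma Lap_diff_single:
 assumes fin: "finite I" and e: "e : I \<times> I" and y: "!!e'. e' ~= e ==> y' e' = y e'"
 shows "Lap I y' i j-Lap I y i j = (y e-y' e)*(edge e i * edge e j)"
proof -
 have "Lap I y' i j-Lap I y i j = (\<Sum>e'\<in>I \<times> I. (y e'-y' e')*(edge e' i * edge e' j))"
 by (simp add: Lap_def sum_subtractf left_diff_distrib)
 also have "... = (\<Sum>e'\<in>{e}. (y e'-y' e')*(edge e' i * edge e' j))"
 using fin e y by (intro sum.mono_neutral_right) auto
 finally show ?thesis by simp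
qed

lemma res2_sym: "res2 I z A i j = res2 I z A j i"
 unfolding res2_def by (rule fcalc_sym)

context
 fixes I :: "'i set"
 assumes fin: "finite I"
begin

lemma sum_edge: "e : I \<times> I ==> (\<Sum>j\<in>I. X j * of_real (edge e j)) = X (fst e)-(X (snd e) :: complex)"
proof -
 assume e: "e : I \<times> I"
 have "(\<Sum>j\<in>I. X j * of_real (edge e j)) = (\<Sum>j\<in>I. X j * of_bool (fst e = j))-(\<Sum>j\<in>I. X j * of_bool (snd e = j))"
 by (auto simp: sum_subtractf[symmetric] edge_def of_bool_def intro!: sum.cong)
 then show ?thesis using e sum_of_bool_mult_left(3)[OF fin, of "fst e" X] sum_of_bool_mult_left(3)[OF fin, of "snd e" X]
 by (simp add: mem_Times_iff)
qed

lemma mv_edge: "e : I \<times> I ==> mv I X (edge e) i = X i (fst e)-X i (snd e)"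
 unfolding mv_def by (rule sum_edge)

lemma qf_edge: "e : I \<times> I ==> qf I X (edge e) = X (fst e) (fst e)-X (fst e) (snd e)-(X (snd e) (fst e)-X (snd e) (snd e))"
 unfolding qf_def by (subst mult.commute) (simp add: sum_edge mv_edge)

lemma edge_norm: "e : I \<times> I ==> (\<Sum>i\<in>I. (edge e i)^2) <= 2"
proof -
 assume e: "e : I \<times> I"
 have "(\<Sum>i\<in>I. (edge e i)^2) <= (\<Sum>i\<in>I. 1 * of_bool (fst e = i)+1 * of_bool (snd e = i))"
 by (intro sum_mono) (auto simp: edge_def)
 also have "... <= 2" unfolding sum.distrib 
 using sum_of_bool_mult_left(3)[OF fin, of "fst e" "%_. 1::real"] sum_of_bool_mult_left(3)[OF fin, of "snd e" "%_. 1::real"] e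
 by (simp add: mem_Times_iff)
 finally show ?thesis .
qed

context
 fixes z :: complex
 assumes z: "Im z > 0"
begin

lemma res_norm_le: "sym_on I A ==> i : I ==> j : I ==> cmod (res I z A i j) <= 1/Im z"
 unfolding res_def by (rule fcalc_norm_le[OF fin _ cmod_inverse_le[OF z]])

lemma res2_norm_le: "sym_on I A ==> i : I ==> j : I ==> cmod (res2 I z A i j) <= (1/Im z)^2"
 unfolding res2_def by (rule fcalc_norm_le[OF fin _ cmod_inverse2_le[OF z]])

lemma norm_diff4: "cmod (a-b-(c-d)) <= cmod a + cmod b + cmod c + cmod d"
 using norm_triangle_ineq4[of "a-b" "c-d"] norm_triangle_ineq4[of a b] norm_triangle_ineq4[of c d] by linarith

lemma qf_res_le: "sym_on I A ==> e : I \<times> I ==> cmod (qf I (res I z A) (edge e)) <= 4*(1/Im z)"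
 unfolding qf_edge
 by (rule order_trans[OF norm_diff4])
 (use res_norm_le[of A "fst e" "fst e"] res_norm_le[of A "fst e" "snd e"] res_norm_le[of A "snd e" "fst e"]
 res_norm_le[of A "snd e" "snd e"] in \<open>auto simp: mem_Times_iff\<close>)

lemma qf_res2_le: "sym_on I A ==> e : I \<times> I ==> cmod (qf I (res2 I z A) (edge e)) <= 4*(1/Im z)^2"
 unfolding qf_edge
 by (rule order_trans[OF norm_diff4])
 (use res2_norm_le[of A "fst e" "fst e"] res2_norm_le[of A "fst e" "snd e"] res2_norm_le[of A "snd e" "fst e"]
 res2_norm_le[of A "snd e" "snd e"] in \<open>auto simp: mem_Times_iff\<close>)

lemma tendsto_Lap:
 "(!!e. e : I \<times> I ==> ((%x. y x e) \<longlongrightarrow> y0 e) F) ==> ((%x. Lap I (y x) i j) \<longlongrightarrow> Lap I y0 i j) F"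
 unfolding Lap_def by (intro tendsto_intros) auto

text \<open>The resolvent identity together with the uniform bound 1/Im z makes the resolvent
  entries Lipschitz in the matrix entries; no continuity of eigenvectors is involved.\<close>

lemma tendsto_res:
 assumes y: "!!e. e : I \<times> I ==> ((%x. y x e) \<longlongrightarrow> y0 e) F" and il: "i : I" "l : I"
 shows "((%x. res I z (Lap I (y x)) i l) \<longlongrightarrow> res I z (Lap I y0) i l) F"
proof -
 let ?D = "%x. \<Sum>j\<in>I. \<Sum>k\<in>I. (1/Im z)^2*\<bar>Lap I y0 j k-Lap I (y x) j k\<bar>"
 have "((%x. res I z (Lap I (y x)) i l-res I z (Lap I y0) i l) \<longlongrightarrow> 0) F"
 proof (rule tendsto_0_le[where K = 1 and f = ?D])
 have "(?D \<longlongrightarrow> (\<Sum>j\<in>I. \<Sum>k\<in>I. (1/Im z)^2*\<bar>Lap I y0 j k-Lap I y0 j k\<bar>)) F"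
 by (intro tendsto_intros tendsto_Lap y)
 then show "(?D \<longlongrightarrow> 0) F" by simp
 show "\<forall>\<^sub>F x in F. norm (res I z (Lap I (y x)) i l-res I z (Lap I y0) i l) <= norm (?D x)*1"
 proof (intro always_eventually allI)
 fix x
 have "cmod (res I z (Lap I (y x)) i l-res I z (Lap I y0) i l) <= ?D x"
 unfolding resolvent_identity[OF fin sym_on_Lap sym_on_Lap z il]
 proof (intro sum_norm_le)
 fix j k assume jk: "j : I" "k : I"
 have le: "cmod (res I z (Lap I (y x)) i j) * cmod (res I z (Lap I y0) k l) <= (1/Im z)*(1/Im z)"
 using jk il z by (intro mult_mono res_norm_le) auto
 then show "cmod (res I z (Lap I (y x)) i j * of_real (Lap I y0 j k-Lap I (y x) j k) * res I z (Lap I y0) k l)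
 <= (1/Im z)^2*\<bar>Lap I y0 j k-Lap I (y x) j k\<bar>"
 using mult_right_mono[OF le, of "\<bar>Lap I y0 j k-Lap I (y x) j k\<bar>"]
 by (simp add: norm_mult power2_eq_square mult_ac del: of_real_diff)
 qed
 then show "norm (res I z (Lap I (y x)) i l-res I z (Lap I y0) i l) <= norm (?D x)*1" by simp
 qed
 qed
 then show ?thesis by (simp add: LIM_zero_iff)
qed

lemma has_vector_derivative_from_quotient:
 assumes "((%y. (f y-f x) /\<^sub>R (y-x)) \<longlongrightarrow> D) (at x)"
 shows "(f has_vector_derivative (D :: 'b :: real_normed_vector)) (at x)"
proof -
 have "((%y. (f y-f x) /\<^sub>R (y-x)-D) \<longlongrightarrow> 0) (at x)" using assms by (simp add: LIM_zero_iff)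
 then have "((%y. norm ((f y-f x) /\<^sub>R (y-x)-D)) \<longlongrightarrow> 0) (at x)" by (rule tendsto_norm_zero)
 moreover have "\<forall>\<^sub>F y in at x. norm ((f y-f x) /\<^sub>R (y-x)-D) = norm ((f y-f x-(y-x) *\<^sub>R D) /\<^sub>R norm (y-x))"
 proof (rule eventually_at_filter[THEN iffD2], intro always_eventually allI impI)
 fix y :: real assume "y ~= x"
 then have "(f y-f x) /\<^sub>R (y-x)-D = (1/(y-x)) *\<^sub>R (f y-f x-(y-x) *\<^sub>R D)"
 by (simp add: scaleR_diff_right divide_inverse)
 then show "norm ((f y-f x) /\<^sub>R (y-x)-D) = norm ((f y-f x-(y-x) *\<^sub>R D) /\<^sub>R norm (y-x))"
 by (simp add: divide_inverse)
 qed
 ultimately have "((%y. norm ((f y-f x-(y-x) *\<^sub>R D) /\<^sub>R norm (y-x))) \<longlongrightarrow> 0) (at x)"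
 by (rule Lim_transform_eventually)
 then have "((%y. (f y-f x-(y-x) *\<^sub>R D) /\<^sub>R norm (y-x)) \<longlongrightarrow> 0) (at x)"
 by (rule tendsto_norm_zero_cancel)
 then show ?thesis unfolding has_vector_derivative_def has_derivative_def
 by (simp add: bounded_linear_scaleR_left Lim_ident_at)
qed

text \<open>For L' = - sum y'_e v_e v_e^T the derivative of the trace is - tr(R L' R) = sum y'_e
  v_e^T R^2 v_e; the two minus signs cancel. The proof passes to the limit in the exact resolvent
  identity.\<close>

lemma trace_res_deriv:
 assumes y: "!!e. e : I \<times> I ==> ((%x. y x e) has_real_derivative y' e) (at s)"
 shows "((%x. \<Sum>i\<in>I. res I z (Lap I (y x)) i i) has_vector_derivative
 (\<Sum>e\<in>I \<times> I. of_real (y' e) * qf I (res2 I z (Lap I (y s))) (edge e))) (at s)"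
proof (rule has_vector_derivative_from_quotient)
 let ?R = "%x. res I z (Lap I (y x))"
 have cont: "((%x. y x e) \<longlongrightarrow> y s e) (at s)" if "e : I \<times> I" for e
 using DERIV_isCont[OF y[OF that]] by (simp add: isCont_def)
 have quot: "((%x. (y s e-y x e)/(x-s)) \<longlongrightarrow>-y' e) (at s)" if "e : I \<times> I" for e
 proof -
 have "((%x.-((y x e-y s e)/(x-s))) \<longlongrightarrow>-y' e) (at s)"
 using y[OF that] by (intro tendsto_minus) (simp add: has_field_derivative_iff)
 then show ?thesis by (simp add: minus_divide_left)
 qed
 have Ld: "(Lap I (y s) j k-Lap I (y x) j k)/(x-s) = Lap I (%e. (y s e-y x e)/(x-s)) j k" for x j k
 by (simp add: Lap_def diff_divide_distrib left_diff_distrib sum_subtractf sum_divide_distrib)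
 have "((%x. \<Sum>i\<in>I. \<Sum>j\<in>I. \<Sum>k\<in>I. ?R x i j * of_real (Lap I (%e. (y s e-y x e)/(x-s)) j k)*?R s k i)
 \<longlongrightarrow> (\<Sum>i\<in>I. \<Sum>j\<in>I. \<Sum>k\<in>I. ?R s i j * of_real (Lap I (%e.-y' e) j k)*?R s k i)) (at s)"
 by (intro tendsto_intros tendsto_res cont tendsto_Lap quot)
 moreover have "((\<Sum>i\<in>I. ?R x i i)-(\<Sum>i\<in>I. ?R s i i)) /\<^sub>R (x-s) =
 (\<Sum>i\<in>I. \<Sum>j\<in>I. \<Sum>k\<in>I. ?R x i j * of_real (Lap I (%e. (y s e-y x e)/(x-s)) j k)*?R s k i)" for x
 proof -
 have "((\<Sum>i\<in>I. ?R x i i)-(\<Sum>i\<in>I. ?R s i i)) = (\<Sum>i\<in>I. \<Sum>j\<in>I. \<Sum>k\<in>I. ?R x i j * of_real (Lap I (y s) j k-Lap I (y x) j k)*?R s k i)"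
 unfolding sum_subtractf[symmetric] by (intro sum.cong refl resolvent_identity fin sym_on_Lap z)
 then show ?thesis unfolding Ld[symmetric]
 by (simp add: scaleR_right.sum) (intro sum.cong refl, simp add: scaleR_conv_of_real divide_inverse mult_ac)
 qed
 moreover have "(\<Sum>i\<in>I. \<Sum>j\<in>I. \<Sum>k\<in>I. ?R s i j * of_real (Lap I (%e.-y' e) j k)*?R s k i) =
 (\<Sum>e\<in>I \<times> I. of_real (y' e) * qf I (res2 I z (Lap I (y s))) (edge e))"
 proof -
 have "(\<Sum>i\<in>I. \<Sum>j\<in>I. \<Sum>k\<in>I. ?R s i j * of_real (Lap I (%e.-y' e) j k)*?R s k i)
 = (\<Sum>j\<in>I. \<Sum>k\<in>I. of_real (Lap I (%e.-y' e) j k)*(\<Sum>i\<in>I. ?R s k i*?R s i j))"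
 by (subst sum.swap, rule sum.cong[OF refl], subst sum.swap) (simp add: sum_distrib_left mult_ac)
 also have "... = (\<Sum>j\<in>I. \<Sum>k\<in>I. \<Sum>e\<in>I \<times> I. of_real (y' e)*(of_real (edge e j)*(res2 I z (Lap I (y s)) j k * of_real (edge e k))))"
 unfolding res_res_mult[OF fin sym_on_Lap]
 by (intro sum.cong refl, subst res2_sym) (simp add: Lap_def sum_negf sum_distrib_left sum_distrib_right mult_ac)
 also have "... = (\<Sum>e\<in>I \<times> I. \<Sum>j\<in>I. \<Sum>k\<in>I. of_real (y' e)*(of_real (edge e j)*(res2 I z (Lap I (y s)) j k * of_real (edge e k))))"
 by (rule trans[OF sum.cong[OF refl sum.swap] sum.swap])
 finally show ?thesis by (simp add: qf_def mv_def sum_distrib_left)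
 qed
 ultimately show "((%x. ((\<Sum>i\<in>I. ?R x i i)-(\<Sum>i\<in>I. ?R s i i)) /\<^sub>R (x-s)) \<longlongrightarrow>
 (\<Sum>e\<in>I \<times> I. of_real (y' e) * qf I (res2 I z (Lap I (y s))) (edge e))) (at s)" by simp
qed

end
end

lemma qf_rank_two:
 assumes "!!i j. i : I ==> j : I ==> X i j-Y i j = c*(a i * b j + a' i * b' j)"
 shows "qf I X v-qf I Y v = c*((\<Sum>i\<in>I. of_real (v i) * a i)*(\<Sum>j\<in>I. of_real (v j) * b j)
 +(\<Sum>i\<in>I. of_real (v i) * a' i)*(\<Sum>j\<in>I. of_real (v j) * b' j))"
proof -
 have "qf I X v-qf I Y v = (\<Sum>i\<in>I. \<Sum>j\<in>I. of_real (v i)*((X i j-Y i j) * of_real (v j)))"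
 by (simp add: qf_def mv_def sum_distrib_left sum_subtractf[symmetric] algebra_simps)
 also have "... = (\<Sum>i\<in>I. \<Sum>j\<in>I. of_real (v i)*((c*(a i * b j + a' i * b' j)) * of_real (v j)))"
 using assms by simp
 also have "... = c*((\<Sum>i\<in>I. \<Sum>j\<in>I. (of_real (v i) * a i)*(of_real (v j) * b j))
 +(\<Sum>i\<in>I. \<Sum>j\<in>I. (of_real (v i) * a' i)*(of_real (v j) * b' j)))"
 unfolding sum_distrib_left sum.distrib[symmetric] by (simp add: algebra_simps)
 finally show ?thesis by (simp only: sum_product)
qed

section \<open>Interpolation between variance profiles in the sign model\<close>

definition rho :: "'i set => complex => ('i \<times> 'i => real) => ('i \<times> 'i) set => 'i => 'i => complex" where
 "rho I z t A = res I z (Lap I (rademacher t A))"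

definition rho2 :: "'i set => complex => ('i \<times> 'i => real) => ('i \<times> 'i) set => 'i => 'i => complex" where
 "rho2 I z t A = res2 I z (Lap I (rademacher t A))"

lemma rademacher_flip: "rademacher t (flip e A) e =-rademacher t A e"
 "e' ~= e ==> rademacher t (flip e A) e' = rademacher t A e'"
 by (simp_all add: rademacher_def sgnset_flip)

lemma abs_rademacher: "0 <= t e ==> \<bar>rademacher t A e\<bar> = sqrt (t e)"
 by (simp add: rademacher_def abs_mult)

context
 fixes I :: "'i set" and z :: complex
 assumes fin: "finite I" and z: "Im z > 0"
begin

lemma Lap_flip:
 "e : I \<times> I ==> Lap I (rademacher t (flip e A)) i j-Lap I (rademacher t A) i j
 = 2 * rademacher t A e*(edge e i * edge e j)"
 by (subst Lap_diff_single[OF fin, of e]) (simp_all add: rademacher_flip)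

lemma rho_flip:
 assumes "e : I \<times> I" "i : I" "j : I"
 shows "rho I z t A i j-rho I z t (flip e A) i j =
 of_real (2 * rademacher t A e) * mv I (rho I z t A) (edge e) i * mv I (rho I z t (flip e A)) (edge e) j"
 unfolding rho_def by (rule res_rank_one[OF fin _ _ z assms(2,3) Lap_flip[OF assms(1)]]) simp_all

lemma rho2_flip:
 assumes "e : I \<times> I" "i : I" "j : I"
 shows "rho2 I z t A i j-rho2 I z t (flip e A) i j =
 of_real (2 * rademacher t A e)*(mv I (rho2 I z t A) (edge e) i * mv I (rho I z t (flip e A)) (edge e) j
 + mv I (rho I z t A) (edge e) i * mv I (rho2 I z t (flip e A)) (edge e) j)"
 unfolding rho_def rho2_def by (rule res2_rank_one[OF fin _ _ z assms(2,3) Lap_flip[OF assms(1)]]) simp_all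

lemma qf_rho_flip:
 assumes "e : I \<times> I"
 shows "qf I (rho I z t A) (edge e)-qf I (rho I z t (flip e A)) (edge e) =
 of_real (2 * rademacher t A e)*(qf I (rho I z t A) (edge e) * qf I (rho I z t (flip e A)) (edge e))"
proof -
 have "rho I z t A i j-rho I z t (flip e A) i j =
 of_real (2 * rademacher t A e)*(mv I (rho I z t A) (edge e) i * mv I (rho I z t (flip e A)) (edge e) j+0*0)"
 if "i : I" "j : I" for i j using rho_flip[OF assms that] by (simp add: mult_ac)
 from qf_rank_two[OF this] show ?thesis by (simp add: qf_def)
qed

lemma qf_rho2_flip:
 assumes "e : I \<times> I"
 shows "qf I (rho2 I z t A) (edge e)-qf I (rho2 I z t (flip e A)) (edge e) =
 of_real (2 * rademacher t A e)*(qf I (rho2 I z t A) (edge e) * qf I (rho I z t (flip e A)) (edge e)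
 + qf I (rho I z t A) (edge e) * qf I (rho2 I z t (flip e A)) (edge e))"
 using qf_rank_two[OF rho2_flip[OF assms]] by (simp add: qf_def)

lemma qf_rho_le: "e : I \<times> I ==> cmod (qf I (rho I z t A) (edge e)) <= 4*(1/Im z)"
 unfolding rho_def by (rule qf_res_le[OF fin z sym_on_Lap])

lemma qf_rho2_le: "e : I \<times> I ==> cmod (qf I (rho2 I z t A) (edge e)) <= 4*(1/Im z)^2"
 unfolding rho2_def by (rule qf_res2_le[OF fin z sym_on_Lap])

text \<open>Integration by parts for a single sign: flipping it turns the sign into a rank-one difference.\<close>

lemma sign_integration_by_parts:
 assumes e: "e : I \<times> I" and te: "0 <= t e" "t e <= kap" and d: "d ~= 0 ==> 0 < t e"
 shows "cmod (cavg (I \<times> I) (%A. of_real (d/(2 * sqrt (t e)) * sgnset A e) * qf I (rho2 I z t A) (edge e))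
 -cavg (I \<times> I) (%A. of_real d*(qf I (rho I z t A) (edge e) * qf I (rho2 I z t A) (edge e))))
 <= 128*(1/Im z) ^ 4 * sqrt kap*\<bar>d\<bar>"
proof -
 define r where "r = (%A. qf I (rho I z t A) (edge e))"
 define q where "q = (%A. qf I (rho2 I z t A) (edge e))"
 define y' where "y' = (%A. d/(2 * sqrt (t e)) * sgnset A e)"
 let ?E = "I \<times> I"
 have finE: "finite ?E" using fin by simp
 have rle: "cmod (r A) <= 4*(1/Im z)" and qle: "cmod (q A) <= 4*(1/Im z)^2" for A
 unfolding r_def q_def by (rule qf_rho_le[OF e] qf_rho2_le[OF e])+
 \<comment> \<open>The coefficient d/(2 sqrt t) is the derivative of sqrt t; multiplied by the jump
   2 sqrt t of the coordinate it leaves d, so the singularity at small t disappears.\<close>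
 have y'y: "y' A*(2 * rademacher t A e) = d" for A
 using d by (cases "d = 0") (auto simp: y'_def rademacher_def field_simps)
 have "cavg ?E (%A. of_real (y' A) * q A) =
 (1/2) *\<^sub>R cavg ?E (%A. of_real (y' A) * q A + of_real (y' (flip e A)) * q (flip e A))"
 by (rule cavg_symmetrize[OF e])
 also have "(%A. of_real (y' A) * q A + of_real (y' (flip e A)) * q (flip e A)) =
 (%A. of_real d*(q A * r (flip e A) + r A * q (flip e A)))"
 proof
 fix A
 have "of_real (y' A) * q A + of_real (y' (flip e A)) * q (flip e A) = of_real (y' A)*(q A-q (flip e A))"
 proof -
 have "y' (flip e A) =-y' A" by (simp add: y'_def sgnset_flip)
 then show ?thesis by (simp add: right_diff_distrib)
 qed
 also have "... = of_real (y' A*(2 * rademacher t A e))*(q A * r (flip e A) + r A * q (flip e A))"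
 unfolding q_def r_def qf_rho2_flip[OF e] by simp
 finally show "of_real (y' A) * q A + of_real (y' (flip e A)) * q (flip e A) = of_real d*(q A * r (flip e A) + r A * q (flip e A))"
 unfolding y'y .
 qed
 also have "(1/2) *\<^sub>R cavg ?E (%A. of_real d*(q A * r (flip e A) + r A * q (flip e A)))
 = of_real d * cavg ?E (%A. q A * r (flip e A))"
 proof -
 \<comment> \<open>By flip invariance the two cross terms have the same average, so a single product
   with one flipped factor remains.\<close>
 have "cavg ?E (%A. r A * q (flip e A)) = cavg ?E (%A. q A * r (flip e A))"
 using cavg_flip[OF e, of "%A. r A * q (flip e A)"] by (simp add: mult.commute)
 then show ?thesis by (simp add: cavg_mult_left cavg_add scaleR_conv_of_real)
 qed
 finally have "cavg ?E (%A. of_real (y' A) * q A)-cavg ?E (%A. of_real d*(r A * q A))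
 = cavg ?E (%A. of_real d*(q A*(r (flip e A)-r A)))"
 by (simp add: cavg_mult_left[symmetric] cavg_diff[symmetric] algebra_simps)
 \<comment> \<open>With b = 1/Im z, undoing the flip costs 2 sqrt kap (4 b)^2, and |q| <= 4 b^2;
   this is the origin of 128 b^4.\<close>
 moreover have "cmod (cavg ?E (%A. of_real d*(q A*(r (flip e A)-r A)))) <= cavg ?E (%A. 128*(1/Im z) ^ 4 * sqrt kap*\<bar>d\<bar>)"
 proof (rule order_trans[OF norm_cavg_le cavg_mono])
 fix A
 have "cmod (r (flip e A)-r A) = cmod (r A-r (flip e A))" by (rule norm_minus_commute)
 also have "... = 2 * sqrt (t e)*(cmod (r A) * cmod (r (flip e A)))"
 unfolding r_def qf_rho_flip[OF e] using te by (simp add: norm_mult abs_rademacher abs_mult del: of_real_mult)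
 also have "... <= 2 * sqrt kap*((4*(1/Im z))*(4*(1/Im z)))"
 using te z by (intro mult_mono rle) auto
 finally have 1: "cmod (r (flip e A)-r A) <= 2 * sqrt kap*((4*(1/Im z))*(4*(1/Im z)))" .
 have "cmod (q A) * cmod (r (flip e A)-r A) <= (4*(1/Im z)^2)*(2 * sqrt kap*((4*(1/Im z))*(4*(1/Im z))))"
 by (rule mult_mono[OF qle 1]) auto
 then have "\<bar>d\<bar>*(cmod (q A) * cmod (r (flip e A)-r A)) <= \<bar>d\<bar>*((4*(1/Im z)^2)*(2 * sqrt kap*((4*(1/Im z))*(4*(1/Im z)))))"
 by (rule mult_left_mono) simp
 also have "... = 128*(1/Im z) ^ 4 * sqrt kap*\<bar>d\<bar>" by (simp add: power2_eq_square power4_eq_xxxx mult_ac)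
 finally show "cmod (of_real d*(q A*(r (flip e A)-r A))) <= 128*(1/Im z) ^ 4 * sqrt kap*\<bar>d\<bar>"
 by (simp add: norm_mult)
 qed
 ultimately show ?thesis by (simp add: cavg_const[OF finE] q_def r_def y'_def)
qed

text \<open>Variances, not standard deviations, are interpolated linearly, so that after integration
  by parts the main term of the derivative is weighted by t1 - t0. Only the open interval is
  differentiated: at an end point a variance may vanish, where sqrt is not differentiable, hence the
  mean value inequality for a function that is merely continuous up to the boundary.\<close>

theorem interpolation:
 assumes t0: "!!e. e : I \<times> I ==> 0 <= t0 e \<and> t0 e <= kap" and t1: "!!e. e : I \<times> I ==> 0 <= t1 e \<and> t1 e <= kap"
 defines "tt \<equiv> %s e. (1-s) * t0 e + s * t1 e"
 assumes B: "!!s. 0 < s ==> s < 1 ==> cmod (cavg (I \<times> I) (%A. \<Sum>e\<in>I \<times> I. of_real (t1 e-t0 e) *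
 (qf I (rho I z (tt s) A) (edge e) * qf I (rho2 I z (tt s) A) (edge e)))) <= B"
 shows "cmod (mean_trace I z t1-mean_trace I z t0) <= B+128*(1/Im z) ^ 4 * sqrt kap*(\<Sum>e\<in>I \<times> I. \<bar>t1 e-t0 e\<bar>)"
proof -
 let ?E = "I \<times> I"
 have finE: "finite ?E" using fin by simp
 define F where "F = (%s. mean_trace I z (tt s))"
 define dy where "dy = (%s A e. (t1 e-t0 e)/(2 * sqrt (tt s e)) * sgnset A e)"
 define F' where "F' = (%s. cavg ?E (%A. \<Sum>e\<in>?E. of_real (dy s A e) * qf I (rho2 I z (tt s) A) (edge e)))"
 have tt: "0 <= tt s e" "tt s e <= kap" if "e : ?E" "0 <= s" "s <= 1" for s e
 proof -
 show "0 <= tt s e" using t0[OF that(1)] t1[OF that(1)] that by (simp add: tt_def)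
 have "tt s e <= (1-s) * kap + s * kap" unfolding tt_def
 using t0[OF that(1)] t1[OF that(1)] that by (intro add_mono mult_left_mono) auto
 then show "tt s e <= kap" by (simp add: algebra_simps)
 qed
 \<comment> \<open>A rate that changes along the path is positive inside it, so its square root is
   differentiable there.\<close>
 have ttpos: "0 < tt s e" if "e : ?E" "0 < s" "s < 1" "t1 e-t0 e ~= 0" for s e
 proof (cases "t0 e = 0")
 case True then show ?thesis using t1[OF that(1)] that by (simp add: tt_def order_less_le)
 next
 case False
 then have "0 < (1-s) * t0 e" using t0[OF that(1)] that by (simp add: order_less_le)
 moreover have "0 <= s * t1 e" using t1[OF that(1)] that by simp
 ultimately show ?thesis by (simp add: tt_def)
 qed
 have cont: "continuous_on {0..1} F"
 proof (rule continuous_at_imp_continuous_on, rule ballI)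
 fix s :: real
 show "isCont F s" unfolding F_def mean_trace_def cavg_def isCont_def
 by (intro tendsto_intros tendsto_res[OF fin z]) (auto simp: rademacher_def tt_def intro!: tendsto_intros)
 qed
 have der: "(F has_vector_derivative F' s) (at s)" if s: "0 < s" "s < 1" for s
 unfolding F_def F'_def mean_trace_def cavg_def
 proof (intro bounded_linear.has_vector_derivative[OF bounded_linear_scaleR_right] has_vector_derivative_sum)
 fix A
 have "((%x. rademacher (tt x) A e) has_real_derivative dy s A e) (at s)" if e: "e : ?E" for e
 proof (cases "t1 e-t0 e = 0")
 case True
 then have "(%x. rademacher (tt x) A e) = (%_. rademacher t0 A e)" by (auto simp: rademacher_def tt_def algebra_simps)
 then show ?thesis using True by (simp add: dy_def)
 next
 case False
 from ttpos[OF e s this] have p: "(1-s) * t0 e + s * t1 e > 0" by (simp add: tt_def)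
 show ?thesis unfolding rademacher_def tt_def dy_def
 by (rule derivative_eq_intros refl | use p in \<open>simp add: field_simps\<close>)+
 qed
 from trace_res_deriv[OF fin z this]
 show "((%x. \<Sum>i\<in>I. res I z (Lap I (rademacher (tt x) A)) i i) has_vector_derivative
 (\<Sum>e\<in>?E. of_real (dy s A e) * qf I (rho2 I z (tt s) A) (edge e))) (at s)" by (simp add: rho2_def)
 qed
 have bound: "cmod (F' s) <= B+128*(1/Im z) ^ 4 * sqrt kap*(\<Sum>e\<in>?E. \<bar>t1 e-t0 e\<bar>)" if s: "0 < s" "s < 1" for s
 proof -
 let ?M = "%e. cavg ?E (%A. of_real (t1 e-t0 e)*(qf I (rho I z (tt s) A) (edge e) * qf I (rho2 I z (tt s) A) (edge e)))"
 let ?D = "%e. cavg ?E (%A. of_real (dy s A e) * qf I (rho2 I z (tt s) A) (edge e))"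
 have "cmod ((\<Sum>e\<in>?E. ?D e)-(\<Sum>e\<in>?E. ?M e)) <= (\<Sum>e\<in>?E. 128*(1/Im z) ^ 4 * sqrt kap*\<bar>t1 e-t0 e\<bar>)"
 unfolding sum_subtractf[symmetric] dy_def
 using s by (intro sum_norm_le sign_integration_by_parts tt ttpos) auto
 moreover have "F' s = (\<Sum>e\<in>?E. ?D e)" unfolding F'_def by (rule cavg_sum)
 moreover have "cmod (\<Sum>e\<in>?E. ?M e) <= B" using B[OF s] unfolding cavg_sum .
 ultimately show ?thesis
 using norm_triangle_sub[of "F' s" "\<Sum>e\<in>?E. ?M e"] by (simp add: sum_distrib_left)
 qed
 obtain s where s: "s : {0<..<1}" "norm (F 1-F 0) <= norm ((1-0) *\<^sub>R F' s)"
 using mvt_general[OF _ cont, of "%s h. h *\<^sub>R F' s"] der unfolding has_vector_derivative_def by auto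
 have "tt 1 = t1" "tt 0 = t0" by (auto simp: tt_def)
 then show ?thesis using s bound[of s] by (simp add: F_def)
qed

end

lemma norm_cavg_bound:
 fixes f :: "'e set => 'b :: real_normed_vector"
 assumes "finite E" "!!A. A \<subseteq> E ==> norm (f A) <= C"
 shows "norm (cavg E f) <= C"
proof -
 have "norm (cavg E f) <= cavg E (%A. norm (f A))" by (rule norm_cavg_le)
 also have "... <= cavg E (%_. C)" using assms(2) by (rule cavg_mono)
 finally show ?thesis using assms(1) by (simp add: cavg_const)
qed

section \<open>Cut norm bounds for bilinear forms and for mean traces\<close>

text \<open>A bilinear form on unit cubes is maximal at vertices: for fixed y, rounding x to the
  indicator of the positive coefficients can only increase the value, and then likewise for
  y.\<close>

lemma cut_bilinear_unit:
 fixes d :: "'i => 'j => real"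
 assumes fin: "finite I" "finite J"
 and cut: "!!S T. S \<subseteq> I ==> T \<subseteq> J ==> (\<Sum>i\<in>S. \<Sum>j\<in>T. d i j) <= c"
 and x: "!!i. i : I ==> 0 <= x i \<and> x i <= 1" and y: "!!j. j : J ==> 0 <= y j \<and> y j <= 1"
 shows "(\<Sum>i\<in>I. \<Sum>j\<in>J. d i j * x i * y j) <= c"
proof -
 have max: "(\<Sum>i\<in>L. w i * g i) <= (\<Sum>i\<in>{i\<in>L. w i > 0}. w i)"
 if "finite L" "!!i. i : L ==> 0 <= g i \<and> g i <= 1" for L :: "'k set" and w g :: "'k => real"
 proof -
 have "(\<Sum>i\<in>L. w i * g i) <= (\<Sum>i\<in>L. if w i > 0 then w i else 0)"
 using that(2) by (intro sum_mono) (auto simp: mult_left_le mult_nonpos_nonneg not_less)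
 also have "... = (\<Sum>i\<in>{i\<in>L. w i > 0}. w i)" using that(1) by (simp add: sum.inter_filter)
 finally show ?thesis .
 qed
 have "(\<Sum>i\<in>I. \<Sum>j\<in>J. d i j * x i * y j) = (\<Sum>i\<in>I. (\<Sum>j\<in>J. d i j * y j) * x i)"
 by (simp add: sum_distrib_left mult_ac)
 also have "... <= (\<Sum>i\<in>{i\<in>I. (\<Sum>j\<in>J. d i j * y j) > 0}. \<Sum>j\<in>J. d i j * y j)" by (rule max[OF fin(1) x])
 also have "... = (\<Sum>j\<in>J. (\<Sum>i\<in>{i\<in>I. (\<Sum>j\<in>J. d i j * y j) > 0}. d i j) * y j)"
 by (subst sum.swap) (simp add: sum_distrib_right)
 also have "... <= (\<Sum>j\<in>{j\<in>J. (\<Sum>i\<in>{i\<in>I. (\<Sum>j\<in>J. d i j * y j) > 0}. d i j) > 0}. \<Sum>i\<in>{i\<in>I. (\<Sum>j\<in>J. d i j * y j) > 0}. d i j)"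
 by (rule max[OF fin(2) y])
 also have "... <= c" by (subst sum.swap) (rule cut; auto)
 finally show ?thesis .
qed

lemma cut_bilinear_abs_unit:
 fixes d :: "'i => 'j => real"
 assumes fin: "finite I" "finite J"
 and cut: "!!S T. S \<subseteq> I ==> T \<subseteq> J ==> \<bar>\<Sum>i\<in>S. \<Sum>j\<in>T. d i j\<bar> <= c"
 and x: "!!i. i : I ==> 0 <= x i \<and> x i <= 1" and y: "!!j. j : J ==> 0 <= y j \<and> y j <= 1"
 shows "\<bar>\<Sum>i\<in>I. \<Sum>j\<in>J. d i j * x i * y j\<bar> <= c"
proof -
 have "(\<Sum>i\<in>I. \<Sum>j\<in>J. d i j * x i * y j) <= c"
 using cut by (intro cut_bilinear_unit fin x y) (auto simp: abs_le_iff)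
 moreover have "(\<Sum>i\<in>I. \<Sum>j\<in>J. (- d i j) * x i * y j) <= c"
 using cut by (intro cut_bilinear_unit fin x y) (auto simp: abs_le_iff sum_negf)
 ultimately show ?thesis by (simp add: sum_negf abs_le_iff)
qed

text \<open>Positive and negative parts lie in the unit cube; the four combinations give the factor
  4.\<close>

lemma cut_bilinear_real:
 fixes d :: "'i => 'j => real"
 assumes fin: "finite I" "finite J"
 and cut: "!!S T. S \<subseteq> I ==> T \<subseteq> J ==> \<bar>\<Sum>i\<in>S. \<Sum>j\<in>T. d i j\<bar> <= c"
 and x: "!!i. i : I ==> \<bar>x i\<bar> <= 1" and y: "!!j. j : J ==> \<bar>y j\<bar> <= 1"
 shows "\<bar>\<Sum>i\<in>I. \<Sum>j\<in>J. d i j * x i * y j\<bar> <= 4 * c"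
proof -
 define P where "P = (%a :: real. max a 0)"
 let ?B = "%x y. \<Sum>i\<in>I. \<Sum>j\<in>J. d i j * x i * y j"
 have P: "0 <= P a \<and> P a <= 1" if "\<bar>a\<bar> <= 1" for a using that by (auto simp: P_def)
 have b: "\<bar>?B (%i. P (f * x i)) (%j. P (g * y j))\<bar> <= c" if "\<bar>f\<bar> = 1" "\<bar>g\<bar> = 1" for f g
 using that x y by (intro cut_bilinear_abs_unit fin cut P) (auto simp: abs_mult)
 have dec: "a = P (1 * a)-P (- 1 * a)" for a by (auto simp: P_def)
 have "?B x y = ?B (%i. P (1 * x i)-P (- 1 * x i)) (%j. P (1 * y j)-P (- 1 * y j))"
 by (simp only: dec[symmetric])
 also have "... = ?B (%i. P (1 * x i)) (%j. P (1 * y j))-?B (%i. P (1 * x i)) (%j. P (- 1 * y j))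
 -?B (%i. P (- 1 * x i)) (%j. P (1 * y j))+?B (%i. P (- 1 * x i)) (%j. P (- 1 * y j))"
 by (simp add: sum_subtractf[symmetric] sum.distrib[symmetric] algebra_simps)
 finally show ?thesis using b[of 1 1] b[of 1 "-1"] b[of "-1" 1] b[of "-1" "-1"] by simp
qed

text \<open>Real forms of size at most 4 c X Y bound the real and the imaginary part by 8 c X Y
  each, and the two add up to the factor 16.\<close>

lemma cut_bilinear_complex:
 fixes d :: "'i => 'j => real"
 assumes fin: "finite I" "finite J"
 and cut: "!!S T. S \<subseteq> I ==> T \<subseteq> J ==> \<bar>\<Sum>i\<in>S. \<Sum>j\<in>T. d i j\<bar> <= c"
 and x: "!!i. i : I ==> cmod (x i) <= X" and y: "!!j. j : J ==> cmod (y j) <= Y" and XY: "X > 0" "Y > 0"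
 shows "cmod (\<Sum>i\<in>I. \<Sum>j\<in>J. of_real (d i j) * x i * y j) <= 16 * c*X*Y"
proof -
 let ?B = "%x y. \<Sum>i\<in>I. \<Sum>j\<in>J. d i j * x i * y j"
 have b: "\<bar>?B (%i. f (x i)) (%j. g (y j))\<bar> <= 4 * c*X*Y"
 if "f = Re \<or> f = Im" "g = Re \<or> g = Im" for f g
 proof -
 have "\<bar>?B (%i. f (x i)/X) (%j. g (y j)/Y)\<bar> <= 4 * c"
 using that XY order_trans[OF abs_Re_le_cmod x] order_trans[OF abs_Im_le_cmod x]
 order_trans[OF abs_Re_le_cmod y] order_trans[OF abs_Im_le_cmod y]
 by (intro cut_bilinear_real fin cut) auto
 moreover have "?B (%i. f (x i)) (%j. g (y j)) = (X*Y)*?B (%i. f (x i)/X) (%j. g (y j)/Y)"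
 unfolding sum_distrib_left using XY by (intro sum.cong refl) simp
 ultimately show ?thesis using XY by (simp add: abs_mult mult_left_mono mult_ac)
 qed
 let ?S = "\<Sum>i\<in>I. \<Sum>j\<in>J. of_real (d i j) * x i * y j"
 have "Re ?S = ?B (%i. Re (x i)) (%j. Re (y j))-?B (%i. Im (x i)) (%j. Im (y j))"
 "Im ?S = ?B (%i. Re (x i)) (%j. Im (y j))+?B (%i. Im (x i)) (%j. Re (y j))"
 by (simp_all add: sum_subtractf[symmetric] sum.distrib[symmetric] algebra_simps)
 then have "\<bar>Re ?S\<bar> <= 8 * c*X*Y" "\<bar>Im ?S\<bar> <= 8 * c*X*Y"
 using b[of Re Re] b[of Re Im] b[of Im Re] b[of Im Im] by auto
 then show ?thesis using cmod_le[of ?S] by linarith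
qed

context
 fixes I :: "'i set" and z :: complex
 assumes fin: "finite I" and z: "Im z > 0"
begin

lemma rho_norm_le: "i : I ==> j : I ==> cmod (rho I z t A i j) <= 1/Im z"
 unfolding rho_def by (rule res_norm_le[OF fin z sym_on_Lap])

lemma rho2_norm_le: "i : I ==> j : I ==> cmod (rho2 I z t A i j) <= (1/Im z)^2"
 unfolding rho2_def by (rule res2_norm_le[OF fin z sym_on_Lap])

lemma rho_row_norm: "j : I ==> (\<Sum>i\<in>I. (cmod (rho I z t A i j))^2) <= (1/Im z)^2"
 unfolding rho_def res_def by (rule fcalc_row_norm[OF fin sym_on_Lap cmod_inverse_le[OF z]])

lemma rho2_row_norm: "j : I ==> (\<Sum>i\<in>I. (cmod (rho2 I z t A i j))^2) <= ((1/Im z)^2)^2"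
 unfolding rho2_def res2_def by (rule fcalc_row_norm[OF fin sym_on_Lap cmod_inverse2_le[OF z]])

lemma mv_rho_norm: "(\<Sum>i\<in>I. (cmod (mv I (rho I z t A) x i))^2) <= (1/Im z)^2*(\<Sum>i\<in>I. (x i)^2)"
 unfolding rho_def res_def mv_def by (rule fcalc_vec_norm[OF fin sym_on_Lap cmod_inverse_le[OF z]])

lemma mv_rho2_norm: "(\<Sum>i\<in>I. (cmod (mv I (rho2 I z t A) x i))^2) <= ((1/Im z)^2)^2*(\<Sum>i\<in>I. (x i)^2)"
 unfolding rho2_def res2_def mv_def by (rule fcalc_vec_norm[OF fin sym_on_Lap cmod_inverse2_le[OF z]])

text \<open>Off-diagonal resolvent entries are square summable along rows, so only diagonal entries
 contribute to the interpolation derivative.\<close>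

lemma offdiag_small:
 assumes d: "!!e. e : I \<times> I ==> \<bar>d e\<bar> <= kap" and kap: "kap > 0"
 and row: "!!j. j : I ==> (\<Sum>i\<in>I. (cmod (X i j))^2) <= gam"
 shows "(\<Sum>e\<in>I \<times> I. \<bar>d e\<bar> * cmod (X (fst e) (snd e))) <= sqrt kap*((\<Sum>e\<in>I \<times> I. \<bar>d e\<bar>) + real (card I) * gam)/2"
proof -
 have "\<bar>d e\<bar> * cmod (X (fst e) (snd e)) <= sqrt kap/2*\<bar>d e\<bar> + sqrt kap/2*(cmod (X (fst e) (snd e)))^2" if "e : I \<times> I" for e
 proof -
 let ?x = "cmod (X (fst e) (snd e))" and ?k = "sqrt kap"
 have k: "?k > 0" "?k*?k = kap" using kap by simp_all
 \<comment> \<open>The balance point sqrt kap splits |d| x into a share of the total mass of d and,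
   using |d| <= kap, a share of the square-summable x^2.\<close>
 have "2*?k*?x <= ?k*?k+?x^2" using sum_squares_bound[of ?k ?x] by (simp add: power2_eq_square)
 then have "\<bar>d e\<bar>*(2*?k*?x) <= \<bar>d e\<bar>*(?k*?k+?x^2)" by (rule mult_left_mono) simp
 also have "... = kap*\<bar>d e\<bar>+\<bar>d e\<bar>*?x^2" unfolding k(2) by (simp add: algebra_simps)
 also have "... <= kap*\<bar>d e\<bar> + kap*?x^2"
 using mult_right_mono[OF d[OF that], of "?x^2"] by simp
 also have "... = ?k*(?k*\<bar>d e\<bar>)+(?k*?k)*?x^2" by (simp only: mult.assoc[symmetric] k(2))
 finally have "?k*(2*(\<bar>d e\<bar>*?x)) <= ?k*(?k*\<bar>d e\<bar>+?k*?x^2)"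
 by (simp only: distrib_left mult_ac)
 then show ?thesis using k(1) by simp
 qed
 then have "(\<Sum>e\<in>I \<times> I. \<bar>d e\<bar> * cmod (X (fst e) (snd e)))
 <= (\<Sum>e\<in>I \<times> I. sqrt kap/2*\<bar>d e\<bar> + sqrt kap/2*(cmod (X (fst e) (snd e)))^2)" by (rule sum_mono)
 also have "... = sqrt kap/2*(\<Sum>e\<in>I \<times> I. \<bar>d e\<bar>) + sqrt kap/2*(\<Sum>e\<in>I \<times> I. (cmod (X (fst e) (snd e)))^2)"
 by (simp add: sum.distrib sum_distrib_left)
 also have "(\<Sum>e\<in>I \<times> I. (cmod (X (fst e) (snd e)))^2) = (\<Sum>j\<in>I. \<Sum>i\<in>I. (cmod (X i j))^2)"
 by (subst sum.swap) (simp add: sum.cartesian_product case_prod_beta)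
 also have "sqrt kap/2*(\<Sum>j\<in>I. \<Sum>i\<in>I. (cmod (X i j))^2) <= sqrt kap/2*(real (card I) * gam)"
 using sum_bounded_above[of I "%j. \<Sum>i\<in>I. (cmod (X i j))^2" gam] row kap by (intro mult_left_mono) auto
 finally show ?thesis by (simp add: algebra_simps)
qed

text \<open>In v_e^T R v_e = R_ii + R_jj - 2 R_ij the cross entry is negligible by
  \<open>offdiag_small\<close>. Expanding the product of the diagonal parts and swapping i and j
  leaves the terms R_ii Q_ii and R_ii Q_jj against the symmetrised d, and both are bilinear forms of
  the shape that the cut norm controls.\<close>

lemma diagonal_reduction:
 assumes d: "!!e. e : I \<times> I ==> \<bar>d e\<bar> <= kap" and kap: "kap > 0"
 defines "bet \<equiv> 1/Im z"
 shows "cmod ((\<Sum>e\<in>I \<times> I. of_real (d e)*(qf I (rho I z t A) (edge e) * qf I (rho2 I z t A) (edge e)))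
 -(\<Sum>i\<in>I. \<Sum>j\<in>I. of_real (d (i, j) + d (j, i))*(rho I z t A i i * rho2 I z t A i i + rho I z t A i i * rho2 I z t A j j)))
 <= sqrt kap*(4 * bet^2+4 * bet ^ 4+2 * bet+2 * bet ^ 5)*((\<Sum>e\<in>I \<times> I. \<bar>d e\<bar>) + real (card I))"
proof -
 let ?R = "rho I z t A" and ?Q = "rho2 I z t A" and ?E = "I \<times> I"
 have bet: "bet > 0" using z by (simp add: bet_def)
 define f where "f = (%i j. ?R i i*?Q i i+?R i i*?Q j j)"
 have "(\<Sum>i\<in>I. \<Sum>j\<in>I. of_real (d (i, j) + d (j, i)) * f i j)
 = (\<Sum>i\<in>I. \<Sum>j\<in>I. of_real (d (i, j)) * f i j)+(\<Sum>i\<in>I. \<Sum>j\<in>I. of_real (d (j, i)) * f i j)"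
 by (simp add: sum.distrib distrib_right)
 also have "(\<Sum>i\<in>I. \<Sum>j\<in>I. of_real (d (j, i)) * f i j) = (\<Sum>i\<in>I. \<Sum>j\<in>I. of_real (d (i, j)) * f j i)"
 by (rule sum.swap)
 also have "(\<Sum>i\<in>I. \<Sum>j\<in>I. of_real (d (i, j)) * f i j)+(\<Sum>i\<in>I. \<Sum>j\<in>I. of_real (d (i, j)) * f j i)
 = (\<Sum>i\<in>I. \<Sum>j\<in>I. of_real (d (i, j))*((?R i i+?R j j)*(?Q i i+?Q j j)))"
 unfolding sum.distrib[symmetric] distrib_left[symmetric]
 by (intro sum.cong refl arg_cong2[where f = "(*)"]) (simp add: f_def algebra_simps)
 also have "... = (\<Sum>e\<in>?E. of_real (d e)*((?R (fst e) (fst e)+?R (snd e) (snd e))*(?Q (fst e) (fst e)+?Q (snd e) (snd e))))"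
 by (simp add: sum.cartesian_product case_prod_beta)
 finally have diag: "(\<Sum>i\<in>I. \<Sum>j\<in>I. of_real (d (i, j) + d (j, i))*(?R i i*?Q i i+?R i i*?Q j j)) = ..."
 unfolding f_def .
 have "cmod ((\<Sum>e\<in>?E. of_real (d e)*(qf I ?R (edge e) * qf I ?Q (edge e)))
 -(\<Sum>e\<in>?E. of_real (d e)*((?R (fst e) (fst e)+?R (snd e) (snd e))*(?Q (fst e) (fst e)+?Q (snd e) (snd e)))))
 <= (\<Sum>e\<in>?E. 8 * bet^2*(\<bar>d e\<bar> * cmod (?R (fst e) (snd e)))+4 * bet*(\<bar>d e\<bar> * cmod (?Q (fst e) (snd e))))"
 unfolding sum_subtractf[symmetric]
 proof (rule sum_norm_le)
 fix e assume e: "e : ?E"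
 let ?i = "fst e" and ?j = "snd e"
 have ij: "?i : I" "?j : I" using e by auto
 have sR: "?R ?j ?i = ?R ?i ?j" "?Q ?j ?i = ?Q ?i ?j"
 unfolding rho_def rho2_def by (rule res_sym res2_sym)+
 have r: "qf I ?R (edge e) = ?R ?i ?i+?R ?j ?j-2*?R ?i ?j" "qf I ?Q (edge e) = ?Q ?i ?i+?Q ?j ?j-2*?Q ?i ?j"
 by (simp_all add: qf_edge[OF fin e] sR)
 have "qf I ?R (edge e) * qf I ?Q (edge e)-(?R ?i ?i+?R ?j ?j)*(?Q ?i ?i+?Q ?j ?j)
 =-(2*?R ?i ?j * qf I ?Q (edge e))-(?R ?i ?i+?R ?j ?j)*(2*?Q ?i ?j)"
 unfolding r by (simp add: algebra_simps)
 also have "cmod ... <= cmod (2*?R ?i ?j * qf I ?Q (edge e)) + cmod ((?R ?i ?i+?R ?j ?j)*(2*?Q ?i ?j))"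
 by (metis norm_minus_cancel norm_triangle_ineq4)
 also have "... = 2 * cmod (?R ?i ?j) * cmod (qf I ?Q (edge e)) + cmod (?R ?i ?i+?R ?j ?j)*(2 * cmod (?Q ?i ?j))"
 by (simp add: norm_mult)
 also have "... <= 2 * cmod (?R ?i ?j)*(4 * bet^2)+(bet + bet)*(2 * cmod (?Q ?i ?j))"
 using qf_rho2_le[OF fin z e, of t A] norm_triangle_le[OF add_mono[OF rho_norm_le[OF ij(1) ij(1), of t A] rho_norm_le[OF ij(2) ij(2), of t A]]]
 using z by (intro add_mono mult_mono) (auto simp: bet_def)
 finally have "\<bar>d e\<bar> * cmod (qf I ?R (edge e) * qf I ?Q (edge e)-(?R ?i ?i+?R ?j ?j)*(?Q ?i ?i+?Q ?j ?j))
 <= \<bar>d e\<bar>*(2 * cmod (?R ?i ?j)*(4 * bet^2)+(bet + bet)*(2 * cmod (?Q ?i ?j)))" by (rule mult_left_mono) simp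
 then show "cmod (of_real (d e)*(qf I ?R (edge e) * qf I ?Q (edge e))-of_real (d e)*((?R ?i ?i+?R ?j ?j)*(?Q ?i ?i+?Q ?j ?j)))
 <= 8 * bet^2*(\<bar>d e\<bar> * cmod (?R ?i ?j))+4 * bet*(\<bar>d e\<bar> * cmod (?Q ?i ?j))"
 unfolding right_diff_distrib[symmetric] norm_mult[of "of_real _"] norm_of_real by (simp add: algebra_simps)
 qed
 also have "... = 8 * bet^2*(\<Sum>e\<in>?E. \<bar>d e\<bar> * cmod (?R (fst e) (snd e)))+4 * bet*(\<Sum>e\<in>?E. \<bar>d e\<bar> * cmod (?Q (fst e) (snd e)))"
 by (simp add: sum.distrib sum_distrib_left)
 also have "... <= 8 * bet^2*(sqrt kap*((\<Sum>e\<in>?E. \<bar>d e\<bar>) + real (card I) * bet^2)/2)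
 +4 * bet*(sqrt kap*((\<Sum>e\<in>?E. \<bar>d e\<bar>) + real (card I)*(bet^2)^2)/2)"
 using bet unfolding bet_def by (intro add_mono mult_left_mono offdiag_small d kap rho_row_norm rho2_row_norm) auto
 also have "... <= sqrt kap*(4 * bet^2+4 * bet ^ 4+2 * bet+2 * bet ^ 5)*((\<Sum>e\<in>?E. \<bar>d e\<bar>) + real (card I))"
 proof -
 define S where "S = (\<Sum>e\<in>?E. \<bar>d e\<bar>)"
 define n where "n = real (card I)"
 have "S >= 0" "n >= 0" by (auto simp: S_def n_def intro!: sum_nonneg)
 then have nn: "0 <= sqrt kap*(4 * bet^2 * n+4 * bet ^ 4*S+2 * bet * n+2 * bet ^ 5*S)"
 using bet kap by simp
 have half: "8 * bet^2*(sqrt kap*(S + n * bet^2)/2) = 4 * bet^2*(sqrt kap*(S + n * bet^2))"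
 "4 * bet*(sqrt kap*(S + n*(bet^2)^2)/2) = 2 * bet*(sqrt kap*(S + n*(bet^2)^2))" by simp_all
 show ?thesis unfolding S_def[symmetric] n_def[symmetric] half
 using nn by (simp add: algebra_simps power2_eq_square eval_nat_numeral)
 qed
 finally show ?thesis unfolding diag .
qed

end

text \<open>Origin of the terms: 32 b^3 from the two bilinear forms, 128 b^4 from integration by
  parts, and the rest from off-diagonal entries; 132 is 128 + 4.\<close>

definition cut_const :: "complex => real" where
 "cut_const z = (let b = 1/Im z in 32 * b ^ 3+4 * b^2+132 * b ^ 4+2 * b+2 * b ^ 5)"

text \<open>On n vertices with rates at most kap = 1/n, the total mass and card I are both of order
  n. The second error is then of order sqrt n, negligible against a trace of order n, and only c
  matters.\<close>

theorem cut_comparison: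
 assumes fin: "finite I" and z: "Im z > 0" and kap: "kap > 0" and c: "c >= 0"
 and t0: "!!e. e : I \<times> I ==> 0 <= t0 e \<and> t0 e <= kap" and t1: "!!e. e : I \<times> I ==> 0 <= t1 e \<and> t1 e <= kap"
 and cut: "!!S T. S \<subseteq> I ==> T \<subseteq> I ==>
 \<bar>\<Sum>i\<in>S. \<Sum>j\<in>T. (t1 (i, j)-t0 (i, j))+(t1 (j, i)-t0 (j, i))\<bar> <= c"
 shows "cmod (mean_trace I z t1-mean_trace I z t0)
 <= cut_const z*(c + sqrt kap*((\<Sum>e\<in>I \<times> I. \<bar>t1 e-t0 e\<bar>) + real (card I)))"
proof -
 define bet where "bet = 1/Im z"
 have bet: "bet > 0" using z by (simp add: bet_def)
 define d where "d = (%e. t1 e-t0 e)"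
 define S where "S = (\<Sum>e\<in>I \<times> I. \<bar>d e\<bar>) + real (card I)"
 define k where "k = 4 * bet^2+4 * bet ^ 4+2 * bet+2 * bet ^ 5"
 have d: "\<bar>d e\<bar> <= kap" if "e : I \<times> I" for e using t0[OF that] t1[OF that] by (auto simp: d_def)
 have "cmod (\<Sum>e\<in>I \<times> I. of_real (d e)*(qf I (rho I z t A) (edge e) * qf I (rho2 I z t A) (edge e)))
 <= 32 * c * bet ^ 3 + sqrt kap * k*S" for t A
 proof -
 let ?R = "rho I z t A" and ?Q = "rho2 I z t A"
 have ds: "\<bar>\<Sum>i\<in>S. \<Sum>j\<in>T. d (i, j) + d (j, i)\<bar> <= c" if "S \<subseteq> I" "T \<subseteq> I" for S T
 using cut[OF that] by (simp add: d_def)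
 have RQ: "cmod (?R i i*?Q i i) <= bet * bet^2" if "i : I" for i
 unfolding norm_mult bet_def using z that by (intro mult_mono rho_norm_le[OF fin z] rho2_norm_le[OF fin z]) auto
 \<comment> \<open>The term local to i is a bilinear form whose second vector is constantly 1, so it
   falls under the cut bound as well.\<close>
 have "cmod (\<Sum>i\<in>I. \<Sum>j\<in>I. of_real (d (i, j) + d (j, i))*(?R i i*?Q i i)*1) <= 16 * c*(bet * bet^2)*1"

 using bet RQ by (intro cut_bilinear_complex[OF fin fin ds]) auto
 moreover have "cmod (\<Sum>i\<in>I. \<Sum>j\<in>I. of_real (d (i, j) + d (j, i))*?R i i*?Q j j) <= 16 * c * bet * bet^2"
 using bet rho_norm_le[OF fin z, of _ _ t A] rho2_norm_le[OF fin z, of _ _ t A]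
 by (intro cut_bilinear_complex[OF fin fin ds]) (auto simp: bet_def)
 moreover have "(\<Sum>i\<in>I. \<Sum>j\<in>I. of_real (d (i, j) + d (j, i))*(?R i i*?Q i i+?R i i*?Q j j))
 = (\<Sum>i\<in>I. \<Sum>j\<in>I. of_real (d (i, j) + d (j, i))*(?R i i*?Q i i)*1)
 +(\<Sum>i\<in>I. \<Sum>j\<in>I. of_real (d (i, j) + d (j, i))*?R i i*?Q j j)"
 by (simp add: sum.distrib[symmetric] algebra_simps)
 ultimately have 1: "cmod (\<Sum>i\<in>I. \<Sum>j\<in>I. of_real (d (i, j) + d (j, i))*(?R i i*?Q i i+?R i i*?Q j j))
 <= 32 * c * bet ^ 3"
 using norm_triangle_ineq[of "\<Sum>i\<in>I. \<Sum>j\<in>I. of_real (d (i, j) + d (j, i))*(?R i i*?Q i i)*1"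
 "\<Sum>i\<in>I. \<Sum>j\<in>I. of_real (d (i, j) + d (j, i))*?R i i*?Q j j"]
 by (simp add: power3_eq_cube power2_eq_square mult_ac)
 from diagonal_reduction[where d = d and t = t and A = A, OF fin z d kap, folded bet_def] 
 show ?thesis using norm_triangle_sub[of "\<Sum>e\<in>I \<times> I. of_real (d e)*(qf I (rho I z t A) (edge e) * qf I (rho2 I z t A) (edge e))"
 "\<Sum>i\<in>I. \<Sum>j\<in>I. of_real (d (i, j) + d (j, i))*(?R i i*?Q i i+?R i i*?Q j j)"] 1
 unfolding k_def S_def by linarith
 qed
 note pw = this
 have "cmod (cavg (I \<times> I) (%A. \<Sum>e\<in>I \<times> I. of_real (d e)*(qf I (rho I z t A) (edge e) * qf I (rho2 I z t A) (edge e))))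
 <= 32 * c * bet ^ 3 + sqrt kap * k*S" for t
 using fin by (intro norm_cavg_bound pw) simp
 from interpolation[where ?t0.0 = t0 and ?t1.0 = t1 and kap = kap, OF fin z t0 t1] this
 have "cmod (mean_trace I z t1-mean_trace I z t0) <= (32 * c * bet ^ 3 + sqrt kap * k*S)+128 * bet ^ 4 * sqrt kap*(\<Sum>e\<in>I \<times> I. \<bar>d e\<bar>)"
 unfolding d_def bet_def by blast
 also have "... <= (32 * c * bet ^ 3 + sqrt kap * k*S)+128 * bet ^ 4 * sqrt kap*S"
 using bet kap by (simp add: S_def)
 also have "... <= (32 * bet ^ 3+(k+128 * bet ^ 4))*(c + sqrt kap*S)"
 proof -
 have "0 <= (k+128 * bet ^ 4) * c+32 * bet ^ 3*(sqrt kap*S)"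
 using bet kap c by (auto simp: S_def k_def intro!: add_nonneg_nonneg mult_nonneg_nonneg sum_nonneg)
 then show ?thesis by (simp add: algebra_simps)
 qed
 finally show ?thesis unfolding cut_const_def Let_def S_def d_def k_def bet_def[symmetric] by (simp add: add_ac)
qed

section \<open>Variance of weighted diagonal sums of the resolvent\<close>

lemma cauchy_schwarz_weighted:
 fixes a b :: "'i => complex"
 assumes "!!i. i : I ==> 0 <= p i"
 shows "(cmod (\<Sum>i\<in>I. of_real (p i)*(a i * b i)))^2 <= (\<Sum>i\<in>I. p i*(cmod (a i))^2)*(\<Sum>i\<in>I. p i*(cmod (b i))^2)"
proof -
 have "cmod (\<Sum>i\<in>I. of_real (p i)*(a i * b i)) <= (\<Sum>i\<in>I. (sqrt (p i) * cmod (a i))*(sqrt (p i) * cmod (b i)))"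
 proof (rule sum_norm_le)
 fix i assume "i : I"
 then have "0 <= p i" by (rule assms)
 have "(sqrt (p i) * cmod (a i))*(sqrt (p i) * cmod (b i)) = (sqrt (p i) * sqrt (p i))*(cmod (a i) * cmod (b i))"
 by (simp only: mult_ac)
 also have "... = cmod (of_real (p i)*(a i * b i))" using \<open>0 \<le> p i\<close> by (simp add: norm_mult)
 finally show "cmod (of_real (p i)*(a i * b i)) <= (sqrt (p i) * cmod (a i))*(sqrt (p i) * cmod (b i))" by simp
 qed
 then have "(cmod (\<Sum>i\<in>I. of_real (p i)*(a i * b i)))^2 <= (\<Sum>i\<in>I. (sqrt (p i) * cmod (a i))*(sqrt (p i) * cmod (b i)))^2"
 by (rule power_mono) simp
 also have "... <= (\<Sum>i\<in>I. (sqrt (p i) * cmod (a i))^2)*(\<Sum>i\<in>I. (sqrt (p i) * cmod (b i))^2)"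
 by (rule Cauchy_Schwarz_ineq_sum)
 also have "... = (\<Sum>i\<in>I. p i*(cmod (a i))^2)*(\<Sum>i\<in>I. p i*(cmod (b i))^2)"
 using assms by (simp add: power_mult_distrib)
 finally show ?thesis .
qed

lemma square_add_le: "(a + b)^2 <= 2*(a^2 + b^2)" for a b :: real
 using sum_squares_bound[of a b] by (simp add: power2_sum)

context
 fixes I :: "'i set" and z :: complex and t :: "'i \<times> 'i => real" and D :: real and p :: "'i => real"
 assumes fin: "finite I" and z: "Im z > 0"
 and t: "!!e. e : I \<times> I ==> 0 <= t e"
 and D: "!!i. i : I ==> (\<Sum>j\<in>I. t (i, j) + t (j, i)) <= D"
 and p: "!!i. i : I ==> 0 <= p i \<and> p i <= 1"
begin

private abbreviation "bet \<equiv> 1/Im z"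

private lemma bet: "bet > 0" using z by simp

text \<open>Summing over pairs before taking norms is the gain: the pairs at a vertex carry total
  rate at most D and the resolvent row at c has squared norm at most bet^2, so no factor card I is
  lost.\<close>

lemma weighted_edge_sum:
 "(\<Sum>e\<in>I \<times> I. t e*(\<Sum>c\<in>I. p c*(cmod (mv I (rho I z t A) (edge e) c))^2)) <= 2*D * bet^2*(\<Sum>c\<in>I. p c)"
proof -
 let ?R = "rho I z t A"
 have "(\<Sum>e\<in>I \<times> I. t e*(\<Sum>c\<in>I. p c*(cmod (mv I ?R (edge e) c))^2))
 = (\<Sum>c\<in>I. p c*(\<Sum>e\<in>I \<times> I. t e*(cmod (mv I ?R (edge e) c))^2))"
 unfolding sum_distrib_left by (subst sum.swap) (simp add: mult_ac)
 also have "... <= (\<Sum>c\<in>I. p c*(2*D * bet^2))"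
 proof (intro sum_mono mult_left_mono)
 fix c assume c: "c : I"
 have "(\<Sum>e\<in>I \<times> I. t e*(cmod (mv I ?R (edge e) c))^2)
 <= (\<Sum>e\<in>I \<times> I. t e*(2*((cmod (?R c (fst e)))^2+(cmod (?R c (snd e)))^2)))"
 proof (intro sum_mono mult_left_mono t)
 fix e assume e: "e : I \<times> I"
 have "(cmod (mv I ?R (edge e) c))^2 <= (cmod (?R c (fst e)) + cmod (?R c (snd e)))^2"
 unfolding mv_edge[OF fin e] by (intro power_mono norm_triangle_ineq4) simp
 also have "... <= 2*((cmod (?R c (fst e)))^2+(cmod (?R c (snd e)))^2)"
 by (rule square_add_le)
 finally show "(cmod (mv I ?R (edge e) c))^2 <= 2*((cmod (?R c (fst e)))^2+(cmod (?R c (snd e)))^2)" .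
 qed
 also have "... = (\<Sum>i\<in>I. \<Sum>j\<in>I. 2 * t (i, j)*(cmod (?R c i))^2)+(\<Sum>i\<in>I. \<Sum>j\<in>I. 2 * t (i, j)*(cmod (?R c j))^2)"
 unfolding sum.cartesian_product sum.distrib[symmetric]
 by (intro sum.cong refl) (simp add: case_prod_beta algebra_simps)
 also have "(\<Sum>i\<in>I. \<Sum>j\<in>I. 2 * t (i, j)*(cmod (?R c j))^2) = (\<Sum>i\<in>I. \<Sum>j\<in>I. 2 * t (j, i)*(cmod (?R c i))^2)"
 by (rule sum.swap)
 also have "(\<Sum>i\<in>I. \<Sum>j\<in>I. 2 * t (i, j)*(cmod (?R c i))^2)+(\<Sum>i\<in>I. \<Sum>j\<in>I. 2 * t (j, i)*(cmod (?R c i))^2)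
 = (\<Sum>i\<in>I. 2*(cmod (?R c i))^2*(\<Sum>j\<in>I. t (i, j) + t (j, i)))"
 unfolding sum.distrib[symmetric] sum_distrib_left by (intro sum.cong refl) (simp add: algebra_simps)
 also have "... <= (\<Sum>i\<in>I. 2*(cmod (?R c i))^2*D)"
 by (intro sum_mono mult_left_mono D) auto
 also have "... = 2*D*(\<Sum>i\<in>I. (cmod (?R i c))^2)"
 unfolding sum_distrib_left rho_def by (subst res_sym) (simp add: mult_ac)
 also have "... <= 2*D * bet^2"
 proof (rule mult_left_mono[OF rho_row_norm[OF fin z c]])
 have "0 <= (\<Sum>j\<in>I. t (c, j) + t (j, c))" using t c by (intro sum_nonneg) auto
 then show "0 <= 2*D" using D[OF c] by simp
 qed
 finally show "(\<Sum>e\<in>I \<times> I. t e*(cmod (mv I ?R (edge e) c))^2) <= 2*D * bet^2" .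
 qed (use p in auto)
 finally show ?thesis unfolding sum_distrib_right[symmetric] by (simp only: mult_ac)
qed

lemma weighted_mv_le:
 assumes e: "e : I \<times> I"
 shows "(\<Sum>c\<in>I. p c*(cmod (mv I (rho I z t A) (edge e) c))^2) <= 2 * bet^2"
 and "(\<Sum>c\<in>I. p c*(cmod (mv I (rho2 I z t A) (edge e) c))^2) <= 2 * bet ^ 4"
proof -
 have le: "(\<Sum>c\<in>I. p c*(cmod (x c))^2) <= (\<Sum>c\<in>I. (cmod (x c))^2)" for x
 using p by (intro sum_mono mult_left_le_one_le) auto
 have "bet^2*(\<Sum>i\<in>I. (edge e i)^2) <= bet^2*2" "(bet^2)^2*(\<Sum>i\<in>I. (edge e i)^2) <= (bet^2)^2*2"
 by (intro mult_left_mono edge_norm[OF fin e]; simp)+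
 then show "(\<Sum>c\<in>I. p c*(cmod (mv I (rho I z t A) (edge e) c))^2) <= 2 * bet^2"
 "(\<Sum>c\<in>I. p c*(cmod (mv I (rho2 I z t A) (edge e) c))^2) <= 2 * bet ^ 4"
 using order_trans[OF le mv_rho_norm[OF fin z, of t A "edge e"]] order_trans[OF le mv_rho2_norm[OF fin z, of t A "edge e"]]
 by (auto simp: power2_eq_square power4_eq_xxxx mult_ac)
qed

lemma rademacher_sq: "e : I \<times> I ==> (cmod (of_real (2 * rademacher t A e)))^2 = 4 * t e"
 using t[of e] by (simp add: rademacher_def power_mult_distrib del: of_real_mult)

text \<open>In the flip difference one of the two Cauchy-Schwarz factors is bounded by the norm of
  the edge vector, and the other is kept for \<open>weighted_edge_sum\<close>. The variance comes
  out linear in the sum of p, not quadratic.\<close>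

lemma diag_variance_rho:
 "cavg (I \<times> I) (%A. (cmod ((\<Sum>c\<in>I. of_real (p c) * rho I z t A c c)-cavg (I \<times> I) (%A. \<Sum>c\<in>I. of_real (p c) * rho I z t A c c)))^2)
 <= 4*D * bet ^ 4*(\<Sum>c\<in>I. p c)"
proof -
 let ?E = "I \<times> I"
 have finE: "finite ?E" using fin by simp
 define f where "f = (%A. \<Sum>c\<in>I. of_real (p c) * rho I z t A c c)"
 have step: "(cmod (f A-f (flip e A)))^2 <= 8 * bet^2*(t e*(\<Sum>c\<in>I. p c*(cmod (mv I (rho I z t A) (edge e) c))^2))"
 if e: "e : ?E" for e A
 proof -
 let ?a = "mv I (rho I z t A) (edge e)" and ?b = "mv I (rho I z t (flip e A)) (edge e)"
 have "f A-f (flip e A) = (\<Sum>c\<in>I. of_real (p c)*(rho I z t A c c-rho I z t (flip e A) c c))"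
 by (simp add: f_def sum_subtractf right_diff_distrib)
 also have "... = of_real (2 * rademacher t A e)*(\<Sum>c\<in>I. of_real (p c)*(?a c*?b c))"
 by (simp add: sum_distrib_left rho_flip[OF fin z e] mult_ac)
 finally have "(cmod (f A-f (flip e A)))^2 = 4 * t e*(cmod (\<Sum>c\<in>I. of_real (p c)*(?a c*?b c)))^2"
 by (simp only: norm_mult power_mult_distrib rademacher_sq[OF e])
 also have "... <= 4 * t e*((\<Sum>c\<in>I. p c*(cmod (?a c))^2)*(\<Sum>c\<in>I. p c*(cmod (?b c))^2))"
 using p t[OF e] by (intro mult_left_mono cauchy_schwarz_weighted) auto
 also have "... <= 4 * t e*((\<Sum>c\<in>I. p c*(cmod (?a c))^2)*(2 * bet^2))"
 using p t[OF e] by (intro mult_left_mono weighted_mv_le[OF e] sum_nonneg) auto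
 finally show ?thesis by (simp add: mult_ac)
 qed
 have "cavg ?E (%A. (cmod (f A-cavg ?E f))^2) <= (\<Sum>e\<in>?E. cavg ?E (%A. (cmod (f A-f (flip e A)))^2))/4"
 by (rule cube_poincare[OF finE])
 also have "... = cavg ?E (%A. \<Sum>e\<in>?E. (cmod (f A-f (flip e A)))^2)/4" by (simp add: cavg_sum)
 also have "... <= cavg ?E (%A. 8 * bet^2*(2*D * bet^2*(\<Sum>c\<in>I. p c)))/4"
 proof (intro divide_right_mono cavg_mono)
 fix A
 have "(\<Sum>e\<in>?E. (cmod (f A-f (flip e A)))^2) <= (\<Sum>e\<in>?E. 8 * bet^2*(t e*(\<Sum>c\<in>I. p c*(cmod (mv I (rho I z t A) (edge e) c))^2)))"
 by (intro sum_mono step)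
 also have "... <= 8 * bet^2*(2*D * bet^2*(\<Sum>c\<in>I. p c))"
 unfolding sum_distrib_left[symmetric] by (intro mult_left_mono weighted_edge_sum) simp
 finally show "(\<Sum>e\<in>?E. (cmod (f A-f (flip e A)))^2) <= 8 * bet^2*(2*D * bet^2*(\<Sum>c\<in>I. p c))" .
 qed simp
 also have "... = 4*D * bet ^ 4*(\<Sum>c\<in>I. p c)"
 unfolding cavg_const[OF finE] by (simp add: power2_eq_square power4_eq_xxxx)
 finally show ?thesis unfolding f_def .
qed

text \<open>As for the resolvent, but the product rule yields two terms, one weighted at A and one
  at the flipped configuration; flip invariance of the average identifies the two
  contributions.\<close>

lemma diag_variance_rho2:
 "cavg (I \<times> I) (%A. (cmod ((\<Sum>c\<in>I. of_real (p c) * rho2 I z t A c c)-cavg (I \<times> I) (%A. \<Sum>c\<in>I. of_real (p c) * rho2 I z t A c c)))^2)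
 <= 16*D * bet ^ 6*(\<Sum>c\<in>I. p c)"
proof -
 let ?E = "I \<times> I"
 have finE: "finite ?E" using fin by simp
 define f where "f = (%A. \<Sum>c\<in>I. of_real (p c) * rho2 I z t A c c)"
 define w where "w = (%e A. \<Sum>c\<in>I. p c*(cmod (mv I (rho I z t A) (edge e) c))^2)"
 define w2 where "w2 = (%e A. \<Sum>c\<in>I. p c*(cmod (mv I (rho2 I z t A) (edge e) c))^2)"
 have w0: "0 <= w e A" "0 <= w2 e A" for e A unfolding w_def w2_def using p by (auto intro!: sum_nonneg)
 have step: "(cmod (f A-f (flip e A)))^2 <= 16 * bet ^ 4*(t e*(w e A + w e (flip e A)))"
 if e: "e : ?E" for e A
 proof -
 let ?a = "mv I (rho I z t A) (edge e)" and ?b = "mv I (rho I z t (flip e A)) (edge e)"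
 let ?a2 = "mv I (rho2 I z t A) (edge e)" and ?b2 = "mv I (rho2 I z t (flip e A)) (edge e)"
 let ?x = "\<Sum>c\<in>I. of_real (p c)*(?a2 c*?b c)" and ?y = "\<Sum>c\<in>I. of_real (p c)*(?a c*?b2 c)"
 have "f A-f (flip e A) = (\<Sum>c\<in>I. of_real (p c)*(rho2 I z t A c c-rho2 I z t (flip e A) c c))"
 by (simp add: f_def sum_subtractf right_diff_distrib)
 also have "... = of_real (2 * rademacher t A e)*(?x+?y)"
 unfolding sum.distrib[symmetric] sum_distrib_left
 by (intro sum.cong refl) (simp add: rho2_flip[OF fin z e] algebra_simps)
 finally have 1: "(cmod (f A-f (flip e A)))^2 = 4 * t e*(cmod (?x+?y))^2"
 by (simp only: norm_mult power_mult_distrib rademacher_sq[OF e])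
 have "(cmod ?x)^2 <= w2 e A * w e (flip e A)" unfolding w_def w2_def using p by (intro cauchy_schwarz_weighted) auto
 also have "... <= (2 * bet ^ 4) * w e (flip e A)"
 using weighted_mv_le(2)[OF e, of A] w0 unfolding w2_def by (intro mult_right_mono)
 finally have x: "(cmod ?x)^2 <= (2 * bet ^ 4) * w e (flip e A)" .
 have "(cmod ?y)^2 <= w e A * w2 e (flip e A)" unfolding w_def w2_def using p by (intro cauchy_schwarz_weighted) auto
 also have "... <= w e A*(2 * bet ^ 4)"
 using weighted_mv_le(2)[OF e, of "flip e A"] w0 unfolding w2_def by (intro mult_left_mono)
 finally have y: "(cmod ?y)^2 <= w e A*(2 * bet ^ 4)" .
 have "(cmod (?x+?y))^2 <= (cmod ?x + cmod ?y)^2" by (intro power_mono norm_triangle_ineq) simp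
 also have "... <= 2*((cmod ?x)^2+(cmod ?y)^2)" by (rule square_add_le)
 also have "... <= 2*((2 * bet ^ 4) * w e (flip e A) + w e A*(2 * bet ^ 4))"
 by (intro mult_left_mono add_mono x y) simp
 finally have "4 * t e*(cmod (?x+?y))^2 <= 4 * t e*(2*((2 * bet ^ 4) * w e (flip e A) + w e A*(2 * bet ^ 4)))"
 using t[OF e] by (intro mult_left_mono) auto
 also have "... = 16 * bet ^ 4*(t e*(w e A + w e (flip e A)))" by (simp add: algebra_simps)
 finally show ?thesis unfolding 1 .
 qed
 have "cavg ?E (%A. (cmod (f A-cavg ?E f))^2) <= (\<Sum>e\<in>?E. cavg ?E (%A. (cmod (f A-f (flip e A)))^2))/4"
 by (rule cube_poincare[OF finE])
 also have "... <= (\<Sum>e\<in>?E. cavg ?E (%A. 32 * bet ^ 4*(t e * w e A)))/4"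
 proof (intro divide_right_mono sum_mono)
 fix e assume e: "e : ?E"
 have "cavg ?E (%A. (cmod (f A-f (flip e A)))^2) <= cavg ?E (%A. 16 * bet ^ 4*(t e*(w e A + w e (flip e A))))"
 by (intro cavg_mono step e)
 also have "... = cavg ?E (%A. 32 * bet ^ 4*(t e * w e A))"
 unfolding cavg_mult_left cavg_add cavg_flip[OF e] by simp
 finally show "cavg ?E (%A. (cmod (f A-f (flip e A)))^2) <= cavg ?E (%A. 32 * bet ^ 4*(t e * w e A))" .
 qed simp
 also have "... = 8 * bet ^ 4 * cavg ?E (%A. \<Sum>e\<in>?E. t e * w e A)"
 unfolding cavg_sum cavg_mult_left sum_distrib_left by (simp add: sum_divide_distrib mult_ac)
 also have "... <= 8 * bet ^ 4 * cavg ?E (%A. 2*D * bet^2*(\<Sum>c\<in>I. p c))"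
 unfolding w_def by (intro mult_left_mono cavg_mono weighted_edge_sum) simp
 also have "... = 16*D * bet ^ 6*(\<Sum>c\<in>I. p c)"
 unfolding cavg_const[OF finE] by (simp add: eval_nat_numeral)
 finally show ?thesis unfolding f_def .
qed

end

subsection \<open>Relabelling\<close>

lemma sgnset_image: "inj_on h E ==> A \<subseteq> E ==> e : E ==> sgnset (h ` A) (h e) = sgnset A e"
 by (auto simp: sgnset_def inj_on_def)

text \<open>Relabelling vertices and signs together carries one linear system into the other, and
  \<open>res_unique\<close> compares the columns. Eigenvectors would not transport, being chosen
  arbitrarily.\<close>

lemma rho_relabel:
 assumes fin: "finite I" and z: "Im z > 0" and h: "bij_betw h I J" and A: "A \<subseteq> I \<times> I" and ij: "i : I" "j : I"
 defines "hh \<equiv> map_prod h h"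
 shows "rho J z t (hh ` A) (h i) (h j) = rho I z (t \<circ> hh) A i j"
proof -
 have hh: "bij_betw hh (I \<times> I) (J \<times> J)" unfolding hh_def by (rule bij_betw_map_prod[OF h h])
 have hI: "h i : J" if "i : I" for i using h that by (auto simp: bij_betw_def)
 have inj: "inj_on h I" using h by (simp add: bij_betw_def)
 have finJ: "finite J" using bij_betw_finite[OF h] fin by simp
 have edge: "edge (hh e) (h i) = edge e i" if "e : I \<times> I" "i : I" for e i
 using that inj by (auto simp: edge_def hh_def inj_on_def)
 have rad: "rademacher t (hh ` A) (hh e) = rademacher (t \<circ> hh) A e" if "e : I \<times> I" for e
 unfolding rademacher_def using sgnset_image[OF _ A that, of hh] hh by (simp add: bij_betw_def)
 have L: "Lap J (rademacher t (hh ` A)) (h i) (h j) = Lap I (rademacher (t \<circ> hh) A) i j" if "i : I" "j : I" for i j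
 unfolding Lap_def using sum.reindex_bij_betw[OF hh, of "%e. rademacher t (hh ` A) e*(edge e (h i) * edge e (h j))", symmetric]
 by (simp add: edge rad that cong: sum.cong)
 show ?thesis unfolding rho_def
 proof (rule res_unique[OF fin sym_on_Lap z ij])
 fix i assume i: "i : I"
 have "(\<Sum>k\<in>I. (of_real (Lap I (rademacher (t \<circ> hh) A) i k)-z * of_bool (i = k)) * res J z (Lap J (rademacher t (hh ` A))) (h k) (h j))
 = (\<Sum>k\<in>I. (of_real (Lap J (rademacher t (hh ` A)) (h i) (h k))-z * of_bool (h i = h k)) * res J z (Lap J (rademacher t (hh ` A))) (h k) (h j))"
 using i inj by (intro sum.cong refl) (auto simp: L inj_on_def)
 also have "... = (\<Sum>k\<in>J. (of_real (Lap J (rademacher t (hh ` A)) (h i) k)-z * of_bool (h i = k)) * res J z (Lap J (rademacher t (hh ` A))) k (h j))"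
 by (rule sum.reindex_bij_betw[OF h])
 also have "... = of_bool (h i = h j)" by (rule res_inverse[OF finJ sym_on_Lap z hI[OF i] hI[OF ij(2)]])
 also have "... = of_bool (i = j)" using i ij inj by (auto simp: inj_on_def)
 finally show "(\<Sum>k\<in>I. (of_real (Lap I (rademacher (t \<circ> hh) A) i k)-z * of_bool (i = k)) * res J z (Lap J (rademacher t (hh ` A))) (h k) (h j))
 = of_bool (i = j)" .
 qed
qed

lemma rho2_relabel:
 assumes fin: "finite I" and z: "Im z > 0" and h: "bij_betw h I J" and A: "A \<subseteq> I \<times> I" and ij: "i : I" "j : I"
 shows "rho2 J z t (map_prod h h ` A) (h i) (h j) = rho2 I z (t \<circ> map_prod h h) A i j"
proof -
 have finJ: "finite J" using bij_betw_finite[OF h] fin by simp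
 note r = res_res_mult[OF fin sym_on_Lap, symmetric] res_res_mult[OF finJ sym_on_Lap, symmetric]
 show ?thesis unfolding rho2_def r
 using rho_relabel[OF fin z h A] ij
 by (subst sum.reindex_bij_betw[OF h, symmetric]) (auto simp: rho_def intro!: sum.cong)
qed

lemma cavg_relabel:
 assumes fin: "finite I" and z: "Im z > 0" and h: "bij_betw h I J" and i: "i : I"
 shows "cavg (J \<times> J) (%A. rho J z t A (h i) (h i)) = cavg (I \<times> I) (%A. rho I z (t \<circ> map_prod h h) A i i)"
 and "cavg (J \<times> J) (%A. rho2 J z t A (h i) (h i)) = cavg (I \<times> I) (%A. rho2 I z (t \<circ> map_prod h h) A i i)"
 unfolding cavg_image[OF bij_betw_map_prod[OF h h], symmetric]
 by (auto intro!: cavg_cong rho_relabel[OF fin z h _ i i] rho2_relabel[OF fin z h _ i i])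

lemma mean_trace_relabel:
 assumes fin: "finite I" and z: "Im z > 0" and h: "bij_betw h I J"
 shows "mean_trace J z t = mean_trace I z (t \<circ> map_prod h h)"
 unfolding mean_trace_def cavg_sum rho_def[symmetric] sum.reindex_bij_betw[OF h, symmetric]
 by (intro sum.cong refl cavg_relabel[OF fin z h])

lemma mean_trace_cong:
 assumes "!!e. e : I \<times> I ==> t e = t' e"
 shows "mean_trace I z t = mean_trace I z t'"
proof -
 have "Lap I (rademacher t A) = Lap I (rademacher t' A)" for A
 using assms by (intro ext) (simp add: Lap_def rademacher_def cong: sum.cong)
 then show ?thesis by (simp add: mean_trace_def)
qed

section \<open>Disjoint copies of a model\<close>

context
 fixes I :: "'i set" and B :: "'b set" and z :: complex
 assumes fin: "finite I" "finite B" and z: "Im z > 0"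
begin

private abbreviation inc :: "'b => 'i \<times> 'i => ('i \<times> 'b) \<times> ('i \<times> 'b)" where
 "inc a \<equiv> %e. ((fst e, a), (snd e, a))"

lemma Lap_direct_sum:
 assumes y: "!!i a j b. a ~= b ==> y ((i, a), (j, b)) = 0" and ab: "a : B" "b : B"
 shows "Lap (I \<times> B) y (i, a) (j, b) = of_bool (a = b)*Lap I (%e. y (inc a e)) i j"
proof -
 let ?h = "%(c, e). inc c e" and ?g = "%e. y e*(edge e (i, a) * edge e (j, b))"
 have inj: "inj_on ?h (B \<times> (I \<times> I))" by (auto simp: inj_on_def)
 have "(\<Sum>e\<in>(I \<times> B) \<times> (I \<times> B). ?g e) = (\<Sum>e\<in>?h ` (B \<times> (I \<times> I)). ?g e)"
 proof (rule sum.mono_neutral_right)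
 show "\<forall>e\<in>(I \<times> B) \<times> (I \<times> B)-?h ` (B \<times> (I \<times> I)). ?g e = 0"
 proof
 fix e assume e: "e : (I \<times> B) \<times> (I \<times> B)-?h ` (B \<times> (I \<times> I))"
 obtain i' a' j' b' where e': "e = ((i', a'), (j', b'))" by (metis prod.collapse)
 have "a' ~= b'" using e unfolding e' by (force simp: image_iff)
 then show "?g e = 0" unfolding e' by (simp add: y)
 qed
 qed (use fin in auto)
 also have "... = (\<Sum>(c, e)\<in>B \<times> (I \<times> I). ?g (inc c e))"
 by (subst sum.reindex[OF inj]) (simp add: case_prod_beta o_def)
 also have "... = (\<Sum>c\<in>B. \<Sum>e\<in>I \<times> I. of_bool (c = a)*(of_bool (c = b)*(y (inc c e)*(edge e i * edge e j))))"
 by (subst sum.cartesian_product[symmetric]) (intro sum.cong refl, auto simp: edge_def)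
 also have "... = (\<Sum>c\<in>B. of_bool (c = a)*(of_bool (c = b)*(\<Sum>e\<in>I \<times> I. y (inc c e)*(edge e i * edge e j))))"
 by (simp add: sum_distrib_left)
 also have "... = of_bool (a = b)*(\<Sum>e\<in>I \<times> I. y (inc a e)*(edge e i * edge e j))"
 by (rule sum_of_bool_mult_left(2)[OF fin(2) ab(1)])
 finally show ?thesis by (simp add: Lap_def)
qed

text \<open>Without rates between different copies the resolvent is block diagonal, and the block of
  copy b depends only on the signs inside that copy; all other signs average out.\<close>

lemma mean_trace_direct_sum:
 assumes t: "!!i a j b. t ((i, a), (j, b)) = of_bool (a = b)*\<tau> (i, j)"
 shows "mean_trace (I \<times> B) z t = of_nat (card B) * mean_trace I z \<tau>"
proof -
 let ?J = "I \<times> B"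
 define restr where "restr = (%a A. {e : I \<times> I. inc a e : A})"
 have rad: "rademacher t A (inc a e) = rademacher \<tau> (restr a A) e" if "e : I \<times> I" for a A e
 using that by (cases e) (auto simp: rademacher_def t restr_def sgnset_def)
 have L: "Lap ?J (rademacher t A) (i, a) (j, b) = of_bool (a = b)*Lap I (rademacher \<tau> (restr a A)) i j"
 if "a : B" "b : B" for A i j a b
 proof -
 have "Lap I (%e. rademacher t A (inc a e)) i j = Lap I (rademacher \<tau> (restr a A)) i j"
 by (simp add: Lap_def rad cong: sum.cong)
 then show ?thesis by (subst Lap_direct_sum[OF _ that]) (simp_all add: rademacher_def t)
 qed
 have r: "rho ?J z t A (i, b) (i, b) = rho I z \<tau> (restr b A) i i" if ib: "i : I" "b : B" for A i b
 proof -
 \<comment> \<open>Candidate column: the resolvent of copy b, extended by zero to the other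
   copies.\<close>
 define X where "X = (%x. of_bool (snd x = b) * rho I z \<tau> (restr b A) (fst x) i)"
 have "X (i, b) = res ?J z (Lap ?J (rademacher t A)) (i, b) (i, b)"
 proof (rule res_unique[OF _ sym_on_Lap z])
 fix x assume x: "x : ?J"
 obtain j a where xj: "x = (j, a)" "j : I" "a : B" using x by auto
 have "(\<Sum>y\<in>?J. (of_real (Lap ?J (rademacher t A) x y)-z * of_bool (x = y))*X y)
 = (\<Sum>k\<in>I. \<Sum>c\<in>B. ((of_real (Lap ?J (rademacher t A) (j, a) (k, c))-z * of_bool ((j, a) = (k, c))) * rho I z \<tau> (restr b A) k i) * of_bool (c = b))"
 unfolding sum.cartesian_product by (intro sum.cong refl) (auto simp: xj X_def)
 also have "... = (\<Sum>k\<in>I. (of_real (Lap ?J (rademacher t A) (j, a) (k, b))-z * of_bool ((j, a) = (k, b))) * rho I z \<tau> (restr b A) k i)"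
 by (intro sum.cong refl sum_of_bool_mult_left(4)[OF fin(2) ib(2)])
 also have "... = (\<Sum>k\<in>I. of_bool (a = b)*((of_real (Lap I (rademacher \<tau> (restr b A)) j k)-z * of_bool (j = k)) * rho I z \<tau> (restr b A) k i))"
 using xj ib by (intro sum.cong refl) (auto simp: L)
 also have "... = of_bool (a = b) * of_bool (j = i)"
 unfolding sum_distrib_left[symmetric] rho_def using res_inverse[OF fin(1) sym_on_Lap z xj(2) ib(1)] by simp
 finally show "(\<Sum>y\<in>?J. (of_real (Lap ?J (rademacher t A) x y)-z * of_bool (x = y))*X y) = of_bool (x = (i, b))"
 by (auto simp: xj)
 qed (use fin ib in auto)
 then show ?thesis by (simp add: rho_def X_def)
 qed
 have "mean_trace ?J z t = (\<Sum>i\<in>I. \<Sum>b\<in>B. cavg (?J \<times> ?J) (%A. rho ?J z t A (i, b) (i, b)))"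
 unfolding mean_trace_def cavg_sum rho_def[symmetric] by (simp add: sum.cartesian_product case_prod_beta)
 also have "... = (\<Sum>i\<in>I. \<Sum>b\<in>B. cavg (I \<times> I) (%A. rho I z \<tau> A i i))"
 proof (intro sum.cong refl)
 fix i b assume ib: "i : I" "b : B"
 have sub: "inc b ` (I \<times> I) \<subseteq> ?J \<times> ?J" using ib by auto
 have bij: "bij_betw (inc b) (I \<times> I) (inc b ` (I \<times> I))" by (auto simp: bij_betw_def inj_on_def)
 have "cavg (?J \<times> ?J) (%A. rho ?J z t A (i, b) (i, b)) = cavg (?J \<times> ?J) (%A. rho I z \<tau> (restr b A) i i)"
 by (intro cavg_cong r ib)
 also have "... = cavg (inc b ` (I \<times> I)) (%A. rho I z \<tau> (restr b A) i i)"
 proof (rule cavg_restrict[OF _ sub])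
 fix A
 have "restr b A = restr b (A \<inter> inc b ` (I \<times> I))" by (auto simp: restr_def)
 then show "rho I z \<tau> (restr b A) i i = rho I z \<tau> (restr b (A \<inter> inc b ` (I \<times> I))) i i" by simp
 qed (use fin in auto)
 also have "... = cavg (I \<times> I) (%A. rho I z \<tau> (restr b (inc b ` A)) i i)"
 by (rule cavg_image[OF bij, symmetric])
 also have "... = cavg (I \<times> I) (%A. rho I z \<tau> A i i)"
 proof (rule cavg_cong)
 fix A assume A: "A \<subseteq> I \<times> I"
 have "restr b (inc b ` A) = A"
 unfolding restr_def using A by (auto simp: image_iff)
 then show "rho I z \<tau> (restr b (inc b ` A)) i i = rho I z \<tau> A i i" by simp
 qed
 finally show "cavg (?J \<times> ?J) (%A. rho ?J z t A (i, b) (i, b)) = cavg (I \<times> I) (%A. rho I z \<tau> A i i)" .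
 qed
 also have "... = of_nat (card B) * mean_trace I z \<tau>"
 unfolding mean_trace_def cavg_sum rho_def by (simp add: sum_distrib_left)
 finally show ?thesis .
qed

end

section \<open>Joining copies: blow-up of a profile that factors through types\<close>

text \<open>The kernel 1/M - [a = b] has vanishing row and column sums, so constants may be
  subtracted from x and y.\<close>

lemma centered_pairing:
 fixes x y :: "'b => complex"
 assumes fin: "finite B" and M: "card B > 0"
 shows "(\<Sum>a\<in>B. \<Sum>b\<in>B. (1/of_nat (card B)-of_bool (a = b))*(x a * y b))
 = (\<Sum>a\<in>B. \<Sum>b\<in>B. (1/of_nat (card B)-of_bool (a = b))*((x a-m)*(y b-m')))"
proof -
 let ?w = "%a b. 1/of_nat (card B)-of_bool (a = b) :: complex"
 have Bne: "of_nat (card B) ~= (0 :: complex)" using M by simp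
 have r: "(\<Sum>b\<in>B. ?w a b) = 0" if "a : B" for a
 using sum_of_bool_mult_left(3)[OF fin that, of "%_. 1 :: complex"] Bne by (simp add: sum_subtractf)
 have c: "(\<Sum>a\<in>B. ?w a b) = 0" if "b : B" for b
 using sum_of_bool_mult_left(4)[OF fin that, of "%_. 1 :: complex"] Bne by (simp add: sum_subtractf)
 have "(\<Sum>a\<in>B. \<Sum>b\<in>B. ?w a b*(m * y b)) = (\<Sum>b\<in>B. (\<Sum>a\<in>B. ?w a b)*(m * y b))"
 by (subst sum.swap) (simp only: sum_distrib_right)
 then have 1: "(\<Sum>a\<in>B. \<Sum>b\<in>B. ?w a b*(m * y b)) = 0" using c by simp
 have "(\<Sum>a\<in>B. \<Sum>b\<in>B. ?w a b*((x a-m) * m')) = (\<Sum>a\<in>B. (\<Sum>b\<in>B. ?w a b)*((x a-m) * m'))"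
 by (simp only: sum_distrib_right)
 then have 2: "(\<Sum>a\<in>B. \<Sum>b\<in>B. ?w a b*((x a-m) * m')) = 0" using r by simp
 have "(\<Sum>a\<in>B. \<Sum>b\<in>B. ?w a b*((x a-m)*(y b-m'))) =
 (\<Sum>a\<in>B. \<Sum>b\<in>B. ?w a b*(x a * y b))-(\<Sum>a\<in>B. \<Sum>b\<in>B. ?w a b*(m * y b))-(\<Sum>a\<in>B. \<Sum>b\<in>B. ?w a b*((x a-m) * m'))"
 unfolding sum_subtractf[symmetric] by (intro sum.cong refl) (simp add: right_diff_distrib left_diff_distrib)
 then show ?thesis unfolding 1 2 by simp
qed

text \<open>The absolute values in a row of the kernel add up to at most 2, so the inequality of
  arithmetic and geometric means bounds the pairing by squared deviations from arbitrary
  centres.\<close>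

lemma centered_pairing_bound:
 fixes x y :: "'b => complex"
 assumes fin: "finite B" and M: "card B > 0"
 shows "cmod (\<Sum>a\<in>B. \<Sum>b\<in>B. (1/of_nat (card B)-of_bool (a = b))*(x a * y b))
 <= (\<Sum>a\<in>B. (cmod (x a-m))^2+(cmod (y a-m'))^2)"
proof -
 let ?M = "real (card B)"
 define f where "f = (%a. cmod (x a-m))"
 define g where "g = (%a. cmod (y a-m'))"
 have pos: "f a >= 0" "g a >= 0" for a by (simp_all add: f_def g_def)
 have amgm: "f a * g b <= ((f a)^2+(g b)^2)/2" for a b using sum_squares_bound[of "f a" "g b"] by simp
 have "cmod (\<Sum>a\<in>B. \<Sum>b\<in>B. (1/of_nat (card B)-of_bool (a = b))*(x a * y b))
 <= (\<Sum>a\<in>B. \<Sum>b\<in>B. (1/?M)*(((f a)^2+(g b)^2)/2) + of_bool (a = b)*(((f a)^2+(g b)^2)/2))"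
 unfolding centered_pairing[OF fin M, of x y m m']
 proof (intro sum_norm_le)
 fix a b :: 'b
 have "cmod (1/of_nat (card B)-of_bool (a = b)) <= cmod (1/of_nat (card B)) + cmod (of_bool (a = b))"
 by (rule norm_triangle_ineq4)
 also have "... = 1/?M + of_bool (a = b)" by (simp add: norm_divide of_bool_def)
 finally have "cmod ((1/of_nat (card B)-of_bool (a = b))*((x a-m)*(y b-m'))) <= (1/?M + of_bool (a = b))*(f a * g b)"
 unfolding norm_mult f_def g_def by (intro mult_right_mono) auto
 also have "... <= (1/?M + of_bool (a = b))*(((f a)^2+(g b)^2)/2)"
 by (intro mult_left_mono amgm) simp
 finally show "cmod ((1/of_nat (card B)-of_bool (a = b))*((x a-m)*(y b-m')))
 <= (1/?M)*(((f a)^2+(g b)^2)/2) + of_bool (a = b)*(((f a)^2+(g b)^2)/2)"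
 by (simp only: distrib_right)
 qed
 also have "... = (1/?M)*(\<Sum>a\<in>B. \<Sum>b\<in>B. ((f a)^2+(g b)^2)/2)+(\<Sum>a\<in>B. \<Sum>b\<in>B. of_bool (a = b)*(((f a)^2+(g b)^2)/2))"
 by (simp only: sum.distrib sum_distrib_left)
 also have "(\<Sum>a\<in>B. \<Sum>b\<in>B. of_bool (a = b)*(((f a)^2+(g b)^2)/2)) = (\<Sum>a\<in>B. ((f a)^2+(g a)^2)/2)"
 by (intro sum.cong refl sum_of_bool_mult_left(1)[OF fin])
 also have "(\<Sum>a\<in>B. \<Sum>b\<in>B. ((f a)^2+(g b)^2)/2) = ?M*(\<Sum>a\<in>B. ((f a)^2+(g a)^2)/2)"
 by (simp add: sum.distrib add_divide_distrib sum_divide_distrib[symmetric] sum_distrib_left[symmetric] distrib_left)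
 finally show ?thesis using M by (simp add: f_def g_def sum_divide_distrib[symmetric])
qed

text \<open>The first two terms are the constants of \<open>diag_variance_rho\<close> and
  \<open>diag_variance_rho2\<close>, the middle group is the off-diagonal error, doubled because it
  applies to mass plus cardinality, and the last term comes from integration by parts.\<close>

definition blow_const :: "complex => real" where
 "blow_const z = (let b = 1/Im z in 4 * b ^ 4+16 * b ^ 6+2*(4 * b^2+4 * b ^ 4+2 * b+2 * b ^ 5)+128 * b ^ 4)"

context
 fixes I :: "'i set" and B :: "'b set" and K :: "'k set" and z :: complex
 and v :: "'k => 'k => real" and p :: "'i => 'k => real" and \<tau> :: "'i => 'i => real"
 assumes fin: "finite I" "finite B" and ne: "I ~= {}" "B ~= {}" and z: "Im z > 0"
 and v: "!!k l. k : K ==> l : K ==> \<bar>v k l\<bar> <= 1"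
 and p: "!!i k. i : I ==> k : K ==> 0 <= p i k \<and> p i k <= 1"
 and \<tau>: "!!i j. \<tau> i j = (\<Sum>k\<in>K. \<Sum>l\<in>K. v k l*(p i k * p j l))"
 and \<tau>01: "!!i j. i : I ==> j : I ==> 0 <= \<tau> i j \<and> \<tau> i j <= 1"
 and \<tau>sym: "!!i j. i : I ==> j : I ==> \<tau> i j = \<tau> j i"
begin

private abbreviation "N \<equiv> real (card I)"
private abbreviation "M \<equiv> real (card B)"
private abbreviation "J \<equiv> I \<times> B"
private abbreviation "beta9 \<equiv> 1/Im z"

text \<open>\<open>t0\<close> is M disjoint copies of the profile on I; \<open>t1\<close> spreads
  the rates of each vertex evenly over all copies. The factor 1/2 compensates the two orientations
  of a pair.\<close>

private definition "t0 = (%(x, y). of_bool (snd x = snd y)*(\<tau> (fst x) (fst y)/(2*N)))"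
private definition "t1 = (%(x, y). \<tau> (fst x) (fst y)/(2*(N*M)))"
private definition "tt s e = (1-s) * t0 e + s * t1 e"

private lemma NM: "N >= 1" "M >= 1" "card B > 0"
 using fin ne by (simp_all add: Suc_leI card_gt_0_iff)

private lemma t_bounds: "e : J \<times> J ==> 0 <= t0 e \<and> t0 e <= 1/N" "e : J \<times> J ==> 0 <= t1 e \<and> t1 e <= 1/N"
proof -
 assume "e : J \<times> J"
 then obtain i a j b where e: "e = ((i, a), (j, b))" "i : I" "j : I" by auto
 have t: "0 <= \<tau> i j" "\<tau> i j <= 1" using \<tau>01 e by auto
 have h: "\<tau> i j/(2*N) <= 1/N" using NM t by (simp add: field_simps)
 show "0 <= t0 e \<and> t0 e <= 1/N" using t h NM by (auto simp: t0_def e)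
 have "\<tau> i j/(2*(N*M)) <= \<tau> i j/(2*N)"
 using t NM by (intro divide_left_mono) (auto simp: mult_le_cancel_left1)
 then show "0 <= t1 e \<and> t1 e <= 1/N" using t h NM by (auto simp: t1_def e)
qed

private lemma tt_nonneg: "e : J \<times> J ==> 0 <= s ==> s <= 1 ==> 0 <= tt s e"
 using t_bounds[of e] by (simp add: tt_def)

text \<open>Joining the copies does not change the total rate at a vertex. This cancels the term R_x
  Q_x in \<open>main_form\<close>.\<close>

private lemma row_sums:
 assumes "x : J"
 shows "(\<Sum>y\<in>J. t0 (x, y) + t0 (y, x)) = (\<Sum>j\<in>I. \<tau> (fst x) j)/N"
 and "(\<Sum>y\<in>J. t1 (x, y) + t1 (y, x)) = (\<Sum>j\<in>I. \<tau> (fst x) j)/N"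
proof -
 obtain i a where x: "x = (i, a)" "i : I" "a : B" using assms by auto
 have "(\<Sum>y\<in>J. t0 (x, y) + t0 (y, x)) = (\<Sum>j\<in>I. \<Sum>b\<in>B. of_bool (a = b)*(\<tau> i j/N))"
 unfolding sum.cartesian_product using NM
 by (intro sum.cong refl) (auto simp: t0_def x \<tau>sym field_simps)
 also have "... = (\<Sum>j\<in>I. \<tau> i j/N)"
 by (intro sum.cong refl sum_of_bool_mult_left(1)[OF fin(2) x(3)])
 finally show "(\<Sum>y\<in>J. t0 (x, y) + t0 (y, x)) = (\<Sum>j\<in>I. \<tau> (fst x) j)/N"
 by (simp add: x sum_divide_distrib)
 have "(\<Sum>y\<in>J. t1 (x, y) + t1 (y, x)) = (\<Sum>j\<in>I. \<Sum>b\<in>B. \<tau> i j/(N*M))"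
 unfolding sum.cartesian_product using NM
 by (intro sum.cong refl) (auto simp: t1_def x \<tau>sym field_simps)
 also have "... = (\<Sum>j\<in>I. \<tau> i j/N)" using NM by simp
 finally show "(\<Sum>y\<in>J. t1 (x, y) + t1 (y, x)) = (\<Sum>j\<in>I. \<tau> (fst x) j)/N"
 by (simp add: x sum_divide_distrib)
qed

private lemma row_le_1: "i : I ==> (\<Sum>j\<in>I. \<tau> i j)/N <= 1"
proof -
 assume i: "i : I"
 have "(\<Sum>j\<in>I. \<tau> i j) <= (\<Sum>j\<in>I. 1)" using \<tau>01 i by (intro sum_mono) auto
 then show ?thesis using NM by simp
qed

private lemma tt_rows: "x : J ==> (\<Sum>y\<in>J. tt s (x, y) + tt s (y, x)) <= 1"
proof -
 assume x: "x : J"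
 have convex: "(1-s) * a + s * a = a" for a :: real by (simp add: algebra_simps)
 have "(\<Sum>y\<in>J. tt s (x, y) + tt s (y, x)) = (1-s)*(\<Sum>y\<in>J. t0 (x, y) + t0 (y, x)) + s*(\<Sum>y\<in>J. t1 (x, y) + t1 (y, x))"
 unfolding sum_distrib_left sum.distrib[symmetric] by (intro sum.cong refl) (simp add: tt_def algebra_simps)
 also have "... = (\<Sum>j\<in>I. \<tau> (fst x) j)/N" unfolding row_sums[OF x] convex ..
 finally show ?thesis using row_le_1[of "fst x"] x by auto
qed

private lemma total: "(\<Sum>e\<in>J \<times> J. \<bar>t1 e-t0 e\<bar>) <= N*M"
proof -
 have sw: "(\<Sum>x\<in>J. \<Sum>y\<in>J. t (y, x)) = (\<Sum>x\<in>J. \<Sum>y\<in>J. t (x, y))" for t :: "_ => real" by (rule sum.swap)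
 have "(\<Sum>e\<in>J \<times> J. \<bar>t1 e-t0 e\<bar>) <= (\<Sum>e\<in>J \<times> J. t1 e + t0 e)"
 proof (rule sum_mono)
 fix e assume "e : J \<times> J"
 from t_bounds[OF this] show "\<bar>t1 e-t0 e\<bar> <= t1 e + t0 e" by (auto simp: abs_le_iff)
 qed
 also have "... = (\<Sum>x\<in>J. \<Sum>y\<in>J. t1 (x, y))+(\<Sum>x\<in>J. \<Sum>y\<in>J. t0 (x, y))"
 by (simp add: sum.distrib sum.cartesian_product split_def)
 also have "... = ((\<Sum>x\<in>J. \<Sum>y\<in>J. t1 (x, y) + t1 (y, x))+(\<Sum>x\<in>J. \<Sum>y\<in>J. t0 (x, y) + t0 (y, x)))/2"
 unfolding sum.distrib sw by simp
 also have "... <= ((\<Sum>x\<in>J. 1)+(\<Sum>x\<in>J. 1))/2"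
 unfolding row_sums using row_le_1
 by (intro divide_right_mono add_mono sum_mono) (auto simp: row_sums)
 also have "... = N*M" by (simp add: card_cartesian_product)
 finally show ?thesis .
qed

text \<open>The factorisation of \<open>\<tau>\<close> turns the double sum over vertices into, for
  each pair of types, a pairing of weighted diagonal sums of the copies through the zero-sum
  kernel.\<close>

private lemma main_form:
 fixes R Q :: "'i \<times> 'b => complex"
 shows "(\<Sum>x\<in>J. \<Sum>y\<in>J. of_real ((t1 (x, y)-t0 (x, y))+(t1 (y, x)-t0 (y, x)))*(R x*Q x+R x*Q y))
 = (1/of_real N)*(\<Sum>k\<in>K. \<Sum>l\<in>K. of_real (v k l)*(\<Sum>a\<in>B. \<Sum>b\<in>B. (1/of_nat (card B)-of_bool (a = b)) *
 ((\<Sum>i\<in>I. of_real (p i k)*R (i, a))*(\<Sum>j\<in>I. of_real (p j l)*Q (j, b)))))"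
proof -
 have J_sum: "(\<Sum>x\<in>J. f x) = (\<Sum>i\<in>I. \<Sum>a\<in>B. f (i, a))" for f :: "'i \<times> 'b => complex"
 by (simp add: sum.cartesian_product)
 let ?d = "%x y. (t1 (x, y)-t0 (x, y))+(t1 (y, x)-t0 (y, x))"
 have d: "?d (i, a) (j, b) = \<tau> i j/N*(1/M-of_bool (a = b))" if "i : I" "j : I" for i j a b
 using NM by (auto simp: t0_def t1_def \<tau>sym[OF that] field_simps)
 have zero: "(\<Sum>y\<in>J. ?d x y) = 0" if "x : J" for x
 using row_sums[OF that] by (simp add: sum.distrib sum_subtractf)
 have "(\<Sum>x\<in>J. \<Sum>y\<in>J. of_real (?d x y)*(R x*Q x)) = (\<Sum>x\<in>J. of_real (\<Sum>y\<in>J. ?d x y)*(R x*Q x))"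
 by (simp only: of_real_sum sum_distrib_right)
 then have z0: "(\<Sum>x\<in>J. \<Sum>y\<in>J. of_real (?d x y)*(R x*Q x)) = 0" using zero by simp
 have "(\<Sum>x\<in>J. \<Sum>y\<in>J. of_real (?d x y)*(R x*Q x+R x*Q y)) = (\<Sum>x\<in>J. \<Sum>y\<in>J. of_real (?d x y)*(R x*Q y))"
 unfolding distrib_left sum.distrib z0 by simp
 also have "... = (\<Sum>i\<in>I. \<Sum>a\<in>B. \<Sum>j\<in>I. \<Sum>b\<in>B. of_real (?d (i, a) (j, b))*(R (i, a)*Q (j, b)))"
 by (simp only: J_sum)
 also have "... = (\<Sum>i\<in>I. \<Sum>a\<in>B. \<Sum>j\<in>I. \<Sum>b\<in>B. \<Sum>k\<in>K. \<Sum>l\<in>K.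
 (1/of_real N)*(of_real (v k l)*((1/of_nat (card B)-of_bool (a = b))*((of_real (p i k)*R (i, a))*(of_real (p j l)*Q (j, b))))))"
 proof (intro sum.cong refl)
 fix i j :: 'i and a b :: 'b assume ij: "i : I" "j : I"
 have "complex_of_real (1/M-of_bool (a = b)) = 1/of_nat (card B)-of_bool (a = b)" by (simp add: of_bool_def)
 then have "of_real (?d (i, a) (j, b))*(R (i, a)*Q (j, b)) = (1/of_real N)*(of_real (\<tau> i j)*((1/of_nat (card B)-of_bool (a = b))*(R (i, a)*Q (j, b))))"
 unfolding d[OF ij] of_real_mult by simp
 also have "of_real (\<tau> i j) = (\<Sum>k\<in>K. \<Sum>l\<in>K. complex_of_real (v k l)*(of_real (p i k) * of_real (p j l)))"
 by (simp add: \<tau>)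
 finally show "of_real (?d (i, a) (j, b))*(R (i, a)*Q (j, b)) = (\<Sum>k\<in>K. \<Sum>l\<in>K.
 (1/of_real N)*(of_real (v k l)*((1/of_nat (card B)-of_bool (a = b))*((of_real (p i k)*R (i, a))*(of_real (p j l)*Q (j, b))))))"
 by (simp only: sum_distrib_left sum_distrib_right mult_ac)
 qed
 also have "... = (\<Sum>k\<in>K. \<Sum>l\<in>K. \<Sum>a\<in>B. \<Sum>b\<in>B. \<Sum>i\<in>I. \<Sum>j\<in>I.
 (1/of_real N)*(of_real (v k l)*((1/of_nat (card B)-of_bool (a = b))*((of_real (p i k)*R (i, a))*(of_real (p j l)*Q (j, b))))))"
 (is "(\<Sum>i\<in>I. \<Sum>a\<in>B. \<Sum>j\<in>I. \<Sum>b\<in>B. \<Sum>k\<in>K. \<Sum>l\<in>K. ?F i a j b k l) = _")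
 proof -
 have "(\<Sum>i\<in>I. \<Sum>a\<in>B. \<Sum>j\<in>I. \<Sum>b\<in>B. \<Sum>k\<in>K. \<Sum>l\<in>K. ?F i a j b k l)
 = (\<Sum>(i,a,j,b,k,l)\<in>I\<times>B\<times>I\<times>B\<times>K\<times>K. ?F i a j b k l)" by (simp only: sum.cartesian_product)
 also have "... = (\<Sum>(k,l,a,b,i,j)\<in>K\<times>K\<times>B\<times>B\<times>I\<times>I. ?F i a j b k l)"
 by (rule sum.reindex_bij_witness[where j = "%(i,a,j,b,k,l). (k,l,a,b,i,j)" and i = "%(k,l,a,b,i,j). (i,a,j,b,k,l)"]) auto
 also have "... = (\<Sum>k\<in>K. \<Sum>l\<in>K. \<Sum>a\<in>B. \<Sum>b\<in>B. \<Sum>i\<in>I. \<Sum>j\<in>I. ?F i a j b k l)" by (simp only: sum.cartesian_product)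
 finally show ?thesis .
 qed
 also have "... = (1/of_real N)*(\<Sum>k\<in>K. \<Sum>l\<in>K. of_real (v k l)*(\<Sum>a\<in>B. \<Sum>b\<in>B. (1/of_nat (card B)-of_bool (a = b)) *
 ((\<Sum>i\<in>I. of_real (p i k)*R (i, a))*(\<Sum>j\<in>I. of_real (p j l)*Q (j, b)))))"
 by (simp only: sum_product, simp only: sum_distrib_left)
 finally show ?thesis .
qed

text \<open>Swapping two copies leaves every interpolated profile invariant, so the expected
  diagonal does not depend on the copy. This symmetry provides the common centre for the
  pairing.\<close>

private lemma copy_invariant_mean:
 assumes "i : I" "a : B" "b : B"
 shows "cavg (J \<times> J) (%A. rho J z (tt s) A (i, a) (i, a)) = cavg (J \<times> J) (%A. rho J z (tt s) A (i, b) (i, b))"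
 and "cavg (J \<times> J) (%A. rho2 J z (tt s) A (i, a) (i, a)) = cavg (J \<times> J) (%A. rho2 J z (tt s) A (i, b) (i, b))"
proof -
 define h where "h = map_prod (id :: 'i => 'i) (Transposition.transpose a b)"
 have "bij_betw (Transposition.transpose a b) B B" using assms by (intro bij_betwI[where g = "Transposition.transpose a b"]) (auto simp: Transposition.transpose_def)
 then have h: "bij_betw h J J" unfolding h_def by (intro bij_betw_map_prod) auto
 have "Transposition.transpose a b c = Transposition.transpose a b c' \<longleftrightarrow> c = c'" for c c' by (metis Transposition.transpose_involutory)
 then have inv: "tt s \<circ> map_prod h h = tt s" by (auto simp: fun_eq_iff tt_def t0_def t1_def h_def)
 have hi: "h (i, b) = (i, a)" by (simp add: h_def)
 have finJ: "finite J" using fin by simp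
 from cavg_relabel[OF finJ z h, of "(i, b)" "tt s"] assms
 show "cavg (J \<times> J) (%A. rho J z (tt s) A (i, a) (i, a)) = cavg (J \<times> J) (%A. rho J z (tt s) A (i, b) (i, b))"
 and "cavg (J \<times> J) (%A. rho2 J z (tt s) A (i, a) (i, a)) = cavg (J \<times> J) (%A. rho2 J z (tt s) A (i, b) (i, b))"
 unfolding hi inv by auto
qed

text \<open>A diagonal sum over one copy is a weighted sum with weights supported on that copy, so
  the total weight is at most N although the model has N M vertices.\<close>

private lemma copy_variance:
 assumes a: "a : B" and k: "k : K" and s: "0 <= s" "s <= 1"
 shows "cavg (J \<times> J) (%A. (cmod ((\<Sum>i\<in>I. of_real (p i k) * rho J z (tt s) A (i, a) (i, a))
 -cavg (J \<times> J) (%A. \<Sum>i\<in>I. of_real (p i k) * rho J z (tt s) A (i, a) (i, a))))^2) <= 4 * beta9 ^ 4*N"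
 and "cavg (J \<times> J) (%A. (cmod ((\<Sum>i\<in>I. of_real (p i k) * rho2 J z (tt s) A (i, a) (i, a))
 -cavg (J \<times> J) (%A. \<Sum>i\<in>I. of_real (p i k) * rho2 J z (tt s) A (i, a) (i, a))))^2) <= 16 * beta9 ^ 6*N"
proof -
 define q where "q = (%x. of_bool (snd x = a) * p (fst x) k)"
 have q: "0 <= q x \<and> q x <= 1" if "x : J" for x using p[of "fst x" k] that k by (auto simp: q_def)
 have sq: "(\<Sum>c\<in>J. of_real (q c)*X c) = (\<Sum>i\<in>I. of_real (p i k)*X (i, a))" for X :: "_ => complex"
 proof -
 have "(\<Sum>c\<in>J. of_real (q c)*X c) = (\<Sum>i\<in>I. \<Sum>b\<in>B. of_bool (b = a)*(of_real (p i k)*X (i, b)))"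
 unfolding sum.cartesian_product by (intro sum.cong refl) (auto simp: q_def)
 also have "... = (\<Sum>i\<in>I. of_real (p i k)*X (i, a))"
 by (intro sum.cong refl sum_of_bool_mult_left(2)[OF fin(2) a])
 finally show ?thesis .
 qed
 have "(\<Sum>c\<in>J. q c) = (\<Sum>i\<in>I. \<Sum>b\<in>B. of_bool (b = a) * p i k)"
 unfolding sum.cartesian_product by (intro sum.cong refl) (auto simp: q_def)
 also have "... = (\<Sum>i\<in>I. p i k)" by (intro sum.cong refl sum_of_bool_mult_left(2)[OF fin(2) a])
 also have "... <= (\<Sum>i\<in>I. 1)" using p k by (intro sum_mono) auto
 finally have qN: "(\<Sum>c\<in>J. q c) <= N" by simp
 have finJ: "finite J" using fin by simp
 note var = diag_variance_rho[where t = "tt s" and p = q and D = 1, OF finJ z tt_nonneg[OF _ s] tt_rows q, unfolded sq]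
 diag_variance_rho2[where t = "tt s" and p = q and D = 1, OF finJ z tt_nonneg[OF _ s] tt_rows q, unfolded sq]
 have "4*1 * beta9 ^ 4*(\<Sum>c\<in>J. q c) <= 4*1 * beta9 ^ 4*N" "16*1 * beta9 ^ 6*(\<Sum>c\<in>J. q c) <= 16*1 * beta9 ^ 6*N"
 using z qN by (auto intro!: mult_left_mono)
 with var show "cavg (J \<times> J) (%A. (cmod ((\<Sum>i\<in>I. of_real (p i k) * rho J z (tt s) A (i, a) (i, a))
 -cavg (J \<times> J) (%A. \<Sum>i\<in>I. of_real (p i k) * rho J z (tt s) A (i, a) (i, a))))^2) <= 4 * beta9 ^ 4*N"
 "cavg (J \<times> J) (%A. (cmod ((\<Sum>i\<in>I. of_real (p i k) * rho2 J z (tt s) A (i, a) (i, a))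
 -cavg (J \<times> J) (%A. \<Sum>i\<in>I. of_real (p i k) * rho2 J z (tt s) A (i, a) (i, a))))^2) <= 16 * beta9 ^ 6*N"
 by (fastforce intro: order_trans)+
qed

text \<open>Each of the M copies contributes a variance of order N; the prefactor 1/N leaves order M
  for each pair of types, whereas the trace itself has size N M.\<close>

private lemma main_bound:
 assumes s: "0 <= s" "s <= 1"
 shows "cmod (cavg (J \<times> J) (%A. \<Sum>x\<in>J. \<Sum>y\<in>J. of_real ((t1 (x, y)-t0 (x, y))+(t1 (y, x)-t0 (y, x))) *
 (rho J z (tt s) A x x * rho2 J z (tt s) A x x + rho J z (tt s) A x x * rho2 J z (tt s) A y y)))
 <= (real (card K))^2*M*(4 * beta9 ^ 4+16 * beta9 ^ 6)"
proof -
 let ?E = "J \<times> J"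
 obtain a0 where a0: "a0 : B" using ne by auto
 define x where "x = (%k a A. \<Sum>i\<in>I. of_real (p i k) * rho J z (tt s) A (i, a) (i, a))"
 define y where "y = (%k a A. \<Sum>i\<in>I. of_real (p i k) * rho2 J z (tt s) A (i, a) (i, a))"
 define m where "m = (%k. cavg ?E (x k a0))"
 define m' where "m' = (%k. cavg ?E (y k a0))"
 have mx: "cavg ?E (x k a) = m k" "cavg ?E (y k a) = m' k" if "a : B" for k a
 unfolding m_def m'_def x_def y_def cavg_sum cavg_mult_left
 using copy_invariant_mean[OF _ that a0] by auto
 let ?P = "%k l A. \<Sum>a\<in>B. \<Sum>b\<in>B. (1/of_nat (card B)-of_bool (a = b))*(x k a A * y l b A)"
 have pair: "cmod (cavg ?E (?P k l)) <= M*(N*(4 * beta9 ^ 4+16 * beta9 ^ 6))" if kl: "k : K" "l : K" for k l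
 proof -
 have "cmod (cavg ?E (?P k l)) <= cavg ?E (%A. cmod (?P k l A))" by (rule norm_cavg_le)
 also have "... <= cavg ?E (%A. \<Sum>a\<in>B. (cmod (x k a A-m k))^2+(cmod (y l a A-m' l))^2)"
 by (intro cavg_mono centered_pairing_bound fin NM)
 also have "... = (\<Sum>a\<in>B. cavg ?E (%A. (cmod (x k a A-m k))^2) + cavg ?E (%A. (cmod (y l a A-m' l))^2))"
 unfolding cavg_sum cavg_add ..
 also have "... <= (\<Sum>a\<in>B. 4 * beta9 ^ 4*N+16 * beta9 ^ 6*N)"
 proof (intro sum_mono add_mono)
 fix a assume a: "a : B"
 show "cavg ?E (%A. (cmod (x k a A-m k))^2) <= 4 * beta9 ^ 4*N"
 using copy_variance(1)[OF a kl(1) s] unfolding mx(1)[OF a, symmetric] x_def .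
 show "cavg ?E (%A. (cmod (y l a A-m' l))^2) <= 16 * beta9 ^ 6*N"
 using copy_variance(2)[OF a kl(2) s] unfolding mx(2)[OF a, symmetric] y_def .
 qed
 also have "... = M*(N*(4 * beta9 ^ 4+16 * beta9 ^ 6))" by (simp add: algebra_simps)
 finally show ?thesis .
 qed
 have "cmod (cavg ?E (%A. (1/of_real N)*(\<Sum>k\<in>K. \<Sum>l\<in>K. of_real (v k l)*?P k l A)))
 = (1/N) * cmod (\<Sum>k\<in>K. \<Sum>l\<in>K. of_real (v k l) * cavg ?E (?P k l))"
 unfolding cavg_mult_left cavg_sum by (simp add: norm_mult norm_divide)
 also have "... <= (1/N)*(\<Sum>k\<in>K. \<Sum>l\<in>K. 1*(M*(N*(4 * beta9 ^ 4+16 * beta9 ^ 6))))"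
 proof (intro mult_left_mono sum_norm_le)
 fix k l assume kl: "k : K" "l : K"
 show "cmod (of_real (v k l) * cavg ?E (?P k l)) <= 1*(M*(N*(4 * beta9 ^ 4+16 * beta9 ^ 6)))"
 unfolding norm_mult norm_of_real by (rule mult_mono[OF v[OF kl] pair[OF kl]]) auto
 qed simp
 also have "... = (real (card K))^2*M*(4 * beta9 ^ 4+16 * beta9 ^ 6)"
 using NM by (simp add: power2_eq_square)
 finally show ?thesis unfolding main_form x_def y_def .
qed

text \<open>The main term is of order (card K)^2 M, and the errors with kap = 1/N are of order N
  M/sqrt N. After division by N M the loss does not depend on the number of copies, so M may be
  taken arbitrarily large.\<close>

theorem blow_up_comparison:
 "cmod (mean_trace J z (%(x, y). \<tau> (fst x) (fst y)/(2*(N*M)))-of_real M * mean_trace I z (%(i, j). \<tau> i j/(2*N)))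
 <= blow_const z*((real (card K))^2+1)*(N*M/sqrt N)"
proof -
 let ?E = "J \<times> J" and ?k = "4 * beta9^2+4 * beta9 ^ 4+2 * beta9+2 * beta9 ^ 5"
 have finJ: "finite J" and finE: "finite ?E" using fin by auto
 have beta9: "beta9 > 0" using z by simp
 have kap: "1/N > 0" using NM by simp
 have cardJ: "real (card J) = N*M" by (simp add: card_cartesian_product)
 have d: "\<bar>t1 e-t0 e\<bar> <= 1/N" if "e : ?E" for e using t_bounds[OF that] by (auto simp: abs_le_iff)
 let ?err = "sqrt (1/N)*?k*(N*M+N*M)"
 have "cmod (cavg ?E (%A. \<Sum>e\<in>?E. of_real (t1 e-t0 e) *
 (qf J (rho J z (tt s) A) (edge e) * qf J (rho2 J z (tt s) A) (edge e))))
 <= (real (card K))^2*M*(4 * beta9 ^ 4+16 * beta9 ^ 6)+?err" if s: "0 < s" "s < 1" for s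
 proof -
 let ?X = "%A. \<Sum>e\<in>?E. of_real (t1 e-t0 e)*(qf J (rho J z (tt s) A) (edge e) * qf J (rho2 J z (tt s) A) (edge e))"
 let ?Y = "%A. \<Sum>x\<in>J. \<Sum>y\<in>J. of_real ((t1 (x, y)-t0 (x, y))+(t1 (y, x)-t0 (y, x))) *
 (rho J z (tt s) A x x * rho2 J z (tt s) A x x + rho J z (tt s) A x x * rho2 J z (tt s) A y y)"
 have "cmod (?X A-?Y A) <= ?err" for A
 proof -
 have "cmod (?X A-?Y A) <= sqrt (1/N)*?k*((\<Sum>e\<in>?E. \<bar>t1 e-t0 e\<bar>) + real (card J))"
 by (rule diagonal_reduction[where d = "%e. t1 e-t0 e", OF finJ z d kap])
 also have "... <= ?err" unfolding cardJ
 by (rule mult_left_mono[OF add_right_mono[OF total]]) (use beta9 in auto)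
 finally show ?thesis .
 qed
 then have "cmod (cavg ?E ?X-cavg ?E ?Y) <= ?err"
 unfolding cavg_diff[symmetric] by (intro norm_cavg_bound finE)
 moreover have "cmod (cavg ?E ?Y) <= (real (card K))^2*M*(4 * beta9 ^ 4+16 * beta9 ^ 6)"
 using s by (intro main_bound) auto
 ultimately show ?thesis using norm_triangle_sub[of "cavg ?E ?X" "cavg ?E ?Y"] by linarith
 qed
 then have "cmod (mean_trace J z t1-mean_trace J z t0) \<le>
 ((real (card K))^2*M*(4 * beta9 ^ 4+16 * beta9 ^ 6)+?err)+128 * beta9 ^ 4 * sqrt (1/N)*(\<Sum>e\<in>?E. \<bar>t1 e-t0 e\<bar>)"
 by (intro interpolation[where ?t0.0 = t0 and ?t1.0 = t1 and kap = "1/N", OF finJ z t_bounds, folded tt_def]) auto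
 also have "... <= ((real (card K))^2*M*(4 * beta9 ^ 4+16 * beta9 ^ 6)+?err)+128 * beta9 ^ 4 * sqrt (1/N)*(N*M)"
 using total beta9 by (intro add_left_mono mult_left_mono) auto
 also have "... <= blow_const z*((real (card K))^2+1)*(N*M/sqrt N)"
 proof -
 define X where "X = N*M/sqrt N"
 define c where "c = 4 * beta9 ^ 4+16 * beta9 ^ 6"
 define L where "L = (real (card K))^2"
 have "1 <= sqrt N" using NM by simp
 then have "sqrt N*1 <= sqrt N * sqrt N" using NM by (intro mult_left_mono) auto
 then have "M * sqrt N <= M*N" using NM by (intro mult_left_mono) auto
 then have MX: "M <= X" unfolding X_def using NM by (simp add: pos_le_divide_eq mult.commute)
 have X: "sqrt (1/N)*(N*M) = X" by (simp add: X_def real_sqrt_divide)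
 have pos: "0 <= c" "0 <= L" "0 <= X" "0 <= ?k" "0 <= beta9 ^ 4" using beta9 NM by (auto simp: c_def L_def X_def)
 have "L*M * c + sqrt (1/N)*?k*(N*M+N*M)+128 * beta9 ^ 4 * sqrt (1/N)*(N*M)
 = L * c*M+2*?k*(sqrt (1/N)*(N*M))+128 * beta9 ^ 4*(sqrt (1/N)*(N*M))" by (simp add: algebra_simps)
 also have "... <= L * c*X+2*?k*X+128 * beta9 ^ 4*X"
 unfolding X using pos MX by (intro add_mono mult_left_mono) auto
 also have "... <= L * c*X+2*?k*X+128 * beta9 ^ 4*X+(c*X+L*(2*?k*X)+L*(128 * beta9 ^ 4*X))"
 using pos by simp
 also have "... = (c+2*?k+128 * beta9 ^ 4)*(L+1)*X" by (simp only: algebra_simps)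
 finally show ?thesis by (simp add: L_def X_def c_def blow_const_def Let_def)
 qed
 finally have "cmod (mean_trace J z t1-mean_trace J z t0) <= blow_const z*((real (card K))^2+1)*(N*M/sqrt N)" .
 moreover have "mean_trace J z t0 = of_nat (card B) * mean_trace I z (%(i, j). \<tau> i j/(2*N))"
 by (rule mean_trace_direct_sum[OF fin z]) (simp add: t0_def)
 ultimately show ?thesis by (simp add: t1_def case_prod_beta)
qed

end

section \<open>Replacing one coordinate: expansion of the resolvent trace\<close>

text \<open>One-coordinate Taylor expansion of the resolvent trace; the remainder is exact by two
 applications of the rank-one identity.\<close>

context
 fixes I :: "'i set" and z :: complex and e :: "'i \<times> 'i"
 assumes fin: "finite I" and z: "Im z > 0" and e: "e : I \<times> I"
begin

private abbreviation "beta10 \<equiv> 1/Im z"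

text \<open>\<open>gam\<close> is the difference quotient of the trace in coordinate e. It solves
  the linear equation gam = a + y * alp * gam exactly; substituting the equation into itself
  produces the Taylor coefficients together with the remainder.\<close>

lemma trace_update_gamma:
 "\<exists>gam. \<forall>y. (\<Sum>i\<in>I. res I z (Lap I (w(e := y))) i i) = (\<Sum>i\<in>I. res I z (Lap I (w(e := 0))) i i) + of_real y * gam y
 \<and> gam y = qf I (res2 I z (Lap I (w(e := 0)))) (edge e) + of_real y * qf I (res I z (Lap I (w(e := 0)))) (edge e) * gam y
 \<and> cmod (gam y) <= 2 * beta10^2"
proof -
 let ?R = "%y. res I z (Lap I (w(e := y)))"
 let ?m = "%y. mv I (?R y) (edge e)"
 define gam where "gam = (%y. \<Sum>i\<in>I. ?m 0 i*?m y i)"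
 have d: "Lap I (w(e := 0)) j k-Lap I (w(e := y)) j k = y*(edge e j * edge e k)" for j k y
 by (subst Lap_diff_single[OF fin e]) auto
 note r1 = res_rank_one[OF fin sym_on_Lap sym_on_Lap z _ _ d]
 have f: "(\<Sum>i\<in>I. ?R y i i) = (\<Sum>i\<in>I. ?R 0 i i) + of_real y * gam y" for y
 proof -
 have "(\<Sum>i\<in>I. ?R y i i)-(\<Sum>i\<in>I. ?R 0 i i) = (\<Sum>i\<in>I. of_real y*?m y i*?m 0 i)"
 unfolding sum_subtractf[symmetric] by (intro sum.cong refl r1)
 then show ?thesis unfolding gam_def sum_distrib_left by (simp add: algebra_simps)
 qed
 have m: "?m y i = ?m 0 i + of_real y*?m y i * qf I (?R 0) (edge e)" if i: "i : I" for y i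
 proof -
 have "?m y i-?m 0 i = (\<Sum>j\<in>I. (?R y i j-?R 0 i j) * of_real (edge e j))"
 by (simp add: mv_def sum_subtractf left_diff_distrib)
 also have "... = (\<Sum>j\<in>I. of_real y*?m y i*(of_real (edge e j)*?m 0 j))"
 using i by (intro sum.cong refl) (simp add: r1 mult_ac)
 also have "... = of_real y*?m y i * qf I (?R 0) (edge e)" by (simp only: qf_def sum_distrib_left)
 finally show ?thesis by (simp add: algebra_simps)
 qed
 have g1: "gam y = (\<Sum>i\<in>I. ?m 0 i*?m 0 i) + of_real y * qf I (?R 0) (edge e) * gam y" for y
 proof -
 have "gam y = (\<Sum>i\<in>I. ?m 0 i*(?m 0 i + of_real y*?m y i * qf I (?R 0) (edge e)))"
 unfolding gam_def
 proof (rule sum.cong[OF refl])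
 fix i assume "i : I"
 from arg_cong[OF m[OF this, of y], of "%t. ?m 0 i * t"]
 show "?m 0 i*?m y i = ?m 0 i*(?m 0 i + of_real y*?m y i * qf I (?R 0) (edge e))" .
 qed
 also have "... = (\<Sum>i\<in>I. ?m 0 i*?m 0 i) + of_real y * qf I (?R 0) (edge e) * gam y"
 unfolding gam_def distrib_left sum.distrib sum_distrib_left by (simp only: mult_ac)
 finally show ?thesis .
 qed
 have g2: "(\<Sum>i\<in>I. ?m 0 i*?m 0 i) = qf I (res2 I z (Lap I (w(e := 0)))) (edge e)"
 proof -
 have "qf I (res2 I z (Lap I (w(e := 0)))) (edge e) = (\<Sum>i\<in>I. of_real (edge e i)*(\<Sum>j\<in>I. ?R 0 i j*?m 0 j))"
 unfolding qf_def mv_res2[OF fin sym_on_Lap] ..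
 also have "... = (\<Sum>j\<in>I. \<Sum>i\<in>I. of_real (edge e i)*(?R 0 i j*?m 0 j))"
 unfolding sum_distrib_left by (rule sum.swap)
 also have "... = (\<Sum>j\<in>I. (\<Sum>i\<in>I. ?R 0 j i * of_real (edge e i))*?m 0 j)"
 unfolding sum_distrib_right by (intro sum.cong refl, subst res_sym) (simp only: mult_ac)
 finally show ?thesis by (simp only: mv_def)
 qed
 have g3: "cmod (gam y) <= 2 * beta10^2" for y
 proof -
 have nb: "(\<Sum>i\<in>I. (cmod (?m y i))^2) <= beta10^2*2" for y
 proof -
 have "(\<Sum>i\<in>I. (cmod (?m y i))^2) <= beta10^2*(\<Sum>i\<in>I. (edge e i)^2)"
 unfolding res_def mv_def by (rule fcalc_vec_norm[OF fin sym_on_Lap cmod_inverse_le[OF z]])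
 also have "... <= beta10^2*2" by (intro mult_left_mono edge_norm fin e) simp
 finally show ?thesis .
 qed
 have "cmod (gam y) <= (\<Sum>i\<in>I. ((cmod (?m 0 i))^2+(cmod (?m y i))^2)/2)"
 unfolding gam_def
 proof (rule sum_norm_le)
 fix i
 show "cmod (?m 0 i*?m y i) <= ((cmod (?m 0 i))^2+(cmod (?m y i))^2)/2"
 using sum_squares_bound[of "cmod (?m 0 i)" "cmod (?m y i)"] by (simp add: norm_mult)
 qed
 also have "... = ((\<Sum>i\<in>I. (cmod (?m 0 i))^2)+(\<Sum>i\<in>I. (cmod (?m y i))^2))/2"
 by (simp only: sum.distrib sum_divide_distrib[symmetric])
 finally show ?thesis using nb[of 0] nb[of y] by simp
 qed
 show ?thesis by (intro exI[of _ gam] allI conjI f g1[unfolded g2] g3)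
qed

lemma trace_update_lipschitz:
 "cmod ((\<Sum>i\<in>I. res I z (Lap I (w(e := y))) i i)-(\<Sum>i\<in>I. res I z (Lap I (w(e := 0))) i i)) <= 2 * beta10^2*\<bar>y\<bar>"
proof -
 obtain gam where gam: "\<forall>y. (\<Sum>i\<in>I. res I z (Lap I (w(e := y))) i i) = (\<Sum>i\<in>I. res I z (Lap I (w(e := 0))) i i) + of_real y * gam y
 \<and> gam y = qf I (res2 I z (Lap I (w(e := 0)))) (edge e) + of_real y * qf I (res I z (Lap I (w(e := 0)))) (edge e) * gam y
 \<and> cmod (gam y) <= 2 * beta10^2"
 using trace_update_gamma[of w] by (elim exE)
 note f = gam[rule_format, THEN conjunct1] and g = gam[rule_format, THEN conjunct2, THEN conjunct1]
 and gb = gam[rule_format, THEN conjunct2, THEN conjunct2]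
 show ?thesis unfolding f[of y] using mult_left_mono[OF gb[of y], of "\<bar>y\<bar>"] by (simp add: norm_mult mult_ac)
qed

text \<open>The two bounds on the remainder serve the Lindeberg condition: the cubic one is for
  small entries, and the quadratic one for large entries, where no third moment is at hand.\<close>

lemma trace_update_taylor:
 obtains a b r where
 "!!y. (\<Sum>i\<in>I. res I z (Lap I (w(e := y))) i i) = (\<Sum>i\<in>I. res I z (Lap I (w(e := 0))) i i) + of_real y * a + of_real (y^2) * b + r y"
 and "!!y. cmod (r y) <= (24 * beta10 ^ 3+32 * beta10 ^ 4) * min (y^2) (\<bar>y\<bar> ^ 3)"
proof -
 obtain gam where gam: "\<forall>y. (\<Sum>i\<in>I. res I z (Lap I (w(e := y))) i i) = (\<Sum>i\<in>I. res I z (Lap I (w(e := 0))) i i) + of_real y * gam y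
 \<and> gam y = qf I (res2 I z (Lap I (w(e := 0)))) (edge e) + of_real y * qf I (res I z (Lap I (w(e := 0)))) (edge e) * gam y
 \<and> cmod (gam y) <= 2 * beta10^2"
 using trace_update_gamma[of w] by (elim exE)
 note f = gam[rule_format, THEN conjunct1] and g = gam[rule_format, THEN conjunct2, THEN conjunct1]
 and gb = gam[rule_format, THEN conjunct2, THEN conjunct2]
 define a where "a = qf I (res2 I z (Lap I (w(e := 0)))) (edge e)"
 define alp where "alp = qf I (res I z (Lap I (w(e := 0)))) (edge e)"
 define r where "r = (%y. of_real (y^2)*(alp*(gam y-a)))"
 have beta10: "beta10 > 0" using z by simp
 have ab: "cmod alp <= 4 * beta10" "cmod a <= 4 * beta10^2"
 unfolding a_def alp_def by (rule qf_res_le[OF fin z sym_on_Lap e] qf_res2_le[OF fin z sym_on_Lap e])+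
 have g': "gam y = a + of_real y * alp * gam y" for y unfolding a_def alp_def by (rule g)
 have "(\<Sum>i\<in>I. res I z (Lap I (w(e := y))) i i) = (\<Sum>i\<in>I. res I z (Lap I (w(e := 0))) i i) + of_real y * a + of_real (y^2)*(alp * a) + r y" for y
 proof -
 have "of_real y * gam y = of_real y * a + of_real (y^2)*(alp * gam y)"
 by (subst g') (simp add: power2_eq_square algebra_simps)
 note eq = this
 show ?thesis unfolding f[of y] eq r_def by (simp add: right_diff_distrib)
 qed
 moreover have "cmod (r y) <= (24 * beta10 ^ 3+32 * beta10 ^ 4) * min (y^2) (\<bar>y\<bar> ^ 3)" for y
 proof -
 have "cmod (gam y-a) <= 6 * beta10^2" using norm_triangle_ineq4[of "gam y" a] gb[of y] ab by linarith
 then have "cmod alp * cmod (gam y-a) <= (4 * beta10)*(6 * beta10^2)" using ab beta10 by (intro mult_mono) auto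
 then have "y^2*(cmod alp * cmod (gam y-a)) <= y^2*((4 * beta10)*(6 * beta10^2))" by (rule mult_left_mono) simp
 then have 1: "cmod (r y) <= 24 * beta10 ^ 3 * y^2"
 by (simp add: r_def norm_mult norm_power power3_eq_cube power2_eq_square mult_ac)
 \<comment> \<open>The equation for \<open>gam\<close> is substituted once more, which trades gam -
   a for another factor y.\<close>
 have "r y = of_real (y ^ 3)*(alp * alp * gam y)"
 proof -
 have "gam y-a = (a + of_real y * alp * gam y)-a" by (rule arg_cong[where f = "%t. t-a", OF g'])
 also have "... = of_real y * alp * gam y" by (rule add_diff_cancel_left')
 finally show ?thesis by (simp add: r_def power3_eq_cube power2_eq_square mult_ac)
 qed
 moreover have "cmod alp * cmod alp * cmod (gam y) <= (4 * beta10)*(4 * beta10)*(2 * beta10^2)"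
 using ab gb beta10 by (intro mult_mono) auto
 then have "\<bar>y\<bar> ^ 3*(cmod alp * cmod alp * cmod (gam y)) <= \<bar>y\<bar> ^ 3*((4 * beta10)*(4 * beta10)*(2 * beta10^2))" by (rule mult_left_mono) simp
 ultimately have 2: "cmod (r y) <= 32 * beta10 ^ 4*\<bar>y\<bar> ^ 3"
 by (simp add: norm_mult norm_power power2_eq_square eval_nat_numeral mult_ac)
 have "24 * beta10 ^ 3 * y^2 <= (24 * beta10 ^ 3+32 * beta10 ^ 4) * y^2" "32 * beta10 ^ 4*\<bar>y\<bar> ^ 3 <= (24 * beta10 ^ 3+32 * beta10 ^ 4)*\<bar>y\<bar> ^ 3"
 using beta10 by (intro mult_right_mono; simp)+
 then show ?thesis using 1 2 by (auto simp: min_def)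
 qed
 ultimately show thesis by (rule that)
qed

end

definition trace_res :: "'i set => complex => ('i \<times> 'i => real) => complex" where
 "trace_res I z y = (\<Sum>i\<in>I. res I z (Lap I y) i i)"

lemma Lap_cong: "(!!e. e : I \<times> I ==> y e = y' e) ==> Lap I y = Lap I y'"
 by (intro ext) (simp add: Lap_def cong: sum.cong)

lemma trace_res_cong: "(!!e. e : I \<times> I ==> y e = y' e) ==> trace_res I z y = trace_res I z y'"
 unfolding trace_res_def by (subst Lap_cong[of I y y']) auto

lemma trace_res_bound:
 assumes "finite I" "Im z > 0"
 shows "cmod (trace_res I z y) <= real (card I)*(1/Im z)"
 unfolding trace_res_def using sum_norm_bound[of I "%i. res I z (Lap I y) i i" "1/Im z"]
 res_norm_le[OF assms sym_on_Lap] by auto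

text \<open>Resolvent entries are continuous in the product topology, and countability of the index
  type turns coordinatewise measurability into measurability of the whole vector. Coordinates
  outside I x I are set to 0 because nothing is assumed about them.\<close>

lemma measurable_res:
 fixes I :: "('i :: countable) set"
 assumes fin: "finite I" and z: "Im z > 0" and Y: "!!e. e : I \<times> I ==> Y e : borel_measurable M" and il: "i : I" "l : I"
 shows "(%x. res I z (Lap I (%e. Y e x)) i l) : borel_measurable M"
proof -
 define F where "F = (%x e. if e : I \<times> I then Y e x else 0)"
 have "F : borel_measurable M" unfolding F_def
 proof (rule measurable_coordinatewise_then_product)
 fix e show "(%x. if e : I \<times> I then Y e x else 0) : borel_measurable M"
 using Y[of e] by (cases "e : I \<times> I") simp_all
 qed
 moreover have "continuous_on UNIV (%y :: 'i \<times> 'i => real. res I z (Lap I y) i l)"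
 proof (rule continuous_at_imp_continuous_on, rule ballI)
 fix y0 :: "'i \<times> 'i => real"
 have "((%y. y e) \<longlongrightarrow> y0 e) (at y0)" for e
 proof -
 have "continuous_on UNIV (%y :: 'i \<times> 'i => real. y e)" by (rule continuous_on_product_coordinates)
 then show ?thesis by (simp add: continuous_on_def)
 qed
 then show "isCont (%y. res I z (Lap I y) i l) y0" unfolding isCont_def by (intro tendsto_res[OF fin z _ il])
 qed
 ultimately have "(%x. res I z (Lap I (F x)) i l) : borel_measurable M"
 using measurable_compose[OF _ borel_measurable_continuous_onI] by blast
 moreover have "Lap I (F x) = Lap I (%e. Y e x)" for x by (rule Lap_cong) (simp add: F_def)
 ultimately show ?thesis by simp
qed

lemma measurable_trace_res:
 fixes I :: "('i :: countable) set"
 assumes "finite I" "Im z > 0" "!!e. e : I \<times> I ==> Y e : borel_measurable M"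
 shows "(%x. trace_res I z (%e. Y e x)) : borel_measurable M"
 unfolding trace_res_def using assms by (intro borel_measurable_sum measurable_res) auto

lemma norm_diff_chain: "cmod (a-b) + cmod (b-c) <= d ==> cmod (a-c) <= d"
 using norm_triangle_ineq[of "a-b" "b-c"] by simp

lemma norm_half_le: "cmod a <= d ==> cmod b <= d ==> cmod ((a + b)/2) <= d"
 using norm_triangle_ineq[of a b] by (simp add: norm_divide)

section \<open>Independent coordinates: Efron-Stein inequality and Lindeberg exchange\<close>

locale real_product_family =
 fixes \<rho> :: "'e => real measure"
 assumes prob_rho: "prob_space (\<rho> e)" and sets_rho [measurable_cong]: "sets (\<rho> e) = sets borel"
begin

lemma space_rho [simp]: "space (\<rho> e) = UNIV" using sets_eq_imp_space_eq[OF sets_rho] by simp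

lemma measure_rho_UNIV [simp]: "measure (\<rho> e) UNIV = 1"
 using prob_space.prob_space[OF prob_rho, of e] by simp

sublocale product_sigma_finite \<rho>
 by (intro product_sigma_finite.intro prob_space_imp_sigma_finite prob_rho)

lemma sets_PiM_rho: "sets (PiM E \<rho>) = sets (PiM E (%_. borel))"
 by (intro sets_PiM_cong refl sets_rho)

lemma measurable_PiM_rho: "borel_measurable (PiM E \<rho>) = borel_measurable (PiM E (%_. borel))"
 by (intro measurable_cong_sets sets_PiM_rho refl)

lemma measurable_update:
 assumes "f : borel_measurable (PiM E \<rho>)" "e : E" "w : space (PiM E \<rho>)"
 shows "(%y. f (w(e := y))) : borel_measurable (\<rho> e)"
proof (rule measurable_compose[OF _ assms(1)])
 show "(%y. w(e := y)) : measurable (\<rho> e) (PiM E \<rho>)"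
 using assms by (intro measurable_fun_upd[where J = E]) (auto simp: insert_absorb)
qed

lemma update_in_space: "w : space (PiM E \<rho>) ==> e : E ==> w(e := y) : space (PiM E \<rho>)"
 "w : space (PiM E \<rho>) ==> w(e := y) : space (PiM (insert e E) \<rho>)"
 by (auto simp: space_PiM PiE_def extensional_def)

lemma integrable_bounded:
 fixes f :: "'x => 'c :: {banach, second_countable_topology}"
 assumes "prob_space M" "f : borel_measurable M" "!!w. w : space M ==> norm (f w) <= K"
 shows "integrable M f"
proof -
 interpret prob_space M by fact
 show ?thesis by (rule integrable_const_bound[where B = K]) (use assms in auto)
qed

lemma integrable_PiM:
 fixes f :: "('e => real) => 'c :: {banach, second_countable_topology}"
 assumes "f : borel_measurable (PiM E \<rho>)" "!!w. w : space (PiM E \<rho>) ==> norm (f w) <= K"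
 shows "integrable (PiM E \<rho>) f"
 by (rule integrable_bounded[OF prob_space_PiM[OF prob_rho] assms])

lemma integrable_update:
 fixes f :: "('e => real) => 'c :: {banach, second_countable_topology}"
 assumes "f : borel_measurable (PiM E \<rho>)" "!!w. w : space (PiM E \<rho>) ==> norm (f w) <= K" "e : E" "w : space (PiM E \<rho>)"
 shows "integrable (\<rho> e) (%y. f (w(e := y)))"
 using assms by (intro integrable_bounded[OF prob_rho, where K = K] measurable_update) (auto intro: update_in_space)

lemma update_insert:
 assumes "w : space (PiM E \<rho>)"
 shows "w(e := y) = (w(e := 0))(e := y)" "w(e := 0) : space (PiM (insert e E) \<rho>)"
 using assms by (auto intro: update_in_space)

lemma integrable_update_insert:
 fixes f :: "('e => real) => 'c :: {banach, second_countable_topology}"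
 assumes "f : borel_measurable (PiM (insert e E) \<rho>)" "!!w. w : space (PiM (insert e E) \<rho>) ==> norm (f w) <= K"
 and w: "w : space (PiM E \<rho>)"
 shows "integrable (\<rho> e) (%y. f (w(e := y)))"
 by (subst update_insert(1)[OF w]) (rule integrable_update[OF assms(1,2) _ update_insert(2)[OF w]], auto)

lemma measurable_partial_integral:
 fixes f :: "('e => real) => 'c :: {banach, second_countable_topology}"
 assumes "f : borel_measurable (PiM (insert e E) \<rho>)"
 shows "(%w. \<integral>y. f (w(e := y)) \<partial>\<rho> e) : borel_measurable (PiM E \<rho>)"
proof -
 interpret sigma_finite_measure "\<rho> e" using prob_rho prob_space_imp_sigma_finite by blast
 have "(%(w, y). f (w(e := y))) : borel_measurable (PiM E \<rho> \<Otimes>\<^sub>M \<rho> e)"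
 using measurable_compose[OF measurable_add_dim assms] by (simp add: case_prod_beta)
 then show ?thesis by (rule borel_measurable_lebesgue_integral)
qed

text \<open>Induction over coordinates: integrating out the new one gives g, which inherits the
  Lipschitz bounds in the others. On a fibre the variance is at most the second moment around the
  value at 0, which is why every update may be compared with the fixed value 0.\<close>

lemma efron_stein:
 fixes f :: "('e => real) => real"
 assumes "finite E" and I2: "!!e. e : E ==> integrable (\<rho> e) (%y. y^2)"
 and "f : borel_measurable (PiM E \<rho>)" and "!!w. w : space (PiM E \<rho>) ==> \<bar>f w\<bar> <= K"
 and "!!e w y. e : E ==> w : space (PiM E \<rho>) ==> \<bar>f (w(e := y))-f (w(e := 0))\<bar> <= c e*\<bar>y\<bar>"
 shows "(\<integral>w. (f w)^2 \<partial>PiM E \<rho>) <= (\<integral>w. f w \<partial>PiM E \<rho>)^2+(\<Sum>e\<in>E. (c e)^2*(\<integral>y. y^2 \<partial>\<rho> e))"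
 using assms
proof (induction E arbitrary: f rule: finite_induct)
 case empty
 then show ?case by (simp add: PiM_empty lebesgue_integral_count_space_finite)
next
 case (insert e E)
 note fm = insert.prems(2) and fb = insert.prems(3) and lip = insert.prems(4)
 interpret R: prob_space "\<rho> e" by (rule prob_rho)
 interpret PE: prob_space "PiM E \<rho>" by (rule prob_space_PiM[OF prob_rho])
 define g where "g = (%w. \<integral>y. f (w(e := y)) \<partial>\<rho> e)"
 \<comment> \<open>Any point of the product space shows that the bound K is nonnegative.\<close>
 have K: "K >= 0" using fb[of "%x. if x : insert e E then 0 else undefined"] 
 by (auto simp: space_PiM PiE_def extensional_def)
 have sqb: "norm ((f w)^2) <= K^2" if "w : space (PiM (insert e E) \<rho>)" for w
 using power_mono[OF fb[OF that], of 2] by simp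
 have fint: "integrable (\<rho> e) (%y. f (w(e := y)))" if "w : space (PiM E \<rho>)" for w
 by (rule integrable_update_insert[OF fm _ that, where K = K]) (use fb in auto)
 have f2int: "integrable (\<rho> e) (%y. (f (w(e := y)))^2)" if "w : space (PiM E \<rho>)" for w
 by (rule integrable_update_insert[OF _ sqb that]) (use fm in simp)
 have gm: "g : borel_measurable (PiM E \<rho>)" unfolding g_def by (rule measurable_partial_integral[OF fm])
 have gb: "\<bar>g w\<bar> <= K" if "w : space (PiM E \<rho>)" for w
 proof -
 have "\<bar>g w\<bar> <= (\<integral>y. \<bar>f (w(e := y))\<bar> \<partial>\<rho> e)" unfolding g_def by (rule integral_abs_bound)
 also have "... <= (\<integral>y. K \<partial>\<rho> e)" using fint[OF that] fb update_in_space(2)[OF that]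
 by (intro integral_mono) auto
 finally show ?thesis by (simp add: R.prob_space)
 qed
 have glip: "\<bar>g (w(e' := y))-g (w(e' := 0))\<bar> <= c e'*\<bar>y\<bar>" if e': "e' : E" and w: "w : space (PiM E \<rho>)" for e' w y
 proof -
 have ne: "e' ~= e" using e' insert by auto
 have i: "integrable (\<rho> e) (%x. f (w(e' := y, e := x)))" for y by (rule fint[OF update_in_space(1)[OF w e']])
 have "g (w(e' := y))-g (w(e' := 0)) = (\<integral>x. f (w(e' := y, e := x))-f (w(e' := 0, e := x)) \<partial>\<rho> e)"
 unfolding g_def by (rule Bochner_Integration.integral_diff[symmetric, OF i i])
 also have "\<bar>...\<bar> <= (\<integral>x. \<bar>f (w(e' := y, e := x))-f (w(e' := 0, e := x))\<bar> \<partial>\<rho> e)" by (rule integral_abs_bound)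
 also have "... <= (\<integral>x. c e'*\<bar>y\<bar> \<partial>\<rho> e)"
 proof (intro integral_mono integrable_abs Bochner_Integration.integrable_diff i)
 fix x
 have "w(e' := y, e := x) = (w(e := x))(e' := y)" for y using ne by (simp add: fun_upd_twist)
 note tw = this
 show "\<bar>f (w(e' := y, e := x))-f (w(e' := 0, e := x))\<bar> <= c e'*\<bar>y\<bar>"
 unfolding tw by (rule lip[OF _ update_in_space(2)[OF w]]) (use e' in simp)
 qed simp
 finally show ?thesis by (simp add: R.prob_space)
 qed
 have fibre: "(\<integral>y. (f (w(e := y)))^2 \<partial>\<rho> e) <= (g w)^2+(c e)^2*(\<integral>y. y^2 \<partial>\<rho> e)" if w: "w : space (PiM E \<rho>)" for w
 proof -
 let ?f0 = "f (w(e := 0))"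
 have e0: "(f (w(e := y)))^2 = (f (w(e := y))-?f0)^2+2*?f0 * f (w(e := y))-?f0^2" for y
 by (simp add: power2_diff)
 have b: "(f (w(e := y)))^2 <= (c e)^2 * y^2+2*?f0 * f (w(e := y))-?f0^2" for y
 proof -
 have "\<bar>f ((w(e := 0))(e := y))-f ((w(e := 0))(e := 0))\<bar> <= c e*\<bar>y\<bar>"
 by (rule lip[OF _ update_in_space(2)[OF w]]) simp
 then have "\<bar>f (w(e := y))-?f0\<bar> <= c e*\<bar>y\<bar>" by (simp only: fun_upd_upd)
 then have "\<bar>f (w(e := y))-?f0\<bar>^2 <= (c e*\<bar>y\<bar>)^2" by (rule power_mono) simp
 then show ?thesis unfolding e0[of y] by (simp add: power_mult_distrib)
 qed
 have "(\<integral>y. (f (w(e := y)))^2 \<partial>\<rho> e) <= (\<integral>y. (c e)^2 * y^2+2*?f0 * f (w(e := y))-?f0^2 \<partial>\<rho> e)"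
 using insert.prems(1)[of e] fint[OF w] b by (intro integral_mono f2int[OF w]) auto
 also have "... = (c e)^2*(\<integral>y. y^2 \<partial>\<rho> e)+2*?f0 * g w-?f0^2"
 using insert.prems(1)[of e] fint[OF w] by (simp add: g_def R.prob_space)
 also have "... <= (g w)^2+(c e)^2*(\<integral>y. y^2 \<partial>\<rho> e)"
 using zero_le_power2[of "g w-?f0"] by (simp add: power2_diff mult_ac)
 finally show ?thesis .
 qed
 have f2: "integrable (PiM (insert e E) \<rho>) (%w. (f w)^2)" by (rule integrable_PiM[OF _ sqb]) (use fm in simp)
 have f1: "integrable (PiM (insert e E) \<rho>) f" by (rule integrable_PiM[OF fm, where K = K]) (use fb in auto)
 have g2: "integrable (PiM E \<rho>) (%w. (g w)^2)"
 proof (rule integrable_PiM[where K = "K^2"])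
 fix w assume "w : space (PiM E \<rho>)"
 then show "norm ((g w)^2) <= K^2" using power_mono[OF gb, of w 2] by simp
 qed (use gm in simp)
 have "(\<integral>w. (f w)^2 \<partial>PiM (insert e E) \<rho>) = (\<integral>w. \<integral>y. (f (w(e := y)))^2 \<partial>\<rho> e \<partial>PiM E \<rho>)"
 by (rule product_integral_insert[OF insert(1,2) f2])
 also have "... <= (\<integral>w. (g w)^2+(c e)^2*(\<integral>y. y^2 \<partial>\<rho> e) \<partial>PiM E \<rho>)"
 proof (intro integral_mono fibre)
 have "norm (\<integral>y. (f (w(e := y)))^2 \<partial>\<rho> e) <= K^2" if "w : space (PiM E \<rho>)" for w
 proof -
 have "norm (\<integral>y. (f (w(e := y)))^2 \<partial>\<rho> e) <= (\<integral>y. norm ((f (w(e := y)))^2) \<partial>\<rho> e)" by (rule integral_norm_bound)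
 also have "... <= (\<integral>y. K^2 \<partial>\<rho> e)" using f2int[OF that] sqb update_in_space(2)[OF that]
 by (intro integral_mono) auto
 finally show ?thesis by (simp add: R.prob_space)
 qed
 then show "integrable (PiM E \<rho>) (%w. \<integral>y. (f (w(e := y)))^2 \<partial>\<rho> e)"
 using fm by (intro integrable_PiM measurable_partial_integral) auto
 qed (use g2 in auto)
 also have "... = (\<integral>w. (g w)^2 \<partial>PiM E \<rho>)+(c e)^2*(\<integral>y. y^2 \<partial>\<rho> e)" using g2 by (simp add: PE.prob_space)
 also have "(\<integral>w. (g w)^2 \<partial>PiM E \<rho>) <= (\<integral>w. g w \<partial>PiM E \<rho>)^2+(\<Sum>e\<in>E. (c e)^2*(\<integral>y. y^2 \<partial>\<rho> e))"
 using insert.prems(1) by (intro insert.IH gm gb glip) auto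
 also have "(\<integral>w. g w \<partial>PiM E \<rho>) = (\<integral>w. f w \<partial>PiM (insert e E) \<rho>)"
 unfolding g_def by (rule product_integral_insert[OF insert(1,2) f1, symmetric])
 finally show ?case using insert(1,2) by simp
qed

text \<open>Coordinates are exchanged one at a time: \<open>h\<close> is f with coordinate e already
  replaced by a sign of scale \<open>s e\<close>. It inherits the replacement bounds of the
  remaining coordinates, since averaging does not increase them.\<close>

lemma lindeberg_exchange:
 fixes f :: "('e => real) => complex"
 assumes "finite E" and "f : borel_measurable (PiM E \<rho>)" and "!!w. w : space (PiM E \<rho>) ==> cmod (f w) <= K"
 and "!!e w. e : E ==> w : space (PiM E \<rho>) ==>
 cmod ((\<integral>y. f (w(e := y)) \<partial>\<rho> e)-(f (w(e := s e)) + f (w(e :=-s e)))/2) <= \<delta> e"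
 shows "cmod ((\<integral>w. f w \<partial>PiM E \<rho>)-cavg E (%A. f (\<lambda>e\<in>E. s e * sgnset A e))) <= (\<Sum>e\<in>E. \<delta> e)"
 using assms
proof (induction E arbitrary: f rule: finite_induct)
 case empty
 then show ?case by (simp add: PiM_empty lebesgue_integral_count_space_finite restrict_def)
next
 case (insert e E)
 note fm = insert.prems(1) and fb = insert.prems(2) and ex = insert.prems(3)
 interpret PE: prob_space "PiM E \<rho>" by (rule prob_space_PiM[OF prob_rho])
 interpret R: prob_space "\<rho> e" by (rule prob_rho)
 define h where "h = (%w. (f (w(e := s e)) + f (w(e :=-s e)))/2)"
 have up: "(%w. w(e := y)) : measurable (PiM E \<rho>) (PiM (insert e E) \<rho>)" for y
 by (intro measurable_fun_upd[where J = E]) auto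
 have hm: "h : borel_measurable (PiM E \<rho>)"
 unfolding h_def by (intro borel_measurable_divide borel_measurable_add measurable_compose[OF up fm] borel_measurable_const)
 have hb: "cmod (h w) <= K" if "w : space (PiM E \<rho>)" for w
 proof -
 have "cmod (f (w(e := y))) <= K" for y by (rule fb[OF update_in_space(2)[OF that]])
 from this[of "s e"] this[of "- s e"] show ?thesis
 using norm_triangle_ineq[of "f (w(e := s e))" "f (w(e :=-s e))"] by (simp add: h_def norm_divide)
 qed
 have hex: "cmod ((\<integral>y. h (w(e' := y)) \<partial>\<rho> e')-(h (w(e' := s e')) + h (w(e' :=-s e')))/2) <= \<delta> e'"
 if e': "e' : E" and w: "w : space (PiM E \<rho>)" for e' w
 proof -
 have ne: "e' ~= e" using e' insert by auto
 have tw: "w(e' := y, e := x) = (w(e := x))(e' := y)" for x y using ne by (simp add: fun_upd_twist)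
 have i: "integrable (\<rho> e') (%y. f ((w(e := x))(e' := y)))" for x
 by (rule integrable_update[OF fm, where K = K]) (use fb e' update_in_space(2)[OF w] in auto)
 let ?d = "%x. (\<integral>y. f ((w(e := x))(e' := y)) \<partial>\<rho> e')-(f ((w(e := x))(e' := s e')) + f ((w(e := x))(e' :=-s e')))/2"
 have "(\<integral>y. h (w(e' := y)) \<partial>\<rho> e') = ((\<integral>y. f ((w(e := s e))(e' := y)) \<partial>\<rho> e')+(\<integral>y. f ((w(e :=-s e))(e' := y)) \<partial>\<rho> e'))/2"
 unfolding h_def tw using i by simp
 then have eq: "(\<integral>y. h (w(e' := y)) \<partial>\<rho> e')-(h (w(e' := s e')) + h (w(e' :=-s e')))/2 = (?d (s e)+?d (- s e))/2"
 unfolding h_def tw by (simp add: field_simps)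
 have "cmod (?d x) <= \<delta> e'" for x by (rule ex[OF _ update_in_space(2)[OF w]]) (use e' in simp)
 then show ?thesis unfolding eq by (intro norm_half_le)
 qed
 have f1: "integrable (PiM (insert e E) \<rho>) f" by (rule integrable_PiM[OF fm, where K = K]) (use fb in auto)
 have hi: "integrable (PiM E \<rho>) h" by (rule integrable_PiM[OF hm hb])
 have gb: "cmod (\<integral>y. f (w(e := y)) \<partial>\<rho> e) <= K" if w: "w : space (PiM E \<rho>)" for w
 proof -
 have "cmod (\<integral>y. f (w(e := y)) \<partial>\<rho> e) <= (\<integral>y. cmod (f (w(e := y))) \<partial>\<rho> e)" by (rule integral_norm_bound)
 also have "... <= (\<integral>y. K \<partial>\<rho> e)"
 using fb update_in_space(2)[OF w] by (intro integral_mono integrable_norm integrable_update_insert[OF fm fb w]) auto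
 finally show ?thesis by (simp add: R.prob_space)
 qed
 have gi: "integrable (PiM E \<rho>) (%w. \<integral>y. f (w(e := y)) \<partial>\<rho> e)"
 by (rule integrable_PiM[OF measurable_partial_integral[OF fm] gb])
 have "(\<integral>w. f w \<partial>PiM (insert e E) \<rho>)-(\<integral>w. h w \<partial>PiM E \<rho>) = (\<integral>w. (\<integral>y. f (w(e := y)) \<partial>\<rho> e)-h w \<partial>PiM E \<rho>)"
 unfolding product_integral_insert[OF insert(1,2) f1] by (rule Bochner_Integration.integral_diff[symmetric, OF gi hi])
 also have "cmod ... <= (\<integral>w. cmod ((\<integral>y. f (w(e := y)) \<partial>\<rho> e)-h w) \<partial>PiM E \<rho>)" by (rule integral_norm_bound)
 also have "... <= (\<integral>w. \<delta> e \<partial>PiM E \<rho>)"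
 proof (intro integral_mono integrable_norm Bochner_Integration.integrable_diff gi hi)
 fix w assume w: "w : space (PiM E \<rho>)"
 show "cmod ((\<integral>y. f (w(e := y)) \<partial>\<rho> e)-h w) <= \<delta> e"
 proof -
 have "cmod ((\<integral>y. f ((w(e := 0))(e := y)) \<partial>\<rho> e)-(f ((w(e := 0))(e := s e)) + f ((w(e := 0))(e :=-s e)))/2) <= \<delta> e"
 by (rule ex[OF _ update_in_space(2)[OF w]]) simp
 then show ?thesis by (simp only: h_def fun_upd_upd)
 qed
 qed simp
 finally have 1: "cmod ((\<integral>w. f w \<partial>PiM (insert e E) \<rho>)-(\<integral>w. h w \<partial>PiM E \<rho>)) <= \<delta> e" by (simp add: PE.prob_space)
 have 2: "cmod ((\<integral>w. h w \<partial>PiM E \<rho>)-cavg E (%A. h (\<lambda>e\<in>E. s e * sgnset A e))) <= (\<Sum>e\<in>E. \<delta> e)"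
 by (rule insert.IH[OF hm hb hex])
 have c: "cavg E (\<lambda>A. h (\<lambda>e\<in>E. s e * sgnset A e)) = cavg (insert e E) (\<lambda>A. f (\<lambda>e\<in>insert e E. s e * sgnset A e))"
 proof -
 have "h (\<lambda>e\<in>E. s e * sgnset A e) = (1/2) *\<^sub>R (f (\<lambda>e\<in>insert e E. s e * sgnset A e) + f (\<lambda>e'\<in>insert e E. s e' * sgnset (insert e A) e'))"
 if A: "A \<subseteq> E" for A
 proof -
 have "(\<lambda>e\<in>E. s e * sgnset A e)(e := s e) = (\<lambda>e'\<in>insert e E. s e' * sgnset (insert e A) e')"
 "(\<lambda>e\<in>E. s e * sgnset A e)(e :=-s e) = (\<lambda>e\<in>insert e E. s e * sgnset A e)"
 using A insert(2) by (auto simp: fun_eq_iff sgnset_def)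
 then show ?thesis by (simp add: h_def scaleR_conv_of_real add.commute)
 qed
 then have "cavg E (\<lambda>A. h (\<lambda>e\<in>E. s e * sgnset A e)) = cavg E (\<lambda>A. (1/2) *\<^sub>R (f (\<lambda>e\<in>insert e E. s e * sgnset A e) + f (\<lambda>e'\<in>insert e E. s e' * sgnset (insert e A) e')))"
 by (rule cavg_cong)
 then show ?thesis unfolding cavg_insert[OF insert(1,2)] cavg_scaleR cavg_add .
 qed
 show ?case unfolding sum.insert[OF insert(1,2)]
 using add_mono[OF 1 2[unfolded c]] by (rule norm_diff_chain)
qed

end

lemma norm_minus_half_le: "cmod (a-(b + c)/2) <= cmod a+(cmod b + cmod c)/2"
proof -
 have "cmod ((b + c)/2) <= (cmod b + cmod c)/2" using norm_triangle_ineq[of b c] by (simp add: norm_divide)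
 then show ?thesis by (rule order_trans[OF norm_triangle_ineq4 add_left_mono])
qed

locale edge_family = real_product_family \<rho> for \<rho> :: "('i :: countable) \<times> 'i => real measure" +
 fixes I :: "'i set" and t :: "'i \<times> 'i => real"
 assumes finI: "finite I"
 and sq_int: "!!e. e : I \<times> I ==> integrable (\<rho> e) (%y. y^2)"
 and mean0: "!!e. e : I \<times> I ==> (\<integral>y. y \<partial>\<rho> e) = 0"
 and second: "!!e. e : I \<times> I ==> (\<integral>y. y^2 \<partial>\<rho> e) = t e"
begin

lemma t_nonneg: "e : I \<times> I ==> 0 <= t e"
 using second[of e] by (metis integral_nonneg_AE zero_le_power2 AE_I2)

lemma first_int: "e : I \<times> I ==> integrable (\<rho> e) (%y. y)"
proof -
 assume e: "e : I \<times> I"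
 interpret prob_space "\<rho> e" by (rule prob_rho)
 show ?thesis using square_integrable_imp_integrable[of "%y. y"] sq_int[OF e] by simp
qed

lemma trace_res_measurable:
 assumes z: "Im z > 0"
 shows "trace_res I z : borel_measurable (PiM (I \<times> I) \<rho>)"
 using measurable_trace_res[OF finI z, of "%e w. w e" "PiM (I \<times> I) \<rho>"]
 by (simp add: measurable_PiM_rho)

lemma trace_res_update:
 "trace_res I z (w(e := y)) = (\<Sum>i\<in>I. res I z (Lap I (w(e := y))) i i)" by (simp add: trace_res_def)

text \<open>The sign of scale sqrt (t e) has the same mean and variance as the entry, so the
  constant, linear and quadratic terms of the Taylor expansion cancel. The remainder of the sign
  itself is of size t e * sqrt (t e).\<close>

theorem universality:
 assumes z: "Im z > 0"
 shows "cmod ((\<integral>w. trace_res I z w \<partial>PiM (I \<times> I) \<rho>)-mean_trace I z t)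
 <= (24*(1/Im z) ^ 3+32*(1/Im z) ^ 4)*(\<Sum>e\<in>I \<times> I. (\<integral>y. min (y^2) (\<bar>y\<bar> ^ 3) \<partial>\<rho> e) + t e * sqrt (t e))"
proof -
 let ?E = "I \<times> I" and ?f = "trace_res I z"
 define C where "C = 24*(1/Im z) ^ 3+32*(1/Im z) ^ 4"
 have C: "C >= 0" using z by (simp add: C_def)
 let ?m = "%y :: real. min (y^2) (\<bar>y\<bar> ^ 3)"
 note fm = trace_res_measurable[OF z] and fb = trace_res_bound[OF finI z]
 have ex: "cmod ((\<integral>y. ?f (w(e := y)) \<partial>\<rho> e)-(?f (w(e := sqrt (t e)))+?f (w(e :=-sqrt (t e))))/2)
 <= C*((\<integral>y. ?m y \<partial>\<rho> e) + t e * sqrt (t e))" if e: "e : ?E" and w: "w : space (PiM ?E \<rho>)" for e w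
 proof -
 interpret R: prob_space "\<rho> e" by (rule prob_rho)
 obtain a b r where tay: "!!y. ?f (w(e := y)) = ?f (w(e := 0)) + of_real y * a + of_real (y^2) * b + r y"
 and rb: "!!y. cmod (r y) <= C*?m y"
 apply (rule trace_update_taylor[OF finI z e, of w])
 subgoal premises prems for a b r
 by (rule that[of a b r]; rule prems[folded trace_res_update C_def])
 done
 define F where "F = (%y. ?f (w(e := y)))"
 have Fi: "integrable (\<rho> e) F" unfolding F_def by (rule integrable_update[OF fm fb e w])
 have yi: "integrable (\<rho> e) (%y. complex_of_real y * a)" "integrable (\<rho> e) (%y. complex_of_real (y^2) * b)"
 using first_int[OF e] sq_int[OF e] by (auto intro!: integrable_mult_left integrable_of_real simp del: of_real_power)
 have r: "r = (%y. F y-F 0-of_real y * a-of_real (y^2) * b)"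
 proof
 fix y show "r y = F y-F 0-of_real y * a-of_real (y^2) * b" using tay[of y] unfolding F_def by (simp add: algebra_simps)
 qed
 have ri: "integrable (\<rho> e) r" unfolding r using Fi yi by (intro Bochner_Integration.integrable_diff) auto
 have mi: "integrable (\<rho> e) ?m"
 by (rule Bochner_Integration.integrable_bound[OF sq_int[OF e]]) (auto simp: min_def)
 have e1: "(\<integral>y. r y \<partial>\<rho> e) = (\<integral>y. F y \<partial>\<rho> e)-F 0-of_real (t e) * b"
 proof -
 show ?thesis unfolding r using Fi yi mean0[OF e] second[OF e] by (simp del: of_real_power)
 qed
 have e2: "(F (sqrt (t e))+F (- sqrt (t e)))/2 = F 0 + of_real (t e) * b+(r (sqrt (t e)) + r (- sqrt (t e)))/2"
 proof -
 have sq: "complex_of_real ((sqrt (t e))^2) = of_real (t e)" "complex_of_real ((- sqrt (t e))^2) = of_real (t e)"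
 using t_nonneg[OF e] by simp_all
 show ?thesis unfolding r sq by (simp add: field_simps)
 qed
 have "(\<integral>y. F y \<partial>\<rho> e)-(F (sqrt (t e))+F (- sqrt (t e)))/2 = (\<integral>y. r y \<partial>\<rho> e)-(r (sqrt (t e)) + r (- sqrt (t e)))/2"
 unfolding e1 e2 by (simp add: algebra_simps)
 also have "cmod ... <= cmod (\<integral>y. r y \<partial>\<rho> e)+(cmod (r (sqrt (t e))) + cmod (r (- sqrt (t e))))/2"
 by (rule norm_minus_half_le)
 also have "cmod (\<integral>y. r y \<partial>\<rho> e) <= (\<integral>y. C*?m y \<partial>\<rho> e)"
 proof -
 have "cmod (\<integral>y. r y \<partial>\<rho> e) <= (\<integral>y. cmod (r y) \<partial>\<rho> e)" by (rule integral_norm_bound)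
 also have "... <= (\<integral>y. C*?m y \<partial>\<rho> e)" using mi ri rb by (intro integral_mono) auto
 finally show ?thesis .
 qed
 also have "(\<integral>y. C*?m y \<partial>\<rho> e) = C*(\<integral>y. ?m y \<partial>\<rho> e)" by simp
 also have "(cmod (r (sqrt (t e))) + cmod (r (- sqrt (t e))))/2 <= C*(t e * sqrt (t e))"
 proof -
 have "?m (sqrt (t e)) <= t e * sqrt (t e)" "?m (- sqrt (t e)) <= t e * sqrt (t e)"
 using t_nonneg[OF e] by (auto simp: min_def power3_eq_cube)
 then have "cmod (r (sqrt (t e))) <= C*(t e * sqrt (t e))" "cmod (r (- sqrt (t e))) <= C*(t e * sqrt (t e))"
 using order_trans[OF rb mult_left_mono[OF _ C]] by blast+
 then show ?thesis by simp
 qed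
 finally show ?thesis by (simp add: F_def distrib_left)
 qed
 have "cmod ((\<integral>w. ?f w \<partial>PiM ?E \<rho>)-cavg ?E (%A. ?f (\<lambda>e\<in>?E. sqrt (t e) * sgnset A e)))
 <= (\<Sum>e\<in>?E. C*((\<integral>y. ?m y \<partial>\<rho> e) + t e * sqrt (t e)))"
 by (rule lindeberg_exchange[where K = "real (card I)*(1/Im z)"]) (use finI fm fb ex in auto)
 moreover have "cavg ?E (%A. ?f (\<lambda>e\<in>?E. sqrt (t e) * sgnset A e)) = mean_trace I z t"
 proof -
 have "?f (\<lambda>e\<in>?E. sqrt (t e) * sgnset A e) = (\<Sum>i\<in>I. res I z (Lap I (rademacher t A)) i i)" for A
 unfolding trace_res_def[symmetric] by (rule trace_res_cong) (simp add: rademacher_def)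
 then show ?thesis unfolding mean_trace_def by simp
 qed
 ultimately show ?thesis by (simp only: sum_distrib_left C_def)
qed

text \<open>One coordinate moves the trace by at most 2 (1/Im z)^2 |y|. Efron-Stein for the real and
  for the imaginary part gives twice the square of this constant, hence 8.\<close>

theorem trace_res_variance:
 assumes z: "Im z > 0"
 defines "m \<equiv> (\<integral>w. trace_res I z w \<partial>PiM (I \<times> I) \<rho>)"
 shows "(\<integral>w. (cmod (trace_res I z w-m))^2 \<partial>PiM (I \<times> I) \<rho>) <= 8*(1/Im z) ^ 4*(\<Sum>e\<in>I \<times> I. t e)"
proof -
 let ?E = "I \<times> I" and ?f = "trace_res I z"
 let ?P = "PiM ?E \<rho>"
 interpret PE: prob_space ?P by (rule prob_space_PiM[OF prob_rho])
 define K where "K = real (card I)*(1/Im z)"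
 note fm = trace_res_measurable[OF z] and fb = trace_res_bound[OF finI z, folded K_def]
 have fi: "integrable ?P ?f" by (rule integrable_PiM[OF fm fb])
 have part: "(\<integral>w. (h (?f w))^2 \<partial>?P)-(h m)^2 <= (\<Sum>e\<in>?E. (2*(1/Im z)^2)^2 * t e)"
 and int2: "integrable ?P (%w. (h (?f w))^2)" and int1: "integrable ?P (%w. h (?f w))"
 and mean: "(\<integral>w. h (?f w) \<partial>?P) = h m"
 if h: "h = Re \<or> h = Im" for h
 proof -
 have le: "\<bar>h x\<bar> <= cmod x" for x using h abs_Re_le_cmod abs_Im_le_cmod by auto
 have hd: "h x-h y = h (x-y)" for x y using h by auto
 have hm: "(%w. h (?f w)) : borel_measurable ?P" using h fm by auto
 show i1: "integrable ?P (%w. h (?f w))" using h fi by auto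
 show me: "(\<integral>w. h (?f w) \<partial>?P) = h m" using h fi by (auto simp: m_def)
 have hb: "\<bar>h (?f w)\<bar> <= K" for w using le[of "?f w"] fb[of w] by linarith
 show "integrable ?P (%w. (h (?f w))^2)"
 proof (rule integrable_PiM[where K = "K^2"])
 fix w show "norm ((h (?f w))^2) <= K^2" using power_mono[OF hb[of w], of 2] by simp
 qed (use hm in simp)
 have "(\<integral>w. (h (?f w))^2 \<partial>?P) <= (\<integral>w. h (?f w) \<partial>?P)^2+(\<Sum>e\<in>?E. (2*(1/Im z)^2)^2*(\<integral>y. y^2 \<partial>\<rho> e))"
 proof (rule efron_stein[where K = K])
 fix e w y assume e: "e : ?E"
 have "\<bar>h (?f (w(e := y)))-h (?f (w(e := 0)))\<bar> <= cmod (?f (w(e := y))-?f (w(e := 0)))" unfolding hd by (rule le)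
 also have "... <= 2*(1/Im z)^2*\<bar>y\<bar>" unfolding trace_res_update by (rule trace_update_lipschitz[OF finI z e])
 finally show "\<bar>h (?f (w(e := y)))-h (?f (w(e := 0)))\<bar> <= 2*(1/Im z)^2*\<bar>y\<bar>" .
 qed (use finI sq_int hm hb in auto)
 then show "(\<integral>w. (h (?f w))^2 \<partial>?P)-(h m)^2 <= (\<Sum>e\<in>?E. (2*(1/Im z)^2)^2 * t e)"
 unfolding me by (simp add: second cong: sum.cong)
 qed
 have exp: "(cmod (?f w-m))^2 = ((Re (?f w))^2-2*Re m*Re (?f w)+(Re m)^2)+((Im (?f w))^2-2*Im m*Im (?f w)+(Im m)^2)" for w
 by (simp add: cmod_power2 power2_diff algebra_simps)
 have "(\<integral>w. (cmod (?f w-m))^2 \<partial>?P) = ((\<integral>w. (Re (?f w))^2 \<partial>?P)-(Re m)^2)+((\<integral>w. (Im (?f w))^2 \<partial>?P)-(Im m)^2)"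
 unfolding exp using int1[of Re] int1[of Im] int2[of Re] int2[of Im] mean[of Re] mean[of Im]
 by (simp add: PE.prob_space power2_eq_square)
 also have "... <= (\<Sum>e\<in>?E. (2*(1/Im z)^2)^2 * t e)+(\<Sum>e\<in>?E. (2*(1/Im z)^2)^2 * t e)"
 by (intro add_mono part) auto
 also have "... = 8*(1/Im z) ^ 4*(\<Sum>e\<in>?E. t e)"
 unfolding sum_distrib_left[symmetric] by (simp add: power2_eq_square power4_eq_xxxx mult_ac)
 finally show ?thesis .
qed

end

text \<open>Exponential moments of the Rademacher model.  Integrating one sign by parts turns
 the trace of \<open>L ^ (2 m + 2)\<close> into sums of products of spectral moments at the vectors
 \<open>edge e\<close>, which are dominated by the spectral moment of order \<open>2 m\<close>.\<close>

definition eig_moment :: "'i set => ('i \<times> 'i => real) => nat => ('i \<times> 'i) set => real" where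
 "eig_moment I t m A = (\<Sum>k\<in>I. eigval I (Lap I (rademacher t A)) k ^ m)"

lemma cosh_converges_even: "(%m. x ^ (2 * m)/fact (2 * m)) sums cosh (x :: real)"
proof -
 have "(%m. (%n. if even n then x ^ n /\<^sub>R fact n else 0) (2 * m)) sums cosh x \<longleftrightarrow> (%n. if even n then x ^ n /\<^sub>R fact n else 0) sums cosh x"
 by (rule sums_mono_reindex) (auto simp: strict_mono_def elim!: evenE)
 then show ?thesis using cosh_converges[of x] by (simp add: divide_inverse mult.commute)
qed

text \<open>The larger of |x| and |y| dominates the product; evenness of p + q removes the absolute
  values at the end.\<close>

lemma power_prod_le:
 fixes x y :: real
 assumes "p + q = 2 * m"
 shows "x ^ p * y ^ q <= x ^ (2 * m) + y ^ (2 * m)"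
proof -
 define M where "M = max \<bar>x\<bar> \<bar>y\<bar>"
 have "x ^ p * y ^ q <= \<bar>x\<bar> ^ p*\<bar>y\<bar> ^ q" by (metis abs_ge_self abs_mult power_abs)
 also have "... <= M ^ p*M ^ q" by (intro mult_mono power_mono) (auto simp: M_def)
 also have "... = M ^ (2 * m)" by (simp add: assms power_add[symmetric])
 also have "... <= \<bar>x\<bar> ^ (2 * m)+\<bar>y\<bar> ^ (2 * m)" by (auto simp: M_def max_def)
 finally show ?thesis by (simp add: power_even_abs)
qed

context
 fixes I :: "'i set" and t :: "'i \<times> 'i => real" and D :: real
 assumes fin: "finite I"
 and t: "!!e. e : I \<times> I ==> 0 <= t e"
 and D: "!!i. i : I ==> (\<Sum>j\<in>I. t (i, j) + t (j, i)) <= D"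
begin

private abbreviation "L \<equiv> %A. Lap I (rademacher t A)"
private abbreviation "u \<equiv> %A. eigvec I (L A)"
private abbreviation "lam \<equiv> %A. eigval I (L A)"

text \<open>\<open>ov\<close> is the overlap of an edge vector with an eigenvector, and
  \<open>smom A e m\<close> is v_e^T L^m v_e, the m-th moment of the spectral measure of L at
  v_e.\<close>

private definition "ov A e k = (\<Sum>i\<in>I. edge e i * u A k i)"
private definition "smom A e m = (\<Sum>k\<in>I. (lam A k) ^ m*(ov A e k)^2)"

private lemma sp13: "spectral I (L A) (lam A) (u A)" by (rule spectral_eig[OF fin sym_on_Lap])

private lemma ov_sum: "e : I \<times> I ==> (\<Sum>k\<in>I. (ov A e k)^2) <= 2"
 using edge_norm[OF fin, of e] spectral_parseval[OF fin sp13[of A], of "edge e" "edge e"]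
 by (simp add: ov_def power2_eq_square)

private lemma moment_expand: "eig_moment I t (Suc m) A =-(\<Sum>e\<in>I \<times> I. rademacher t A e * smom A e m)"
proof -
 have lam: "lam A k = (\<Sum>i\<in>I. \<Sum>j\<in>I. u A k i*L A i j * u A k j)" if k: "k : I" for k
 proof -
 have "(\<Sum>i\<in>I. \<Sum>j\<in>I. u A k i*L A i j * u A k j) = (\<Sum>i\<in>I. u A k i*(\<Sum>j\<in>I. L A i j * u A k j))"
 by (simp add: sum_distrib_left mult.assoc)
 also have "... = (\<Sum>i\<in>I. u A k i*(lam A k * u A k i))" using sp13[of A] k by (simp add: spectral_def)
 also have "... = lam A k*(\<Sum>i\<in>I. u A k i * u A k i)" by (simp add: sum_distrib_left mult_ac)
 also have "... = lam A k" using sp13[of A] k by (simp add: spectral_def)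
 finally show ?thesis by simp
 qed
 have lam2: "lam A k =-(\<Sum>e\<in>I \<times> I. rademacher t A e*(ov A e k)^2)" if k: "k : I" for k
 proof -
 have "lam A k =-(\<Sum>i\<in>I. \<Sum>j\<in>I. \<Sum>e\<in>I \<times> I. rademacher t A e*((edge e i * u A k i)*(edge e j * u A k j)))"
 unfolding lam[OF k] by (simp add: Lap_def sum_distrib_left sum_distrib_right sum_negf mult_ac)
 also have "(\<Sum>i\<in>I. \<Sum>j\<in>I. \<Sum>e\<in>I \<times> I. rademacher t A e*((edge e i * u A k i)*(edge e j * u A k j)))
 = (\<Sum>e\<in>I \<times> I. \<Sum>i\<in>I. \<Sum>j\<in>I. rademacher t A e*((edge e i * u A k i)*(edge e j * u A k j)))"
 by (rule trans[OF sum.cong[OF refl sum.swap] sum.swap])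
 also have "... = (\<Sum>e\<in>I \<times> I. rademacher t A e*(ov A e k)^2)"
 unfolding ov_def power2_eq_square by (simp only: sum_product, simp only: sum_distrib_left)
 finally show ?thesis .
 qed
 have "eig_moment I t (Suc m) A = (\<Sum>k\<in>I. lam A k ^ m * lam A k)" by (simp add: eig_moment_def mult.commute)
 also have "... = (\<Sum>k\<in>I. lam A k ^ m *-(\<Sum>e\<in>I \<times> I. rademacher t A e*(ov A e k)^2))"
 by (intro sum.cong refl arg_cong2[where f = "(*)"] lam2)
 also have "... =-(\<Sum>k\<in>I. \<Sum>e\<in>I \<times> I. rademacher t A e*(lam A k ^ m*(ov A e k)^2))"
 by (simp add: sum_negf sum_distrib_left mult_ac)
 also have "(\<Sum>k\<in>I. \<Sum>e\<in>I \<times> I. rademacher t A e*(lam A k ^ m*(ov A e k)^2))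
 = (\<Sum>e\<in>I \<times> I. rademacher t A e * smom A e m)"
 by (subst sum.swap) (simp only: smom_def sum_distrib_left)
 finally show ?thesis .
qed

text \<open>Both moments are written in the mixed basis of eigenvectors before and after the flip.
  Eigenvalue gap times overlap is -2 y times the product of the two edge overlaps, so the difference
  of odd powers becomes a sum of mixed powers of total degree 2 m with nonnegative weights, to which
  \<open>power_prod_le\<close> applies.\<close>

private lemma smom_flip:
 assumes e: "e : I \<times> I"
 shows "- (rademacher t A e*(smom A e (Suc (2 * m))-smom (flip e A) e (Suc (2 * m))))
 <= 4*(real (2 * m)+1) * t e*(smom A e (2 * m) + smom (flip e A) e (2 * m))"
proof -
 let ?B = "flip e A"
 define y where "y = rademacher t A e"
 define q where "q = (%k l. \<Sum>i\<in>I. u A k i * u ?B l i)"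
 have y2: "y^2 = t e" using t[OF e] by (simp add: y_def rademacher_def power_mult_distrib)
 have mix: "smom A e n = (\<Sum>k\<in>I. \<Sum>l\<in>I. lam A k ^ n*(ov A e k * q k l * ov ?B e l))"
 "smom ?B e n = (\<Sum>k\<in>I. \<Sum>l\<in>I. lam ?B l ^ n*(ov A e k * q k l * ov ?B e l))" for n
 proof -
 have "(\<Sum>l\<in>I. q k l * ov ?B e l) = ov A e k" for k
 proof -
 have "(\<Sum>l\<in>I. q k l * ov ?B e l) = (\<Sum>i\<in>I. u A k i * edge e i)"
 unfolding q_def ov_def by (rule spectral_parseval[OF fin sp13])
 then show ?thesis by (simp add: ov_def mult.commute)
 qed
 then have "(\<Sum>l\<in>I. lam A k ^ n*(ov A e k * q k l * ov ?B e l)) = lam A k ^ n*(ov A e k)^2" for k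
 by (simp only: sum_distrib_left[symmetric] mult.assoc power2_eq_square)
 then show "smom A e n = (\<Sum>k\<in>I. \<Sum>l\<in>I. lam A k ^ n*(ov A e k * q k l * ov ?B e l))" by (simp add: smom_def)
 have "(\<Sum>k\<in>I. ov A e k * q k l) = ov ?B e l" for l
 proof -
 have "(\<Sum>k\<in>I. ov A e k * q k l) = (\<Sum>k\<in>I. (\<Sum>i\<in>I. edge e i * u A k i)*(\<Sum>i\<in>I. u ?B l i * u A k i))"
 unfolding q_def ov_def by (simp add: mult.commute)
 also have "... = (\<Sum>i\<in>I. edge e i * u ?B l i)" by (rule spectral_parseval[OF fin sp13])
 finally show ?thesis by (simp add: ov_def)
 qed
 then have "(\<Sum>k\<in>I. lam ?B l ^ n*(ov A e k * q k l * ov ?B e l)) = lam ?B l ^ n*(ov ?B e l)^2" for l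
 by (simp only: sum_distrib_left[symmetric] sum_distrib_right[symmetric] power2_eq_square)
 then show "smom ?B e n = (\<Sum>k\<in>I. \<Sum>l\<in>I. lam ?B l ^ n*(ov A e k * q k l * ov ?B e l))"
 by (subst sum.swap) (simp add: smom_def)
 qed
 have diff: "(lam A k-lam ?B l) * q k l =-2 * y*(ov A e k * ov ?B e l)" if kl: "k : I" "l : I" for k l
 proof -
 have d: "L A i j-L ?B i j =-2 * y*(edge e i * edge e j)" for i j
 proof -
 have "L ?B i j-L A i j = (rademacher t A e-rademacher t ?B e)*(edge e i * edge e j)"
 by (rule Lap_diff_single[OF fin e]) (simp add: rademacher_flip)
 then show ?thesis by (simp add: rademacher_flip y_def algebra_simps)
 qed
 have "(lam A k-lam ?B l) * q k l = (\<Sum>i\<in>I. \<Sum>j\<in>I. u A k i*(L A i j-L ?B i j) * u ?B l j)"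
 unfolding q_def by (rule spectral_difference[OF sp13 sp13 sym_on_Lap kl])
 also have "... = (\<Sum>i\<in>I. \<Sum>j\<in>I.-2 * y*((edge e i * u A k i)*(edge e j * u ?B l j)))"
 unfolding d by (simp add: mult_ac)
 also have "... =-2 * y*(ov A e k * ov ?B e l)"
 unfolding ov_def by (simp only: sum_product, simp only: sum_distrib_left)
 finally show ?thesis .
 qed
 let ?n = "Suc (2 * m)"
 have "smom A e ?n-smom ?B e ?n = (\<Sum>k\<in>I. \<Sum>l\<in>I. (lam A k ^ ?n-lam ?B l ^ ?n)*(ov A e k * q k l * ov ?B e l))"
 unfolding mix sum_subtractf[symmetric] left_diff_distrib ..
 also have "... = (\<Sum>k\<in>I. \<Sum>l\<in>I.-2 * y*((\<Sum>p<?n. lam A k ^ p * lam ?B l ^ (?n-Suc p))*((ov A e k)^2*(ov ?B e l)^2)))"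
 proof (intro sum.cong refl)
 fix k l assume kl: "k : I" "l : I"
 have "(lam A k ^ ?n-lam ?B l ^ ?n)*(ov A e k * q k l * ov ?B e l)
 = ((lam A k-lam ?B l) * q k l)*((\<Sum>p<?n. lam A k ^ p * lam ?B l ^ (?n-Suc p))*(ov A e k * ov ?B e l))"
 unfolding diff_power_eq_sum by (simp add: mult_ac)
 then show "(lam A k ^ ?n-lam ?B l ^ ?n)*(ov A e k * q k l * ov ?B e l)
 =-2 * y*((\<Sum>p<?n. lam A k ^ p * lam ?B l ^ (?n-Suc p))*((ov A e k)^2*(ov ?B e l)^2))"
 unfolding diff[OF kl] by (simp add: power2_eq_square mult_ac)
 qed
 also have "... =-2 * y*(\<Sum>k\<in>I. \<Sum>l\<in>I. (\<Sum>p<?n. lam A k ^ p * lam ?B l ^ (?n-Suc p))*((ov A e k)^2*(ov ?B e l)^2))"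
 by (simp only: sum_distrib_left)
 finally have "- (y*(smom A e ?n-smom ?B e ?n)) = 2 * t e*(\<Sum>k\<in>I. \<Sum>l\<in>I. (\<Sum>p<?n. lam A k ^ p * lam ?B l ^ (?n-Suc p))*((ov A e k)^2*(ov ?B e l)^2))"
 by (simp add: y2[symmetric] power2_eq_square mult_ac)
 also have "... <= 2 * t e*(\<Sum>k\<in>I. \<Sum>l\<in>I. (real ?n*(lam A k ^ (2 * m) + lam ?B l ^ (2 * m)))*((ov A e k)^2*(ov ?B e l)^2))"
 proof (intro mult_left_mono sum_mono mult_right_mono)
 fix k l
 have "(\<Sum>p<?n. lam A k ^ p * lam ?B l ^ (?n-Suc p)) <= (\<Sum>p<?n. lam A k ^ (2 * m) + lam ?B l ^ (2 * m))"
 by (intro sum_mono power_prod_le) auto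
 then show "(\<Sum>p<?n. lam A k ^ p * lam ?B l ^ (?n-Suc p)) <= real ?n*(lam A k ^ (2 * m) + lam ?B l ^ (2 * m))" by simp
 qed (use t[OF e] in auto)
 also have "(\<Sum>k\<in>I. \<Sum>l\<in>I. (real ?n*(lam A k ^ (2 * m) + lam ?B l ^ (2 * m)))*((ov A e k)^2*(ov ?B e l)^2))
 = real ?n*(smom A e (2 * m)*(\<Sum>l\<in>I. (ov ?B e l)^2)+(\<Sum>k\<in>I. (ov A e k)^2) * smom ?B e (2 * m))"
 proof -
 have "smom A e (2 * m)*(\<Sum>l\<in>I. (ov ?B e l)^2) = (\<Sum>k\<in>I. \<Sum>l\<in>I. (lam A k ^ (2 * m)*(ov A e k)^2)*(ov ?B e l)^2)"
 "(\<Sum>k\<in>I. (ov A e k)^2) * smom ?B e (2 * m) = (\<Sum>k\<in>I. \<Sum>l\<in>I. (ov A e k)^2*(lam ?B l ^ (2 * m)*(ov ?B e l)^2))"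
 unfolding smom_def by (rule sum_product)+
 then show ?thesis unfolding sum.distrib[symmetric]
 by (simp only: sum.distrib[symmetric] sum_distrib_left) (intro sum.cong refl, simp add: algebra_simps)
 qed
 finally have "- (y*(smom A e ?n-smom ?B e ?n)) <= 2 * t e*(real ?n*(smom A e (2 * m)*(\<Sum>l\<in>I. (ov ?B e l)^2)+(\<Sum>k\<in>I. (ov A e k)^2) * smom ?B e (2 * m)))" .
 also have "... <= 2 * t e*(real ?n*(smom A e (2 * m)*2+2 * smom ?B e (2 * m)))"
 proof -
 have "0 <= smom A e (2 * m)" for A unfolding smom_def by (intro sum_nonneg mult_nonneg_nonneg) auto
 then show ?thesis using t[OF e]
 by (intro mult_left_mono add_mono mult_right_mono ov_sum e) auto
 qed
 finally show ?thesis by (simp add: y_def algebra_simps)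
qed

text \<open>Summed over pairs, the terms t e * (ov A e k)^2 of one eigenvector are its Dirichlet
  energy, which is at most twice the maximal total rate at a vertex.\<close>

private lemma smom_total: "(\<Sum>e\<in>I \<times> I. t e * smom A e (2 * m)) <= 2*D * eig_moment I t (2 * m) A"
proof -
 have ov2: "(\<Sum>e\<in>I \<times> I. t e*(ov A e k)^2) <= 2*D" if k: "k : I" for k
 proof -
 have "(\<Sum>e\<in>I \<times> I. t e*(ov A e k)^2) <= (\<Sum>e\<in>I \<times> I. t e*(2*((u A k (fst e))^2+(u A k (snd e))^2)))"
 proof (intro sum_mono mult_left_mono t)
 fix e assume e: "e : I \<times> I"
 have "ov A e k = (\<Sum>i\<in>I. of_bool (fst e = i) * u A k i)-(\<Sum>i\<in>I. of_bool (snd e = i) * u A k i)"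
 by (simp add: ov_def edge_def left_diff_distrib sum_subtractf)
 also have "... = u A k (fst e)-u A k (snd e)"
 using e sum_of_bool_mult_left(1)[OF fin, of "fst e" "u A k"] sum_of_bool_mult_left(1)[OF fin, of "snd e" "u A k"] by auto
 finally show "(ov A e k)^2 <= 2*((u A k (fst e))^2+(u A k (snd e))^2)"
 using square_add_le[of "u A k (fst e)" "- u A k (snd e)"] by simp
 qed
 also have "... = (\<Sum>i\<in>I. \<Sum>j\<in>I. 2 * t (i, j)*(u A k i)^2)+(\<Sum>i\<in>I. \<Sum>j\<in>I. 2 * t (i, j)*(u A k j)^2)"
 unfolding sum.cartesian_product sum.distrib[symmetric]
 by (intro sum.cong refl) (simp add: case_prod_beta algebra_simps)
 also have "(\<Sum>i\<in>I. \<Sum>j\<in>I. 2 * t (i, j)*(u A k j)^2) = (\<Sum>i\<in>I. \<Sum>j\<in>I. 2 * t (j, i)*(u A k i)^2)" by (rule sum.swap)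
 also have "(\<Sum>i\<in>I. \<Sum>j\<in>I. 2 * t (i, j)*(u A k i)^2)+(\<Sum>i\<in>I. \<Sum>j\<in>I. 2 * t (j, i)*(u A k i)^2)
 = (\<Sum>i\<in>I. 2*(u A k i)^2*(\<Sum>j\<in>I. t (i, j) + t (j, i)))"
 unfolding sum.distrib[symmetric] sum_distrib_left by (intro sum.cong refl) (simp add: algebra_simps)
 also have "... <= (\<Sum>i\<in>I. 2*(u A k i)^2*D)" by (intro sum_mono mult_left_mono D) auto
 also have "... = 2*D*(\<Sum>i\<in>I. u A k i * u A k i)" by (simp add: sum_distrib_left power2_eq_square mult_ac)
 also have "... = 2*D" using sp13[of A] k by (simp add: spectral_def)
 finally show ?thesis .
 qed
 have "(\<Sum>e\<in>I \<times> I. t e * smom A e (2 * m)) = (\<Sum>k\<in>I. lam A k ^ (2 * m)*(\<Sum>e\<in>I \<times> I. t e*(ov A e k)^2))"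
 unfolding smom_def sum_distrib_left by (subst sum.swap) (simp only: mult_ac)
 also have "... <= (\<Sum>k\<in>I. lam A k ^ (2 * m)*(2*D))" by (intro sum_mono mult_left_mono ov2) auto
 also have "... = 2*D * eig_moment I t (2 * m) A" by (simp add: eig_moment_def sum_distrib_left mult_ac)
 finally show ?thesis .
qed

text \<open>Symmetrising over the flip absorbs the sign of the coordinate, and averaging identifies
  flipped moments with the original ones. The factor 2 m + 1 counts the mixed powers.\<close>

lemma moment_recursion:
 "cavg (I \<times> I) (eig_moment I t (2 * m+2)) <= 8*D*(real (2 * m)+1) * cavg (I \<times> I) (eig_moment I t (2 * m))"
proof -
 let ?E = "I \<times> I" and ?n = "Suc (2 * m)"
 have "cavg ?E (eig_moment I t (Suc ?n)) = (\<Sum>e\<in>?E. cavg ?E (%A.-(rademacher t A e * smom A e ?n)))"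
 unfolding cavg_sum[symmetric] by (rule cavg_cong) (simp add: moment_expand sum_negf)
 also have "... <= (\<Sum>e\<in>?E. cavg ?E (%A. 4*(real (2 * m)+1)*(t e * smom A e (2 * m))))"
 proof (rule sum_mono)
 fix e assume e: "e : ?E"
 have "cavg ?E (%A.-(rademacher t A e * smom A e ?n)) =
 (1/2) *\<^sub>R cavg ?E (%A.-(rademacher t A e * smom A e ?n) +-(rademacher t (flip e A) e * smom (flip e A) e ?n))"
 by (rule cavg_symmetrize[OF e])
 also have "... = (1/2) *\<^sub>R cavg ?E (%A.-(rademacher t A e*(smom A e ?n-smom (flip e A) e ?n)))"
 by (intro arg_cong[where f = "scaleR (1/2)"] cavg_cong) (simp add: rademacher_flip right_diff_distrib)
 also have "... <= (1/2) *\<^sub>R cavg ?E (%A. 4*(real (2 * m)+1) * t e*(smom A e (2 * m) + smom (flip e A) e (2 * m)))"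
 by (intro scaleR_left_mono cavg_mono smom_flip e) simp
 also have "... = cavg ?E (%A. 4*(real (2 * m)+1)*(t e * smom A e (2 * m)))"
 unfolding cavg_mult_left cavg_add cavg_flip[OF e, of "%A. smom A e (2 * m)"] by simp
 finally show "cavg ?E (%A.-(rademacher t A e * smom A e ?n)) <= cavg ?E (%A. 4*(real (2 * m)+1)*(t e * smom A e (2 * m)))" .
 qed
 also have "... = 4*(real (2 * m)+1) * cavg ?E (%A. \<Sum>e\<in>?E. t e * smom A e (2 * m))"
 unfolding cavg_sum cavg_mult_left sum_distrib_left ..
 also have "... <= 4*(real (2 * m)+1) * cavg ?E (%A. 2*D * eig_moment I t (2 * m) A)"
 by (intro mult_left_mono cavg_mono smom_total) simp
 also have "... = 8*D*(real (2 * m)+1) * cavg ?E (eig_moment I t (2 * m))"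
 unfolding cavg_mult_left by simp
 finally show ?thesis by simp
qed

text \<open>Gaussian growth: 8 D (2m + 1) is exactly the quotient of consecutive values of (4 D)^m
  (2m)!/m!. The factorial of m stays on the left so that only products occur.\<close>

lemma even_moment_bound:
 assumes "D >= 0"
 shows "cavg (I \<times> I) (eig_moment I t (2 * m)) * fact m <= real (card I)*(4*D) ^ m * fact (2 * m)"
proof (induction m)
 case 0
 have "finite (I \<times> I)" using fin by simp
 then show ?case by (simp add: eig_moment_def cavg_const)
next
 case (Suc m)
 let ?c = "%m. cavg (I \<times> I) (eig_moment I t (2 * m))"
 have "?c (Suc m) * fact (Suc m) <= (8*D*(real (2 * m)+1)*?c m) * fact (Suc m)"
 using moment_recursion[of m] by (intro mult_right_mono) auto
 also have "... = (8*D*(real (2 * m)+1)*(real m+1))*(?c m * fact m)" by (simp add: algebra_simps)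
 also have "... <= (8*D*(real (2 * m)+1)*(real m+1))*(real (card I)*(4*D) ^ m * fact (2 * m))"
 using Suc assms by (intro mult_left_mono) auto
 also have "... = real (card I)*(4*D) ^ Suc m * fact (2*Suc m)"
 by (simp add: algebra_simps)
 finally show ?case .
qed

theorem exponential_moment:
 assumes "D >= 0"
 shows "cavg (I \<times> I) (%A. \<Sum>k\<in>I. cosh (x * eigval I (Lap I (rademacher t A)) k)) <= real (card I) * exp (4*D * x^2)"
proof -
 let ?E = "I \<times> I"
 let ?a = "%m. x ^ (2 * m)/fact (2 * m) * cavg ?E (eig_moment I t (2 * m))"
 have "(%m. \<Sum>k\<in>I. (x * lam A k) ^ (2 * m)/fact (2 * m)) sums (\<Sum>k\<in>I. cosh (x * lam A k))" for A
 by (intro sums_sum) (rule cosh_converges_even)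
 then have s: "(%m. x ^ (2 * m)/fact (2 * m) * eig_moment I t (2 * m) A) sums (\<Sum>k\<in>I. cosh (x * lam A k))" for A
 by (simp add: eig_moment_def power_mult_distrib sum_distrib_left)
 have "(%m. cavg ?E (%A. x ^ (2 * m)/fact (2 * m) * eig_moment I t (2 * m) A)) sums cavg ?E (%A. \<Sum>k\<in>I. cosh (x * lam A k))"
 unfolding cavg_def by (intro sums_scaleR_right sums_sum s)
 then have 1: "?a sums cavg ?E (%A. \<Sum>k\<in>I. cosh (x * lam A k))" by (simp only: cavg_mult_left)
 have "(%m. (4*D * x^2) ^ m /\<^sub>R fact m) sums exp (4*D * x^2)" by (rule exp_converges)
 then have 2: "(%m. real (card I)*((4*D * x^2) ^ m/fact m)) sums (real (card I) * exp (4*D * x^2))"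
 by (intro sums_mult) (simp add: divide_inverse mult.commute)
 show ?thesis
 proof (rule sums_le[OF _ 1 2])
 fix m
 have "cavg ?E (eig_moment I t (2 * m)) <= real (card I)*(4*D) ^ m * fact (2 * m)/fact m"
 using even_moment_bound[OF assms, of m] by (simp add: pos_le_divide_eq)
 then have "x ^ (2 * m)/fact (2 * m) * cavg ?E (eig_moment I t (2 * m)) <= x ^ (2 * m)/fact (2 * m)*(real (card I)*(4*D) ^ m * fact (2 * m)/fact m)"
 by (intro mult_left_mono) auto
 also have "... = real (card I)*((4*D * x^2) ^ m/fact m)"
 by (simp add: power_mult_distrib power_mult[symmetric])
 finally show "?a m <= real (card I)*((4*D * x^2) ^ m/fact m)" .
 qed
qed

end

section \<open>Cauchy kernels as test functions\<close>

text \<open>Up to the factor pi this is the Cauchy density with location Re z and scale Im z; its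
  integral against a spectral distribution is the imaginary part of the Stieltjes transform.\<close>

definition cauchy_kernel :: "complex => real => real" where
 "cauchy_kernel z x = Im (1/(of_real x-z))"

lemma cauchy_kernel_eq: "cauchy_kernel (Complex a b) x = b/((x-a)^2 + b^2)"
 by (simp add: cauchy_kernel_def Im_divide)

lemma cauchy_profile_lipschitz:
 fixes b :: real
 assumes b: "b > 0"
 shows "\<bar>b/(u^2 + b^2)-b/(v^2 + b^2)\<bar> <= \<bar>u-v\<bar>/b^2"
proof -
 have half: "b*\<bar>u\<bar>/(u^2 + b^2) <= 1/2" for u
 proof -
 have "u^2 + b^2 > 0" using b by (simp add: sum_power2_gt_zero_iff)
 then show ?thesis using sum_squares_bound[of "\<bar>u\<bar>" b] by (simp add: divide_le_eq mult.commute)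
 qed
 have inv: "1/(v^2 + b^2) <= 1/b^2" "1/(v^2 + b^2) >= 0" for v using b by (auto intro!: frac_le)
 have pos: "u^2 + b^2 > 0" "v^2 + b^2 > 0" using b by (simp_all add: sum_power2_gt_zero_iff)
 have "b/(u^2 + b^2)-b/(v^2 + b^2) = b*(v-u)*(v + u)/((u^2 + b^2)*(v^2 + b^2))"
 using pos by (subst diff_frac_eq) (auto simp: power2_eq_square algebra_simps)
 then have "\<bar>b/(u^2 + b^2)-b/(v^2 + b^2)\<bar> = \<bar>u-v\<bar>*(b*\<bar>v + u\<bar>/((u^2 + b^2)*(v^2 + b^2)))"
 using b pos by (simp add: abs_mult abs_divide abs_minus_commute)
 also have "... <= \<bar>u-v\<bar>*(b*(\<bar>v\<bar>+\<bar>u\<bar>)/((u^2 + b^2)*(v^2 + b^2)))"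
 using b pos by (intro mult_left_mono divide_right_mono) auto
 also have "b*(\<bar>v\<bar>+\<bar>u\<bar>)/((u^2 + b^2)*(v^2 + b^2))
 = (b*\<bar>v\<bar>/(v^2 + b^2))*(1/(u^2 + b^2))+(b*\<bar>u\<bar>/(u^2 + b^2))*(1/(v^2 + b^2))"
 by (simp add: distrib_left add_divide_distrib mult.commute)
 also have "\<bar>u-v\<bar> * ... <= \<bar>u-v\<bar>*(1/2*(1/b^2)+1/2*(1/b^2))"
 using half inv b by (intro mult_left_mono add_mono mult_mono) auto
 finally show ?thesis by simp
qed

text \<open>The difference of arctangents is the integral of the kernel over a cell of length d, so
  it differs from the Riemann term at the left end by at most d times the oscillation over the
  cell.\<close>

lemma arctan_cell:
 assumes b: "b > 0" and d: "d >= 0"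
 shows "\<bar>(arctan ((a + d-x)/b)-arctan ((a-x)/b))-d*(b/((x-a)^2 + b^2))\<bar> <= d^2/b^2"
proof (cases "d = 0")
 case False
 then have d': "d > 0" using d by simp
 have deriv: "((%s. arctan ((s-x)/b)) has_real_derivative b/((x-s)^2 + b^2)) (at s)" for s
 proof -
 have pos: "(x-s)^2 + b^2 > 0" using b by (simp add: sum_power2_gt_zero_iff)
 have "((%s. arctan ((s-x)/b)) has_real_derivative inverse (1+((s-x)/b)^2)*(1/b)) (at s)"
 using b by (auto intro!: derivative_eq_intros)
 moreover have "inverse (1+((s-x)/b)^2)*(1/b) = b/((x-s)^2 + b^2)"
 proof -
 have "1+((s-x)/b)^2 = ((x-s)^2 + b^2)/b^2"
 using b by (simp add: power_divide add_divide_distrib power2_commute)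
 then show ?thesis using b by (simp add: power2_eq_square)
 qed
 ultimately show ?thesis by simp
 qed
 obtain s where s: "a < s" "s < a + d"
 "arctan ((a + d-x)/b)-arctan ((a-x)/b) = (a + d-a)*(b/((x-s)^2 + b^2))"
 using MVT2[of a "a + d" "%s. arctan ((s-x)/b)" "%s. b/((x-s)^2 + b^2)"] deriv d' by auto
 have gen: "\<bar>d * p-d * q\<bar> = d*\<bar>p-q\<bar>" for p q
 using d by (simp add: right_diff_distrib[symmetric] abs_mult del: right_diff_distrib)
 have "\<bar>(arctan ((a + d-x)/b)-arctan ((a-x)/b))-d*(b/((x-a)^2 + b^2))\<bar>
 = d*\<bar>b/((x-s)^2 + b^2)-b/((x-a)^2 + b^2)\<bar>"
 unfolding s(3) add_diff_cancel_left' by (rule gen)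
 also have "... <= d*(\<bar>(x-s)-(x-a)\<bar>/b^2)" by (intro mult_left_mono cauchy_profile_lipschitz b d)
 also have "... <= d*(d/b^2)" using s d b by (intro mult_left_mono divide_right_mono) auto
 finally show ?thesis by (simp add: power2_eq_square)
qed simp

text \<open>Mass splitting for the arctangent cells: cells at distance at least \<open>\<delta> / 2\<close> from \<open>x\<close> carry little mass
 because the truncated arctangents below telescope.\<close>

lemma arctan_cells_approx:
 fixes g :: "real => real"
 assumes b: "b > 0" and \<delta>: "\<delta> > 0" and d: "0 <= d" "d <= \<delta>/2" and G: "!!x. \<bar>g x\<bar> <= G"
 and uc: "!!x y. \<bar>x-y\<bar> < \<delta> ==> \<bar>g x-g y\<bar> <= eps" and eps: "eps >= 0"
 and supp: "g x ~= 0 ==> a 0+\<delta> <= x \<and> x+\<delta> <= a n"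
 and a: "!!j. a (Suc j) = a j + d"
 defines "K \<equiv> %j. (arctan ((a j + d-x)/b)-arctan ((a j-x)/b))/pi"
 and "\<theta> \<equiv> (pi/2-arctan (\<delta>/2/b))/pi"
 shows "\<bar>g x-(\<Sum>j<n. g (a j)*K j)\<bar> <= eps+6*G*\<theta>"
proof -
 \<comment> \<open>\<open>l\<close> grows only to the left of x - \<delta>/2 and \<open>r\<close>
   only to the right of x + \<delta>/2; the total growth of either is at most
   \<open>\<theta>\<close>.\<close>
 define l where "l = (%y. arctan (min (y-x) (- \<delta>/2)/b)/pi)"
 define r where "r = (%y. arctan (max (y-x) (\<delta>/2)/b)/pi)"
 have G0: "G >= 0" using order_trans[OF abs_ge_zero G] .
 have \<theta>0: "\<theta> >= 0" using arctan_ubound[of "\<delta>/2/b"] by (simp add: \<theta>_def)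
 have K0: "K j >= 0" for j unfolding K_def using d b by (auto simp: arctan_le_iff divide_right_mono)
 have lm: "l (a j + d)-l (a j) >= 0" and rm: "r (a j + d)-r (a j) >= 0" for j
 unfolding l_def r_def using d b by (auto simp: arctan_le_iff divide_right_mono min_def max_def)
 have cell: "\<bar>g x-g (a j)\<bar>*K j <= eps*K j+2*G*((l (a j + d)-l (a j))+(r (a j + d)-r (a j)))" for j
 proof -
 have nn: "0 <= 2*G*((l (a j + d)-l (a j))+(r (a j + d)-r (a j)))" using lm[of j] rm[of j] G0 by simp
 have nn2: "0 <= eps*K j" using eps K0 by simp
 have g2: "\<bar>g x-g (a j)\<bar> <= 2*G" using abs_triangle_ineq4[of "g x" "g (a j)"] G[of x] G[of "a j"] by linarith
 \<comment> \<open>A cell whose left end is at distance at least \<delta> from x stays at distance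
   \<delta>/2 from it, because its length is at most \<delta>/2.\<close>
 consider "\<bar>x-a j\<bar> < \<delta>" | "a j <= x-\<delta>" | "a j >= x+\<delta>" by linarith
 then show ?thesis
 proof cases
 case 1 then show ?thesis using mult_right_mono[OF uc[OF 1] K0[of j]] nn by linarith
 next
 case 2
 have "min (a j + d-x) (- \<delta>/2) = a j + d-x" "min (a j-x) (- \<delta>/2) = a j-x" using 2 d \<delta> by auto
 then have "K j = l (a j + d)-l (a j)" by (simp add: l_def K_def diff_divide_distrib)
 then have "\<bar>g x-g (a j)\<bar>*K j <= 2*G*(l (a j + d)-l (a j))" using mult_right_mono[OF g2 K0[of j]] by simp
 also have "... <= 2*G*((l (a j + d)-l (a j))+(r (a j + d)-r (a j)))" using rm G0 by (intro mult_left_mono) auto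
 finally show ?thesis using nn2 by linarith
 next
 case 3
 have "max (a j + d-x) (\<delta>/2) = a j + d-x" "max (a j-x) (\<delta>/2) = a j-x" using 3 d \<delta> by auto
 then have "K j = r (a j + d)-r (a j)" by (simp add: r_def K_def diff_divide_distrib)
 then have "\<bar>g x-g (a j)\<bar>*K j <= 2*G*(r (a j + d)-r (a j))" using mult_right_mono[OF g2 K0[of j]] by simp
 also have "... <= 2*G*((l (a j + d)-l (a j))+(r (a j + d)-r (a j)))" using lm G0 by (intro mult_left_mono) auto
 finally show ?thesis using nn2 by linarith
 qed
 qed
 have tel: "(\<Sum>j<n. f (a j + d)-f (a j)) = f (a n)-f (a 0)" for f :: "real => real"
 using sum_lessThan_telescope[of "%j. f (a j)" n] by (simp add: a)
 define T where "T = (\<Sum>j<n. K j)"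
 have T: "T = (arctan ((a n-x)/b)-arctan ((a 0-x)/b))/pi"
 unfolding T_def K_def sum_divide_distrib[symmetric] using tel[of "%y. arctan ((y-x)/b)"] by simp
 have T1: "T <= 1"
 proof -
 have "arctan ((a n-x)/b)-arctan ((a 0-x)/b) <= pi"
 using arctan_ubound[of "(a n-x)/b"] arctan_lbound[of "(a 0-x)/b"] by linarith
 then show ?thesis unfolding T by (subst pos_divide_le_eq) auto
 qed
 have neg: "- (\<delta>/2/b) = (- \<delta>/2)/b" by simp
 have ltel: "(\<Sum>j<n. l (a j + d)-l (a j)) <= \<theta>"
 proof -
 have "l (a n) <= arctan (- (\<delta>/2/b))/pi" unfolding l_def neg arctan_le_iff
 using b by (intro divide_right_mono arctan_le_iff[THEN iffD2]) auto
 moreover have "- (pi/2)/pi <= l (a 0)" unfolding l_def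
 using arctan_lbound by (intro divide_right_mono) (auto simp: less_imp_le)
 moreover have "arctan (- (\<delta>/2/b))/pi --(pi/2)/pi = \<theta>"
 unfolding \<theta>_def arctan_minus by (simp add: diff_divide_distrib)
 ultimately show ?thesis unfolding tel by linarith
 qed
 have rtel: "(\<Sum>j<n. r (a j + d)-r (a j)) <= \<theta>"
 proof -
 have "arctan (\<delta>/2/b)/pi <= r (a 0)" unfolding r_def
 using b by (intro divide_right_mono arctan_le_iff[THEN iffD2]) auto
 moreover have "r (a n) <= (pi/2)/pi" unfolding r_def
 using arctan_ubound by (intro divide_right_mono) (auto simp: less_imp_le)
 moreover have "(pi/2)/pi-arctan (\<delta>/2/b)/pi = \<theta>"
 unfolding \<theta>_def by (simp add: diff_divide_distrib)
 ultimately show ?thesis unfolding tel by linarith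
 qed
 have edge: "\<bar>g x*(1-T)\<bar> <= 2*G*\<theta>"
 proof (cases "g x = 0")
 case False
 have "arctan (\<delta>/2/b) <= arctan ((a n-x)/b)" "arctan ((a 0-x)/b) <= arctan (- (\<delta>/2/b))"
 unfolding neg arctan_le_iff using supp[OF False] \<delta> b by (intro divide_right_mono; linarith)+
 then have "(arctan (\<delta>/2/b)-arctan (- (\<delta>/2/b)))/pi <= T" unfolding T by (intro divide_right_mono) auto
 moreover have "(arctan (\<delta>/2/b)-arctan (- (\<delta>/2/b)))/pi = 1-2*\<theta>"
 unfolding \<theta>_def arctan_minus by (simp add: diff_divide_distrib)
 ultimately have "1-T <= 2*\<theta>" by linarith
 then have "\<bar>g x\<bar>*(1-T) <= G*(2*\<theta>)" using T1 G0 G[of x] by (intro mult_mono) auto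
 then show ?thesis using T1 by (simp add: abs_mult)
 qed (use G0 \<theta>0 in simp)
 have "g x-(\<Sum>j<n. g (a j)*K j) = g x*(1-T)+(\<Sum>j<n. (g x-g (a j))*K j)"
 unfolding T_def by (simp add: left_diff_distrib right_diff_distrib sum_subtractf sum_distrib_left)
 then have "\<bar>g x-(\<Sum>j<n. g (a j)*K j)\<bar> <= \<bar>g x*(1-T)\<bar>+\<bar>\<Sum>j<n. (g x-g (a j))*K j\<bar>"
 using abs_triangle_ineq by simp
 also have "\<bar>\<Sum>j<n. (g x-g (a j))*K j\<bar> <= (\<Sum>j<n. \<bar>g x-g (a j)\<bar>*K j)"
 by (rule order_trans[OF sum_abs]) (simp add: abs_mult K0)
 also have "... <= (\<Sum>j<n. eps*K j+2*G*((l (a j + d)-l (a j))+(r (a j + d)-r (a j))))"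
 by (intro sum_mono cell)
 also have "... = eps*T+2*G*((\<Sum>j<n. l (a j + d)-l (a j))+(\<Sum>j<n. r (a j + d)-r (a j)))"
 unfolding T_def sum.distrib[symmetric] sum_distrib_left by (simp add: algebra_simps)
 also have "... <= eps*1+2*G*(\<theta>+\<theta>)"
 using eps T1 G0 ltel rtel by (intro add_mono mult_left_mono) auto
 finally show ?thesis using edge by simp
qed

text \<open>The convolution of g with a narrow Cauchy density, cut into cells. Three errors share
  eps equally: the oscillation of g, the kernel mass far from x, and the replacement of cell masses
  by kernel values.\<close>

theorem cauchy_kernels_dense:
 fixes g :: "real => real"
 assumes cont: "continuous_on UNIV g" and supp: "!!x. \<bar>x\<bar> >= A ==> g x = 0" and eps: "eps > 0"
 shows "\<exists>(n :: nat) a c b. b > 0 \<and> (\<forall>x. \<bar>g x-(\<Sum>j<n. c j * cauchy_kernel (Complex (a j) b) x)\<bar> <= eps)"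
proof -
 define A' where "A' = max A 1"
 have A': "A' > 0" "!!x. \<bar>x\<bar> >= A' ==> g x = 0" using supp by (auto simp: A'_def)
 have "bounded (g ` {- A'..A'})"
 by (intro compact_imp_bounded compact_continuous_image continuous_on_subset[OF cont]) auto
 then obtain G0 where G0: "!!x. x : {- A'..A'} ==> \<bar>g x\<bar> <= G0" unfolding bounded_iff
 by (metis image_eqI real_norm_def)
 define G where "G = max G0 1"
 have G: "\<bar>g x\<bar> <= G" for x
 proof (cases "\<bar>x\<bar> <= A'")
 case True
 then have "x : {- A'..A'}" by auto
 from G0[OF this] show ?thesis unfolding G_def by linarith
 next
 case False then show ?thesis using A'(2)[of x] by (simp add: G_def)
 qed
 have G1: "G >= 1" by (simp add: G_def)
 have "uniformly_continuous_on {- A'-1..A'+1} g"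
 by (intro compact_uniformly_continuous continuous_on_subset[OF cont]) auto
 then obtain \<delta>0 where \<delta>0: "\<delta>0 > 0"
 "!!x y. x : {- A'-1..A'+1} ==> y : {- A'-1..A'+1} ==> \<bar>x-y\<bar> < \<delta>0 ==> \<bar>g x-g y\<bar> < eps/3"
 unfolding uniformly_continuous_on_def dist_real_def using eps by (metis abs_minus_commute divide_pos_pos zero_less_numeral)
 define \<delta> where "\<delta> = min \<delta>0 1"
 have \<delta>: "\<delta> > 0" "\<delta> <= 1" using \<delta>0 by (auto simp: \<delta>_def)
 have uc: "\<bar>g x-g y\<bar> <= eps/3" if xy: "\<bar>x-y\<bar> < \<delta>" for x y
 proof (cases "x : {- A'-1..A'+1} \<and> y : {- A'-1..A'+1}")
 case True then show ?thesis using \<delta>0(2)[of x y] xy by (auto simp: \<delta>_def)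
 next
 case False
 then have "\<bar>x\<bar> >= A'" "\<bar>y\<bar> >= A'" using xy \<delta> by auto
 then show ?thesis using A'(2) eps by simp
 qed
 have "((%s. (pi/2-arctan s)/pi) \<longlongrightarrow> (pi/2-pi/2)/pi) at_top"
 by (intro tendsto_intros tendsto_arctan_at_top) simp
 \<comment> \<open>The tail enters with the factor 6 G, so a tail below eps/(18 G) costs
   eps/3.\<close>
 then have ev: "\<forall>\<^sub>F s in at_top. (pi/2-arctan s)/pi < eps/(18*G)"
 using eps G1 by (intro order_tendstoD(2)[where y = "(pi/2-pi/2)/pi"]) auto
 then obtain s where s: "s > 0" "(pi/2-arctan s)/pi < eps/(18*G)"
 using eventually_happens[OF eventually_conj[OF ev eventually_gt_at_top[of 0]]] by auto
 define b where "b = \<delta>/2/s"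
 have b: "b > 0" "\<delta>/2/b = s" using \<delta> s by (auto simp: b_def)
 \<comment> \<open>One unit of room beyond the support covers the margin \<delta> <= 1. Of the lower
   bounds on n, the first makes the cells shorter than \<delta>/2 and the second makes the Riemann
   error 4 A2^2 G/(b^2 n) at most eps/3.\<close>
 define A2 where "A2 = A'+1"
 obtain n where n: "real n > 2*A2/(\<delta>/2)" "real n > 4*A2^2*G*3/(b^2 * eps)" "n > 0"
 proof -
 obtain n where "real n > max (2*A2/(\<delta>/2)) (max (4*A2^2*G*3/(b^2 * eps)) 0)" using reals_Archimedean2 by blast
 then show thesis by (intro that[of n]) auto
 qed
 define d where "d = 2*A2/real n"
 define a where "a = (%j.-A2 + real j * d)"
 have "2*A2 < real n*(\<delta>/2)" using n(1) \<delta> by (simp add: pos_divide_less_eq)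
 then have d0: "0 <= d" "d <= \<delta>/2" using n(3) A' by (auto simp: d_def A2_def pos_divide_le_eq mult.commute)
 have dn: "real n * d = 2*A2" using n by (simp add: d_def)
 have a: "a (Suc j) = a j + d" for j by (simp add: a_def algebra_simps)
 have an: "a 0 =-A2" "a n = A2" using dn by (simp_all add: a_def)
 let ?K = "%x j. (arctan ((a j + d-x)/b)-arctan ((a j-x)/b))/pi"
 have main: "\<bar>g x-(\<Sum>j<n. (g (a j) * d/pi) * cauchy_kernel (Complex (a j) b) x)\<bar> <= eps" for x
 proof -
 have "\<bar>g x-(\<Sum>j<n. g (a j)*?K x j)\<bar> <= eps/3+6*G*((pi/2-arctan (\<delta>/2/b))/pi)"
 proof (rule arctan_cells_approx[OF b(1) \<delta>(1) d0 G uc])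
 assume "g x ~= 0"
 then have "\<bar>x\<bar> < A'" using A'(2)[of x] by force
 then show "a 0+\<delta> <= x \<and> x+\<delta> <= a n" using \<delta> by (auto simp: an A2_def)
 qed (use eps a in auto)
 moreover have "6*G*((pi/2-arctan (\<delta>/2/b))/pi) <= 6*G*(eps/(18*G))"
 using s G1 unfolding b(2) by (intro mult_left_mono) auto
 moreover have "6*G*(eps/(18*G)) = eps/3" using G1 by simp
 ultimately have 1: "\<bar>g x-(\<Sum>j<n. g (a j)*?K x j)\<bar> <= 2 * eps/3" by linarith
 have "\<bar>(\<Sum>j<n. g (a j)*?K x j)-(\<Sum>j<n. (g (a j) * d/pi) * cauchy_kernel (Complex (a j) b) x)\<bar>
 <= (\<Sum>j<n. G*(d^2/b^2))"
 unfolding sum_subtractf[symmetric]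
 proof (rule order_trans[OF sum_abs sum_mono])
 fix j
 let ?X = "arctan ((a j + d-x)/b)-arctan ((a j-x)/b)" and ?Y = "d*(b/((x-a j)^2 + b^2))"
 have "g (a j)*?K x j-(g (a j) * d/pi) * cauchy_kernel (Complex (a j) b) x = g (a j)*((?X-?Y)/pi)"
 by (simp add: cauchy_kernel_eq diff_divide_distrib right_diff_distrib mult.commute mult.left_commute)
 also have "\<bar>...\<bar> <= G*(d^2/b^2)"
 unfolding abs_mult
 proof (rule mult_mono[OF G])
 have "\<bar>(?X-?Y)/pi\<bar> <= \<bar>?X-?Y\<bar>/1" unfolding abs_divide using pi_ge_two by (intro divide_left_mono) auto
 also have "... <= d^2/b^2" using arctan_cell[OF b(1) d0(1), of "a j" x] by simp
 finally show "\<bar>(?X-?Y)/pi\<bar> <= d^2/b^2" .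
 qed (use G1 in auto)
 finally show "\<bar>g (a j)*?K x j-(g (a j) * d/pi) * cauchy_kernel (Complex (a j) b) x\<bar> <= G*(d^2/b^2)" .
 qed
 also have "... = 4*A2^2*G/(b^2 * real n)"
 using n(3) by (simp add: d_def power2_eq_square mult_ac)
 also have "... <= eps/3"
 proof -
 have bn: "0 < b^2 * real n" "0 < b^2 * eps" using b n(3) eps by auto
 have "4*A2^2*G*3 < real n*(b^2 * eps)" using n(2) bn(2) by (simp add: pos_divide_less_eq)
 also have "... = 3*(eps/3*(b^2 * real n))" by simp
 finally show ?thesis unfolding pos_divide_le_eq[OF bn(1)] by linarith
 qed
 finally show ?thesis using 1 by linarith
 qed
 have "b > 0 \<and> (\<forall>x. \<bar>g x-(\<Sum>j<n. (g (a j) * d/pi) * cauchy_kernel (Complex (a j) b) x)\<bar> <= eps)"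
 using b(1) main by simp
 then show ?thesis by (intro exI)
qed

section \<open>Distributions determined by test functions or by moments\<close>

text \<open>Real and imaginary part of the characteristic function are integrals of bounded
  continuous functions.\<close>

lemma real_distribution_eqI:
 assumes M1: "real_distribution M1" and M2: "real_distribution M2"
 and eq: "!!g :: real => real. continuous_on UNIV g ==> bounded (range g) ==> (\<integral>x. g x \<partial>M1) = (\<integral>x. g x \<partial>M2)"
 shows "M1 = M2"
proof (rule Levy_uniqueness[OF M1 M2], rule ext)
 fix s
 have re_im: "char M s = Complex (\<integral>x. cos (s * x) \<partial>M) (\<integral>x. sin (s * x) \<partial>M)" if "real_distribution M" for M
 proof -
 interpret real_distribution M by fact
 have c: "char M s = (\<integral>x. cis (s * x) \<partial>M)" unfolding char_def cis_conv_exp ..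
 have "(%x. cis (s * x)) : borel_measurable borel"
 by (intro borel_measurable_continuous_onI continuous_intros)
 then have i: "integrable M (%x. cis (s * x))"
 by (intro integrable_const_bound[where B = 1]) auto
 have "Re (char M s) = (\<integral>x. Re (cis (s * x)) \<partial>M)" "Im (char M s) = (\<integral>x. Im (cis (s * x)) \<partial>M)"
 unfolding c using i by (simp_all only: integral_Re integral_Im)
 then show ?thesis by (simp add: complex_eq_iff)
 qed
 have "bounded (range (%x. cos (s * x)))" "bounded (range (%x. sin (s * x)))"
 by (auto simp: bounded_iff intro!: exI[of _ 1])
 then have "(\<integral>x. cos (s * x) \<partial>M1) = (\<integral>x. cos (s * x) \<partial>M2)" "(\<integral>x. sin (s * x) \<partial>M1) = (\<integral>x. sin (s * x) \<partial>M2)"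
 by (intro eq continuous_intros; simp)+
 then show "char M1 s = char M2 s" unfolding re_im[OF M1] re_im[OF M2] by simp
qed

lemma abs_power_le_cosh: "\<bar>s * x\<bar> ^ k/fact k <= 2 * cosh (s * x)" for s x :: real
proof -
 have "\<bar>s * x\<bar> ^ k/fact k <= exp \<bar>s * x\<bar>"
 using exp_converges[of "\<bar>s * x\<bar>"] sum_le_suminf[of "%k. \<bar>s * x\<bar> ^ k /\<^sub>R fact k" "{k}"]
 by (simp add: sums_iff divide_inverse mult.commute)
 also have "... <= 2 * cosh (s * x)" by (auto simp: cosh_def abs_if)
 finally show ?thesis .
qed

lemma sum_exp_le_cosh: "(\<Sum>k<n. \<bar>s * x\<bar> ^ k/fact k) <= 2 * cosh (s * x)" for s x :: real
proof -
 have "(\<Sum>k<n. \<bar>s * x\<bar> ^ k/fact k) <= exp \<bar>s * x\<bar>"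
 using exp_converges[of "\<bar>s * x\<bar>"] sum_le_suminf[of "%k. \<bar>s * x\<bar> ^ k /\<^sub>R fact k" "{..<n}"]
 by (simp add: sums_iff divide_inverse mult.commute)
 also have "... <= 2 * cosh (s * x)" by (auto simp: cosh_def abs_if)
 finally show ?thesis .
qed

lemma measurable_cosh [measurable]: "(%x. cosh (s * x)) : borel_measurable borel" for s :: real
 by (intro borel_measurable_continuous_onI continuous_intros)

context real_distribution
begin

lemma integrable_power_of_cosh:
 assumes "integrable M (%x. cosh x)"
 shows "integrable M (%x. x ^ k)"
proof (rule Bochner_Integration.integrable_bound)
 show "integrable M (%x. 2 * cosh x * fact k)" using assms by simp
 show "AE x in M. norm (x ^ k) <= norm (2 * cosh x * fact k)"
 proof (rule AE_I2)
 fix x :: real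
 show "norm (x ^ k) <= norm (2 * cosh x * fact k)"
 using abs_power_le_cosh[of 1 x k] by (simp add: power_abs divide_le_eq abs_mult)
 qed
qed simp

text \<open>The exponential series may be integrated term by term because the sum of its absolute
  values is dominated by 2 cosh; hence the moments determine the characteristic function on the
  whole line.\<close>

lemma char_sums_moments:
 assumes co: "!!s. integrable M (%x. cosh (s * x))"
 shows "(%k. (\<i> * of_real s) ^ k/fact k * of_real (\<integral>x. x ^ k \<partial>M)) sums char M s"
proof -
 have pk: "integrable M (%x. x ^ k)" for k using integrable_power_of_cosh co[of 1] by simp
 define f where "f = (%k x. (\<i> * of_real (s * x)) ^ k/fact k :: complex)"
 have fe: "f k x = (\<i> * of_real s) ^ k/fact k * of_real (x ^ k)" for k x
 by (simp add: f_def power_mult_distrib mult_ac)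
 have fi: "integrable M (f k)" for k unfolding fe using pk[of k] by (intro integrable_mult_right integrable_of_real)
 have fn: "norm (f k x) = \<bar>s * x\<bar> ^ k/fact k" for k x
 by (simp add: f_def norm_divide norm_power norm_mult abs_mult)
 have fs: "(%k. f k x) sums iexp (s * x)" for x
 using exp_converges[of "\<i> * of_real (s * x)"] by (simp add: f_def scaleR_conv_of_real divide_inverse mult.commute)
 have summ: "summable (%k. norm (f k x))" for x
 using exp_converges[of "\<bar>s * x\<bar>"] unfolding fn by (auto simp: sums_iff divide_inverse mult.commute)
 have summ2: "summable (%k. \<integral>x. norm (f k x) \<partial>M)"
 proof (rule summableI_nonneg_bounded)
 fix n
 have "(\<Sum>k<n. \<integral>x. norm (f k x) \<partial>M) = (\<integral>x. (\<Sum>k<n. norm (f k x)) \<partial>M)"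
 using fi by (intro Bochner_Integration.integral_sum[symmetric] integrable_norm)
 also have "... <= (\<integral>x. 2 * cosh (s * x) \<partial>M)"
 using fi co[of s] sum_exp_le_cosh unfolding fn[symmetric]
 by (intro integral_mono Bochner_Integration.integrable_sum integrable_norm) (auto simp: fn)
 finally show "(\<Sum>k<n. \<integral>x. norm (f k x) \<partial>M) <= (\<integral>x. 2 * cosh (s * x) \<partial>M)" .
 qed simp
 have "(%k. \<integral>x. f k x \<partial>M) sums (\<integral>x. (\<Sum>k. f k x) \<partial>M)"
 by (rule sums_integral[OF fi AE_I2[OF summ] summ2])
 moreover have "(\<integral>x. (\<Sum>k. f k x) \<partial>M) = char M s"
 unfolding char_def using fs by (simp add: sums_iff)
 moreover have "(\<integral>x. f k x \<partial>M) = (\<i> * of_real s) ^ k/fact k * of_real (\<integral>x. x ^ k \<partial>M)" for k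
 unfolding fe using pk[of k] by (simp del: of_real_power)
 ultimately show ?thesis by simp
qed

text \<open>With nonnegative terms sum and integral may be interchanged even if the value is
  infinite. This transfers integrability of cosh to any measure with the same moments before
  anything is known about its tails.\<close>

lemma nn_cosh_moments:
 "(\<integral>\<^sup>+x. ennreal (cosh (s * x)) \<partial>M) = (\<Sum>k. \<integral>\<^sup>+x. ennreal (s ^ (2 * k)/fact (2 * k) * x ^ (2 * k)) \<partial>M)"
proof -
 have nn: "0 <= s ^ (2 * k)/fact (2 * k) * x ^ (2 * k)" for k x by simp
 have "ennreal (cosh (s * x)) = (\<Sum>k. ennreal (s ^ (2 * k)/fact (2 * k) * x ^ (2 * k)))" for x
 proof -
 have "(%k. s ^ (2 * k)/fact (2 * k) * x ^ (2 * k)) sums cosh (s * x)"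
 using cosh_converges_even[of "s * x"] by (simp add: power_mult_distrib)
 then have "(\<Sum>k. ennreal (s ^ (2 * k)/fact (2 * k) * x ^ (2 * k))) = ennreal (cosh (s * x))"
 by (intro suminf_ennreal_eq) (rule nn)
 then show ?thesis by simp
 qed
 then show ?thesis by (simp add: nn_integral_suminf)
qed

lemma moment_determinate_of_cosh:
 assumes co: "!!s. integrable M (%x. cosh (s * x))"
 shows "moment_determinate M"
 unfolding moment_determinate_def
proof (intro conjI allI impI)
 have pk: "integrable M (%x. x ^ k)" for k using integrable_power_of_cosh co[of 1] by simp
 show "integrable M (%x. x ^ k)" for k by (rule pk)
 fix \<mu> assume m: "real_distribution \<mu>"
 and mom: "\<forall>k. integrable \<mu> (%x. x ^ k) \<and> (\<integral>x. x ^ k \<partial>\<mu>) = (\<integral>x. x ^ k \<partial>M)"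
 interpret m: real_distribution \<mu> by (rule m)
 have "(\<integral>\<^sup>+x. ennreal (s ^ (2 * k)/fact (2 * k) * x ^ (2 * k)) \<partial>\<mu>) = (\<integral>\<^sup>+x. ennreal (s ^ (2 * k)/fact (2 * k) * x ^ (2 * k)) \<partial>M)" for s k
 using mom pk[of "2 * k"] by (simp add: nn_integral_eq_integral)
 then have "(\<integral>\<^sup>+x. ennreal (cosh (s * x)) \<partial>\<mu>) = (\<integral>\<^sup>+x. ennreal (cosh (s * x)) \<partial>M)" for s
 unfolding nn_cosh_moments m.nn_cosh_moments by simp
 also have "... s = ennreal (\<integral>x. cosh (s * x) \<partial>M)" for s
 using co[of s] by (intro nn_integral_eq_integral) (auto simp: cosh_real_nonneg)
 finally have "(\<integral>\<^sup>+x. ennreal (cosh (s * x)) \<partial>\<mu>) < \<infinity>" for s by simp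
 then have co': "integrable \<mu> (%x. cosh (s * x))" for s
 by (intro integrableI_bounded) (auto simp: cosh_real_nonneg)
 show "\<mu> = M"
 proof (rule Levy_uniqueness[OF m real_distribution_axioms], rule ext)
 fix s
 show "char \<mu> s = char M s"
 using sums_unique2[OF m.char_sums_moments[OF co', of s]] char_sums_moments[OF co, of s] mom by simp
 qed
qed

end

section \<open>Mean spectral distribution of the Rademacher model\<close>

text \<open>The law of an eigenvalue whose index is drawn uniformly, together with uniform
  signs.\<close>

definition mean_esd :: "'i set => ('i \<times> 'i => real) => real measure" where
 "mean_esd I t = distr (measure_pmf (pmf_of_set (Pow (I \<times> I) \<times> I))) borel
 (%(A, k). eigval I (Lap I (rademacher t A)) k)"

lemma real_distribution_mean_esd: "real_distribution (mean_esd I t)"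
 unfolding mean_esd_def by (intro prob_space.real_distribution_distr prob_space_measure_pmf) simp

context
 fixes I :: "'i set" and t :: "'i \<times> 'i => real"
 assumes fin: "finite I" and ne: "I ~= {}"
begin

lemma integral_mean_esd:
 fixes g :: "real => real"
 assumes [measurable]: "g : borel_measurable borel"
 shows "(\<integral>x. g x \<partial>mean_esd I t) = cavg (I \<times> I) (%A. \<Sum>k\<in>I. g (eigval I (Lap I (rademacher t A)) k))/real (card I)"
proof -
 have "(\<integral>x. g x \<partial>mean_esd I t) = (\<integral>p. g (case p of (A, k) => eigval I (Lap I (rademacher t A)) k) \<partial>measure_pmf (pmf_of_set (Pow (I \<times> I) \<times> I)))"
 unfolding mean_esd_def by (rule integral_distr) auto
 also have "... = (\<Sum>p\<in>Pow (I \<times> I) \<times> I. g (case p of (A, k) => eigval I (Lap I (rademacher t A)) k))/card (Pow (I \<times> I) \<times> I)"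
 using fin ne by (intro integral_pmf_of_set) auto
 also have "(\<Sum>p\<in>Pow (I \<times> I) \<times> I. g (case p of (A, k) => eigval I (Lap I (rademacher t A)) k))
 = (\<Sum>A\<in>Pow (I \<times> I). \<Sum>k\<in>I. g (eigval I (Lap I (rademacher t A)) k))"
 by (simp add: sum.cartesian_product case_prod_beta)
 finally show ?thesis using fin by (simp add: cavg_def card_cartesian_product card_Pow)
qed

lemma integral_cauchy_kernel_mean_esd:
 "(\<integral>x. cauchy_kernel z x \<partial>mean_esd I t) = Im (mean_trace I z t)/real (card I)"
proof -
 have m: "cauchy_kernel z : borel_measurable borel" unfolding cauchy_kernel_def by measurable
 have "(\<Sum>k\<in>I. cauchy_kernel z (eigval I (Lap I (rademacher t A)) k)) = Im (\<Sum>i\<in>I. res I z (Lap I (rademacher t A)) i i)" for A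
 unfolding res_def fcalc_trace[OF fin sym_on_Lap] by (simp add: cauchy_kernel_def)
 then show ?thesis unfolding integral_mean_esd[OF m] mean_trace_def
 by (simp add: cavg_bounded_linear[OF bounded_linear_Im])
qed

lemma integrable_mean_esd:
 fixes g :: "real => real"
 assumes [measurable]: "g : borel_measurable borel"
 shows "integrable (mean_esd I t) g"
proof -
 have "set_pmf (pmf_of_set (Pow (I \<times> I) \<times> I)) = Pow (I \<times> I) \<times> I"
 using fin ne by (intro set_pmf_of_set) auto
 then show ?thesis unfolding mean_esd_def using fin
 by (subst integrable_distr_eq) (auto intro!: integrable_measure_pmf_finite)
qed

text \<open>Flipping all signs negates the matrix, and complementation preserves the uniform
  average. The chosen eigenvalues may be permuted in between, hence
  \<open>spectral_sum_unique\<close>.\<close>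

lemma mean_esd_symmetric:
 fixes g :: "real => real"
 assumes [measurable]: "g : borel_measurable borel"
 shows "(\<integral>x. g (- x) \<partial>mean_esd I t) = (\<integral>x. g x \<partial>mean_esd I t)"
proof -
 let ?E = "I \<times> I"
 have "(\<Sum>k\<in>I. g (- eigval I (Lap I (rademacher t A)) k)) = (\<Sum>k\<in>I. g (eigval I (Lap I (rademacher t (?E-A))) k))" for A
 proof -
 let ?L = "Lap I (rademacher t A)" and ?L' = "Lap I (rademacher t (?E-A))"
 have neg: "?L' i j =-?L i j" for i j
 unfolding Lap_def sum_negf[symmetric] by (intro arg_cong[where f = uminus] sum.cong refl) (auto simp: rademacher_def sgnset_def)
 have "spectral I ?L (eigval I ?L) (eigvec I ?L)" by (rule spectral_eig[OF fin sym_on_Lap])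
 then have "spectral I ?L' (%k.-eigval I ?L k) (eigvec I ?L)"
 unfolding spectral_def neg by (simp add: sum_negf)
 from spectral_sum_unique[OF fin this spectral_eig[OF fin sym_on_Lap] sym_on_Lap]
 show ?thesis .
 qed
 then have "cavg ?E (%A. \<Sum>k\<in>I. g (- eigval I (Lap I (rademacher t A)) k)) = cavg ?E (%A. \<Sum>k\<in>I. g (eigval I (Lap I (rademacher t A)) k))"
 using cavg_compl[of ?E "%A. \<Sum>k\<in>I. g (eigval I (Lap I (rademacher t A)) k)"] by simp
 then show ?thesis using integral_mean_esd[of "%x. g (- x)"] integral_mean_esd[of g] by simp
qed

lemma mean_esd_cosh_bound:
 assumes "!!e. e : I \<times> I ==> 0 <= t e" "!!i. i : I ==> (\<Sum>j\<in>I. t (i, j) + t (j, i)) <= D" "D >= 0"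
 shows "(\<integral>x. cosh (s * x) \<partial>mean_esd I t) <= exp (4*D * s^2)"
proof -
 have "card I > 0" using fin ne by (simp add: card_gt_0_iff)
 then show ?thesis using exponential_moment[OF fin assms, of s]
 unfolding integral_mean_esd[OF measurable_cosh] by (simp add: pos_divide_le_eq mult.commute)
qed

end

section \<open>From Cauchy kernels to bounded continuous functions\<close>

definition cutoff :: "real => real => real" where
 "cutoff A x = max 0 (min 1 (A+1-\<bar>x\<bar>))"

lemma cutoff_props:
 "0 <= cutoff A x" "cutoff A x <= 1" "\<bar>x\<bar> <= A ==> cutoff A x = 1" "\<bar>x\<bar> >= A+1 ==> cutoff A x = 0"
 "continuous_on UNIV (cutoff A)"
 unfolding cutoff_def by (auto intro!: continuous_intros)

lemma continuous_cauchy_kernel: "Im z > 0 ==> continuous_on UNIV (cauchy_kernel z)"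
 unfolding cauchy_kernel_def by (intro continuous_intros) (auto simp: complex_eq_iff)

lemma cauchy_kernel_bound: "Im z > 0 ==> \<bar>cauchy_kernel z x\<bar> <= 1/Im z"
 unfolding cauchy_kernel_def using order_trans[OF abs_Im_le_cmod cmod_inverse_le] by blast

definition spectral_mean :: "'i set => ('i \<times> 'i => real) => (real => real) => real" where
 "spectral_mean I y g = (\<Sum>k\<in>I. g (eigval I (Lap I y) k))/real (card I)"

lemma spectral_mean_kernel: "finite I ==> spectral_mean I y (cauchy_kernel z) = Im (trace_res I z y)/real (card I)"
 unfolding spectral_mean_def trace_res_def res_def by (subst fcalc_trace) (auto simp: cauchy_kernel_def)

lemma spectral_mean_linear:
 "spectral_mean I y (%x. g x-h x) = spectral_mean I y g-spectral_mean I y h"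
 "spectral_mean I y (%x. \<Sum>j<n. c j * f j x) = (\<Sum>j<(n :: nat). c j * spectral_mean I y (f j))"
 unfolding spectral_mean_def
 by (simp_all add: sum_subtractf diff_divide_distrib sum_distrib_left sum_divide_distrib sum.swap[of _ I])

lemma spectral_mean_abs_le:
 assumes "!!x. \<bar>g x\<bar> <= h x"
 shows "\<bar>spectral_mean I y g\<bar> <= spectral_mean I y h"
 unfolding spectral_mean_def abs_divide using assms
 by (auto intro!: divide_right_mono order_trans[OF sum_abs] sum_mono)

lemma spectral_mean_const: "finite I ==> I ~= {} ==> spectral_mean I y (%_. c) = c"
 by (simp add: spectral_mean_def card_gt_0_iff)

text \<open>Eigenvalues are picked by choice, so measurability is not immediate. It holds for Cauchy
  kernels through the resolvent trace, passes to compactly supported functions by uniform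
  approximation, and then to bounded ones by cutoffs, which are eventually 1 on a given finite
  spectrum.\<close>

lemma spectral_mean_measurable:
 fixes I :: "('i :: countable) set"
 assumes fin: "finite I" and ne: "I ~= {}" and Y: "!!e. e : I \<times> I ==> Y e : borel_measurable M"
 and g: "continuous_on UNIV g" and bdd: "bounded (range g)"
 shows "(%w. spectral_mean I (%e. Y e w) g) : borel_measurable M"
proof -
 let ?S = "%g w. spectral_mean I (%e. Y e w) g"
 have kern: "?S (cauchy_kernel z) : borel_measurable M" if "Im z > 0" for z
 unfolding spectral_mean_kernel[OF fin] using measurable_trace_res[OF fin that Y] by simp
 have cc: "?S f : borel_measurable M" if f: "continuous_on UNIV f" and supp: "!!x. \<bar>x\<bar> >= A ==> f x = 0" for f A
 proof -
 have "\<exists>h. ?S h : borel_measurable M \<and> (\<forall>x. \<bar>f x-h x\<bar> <= 1/real (Suc n))" for n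
 proof -
 obtain m :: nat and a c b where b: "b > 0" "!!x. \<bar>f x-(\<Sum>j<m. c j * cauchy_kernel (Complex (a j) b) x)\<bar> <= 1/real (Suc n)"
 using cauchy_kernels_dense[where A = A and eps = "1/real (Suc n)", OF f supp] by auto
 have "?S (%x. \<Sum>j<m. c j * cauchy_kernel (Complex (a j) b) x) : borel_measurable M"
 unfolding spectral_mean_linear using kern b(1) by (intro borel_measurable_sum borel_measurable_times) auto
 then show ?thesis using b(2) by blast
 qed
 then obtain h where h: "!!n. ?S (h n) : borel_measurable M" "!!n x. \<bar>f x-h n x\<bar> <= 1/real (Suc n)" by metis
 show ?thesis
 proof (rule borel_measurable_LIMSEQ_real[OF _ h(1)])
 fix w
 show "(%n. ?S (h n) w) \<longlonglongrightarrow> ?S f w" unfolding spectral_mean_def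
 proof (intro tendsto_divide tendsto_sum tendsto_const)
 fix k
 let ?x = "eigval I (Lap I (%e. Y e w)) k"
 have "(%n. h n ?x-f ?x) \<longlonglongrightarrow> 0"
 proof (rule Lim_null_comparison[OF _ LIMSEQ_inverse_real_of_nat])
 show "\<forall>\<^sub>F n in sequentially. norm (h n ?x-f ?x) <= inverse (real (Suc n))"
 using h(2)[of ?x] by (auto simp: abs_minus_commute inverse_eq_divide)
 qed
 then show "(%n. h n ?x) \<longlonglongrightarrow> f ?x" by (simp add: LIM_zero_iff)
 qed (use fin ne in auto)
 qed
 qed
 show ?thesis
 proof (rule borel_measurable_LIMSEQ_real[where u = "%n. ?S (%x. g x * cutoff (real n) x)"])
 show "?S (%x. g x * cutoff (real n) x) : borel_measurable M" for n
 by (rule cc[where A = "real n+1"]) (auto intro!: continuous_intros g cutoff_props)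
 fix w
 show "(%n. ?S (%x. g x * cutoff (real n) x) w) \<longlonglongrightarrow> ?S g w" unfolding spectral_mean_def
 proof (intro tendsto_divide tendsto_sum tendsto_const)
 fix k
 let ?x = "eigval I (Lap I (%e. Y e w)) k"
 obtain n0 where n0: "\<bar>?x\<bar> <= real n0" using real_arch_simple by blast
 have "\<forall>\<^sub>F n in sequentially. g ?x = g ?x * cutoff (real n) ?x"
 using eventually_ge_at_top[of n0] by eventually_elim (use n0 in \<open>simp add: cutoff_props(3)\<close>)
 then show "(%n. g ?x * cutoff (real n) ?x) \<longlonglongrightarrow> g ?x"
 by (rule Lim_transform_eventually[OF tendsto_const])
 qed (use fin ne in auto)
 qed
qed

text \<open>Tightness of the random spectra is extracted from the kernel at z = A i: the function 1
  - A * kA x = x^2/(x^2 + A^2) is at least 1/2 for |x| > A, and its spectral mean is close to its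
  integral against \<open>\<nu>\<close>, which the second moment makes small.\<close>

theorem mean_convergence_from_kernels:
 fixes I :: "nat => ('i :: countable) set" and Y :: "nat => 'i \<times> 'i => 'a => real" and P :: "nat => 'a measure"
 assumes P: "!!N. prob_space (P N)" and fin: "!!N. finite (I N)" and ne: "!!N. I N ~= {}"
 and Y: "!!N e. e : I N \<times> I N ==> Y N e : borel_measurable (P N)"
 and \<nu>: "real_distribution \<nu>" "integrable \<nu> (%x. x^2)"
 and kernel: "!!z. Im z > 0 ==>
 (%N. \<integral>w. \<bar>spectral_mean (I N) (%e. Y N e w) (cauchy_kernel z)-(\<integral>x. cauchy_kernel z x \<partial>\<nu>)\<bar> \<partial>P N) \<longlonglongrightarrow> 0"
 and g: "continuous_on UNIV g" "bounded (range g)"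
 shows "(%N. \<integral>w. \<bar>spectral_mean (I N) (%e. Y N e w) g-(\<integral>x. g x \<partial>\<nu>)\<bar> \<partial>P N) \<longlonglongrightarrow> 0"
proof -
 interpret \<nu>: real_distribution \<nu> by (rule \<nu>)
 let ?S = "%N w g. spectral_mean (I N) (%e. Y N e w) g"
 obtain G where G: "!!x. \<bar>g x\<bar> <= G" using g(2) unfolding bounded_iff by (metis rangeI real_norm_def)
 have G0: "G >= 0" using order_trans[OF abs_ge_zero G] .
 define C2 where "C2 = (\<integral>x. x^2 \<partial>\<nu>)"
 have C2: "C2 >= 0" unfolding C2_def by simp
 \<comment> \<open>\<open>C\<close> is the tail constant for the spectral means, where bounding the
   indicator by the kernel costs a factor 2; \<open>C2\<close> is the tail constant for
   \<open>\<nu>\<close>.\<close>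
 define C where "C = 2*C2"
 have C0: "C >= 0" using C2 by (simp add: C_def)
 have bint: "integrable \<nu> f" if "continuous_on UNIV f" "!!x. \<bar>f x\<bar> <= B" for f :: "real => real" and B :: real
 using that borel_measurable_continuous_onI[OF that(1)] by (intro \<nu>.integrable_const_bound[where B = B]) auto
 have Sint: "integrable (P N) (%w. ?S N w f)" if "continuous_on UNIV f" "!!x. \<bar>f x\<bar> <= B" for f :: "real => real" and B :: real and N
 proof -
 interpret prob_space "P N" by (rule P)
 have "\<bar>?S N w f\<bar> <= B" for w
 using spectral_mean_abs_le[of f "%_. B"] that(2) spectral_mean_const[OF fin ne] by metis
 moreover have "bounded (range f)" using that(2) by (auto simp: bounded_iff)
 ultimately show ?thesis
 using spectral_mean_measurable[OF fin ne Y that(1)] by (intro integrable_const_bound[where B = B]) auto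
 qed
 show ?thesis
 proof (rule LIMSEQ_I)
 fix r :: real assume r: "r > 0"
 \<comment> \<open>This level makes the tails cost at most r/4. The two approximations by kernels
   cost r/8 each and the finitely many kernel deviations less than r/4, which stays below r.\<close>
 define A where "A = sqrt (4*G*(C+C2+1)/r)+1"
 have A: "A >= 1" using r G0 C0 C2 by (simp add: A_def)
 have GA: "G*(C+C2)/A^2 <= r/4"
 proof -
 have "4*G*(C+C2+1)/r <= A^2"
 proof -
 have "sqrt (4*G*(C+C2+1)/r) <= A" by (simp add: A_def)
 then show ?thesis using real_le_lsqrt sqrt_le_D by blast
 qed
 then have "4*G*(C+C2+1) <= A^2 * r" using r by (simp add: pos_divide_le_eq)
 moreover have "4*G*(C+C2) <= 4*G*(C+C2+1)" using G0 by (intro mult_left_mono) auto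
 ultimately have "G*(C+C2) <= r/4*A^2" by (simp add: mult_ac)
 then show ?thesis using A by (subst pos_divide_le_eq) auto
 qed
 define g1 where "g1 = (%x. g x * cutoff A x)"
 have g1c: "continuous_on UNIV g1" unfolding g1_def by (intro continuous_intros g cutoff_props)
 have g1b: "\<bar>g1 x\<bar> <= G" for x
 unfolding g1_def abs_mult using G[of x] cutoff_props(1,2)[of A x] G0 mult_mono[of "\<bar>g x\<bar>" G "\<bar>cutoff A x\<bar>" 1] by simp
 define kA where "kA = cauchy_kernel (Complex 0 A)"
 have kA: "A * kA x = A^2/(x^2+A^2)" for x
 using A by (simp add: kA_def cauchy_kernel_def inverse_eq_divide[symmetric] power2_eq_square divide_inverse)
 have pos: "x^2+A^2 > 0" for x using A by (simp add: add_nonneg_pos)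
 have kA1: "1-A * kA x = x^2/(x^2+A^2)" for x
 proof -
 have "x^2/(x^2+A^2)+A^2/(x^2+A^2) = 1" unfolding add_divide_distrib[symmetric] by (rule divide_self[OF less_imp_neq[OF pos, symmetric]])
 then show ?thesis unfolding kA by linarith
 qed
 have far: "\<bar>g x-g1 x\<bar> <= G * of_bool (\<bar>x\<bar> > A)" for x
 proof (cases "\<bar>x\<bar> <= A")
 case False
 have "\<bar>g x-g1 x\<bar> = \<bar>g x\<bar>*(1-cutoff A x)"
 unfolding g1_def using cutoff_props(2)[of A x] by (metis abs_mult abs_of_nonneg diff_ge_0_iff_ge mult.right_neutral right_diff_distrib)
 also have "... <= G*1" using G cutoff_props(1,2)[of A x] G0 by (intro mult_mono) auto
 finally show ?thesis using False by simp
 qed (simp add: g1_def cutoff_props(3))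
 have ind: "of_bool (\<bar>x\<bar> > A) <= 2*(x^2/(x^2+A^2))" "of_bool (\<bar>x\<bar> > A) <= x^2/A^2" for x
 proof -
 have "A^2 <= x^2" if "\<bar>x\<bar> > A" using power_mono[of A "\<bar>x\<bar>" 2] that A by simp
 then show "of_bool (\<bar>x\<bar> > A) <= 2*(x^2/(x^2+A^2))" "of_bool (\<bar>x\<bar> > A) <= x^2/A^2"
 using pos[of x] A by (auto simp: pos_le_divide_eq)
 qed
 have tail: "\<bar>g x-g1 x\<bar> <= 2*G*(1-A * kA x)" for x
 using order_trans[OF far mult_left_mono[OF ind(1) G0]] unfolding kA1 by (simp only: mult_ac)
 have tail0: "\<bar>g x-g1 x\<bar> <= G/A^2 * x^2" for x
 using order_trans[OF far mult_left_mono[OF ind(2) G0]] by simp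
 have tail2: "1-A * kA x <= x^2/A^2" for x
 unfolding kA1 using A pos[of x] by (intro divide_left_mono) auto
 obtain m :: nat and a c b where b: "b > 0"
 "!!x. \<bar>g1 x-(\<Sum>j<m. c j * cauchy_kernel (Complex (a j) b) x)\<bar> <= r/8"
 using cauchy_kernels_dense[OF g1c, of "A+1" "r/8"] r by (auto simp: g1_def cutoff_props(4))
 \<comment> \<open>Index m is reserved for the truncation kernel, with the weight 2 G A from the
   tail estimate.\<close>
 define k where "k = (%j. if j < m then cauchy_kernel (Complex (a j) b) else kA)"
 define c' where "c' = (%j. if j < m then c j else 2*G*A)"
 have kc: "continuous_on UNIV (k j)" for j
 unfolding k_def kA_def using b(1) A by (auto intro!: continuous_cauchy_kernel)
 have kb: "\<bar>k j x\<bar> <= 1/b+1/A" for j x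
 proof -
 have "0 <= 1/b" "0 <= 1/A" using b(1) A by auto
 then show ?thesis unfolding k_def kA_def
 using b(1) A cauchy_kernel_bound[of "Complex (a j) b" x] cauchy_kernel_bound[of "Complex 0 A" x] by auto
 qed
 define h where "h = (%x. \<Sum>j<m. c j * k j x)"
 have hb: "\<bar>g1 x-h x\<bar> <= r/8" for x using b(2)[of x] by (simp add: h_def k_def)
 have hc: "continuous_on UNIV h" unfolding h_def by (intro continuous_intros kc)
 have hB: "\<bar>h x\<bar> <= G + r/8" for x using hb[of x] g1b[of x] by linarith
 have ki: "integrable \<nu> (k j)" for j by (rule bint[OF kc kb])
 have ci: "continuous_on UNIV kA" "\<bar>kA x\<bar> <= 1/A" for x
 unfolding kA_def using A by (auto intro!: continuous_cauchy_kernel order_trans[OF cauchy_kernel_bound])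
 have iA: "integrable \<nu> kA" by (rule bint[OF ci])
 have nuA: "1-A*(\<integral>x. kA x \<partial>\<nu>) <= C2/A^2"
 proof -
 have "1-A*(\<integral>x. kA x \<partial>\<nu>) = (\<integral>x. 1-A * kA x \<partial>\<nu>)" using iA \<nu>.prob_space by simp
 also have "... <= (\<integral>x. x^2/A^2 \<partial>\<nu>)" using iA \<nu>(2) tail2 by (intro integral_mono) auto
 also have "... = C2/A^2" by (simp add: C2_def)
 finally show ?thesis .
 qed
 have pw: "\<bar>?S N w g-(\<integral>x. g x \<partial>\<nu>)\<bar> <= (G/A^2*C+(G/A^2*C2 + r/4))
 +(\<Sum>j<Suc m. \<bar>c' j\<bar>*\<bar>?S N w (k j)-(\<integral>x. k j x \<partial>\<nu>)\<bar>)" for N w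
 proof -
 have 1: "\<bar>?S N w g-?S N w g1\<bar> <= G/A^2*C+2*G*A*\<bar>?S N w kA-(\<integral>x. kA x \<partial>\<nu>)\<bar>"
 proof -
 have "\<bar>?S N w (%x. g x-g1 x)\<bar> <= ?S N w (%x. 2*G*(1-A * kA x))" by (rule spectral_mean_abs_le[OF tail])
 also have "... = 2*G*(1-A*?S N w kA)"
 proof -
 have "?S N w (%x. 2*G*(1-A * kA x)) = 2*G*?S N w (%x. 1-A * kA x)" by (simp add: spectral_mean_def sum_distrib_left)
 also have "?S N w (%x. 1-A * kA x) = ?S N w (%x. 1)-?S N w (%x. A * kA x)" by (rule spectral_mean_linear)
 also have "?S N w (%x. A * kA x) = A*?S N w kA" by (simp add: spectral_mean_def sum_distrib_left)
 finally show ?thesis by (simp only: spectral_mean_const[OF fin ne])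
 qed
 also have "... <= 2*G*(C2/A^2+A*\<bar>?S N w kA-(\<integral>x. kA x \<partial>\<nu>)\<bar>)"
 proof (rule mult_left_mono)
 have "A*((\<integral>x. kA x \<partial>\<nu>)-?S N w kA) <= A*\<bar>?S N w kA-(\<integral>x. kA x \<partial>\<nu>)\<bar>" using A by (intro mult_left_mono) auto
 then show "1-A*?S N w kA <= C2/A^2+A*\<bar>?S N w kA-(\<integral>x. kA x \<partial>\<nu>)\<bar>" using nuA by (simp add: right_diff_distrib)
 qed (use G0 in simp)
 finally show ?thesis by (simp add: spectral_mean_linear C_def algebra_simps)
 qed
 have 2: "\<bar>?S N w g1-?S N w h\<bar> <= r/8"
 proof -
 have "\<bar>?S N w (%x. g1 x-h x)\<bar> <= ?S N w (%x. r/8)" by (rule spectral_mean_abs_le[OF hb])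
 then show ?thesis by (simp only: spectral_mean_linear spectral_mean_const[OF fin ne])
 qed
 have 3: "\<bar>?S N w h-(\<integral>x. h x \<partial>\<nu>)\<bar> <= (\<Sum>j<m. \<bar>c j\<bar>*\<bar>?S N w (k j)-(\<integral>x. k j x \<partial>\<nu>)\<bar>)"
 proof -
 have "?S N w h-(\<integral>x. h x \<partial>\<nu>) = (\<Sum>j<m. c j*(?S N w (k j)-(\<integral>x. k j x \<partial>\<nu>)))"
 unfolding h_def spectral_mean_linear using ki by (simp add: right_diff_distrib sum_subtractf)
 then show ?thesis by (metis (no_types, lifting) abs_mult sum.cong sum_abs)
 qed
 have 4: "\<bar>(\<integral>x. h x \<partial>\<nu>)-(\<integral>x. g1 x \<partial>\<nu>)\<bar> <= r/8"
 proof -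
 have "(\<integral>x. h x \<partial>\<nu>)-(\<integral>x. g1 x \<partial>\<nu>) = (\<integral>x. h x-g1 x \<partial>\<nu>)"
 by (rule Bochner_Integration.integral_diff[symmetric, OF bint[OF hc hB] bint[OF g1c g1b]])
 also have "\<bar>...\<bar> <= (\<integral>x. \<bar>h x-g1 x\<bar> \<partial>\<nu>)" by (rule integral_abs_bound)
 also have "... <= (\<integral>x. r/8 \<partial>\<nu>)"
 using hb by (intro integral_mono integrable_abs Bochner_Integration.integrable_diff bint[OF hc hB] bint[OF g1c g1b])
 (auto simp: abs_minus_commute)
 also have "... = r/8" using \<nu>.prob_space by simp
 finally show ?thesis .
 qed
 have 5: "\<bar>(\<integral>x. g1 x \<partial>\<nu>)-(\<integral>x. g x \<partial>\<nu>)\<bar> <= G/A^2*C2"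
 proof -
 have "(\<integral>x. g1 x \<partial>\<nu>)-(\<integral>x. g x \<partial>\<nu>) = (\<integral>x. g1 x-g x \<partial>\<nu>)"
 by (rule Bochner_Integration.integral_diff[symmetric, OF bint[OF g1c g1b] bint[OF g(1) G]])
 also have "\<bar>...\<bar> <= (\<integral>x. \<bar>g1 x-g x\<bar> \<partial>\<nu>)" by (rule integral_abs_bound)
 also have "... <= (\<integral>x. G/A^2 * x^2 \<partial>\<nu>)"
 using tail0 \<nu>(2) by (intro integral_mono integrable_abs Bochner_Integration.integrable_diff bint[OF g1c g1b] bint[OF g(1) G] integrable_mult_right)
 (auto simp: abs_minus_commute)
 also have "... = G/A^2*C2" unfolding C2_def by (rule integral_mult_right_zero)
 finally show ?thesis .
 qed
 have "(\<Sum>j<Suc m. \<bar>c' j\<bar>*\<bar>?S N w (k j)-(\<integral>x. k j x \<partial>\<nu>)\<bar>)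
 = (\<Sum>j<m. \<bar>c j\<bar>*\<bar>?S N w (k j)-(\<integral>x. k j x \<partial>\<nu>)\<bar>)+2*G*A*\<bar>?S N w kA-(\<integral>x. kA x \<partial>\<nu>)\<bar>"
 using G0 A by (simp add: c'_def k_def)
 with 1 2 3 4 5 show ?thesis unfolding abs_le_iff by linarith
 qed
 have ks: "(%N. \<Sum>j<Suc m. \<bar>c' j\<bar>*(\<integral>w. \<bar>?S N w (k j)-(\<integral>x. k j x \<partial>\<nu>)\<bar> \<partial>P N)) \<longlonglongrightarrow> (\<Sum>j<Suc m. \<bar>c' j\<bar>*0)"
 proof (intro tendsto_sum tendsto_mult tendsto_const)
 fix j
 show "(%N. \<integral>w. \<bar>?S N w (k j)-(\<integral>x. k j x \<partial>\<nu>)\<bar> \<partial>P N) \<longlonglongrightarrow> 0"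
 using kernel[of "Complex (a j) b"] kernel[of "Complex 0 A"] b(1) A by (cases "j < m") (simp_all add: k_def kA_def)
 qed
 then have "\<forall>\<^sub>F N in sequentially. (\<Sum>j<Suc m. \<bar>c' j\<bar>*(\<integral>w. \<bar>?S N w (k j)-(\<integral>x. k j x \<partial>\<nu>)\<bar> \<partial>P N)) < r/4"
 using r by (intro order_tendstoD(2)[OF ks]) auto
 then obtain N0 where N0: "!!N. N >= N0 ==> (\<Sum>j<Suc m. \<bar>c' j\<bar>*(\<integral>w. \<bar>?S N w (k j)-(\<integral>x. k j x \<partial>\<nu>)\<bar> \<partial>P N)) < r/4"
 unfolding eventually_sequentially by blast
 show "\<exists>no. \<forall>N\<ge>no. norm ((\<integral>w. \<bar>?S N w g-(\<integral>x. g x \<partial>\<nu>)\<bar> \<partial>P N)-0) < r"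
 proof (intro exI allI impI)
 fix N assume N: "N >= N0"
 interpret PN: prob_space "P N" by (rule P)
 have ik: "integrable (P N) (%w. \<bar>?S N w (k j)-(\<integral>x. k j x \<partial>\<nu>)\<bar>)" for j
 by (intro integrable_abs Bochner_Integration.integrable_diff Sint[OF kc kb] PN.integrable_const)
 have i3: "integrable (P N) (%w. \<Sum>j<Suc m. \<bar>c' j\<bar>*\<bar>?S N w (k j)-(\<integral>x. k j x \<partial>\<nu>)\<bar>)"
 by (intro Bochner_Integration.integrable_sum integrable_mult_right ik)
 have "(\<integral>w. \<bar>?S N w g-(\<integral>x. g x \<partial>\<nu>)\<bar> \<partial>P N) \<le>
 (\<integral>w. (G/A^2*C+(G/A^2*C2 + r/4))+(\<Sum>j<Suc m. \<bar>c' j\<bar>*\<bar>?S N w (k j)-(\<integral>x. k j x \<partial>\<nu>)\<bar>) \<partial>P N)"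
 using pw[of N]
 by (intro integral_mono Bochner_Integration.integrable_add i3 PN.integrable_const integrable_abs
 Bochner_Integration.integrable_diff Sint[OF g(1) G]) (simp add: add.assoc)
 also have "... = (G/A^2*C+(G/A^2*C2 + r/4))
 +(\<Sum>j<Suc m. \<bar>c' j\<bar>*(\<integral>w. \<bar>?S N w (k j)-(\<integral>x. k j x \<partial>\<nu>)\<bar> \<partial>P N))"
 unfolding Bochner_Integration.integral_add[OF PN.integrable_const i3] Bochner_Integration.integral_sum[OF integrable_mult_right[OF ik]]
 by (simp add: PN.prob_space)
 also have "... < (G/A^2*C+(G/A^2*C2 + r/4)) + r/4" using N0[OF N] by linarith
 also have "... <= r"
 proof -
 have "G/A^2*C+G/A^2*C2 = G*(C+C2)/A^2" by (simp add: add_divide_distrib distrib_left)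
 then show ?thesis using GA r by linarith
 qed
 finally show "norm ((\<integral>w. \<bar>?S N w g-(\<integral>x. g x \<partial>\<nu>)\<bar> \<partial>P N)-0) < r" by simp
 qed
 qed
qed

lemma abs_min_le: "0 <= a ==> 0 < K ==> \<bar>min a K\<bar> <= (K :: real)"
 by (auto simp: min_def)

text \<open>Weak limits only see bounded test functions; monotone convergence removes the truncation
  afterwards.\<close>

lemma (in real_distribution) cosh_bound_of_truncations:
 fixes s B :: real
 assumes B: "!!K. K > 0 ==> (\<integral>x. min (cosh (s * x)) K \<partial>M) <= B"
 shows "integrable M (%x. cosh (s * x))" "(\<integral>x. cosh (s * x) \<partial>M) <= B"
proof -
 have minint: "integrable M (%x. min (cosh (s * x)) (real (Suc n)))" for n
 by (rule integrable_const_bound[where B = "real (Suc n)"]) (auto simp: cosh_real_nonneg min_def)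
 have B0: "B >= 0"
 proof -
 have "0 <= (\<integral>x. min (cosh (s * x)) 1 \<partial>M)" by (intro integral_nonneg_AE AE_I2) (simp add: cosh_real_nonneg)
 then show ?thesis using B[of 1] by linarith
 qed
 have "(\<integral>\<^sup>+x. ennreal (cosh (s * x)) \<partial>M) = (\<integral>\<^sup>+x. (SUP n. ennreal (min (cosh (s * x)) (real (Suc n)))) \<partial>M)"
 proof (rule nn_integral_cong)
 fix x
 obtain n0 where n0: "cosh (s * x) <= real n0" using real_arch_simple by blast
 show "ennreal (cosh (s * x)) = (SUP n. ennreal (min (cosh (s * x)) (real (Suc n))))"
 proof (rule antisym)
 have "ennreal (cosh (s * x)) = ennreal (min (cosh (s * x)) (real (Suc n0)))" using n0 by (simp add: min_def)
 also have "... <= (SUP n. ennreal (min (cosh (s * x)) (real (Suc n))))" by (rule SUP_upper) simp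
 finally show "ennreal (cosh (s * x)) <= (SUP n. ennreal (min (cosh (s * x)) (real (Suc n))))" .
 qed (auto intro!: SUP_least ennreal_leI)
 qed
 also have "... = (SUP n. \<integral>\<^sup>+x. ennreal (min (cosh (s * x)) (real (Suc n))) \<partial>M)"
 by (rule nn_integral_monotone_convergence_SUP) (auto simp: incseq_def le_fun_def intro!: ennreal_leI)
 also have "... <= ennreal B"
 proof (rule SUP_least)
 fix n
 have "(\<integral>\<^sup>+x. ennreal (min (cosh (s * x)) (real (Suc n))) \<partial>M) = ennreal (\<integral>x. min (cosh (s * x)) (real (Suc n)) \<partial>M)"
 by (rule nn_integral_eq_integral[OF minint]) (simp add: cosh_real_nonneg)
 then show "(\<integral>\<^sup>+x. ennreal (min (cosh (s * x)) (real (Suc n))) \<partial>M) <= ennreal B" using B[of "real (Suc n)"] by (simp add: ennreal_leI)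
 qed
 finally have le: "(\<integral>\<^sup>+x. ennreal (cosh (s * x)) \<partial>M) <= ennreal B" .
 show i: "integrable M (%x. cosh (s * x))"
 proof (rule integrableI_bounded)
 show "(\<integral>\<^sup>+x. ennreal (norm (cosh (s * x))) \<partial>M) < \<infinity>"
 using le_less_trans[OF le ennreal_less_top] by (simp add: cosh_real_nonneg)
 qed simp
 have "ennreal (\<integral>x. cosh (s * x) \<partial>M) = (\<integral>\<^sup>+x. ennreal (cosh (s * x)) \<partial>M)"
 by (rule nn_integral_eq_integral[symmetric, OF i]) (simp add: cosh_real_nonneg)
 then have "ennreal (\<integral>x. cosh (s * x) \<partial>M) <= ennreal B" using le by metis
 then show "(\<integral>x. cosh (s * x) \<partial>M) <= B" using B0 by (simp only: ennreal_le_iff)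
qed

section \<open>Limit points of the mean spectral distributions\<close>

locale profile_sequence =
 fixes t :: "nat => nat \<times> nat => real"
 assumes t_nonneg: "!!N e. e : {1..N} \<times> {1..N} ==> 0 <= t N e"
 and t_rows: "!!N i. i : {1..N} ==> (\<Sum>j\<in>{1..N}. t N (i, j) + t N (j, i)) <= 1"
begin

text \<open>Shifted by one so that the vertex set is never empty.\<close>

definition "mu n = mean_esd {1..Suc n} (t (Suc n))"

lemma mu_cosh:
 fixes s :: real and n :: nat
 shows "(\<integral>x. cosh (s * x) \<partial>mu n) <= exp (4 * s^2)"
proof -
 have "(\<integral>x. cosh (s * x) \<partial>mean_esd {1..Suc n} (t (Suc n))) <= exp (4*1 * s^2)"
 by (rule mean_esd_cosh_bound) (use t_nonneg t_rows[of _ "Suc n"] in auto)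
 then show ?thesis by (simp add: mu_def)
qed

lemma real_distribution_mu: "real_distribution (mu n)"
 unfolding mu_def by (rule real_distribution_mean_esd)

lemma integrable_mu:
 fixes g :: "real => real"
 shows "g : borel_measurable borel ==> integrable (mu n) g"
 unfolding mu_def by (rule integrable_mean_esd) auto

lemma tight_mu: "tight mu"
 unfolding tight_def
proof (intro conjI allI impI real_distribution_mu)
 fix eps :: real assume eps: "eps > 0"
 define K where "K = max 1 (exp 4/(eps/2))"
 obtain a where a: "a > 0" "cosh a >= K"
 proof -
 have "exp (ln (2*K)) <= 2 * cosh (ln (2*K))" unfolding cosh_def by simp
 moreover have K: "K >= 1" by (simp add: K_def)
 ultimately have "cosh (ln (2*K)) >= K" by simp
 then show thesis using K by (intro that[of "ln (2*K)"]) auto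
 qed
 show "\<exists>a b. a < b \<and> (\<forall>n. measure (mu n) {a<..b} > 1-eps)"
 proof (rule exI[of _ "- a"], rule exI[of _ a], intro conjI allI)
 fix n
 interpret real_distribution "mu n" by (rule real_distribution_mu)
 have "prob {x : space (mu n). cosh ((1::real) * x) >= K} <= (\<integral>x. cosh ((1::real) * x) \<partial>mu n)/K"
 by (rule integral_Markov_inequality_measure[where A = "{}"])
 (auto intro!: integrable_mu simp: cosh_real_nonneg K_def measurable_cosh[of 1, simplified])
 also have "... <= exp 4/K" using mu_cosh[where s = 1 and n = n] by (intro divide_right_mono) (auto simp: K_def)
 also have "... <= eps/2"
 proof -
 have "exp 4/(eps/2) <= K" "K > 0" by (auto simp: K_def)
 then show ?thesis using eps by (simp add: pos_divide_le_eq mult.commute)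
 qed
 finally have p: "prob {x : space (mu n). cosh x >= K} <= eps/2" by simp
 have "space (mu n) - {x : space (mu n). cosh x >= K} \<subseteq> {- a<..a}"
 proof
 fix x assume "x : space (mu n) - {x : space (mu n). cosh x >= K}"
 then have "cosh \<bar>x\<bar> < cosh a" using a by (auto simp: abs_if)
 then have "\<bar>x\<bar> < a" using a by (metis abs_ge_zero cosh_real_nonneg_le_iff less_imp_le not_le)
 then show "x : {- a<..a}" by auto
 qed
 then have "prob (space (mu n) - {x : space (mu n). cosh x >= K}) <= prob {- a<..a}"
 by (intro finite_measure_mono) auto
 moreover have "prob (space (mu n) - {x : space (mu n). cosh x >= K}) = 1-prob {x : space (mu n). cosh x >= K}"
 using measurable_cosh[of 1] by (intro prob_compl) simp
 ultimately show "measure (mu n) {- a<..a} > 1-eps" using p eps by simp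
 qed (use a in auto)
qed

text \<open>Only a subsequence converges at this stage. Its limit inherits the bound exp (4 s^2) on
  all cosh integrals, which yields determinacy by moments; the full sequence is handled later
  through the kernels.\<close>

theorem limit_exists:
 obtains \<nu> and r :: "nat => nat" where "real_distribution \<nu>" "strict_mono r" "symmetric_measure \<nu>"
 "!!s. integrable \<nu> (%x. cosh (s * x))" "moment_determinate \<nu>"
 "!!g :: real => real. continuous_on UNIV g ==> bounded (range g) ==> (%n. \<integral>x. g x \<partial>mu (r n)) \<longlonglongrightarrow> (\<integral>x. g x \<partial>\<nu>)"
proof -
 obtain r \<nu> where r: "strict_mono r" and \<nu>: "real_distribution \<nu>" and wc: "weak_conv_m (mu \<circ> id \<circ> r) \<nu>"
 using tight_imp_convergent_subsubsequence[OF tight_mu strict_mono_id] by blast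
 interpret \<nu>: real_distribution \<nu> by (rule \<nu>)
 have conv: "(%n. \<integral>x. g x \<partial>mu (r n)) \<longlonglongrightarrow> (\<integral>x. g x \<partial>\<nu>)"
 if g: "continuous_on UNIV g" "bounded (range g)" for g :: "real => real"
 proof -
 obtain G where "!!x. norm (g x) <= G" using g(2) unfolding bounded_iff by (metis rangeI)
 then show ?thesis
 using weak_conv_imp_integral_bdd_continuous_conv[of "%n. mu (r n)" \<nu> g G] wc g(1) \<nu> real_distribution_mu
 by (simp add: o_def continuous_on_eq_continuous_at)
 qed
 have bmin: "bounded (range (%x. min (cosh (s * x)) K))" "continuous_on UNIV (%x. min (cosh (s * x)) K)" if "K > 0" for s K :: real
 using that by (auto simp: bounded_iff cosh_real_nonneg abs_min_le intro!: exI[of _ K] continuous_intros)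
 have tr: "(\<integral>x. min (cosh (s * x)) K \<partial>\<nu>) <= exp (4 * s^2)" if K: "K > 0" for s K
 proof (rule LIMSEQ_le_const2[OF conv[OF bmin(2,1)[OF K]]], intro exI allI impI)
 fix n
 have "(\<integral>x. min (cosh (s * x)) K \<partial>mu (r n)) <= (\<integral>x. cosh (s * x) \<partial>mu (r n))"
 by (intro integral_mono integrable_mu) auto
 also have "... <= exp (4 * s^2)" by (rule mu_cosh)
 finally show "(\<integral>x. min (cosh (s * x)) K \<partial>mu (r n)) <= exp (4 * s^2)" .
 qed
 have co: "integrable \<nu> (%x. cosh (s * x))" for s by (rule \<nu>.cosh_bound_of_truncations[OF tr])
 have "symmetric_measure \<nu>" unfolding symmetric_measure_def
 proof (rule real_distribution_eqI)
 show "real_distribution (distr \<nu> borel uminus)" by (rule \<nu>.real_distribution_distr) simp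
 fix g :: "real => real" assume g: "continuous_on UNIV g" "bounded (range g)"
 have gm: "g : borel_measurable borel" by (rule borel_measurable_continuous_onI[OF g(1)])
 have g': "continuous_on UNIV (%x. g (- x))" "bounded (range (%x. g (- x)))"
 by (auto intro!: continuous_on_compose2[OF g(1)] continuous_intros bounded_subset[OF g(2)])
 have "(\<integral>x. g (- x) \<partial>mu n) = (\<integral>x. g x \<partial>mu n)" for n
 unfolding mu_def by (rule mean_esd_symmetric[OF _ _ gm]) auto
 then have "(\<integral>x. g (- x) \<partial>\<nu>) = (\<integral>x. g x \<partial>\<nu>)" using conv[OF g'] conv[OF g] by (simp add: LIMSEQ_unique)
 moreover have "(\<integral>x. g x \<partial>distr \<nu> borel uminus) = (\<integral>x. g (- x) \<partial>\<nu>)"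
 using gm by (intro integral_distr) auto
 ultimately show "(\<integral>x. g x \<partial>distr \<nu> borel uminus) = (\<integral>x. g x \<partial>\<nu>)" by simp
 qed (rule \<nu>)
 then show thesis using that[OF \<nu> r _ co \<nu>.moment_determinate_of_cosh[OF co] conv] by blast
qed

end

section \<open>Unbounded support\<close>

text \<open>Each diagonal entry is a convex combination of eigenvalues, with weights from a doubly
  stochastic matrix. Jensen's inequality applies row by row, and the column sums recombine the
  right-hand side.\<close>

lemma peierls_exp:
 assumes fin: "finite I" and sym: "sym_on I A"
 shows "(\<Sum>i\<in>I. exp (s*A i i)) <= (\<Sum>k\<in>I. exp (s * eigval I A k))"
proof -
 let ?l = "eigval I A" and ?u = "eigvec I A"
 have sp: "spectral I A ?l ?u" by (rule spectral_eig[OF fin sym])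
 have diag: "A i i = (\<Sum>k\<in>I. (?u k i)^2*?l k)" if i: "i : I" for i
 proof -
 have "A i i = (\<Sum>j\<in>I. A i j * of_bool (j = i))" by (rule sum_of_bool_mult_left(4)[OF fin i, symmetric])
 also have "... = (\<Sum>j\<in>I. A i j*(\<Sum>k\<in>I. ?u k j*?u k i))" using sp i by (intro sum.cong refl) (simp add: spectral_def)
 also have "... = (\<Sum>k\<in>I. (\<Sum>j\<in>I. A i j*?u k j)*?u k i)"
 unfolding sum_distrib_left sum_distrib_right by (subst sum.swap) (simp add: mult_ac)
 also have "... = (\<Sum>k\<in>I. (?l k*?u k i)*?u k i)" using sp i by (intro sum.cong refl) (simp add: spectral_def)
 finally show ?thesis by (simp add: power2_eq_square mult_ac)
 qed
 have w: "(\<Sum>k\<in>I. (?u k i)^2) = 1" if "i : I" for i using sp that by (simp add: spectral_def power2_eq_square)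
 have w': "(\<Sum>i\<in>I. (?u k i)^2) = 1" if "k : I" for k using sp that by (simp add: spectral_def power2_eq_square)
 have "(\<Sum>i\<in>I. exp (s*A i i)) <= (\<Sum>i\<in>I. \<Sum>k\<in>I. (?u k i)^2 * exp (s*?l k))"
 proof (rule sum_mono)
 fix i assume i: "i : I"
 have "exp (s*A i i) = exp (\<Sum>k\<in>I. (?u k i)^2 *\<^sub>R (s*?l k))"
 unfolding diag[OF i] by (simp add: sum_distrib_left mult_ac)
 also have "... <= (\<Sum>k\<in>I. (?u k i)^2 * exp (s*?l k))"
 using fin i w[OF i] by (intro convex_on_sum[where C = UNIV] exp_convex) auto
 finally show "exp (s*A i i) <= (\<Sum>k\<in>I. (?u k i)^2 * exp (s*?l k))" .
 qed
 also have "... = (\<Sum>k\<in>I. (\<Sum>i\<in>I. (?u k i)^2) * exp (s*?l k))"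
 unfolding sum_distrib_right by (rule sum.swap)
 also have "... = (\<Sum>k\<in>I. exp (s*?l k))" using w' by simp
 finally show ?thesis .
qed

lemma cavg_exp_signs:
 assumes "finite E"
 shows "cavg E (%A. exp (\<Sum>e\<in>E. c e * sgnset A e)) = (\<Prod>e\<in>E. cosh (c e :: real))"
 using assms
proof (induction E rule: finite_induct)
 case (insert e E)
 have 1: "cavg E (%A. exp (\<Sum>e'\<in>insert e E. c e' * sgnset A e')) = exp (- c e) * cavg E (%A. exp (\<Sum>e\<in>E. c e * sgnset A e))"
 unfolding cavg_mult_left[symmetric]
 using insert by (intro cavg_cong) (auto simp: sgnset_def exp_add[symmetric] subset_iff)
 have 2: "cavg E (%A. exp (\<Sum>e'\<in>insert e E. c e' * sgnset (insert e A) e')) = exp (c e) * cavg E (%A. exp (\<Sum>e\<in>E. c e * sgnset A e))"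
 unfolding cavg_mult_left[symmetric]
 proof (rule cavg_cong)
 fix A
 have "(\<Sum>e'\<in>E. c e' * sgnset (insert e A) e') = (\<Sum>e'\<in>E. c e' * sgnset A e')"
 using insert by (intro sum.cong refl) (auto simp: sgnset_def)
 then show "exp (\<Sum>e'\<in>insert e E. c e' * sgnset (insert e A) e') = exp (c e) * exp (\<Sum>e\<in>E. c e * sgnset A e)"
 using insert by (simp add: exp_add sgnset_def[of _ e])
 qed
 show ?case unfolding cavg_insert[OF insert(1,2)] 1 2 insert.IH using insert
 by (simp add: cosh_def algebra_simps)
qed simp

text \<open>The constant 1/4 leaves room to absorb the quadratic term of the exponential on |c| <=
  1.\<close>

lemma cosh_ge_exp_square: "\<bar>c\<bar> <= 1 ==> exp (c^2/4) <= cosh (c :: real)"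
proof -
 assume c: "\<bar>c\<bar> <= 1"
 have c1: "c^2 <= 1" using c by (simp add: abs_square_le_1)
 have "exp (c^2/4) <= 1 + c^2/4+(c^2/4)^2" using c1 by (intro exp_bound) auto
 also have "... <= 1 + c^2/2"
 proof -
 have "(c^2/4)^2 = c^2 * c^2/16" by (simp add: power_divide power2_eq_square)
 moreover have "c^2 * c^2 <= c^2*1" by (intro mult_left_mono c1) simp
 ultimately show ?thesis using zero_le_power2[of c] by linarith
 qed
 also have "... <= cosh c"
 proof -
 have sm: "(%m. c ^ (2 * m)/fact (2 * m)) sums cosh c" by (rule cosh_converges_even)
 have "(\<Sum>m<2. c ^ (2 * m)/fact (2 * m)) <= (\<Sum>m. c ^ (2 * m)/fact (2 * m))"
 by (rule sum_le_suminf[OF sums_summable[OF sm]]) (auto simp: power_mult)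
 then show ?thesis unfolding sums_unique[OF sm, symmetric] by (simp add: numeral_2_eq_2)
 qed
 finally show ?thesis .
qed

text \<open>A diagonal entry is a sum of independent signs, so its exponential moment is an explicit
  product of hyperbolic cosines. Jensen's inequality over the vertices leaves only the total rate,
  in which each pair is counted at both of its end points.\<close>

lemma mean_esd_cosh_lower:
 assumes fin: "finite I" and ne: "I ~= {}" and t: "!!e. e : I \<times> I ==> 0 <= t e \<and> t e <= kap" and s: "s^2 * kap <= 1"
 and off: "!!i. i : I ==> t (i, i) = 0"
 shows "exp (s^2/2*(\<Sum>e\<in>I \<times> I. t e)/real (card I))/2 <= (\<integral>x. cosh (s * x) \<partial>mean_esd I t)"
proof -
 let ?E = "I \<times> I" and ?L = "%A. Lap I (rademacher t A)"
 have cI: "card I > 0" using fin ne by (simp add: card_gt_0_iff)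
 have finE: "finite ?E" using fin by simp
 define d where "d = (%i. \<Sum>e\<in>?E. t e*(edge e i)^2)"
 have row: "exp (s^2/4 * d i) <= cavg ?E (%A. exp (s*?L A i i))" for i
 proof -
 define c where "c = (%e.-s * sqrt (t e)*(edge e i)^2)"
 have c2: "(c e)^2 = s^2*(t e*(edge e i)^2)" "\<bar>c e\<bar> <= 1" if e: "e : ?E" for e
 proof -
 have ed: "edge e i = 0 \<or> edge e i = 1 \<or> edge e i =-1" by (auto simp: edge_def)
 show sq: "(c e)^2 = s^2*(t e*(edge e i)^2)" using t[OF e] ed by (auto simp: c_def power_mult_distrib)
 have "s^2*(t e*(edge e i)^2) <= s^2 * kap" using t[OF e] ed by (intro mult_left_mono) auto
 then have "(c e)^2 <= 1" using s unfolding sq by linarith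
 then show "\<bar>c e\<bar> <= 1" by (simp add: abs_square_le_1)
 qed
 have "exp (s^2/4 * d i) = (\<Prod>e\<in>?E. exp ((c e)^2/4))"
 using c2 by (simp add: exp_sum[OF finE, symmetric] d_def sum_distrib_left sum_divide_distrib)
 also have "... <= (\<Prod>e\<in>?E. cosh (c e))" using c2 by (intro prod_mono conjI cosh_ge_exp_square) auto
 also have "... = cavg ?E (%A. exp (\<Sum>e\<in>?E. c e * sgnset A e))" by (rule cavg_exp_signs[OF finE, symmetric])
 also have "(%A. exp (\<Sum>e\<in>?E. c e * sgnset A e)) = (%A. exp (s*?L A i i))"
 by (simp add: c_def Lap_def rademacher_def sum_distrib_left sum_negf power2_eq_square mult_ac)
 finally show ?thesis .
 qed
 have total: "(\<Sum>i\<in>I. d i) = 2*(\<Sum>e\<in>?E. t e)"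
 proof -
 have "(\<Sum>i\<in>I. d i) = (\<Sum>e\<in>?E. t e*(\<Sum>i\<in>I. (edge e i)^2))"
 unfolding d_def sum_distrib_left by (rule sum.swap)
 also have "... = (\<Sum>e\<in>?E. t e*2)"
 proof (rule sum.cong[OF refl])
 fix e assume e: "e : ?E"
 show "t e*(\<Sum>i\<in>I. (edge e i)^2) = t e*2"
 proof (cases "fst e = snd e")
 case True then show ?thesis using off[of "fst e"] e by (cases e) auto
 next
 case False
 have "(\<Sum>i\<in>I. (edge e i)^2) = (\<Sum>i\<in>I. 1 * of_bool (fst e = i)+1 * of_bool (snd e = i))"
 using False by (intro sum.cong refl) (auto simp: edge_def)
 also have "... = 2" unfolding sum.distrib
 using sum_of_bool_mult_left(3)[OF fin, of "fst e" "%_. 1::real"] sum_of_bool_mult_left(3)[OF fin, of "snd e" "%_. 1::real"] e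
 by (simp add: mem_Times_iff)
 finally show ?thesis by simp
 qed
 qed
 finally show ?thesis by (simp add: sum_distrib_left mult.commute)
 qed
 have "exp (s^2/2*(\<Sum>e\<in>?E. t e)/real (card I)) = exp (\<Sum>i\<in>I. (1/real (card I)) *\<^sub>R (s^2/4 * d i))"
 using total by (simp add: sum_distrib_left[symmetric] sum_divide_distrib[symmetric])
 also have "... <= (\<Sum>i\<in>I. (1/real (card I)) * exp (s^2/4 * d i))"
 using fin ne cI by (intro convex_on_sum[where C = UNIV] exp_convex) auto
 also have "... <= (\<Sum>i\<in>I. (1/real (card I)) * cavg ?E (%A. exp (s*?L A i i)))"
 by (intro sum_mono mult_left_mono row) simp
 also have "... = (1/real (card I)) * cavg ?E (%A. \<Sum>i\<in>I. exp (s*?L A i i))"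
 by (simp only: cavg_sum sum_distrib_left)
 also have "... <= (1/real (card I)) * cavg ?E (%A. \<Sum>k\<in>I. 2 * cosh (s * eigval I (?L A) k))"
 proof (intro mult_left_mono cavg_mono)
 fix A
 have "(\<Sum>i\<in>I. exp (s*?L A i i)) <= (\<Sum>k\<in>I. exp (s * eigval I (?L A) k))" by (rule peierls_exp[OF fin sym_on_Lap])
 also have "... <= (\<Sum>k\<in>I. 2 * cosh (s * eigval I (?L A) k))" by (intro sum_mono) (simp add: cosh_def)
 finally show "(\<Sum>i\<in>I. exp (s*?L A i i)) <= (\<Sum>k\<in>I. 2 * cosh (s * eigval I (?L A) k))" .
 qed simp
 also have "... = 2*(\<integral>x. cosh (s * x) \<partial>mean_esd I t)"
 unfolding integral_mean_esd[OF fin ne measurable_cosh] sum_distrib_left[symmetric] cavg_mult_left by simp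
 finally show ?thesis by simp
qed

text \<open>The complement of the support is a union of null balls, and Lindelof's theorem reduces
  it to countably many of them.\<close>

lemma bounded_support_null:
 assumes "real_distribution \<nu>" and R: "!!x. x : measure_support \<nu> ==> \<bar>x\<bar> <= R"
 shows "AE x in \<nu>. \<bar>x\<bar> <= R"
proof -
 interpret real_distribution \<nu> by fact
 define F where "F = {ball x e | x e. e > 0 \<and> emeasure \<nu> (ball x e) = 0}"
 obtain F' where F': "F' \<subseteq> F" "countable F'" "\<Union>F' = \<Union>F"
 using Lindelof[of F] by (auto simp: F_def)
 have "(\<Union>S\<in>F'. S) : null_sets \<nu>"
 using F'(1,2) by (intro null_sets_UN') (auto simp: F_def null_sets_def)
 moreover have "{x. \<not> \<bar>x\<bar> <= R} \<subseteq> (\<Union>S\<in>F'. S)"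
 proof
 fix x assume "x : {x. \<not> \<bar>x\<bar> <= R}"
 then have "x \<notin> measure_support \<nu>" using R by auto
 then obtain e where "e > 0" "emeasure \<nu> (ball x e) = 0" by (auto simp: measure_support_def)
 then have "ball x e : F" "x : ball x e" by (auto simp: F_def)
 then have "x : \<Union>F" by blast
 then show "x : (\<Union>S\<in>F'. S)" using F'(3) by simp
 qed
 ultimately show ?thesis by (intro AE_I'[where N = "\<Union>S\<in>F'. S"]) auto
qed

context profile_sequence
begin

text \<open>The lower bound for the mean distributions grows like the exponential of a multiple of
  s^2, whereas support inside [-R, R] allows only exp (s R). Since cosh is unbounded, the comparison
  passes to the limit through a truncation whose loss is at most 1.\<close>

theorem unbounded_support:
 assumes \<nu>: "real_distribution \<nu>" and r: "strict_mono (r :: nat => nat)"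
 and conv: "!!g :: real => real. continuous_on UNIV g ==> bounded (range g) ==> (%n. \<integral>x. g x \<partial>mu (r n)) \<longlonglongrightarrow> (\<integral>x. g x \<partial>\<nu>)"
 and t_small: "!!N e. e : {1..N} \<times> {1..N} ==> t N e <= 1/real N"
 and off: "!!N i. t N (i, i) = 0"
 and w: "w > 0" "\<forall>\<^sub>F N in sequentially. (\<Sum>e\<in>{1..N} \<times> {1..N}. t N e) >= w * real N"
 shows "\<not> bounded (measure_support \<nu>)"
proof
 interpret \<nu>: real_distribution \<nu> by (rule \<nu>)
 assume "bounded (measure_support \<nu>)"
 then obtain R0 where R0: "!!x. x : measure_support \<nu> ==> \<bar>x\<bar> <= R0" unfolding bounded_iff by auto
 define R where "R = max R0 0"
 have R: "R >= 0" "AE x in \<nu>. \<bar>x\<bar> <= R" using bounded_support_null[OF \<nu>, of R] R0 by (force simp: R_def)+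
 \<comment> \<open>Chosen so that s^2 w/2 >= s R + 4; the factor exp 4 >= 5 then contradicts the
   upper bound 2 exp (s R) + 2.\<close>
 define s :: real where "s = (2*R+8)/w+1"
 have s: "s >= 1" using w R by (simp add: s_def)
 define B where "B = exp (s^2/2 * w)/2"
 \<comment> \<open>The part of cosh (s x) above K is at most cosh (2 s x)/K, whose mean is at most 1
   because exp (4 (2 s)^2) = K.\<close>
 define K where "K = exp (16 * s^2)"
 have lower: "\<forall>\<^sub>F n in sequentially. B-1 <= (\<integral>x. min (cosh (s * x)) K \<partial>mu (r n))"
 proof -
 obtain N1 where N1: "!!N. N >= N1 ==> (\<Sum>e\<in>{1..N} \<times> {1..N}. t N e) >= w * real N" using w(2) unfolding eventually_sequentially by blast
 \<comment> \<open>From this size on, s^2 times the largest rate 1/N is at most 1.\<close>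
 obtain N2 where N2: "s^2 <= real N2" using real_arch_simple by blast
 show ?thesis unfolding eventually_sequentially
 proof (intro exI[of _ "max N1 N2"] allI impI)
 fix n assume n: "n >= max N1 N2"
 define N where "N = Suc (r n)"
 have N: "N >= N1" "N >= N2" "N > 0" using n seq_suble[OF r, of n] by (auto simp: N_def)
 have "exp (s^2/2*(\<Sum>e\<in>{1..N} \<times> {1..N}. t N e)/real (card {1..N}))/2 <= (\<integral>x. cosh (s * x) \<partial>mean_esd {1..N} (t N))"
 proof (rule mean_esd_cosh_lower[where kap = "1/real N"])
 have "s^2 <= real N" using N2 N by linarith
 then show "s^2*(1/real N) <= 1" using N by simp
 qed (use N t_nonneg t_small off in auto)
 moreover have "s^2/2 * w <= s^2/2*(\<Sum>e\<in>{1..N} \<times> {1..N}. t N e)/real (card {1..N})"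
 proof -
 have "s^2/2*(w * real N) <= s^2/2*(\<Sum>e\<in>{1..N} \<times> {1..N}. t N e)" by (intro mult_left_mono N1 N) simp
 then show ?thesis using N by (simp add: pos_le_divide_eq mult_ac)
 qed
 ultimately have B: "B <= (\<integral>x. cosh (s * x) \<partial>mu (r n))" unfolding B_def mu_def N_def[symmetric]
 by (meson divide_right_mono exp_le_cancel_iff order_trans zero_le_numeral)
 have "(\<integral>x. cosh (s * x) \<partial>mu (r n)) <= (\<integral>x. min (cosh (s * x)) K + cosh (2 * s * x)/K \<partial>mu (r n))"
 proof (intro integral_mono integrable_mu)
 fix x
 have K: "K > 0" by (simp add: K_def)
 have c2: "(cosh (s * x))^2 <= cosh (2 * s * x)"
 proof -
 have "cosh (2*(s * x)) = (cosh (s * x))^2+(sinh (s * x))^2" by (rule cosh_double)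
 then show ?thesis by (simp add: mult.assoc)
 qed
 show "cosh (s * x) <= min (cosh (s * x)) K + cosh (2 * s * x)/K"
 proof (cases "cosh (s * x) <= K")
 case True then show ?thesis using K by (simp add: cosh_real_nonneg)
 next
 case False
 then have "cosh (s * x)*K <= (cosh (s * x))^2" unfolding power2_eq_square
 by (intro mult_left_mono) (auto simp: cosh_real_nonneg)
 then have "cosh (s * x) <= cosh (2 * s * x)/K" using c2 K by (simp add: pos_le_divide_eq)
 then show ?thesis using False K by auto
 qed
 qed (use measurable_cosh in auto)
 also have "... = (\<integral>x. min (cosh (s * x)) K \<partial>mu (r n))+(\<integral>x. cosh ((2 * s) * x) \<partial>mu (r n))/K"
 using measurable_cosh[of s] measurable_cosh[of "2 * s"]
 by (subst Bochner_Integration.integral_add) (auto intro!: integrable_mu)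
 also have "(\<integral>x. cosh ((2 * s) * x) \<partial>mu (r n))/K <= 1"
 using mu_cosh[where s = "2 * s" and n = "r n"] by (simp add: K_def power_mult_distrib)
 finally show "B-1 <= (\<integral>x. min (cosh (s * x)) K \<partial>mu (r n))" using B by linarith
 qed
 qed
 have "bounded (range (%x. min (cosh (s * x)) K))" "continuous_on UNIV (%x. min (cosh (s * x)) K)"
 by (auto simp: bounded_iff cosh_real_nonneg abs_min_le K_def intro!: exI[of _ K] continuous_intros)
 from tendsto_lowerbound[OF conv[OF this(2,1)] lower] have "B-1 <= (\<integral>x. min (cosh (s * x)) K \<partial>\<nu>)" by simp
 also have "... <= (\<integral>x. exp (s*R) \<partial>\<nu>)"
 proof (rule integral_mono_AE)
 show "integrable \<nu> (%x. min (cosh (s * x)) K)"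
 by (rule \<nu>.integrable_const_bound[where B = K]) (auto simp: cosh_real_nonneg min_def K_def)
 show "AE x in \<nu>. min (cosh (s * x)) K <= exp (s*R)"
 using R(2)
 proof eventually_elim
 fix x assume x: "\<bar>x\<bar> <= R"
 have "cosh (s * x) = cosh (s*\<bar>x\<bar>)" by (auto simp: abs_if)
 also have "... <= exp (s*\<bar>x\<bar>)" using s by (simp add: cosh_def)
 also have "... <= exp (s*R)" using x s by simp
 finally show "min (cosh (s * x)) K <= exp (s*R)" by linarith
 qed
 qed simp
 also have "... = exp (s*R)" using \<nu>.prob_space by simp
 finally have le: "exp (s^2/2 * w) <= 2 * exp (s*R)+2" by (simp add: B_def)
 have "s*R+4 <= s^2/2 * w"
 proof -
 have "s * w >= 2*R+8" proof -
 have "(2*R+8)/w * w = 2*R+8" using w by simp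
 then show ?thesis using w(1) unfolding s_def distrib_right by linarith
 qed
 then have "s*(s * w) >= s*(2*R+8)" using s by (intro mult_left_mono) auto
 then show ?thesis using s by (simp add: power2_eq_square algebra_simps)
 qed
 then have "exp 4 * exp (s*R) <= exp (s^2/2 * w)" unfolding exp_add[symmetric] by simp
 moreover have "exp (s*R) >= 1" using s R by simp
 moreover have "exp (4 :: real) >= 5" using exp_ge_add_one_self[of 4] by simp
 ultimately have "5 * exp (s*R) <= 2 * exp (s*R)+2" using le mult_right_mono[of 5 "exp 4" "exp (s*R)"] by linarith
 then show False using \<open>exp (s * R) \<ge> 1\<close> by linarith
qed

end

section \<open>Comparing profiles on different vertex sets through types\<close>

text \<open>Normalised trace of the model in which, for symmetric s, the off-diagonal entry at {x,
  y} has variance s x y/card I; the factor 2 accounts for the two orientations of a pair.\<close>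

definition scaled_trace :: "'i set => complex => ('i => 'i => real) => complex" where
 "scaled_trace I z s = mean_trace I z (%(x, y). s x y/(2 * real (card I)))/of_nat (card I)"

definition unit_kernel :: "'i set => ('i => 'i => real) => bool" where
 "unit_kernel I s \<longleftrightarrow> (\<forall>x\<in>I. \<forall>y\<in>I. 0 <= s x y \<and> s x y <= 1 \<and> s x y = s y x)"

lemma unit_kernelD:
 assumes "unit_kernel I s" "x : I" "y : I"
 shows "0 <= s x y" "s x y <= 1" "s x y = s y x"
 using assms unfolding unit_kernel_def by blast+

lemma unit_kernel_comp: "unit_kernel K v ==> f ` J \<subseteq> K ==> unit_kernel J (%x y. v (f x) (f y))"
 by (auto simp: unit_kernel_def image_subset_iff)

lemma cut_const_nonneg: "Im z > 0 ==> cut_const z >= 0"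
 by (simp add: cut_const_def Let_def)

lemma scaled_trace_cut:
 assumes fin: "finite I" and ne: "I ~= {}" and z: "Im z > 0"
 and s: "unit_kernel I s0" "unit_kernel I s1" and c: "c >= 0"
 and cut: "!!S T. S \<subseteq> I ==> T \<subseteq> I ==> \<bar>\<Sum>i\<in>S. \<Sum>j\<in>T. s1 i j-s0 i j\<bar> <= c*(real (card I))^2"
 shows "cmod (scaled_trace I z s1-scaled_trace I z s0) <= cut_const z*(c+2/sqrt (real (card I)))"
proof -
 define n where "n = real (card I)"
 have n: "n > 0" using fin ne by (simp add: n_def card_gt_0_iff)
 have sn: "sqrt n > 0" "sqrt n * sqrt n = n" using n by auto
 let ?t = "%s (x, y). s x y/(2 * n)"
 have b: "0 <= ?t s e \<and> ?t s e <= 1/n" if "unit_kernel I s" "e : I \<times> I" for s e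
 using that unit_kernelD[OF that(1), of "fst e" "snd e"] n by (auto simp: field_simps split: prod.splits)
 have "cmod (mean_trace I z (?t s1)-mean_trace I z (?t s0))
 <= cut_const z*(c * n + sqrt (1/n)*((\<Sum>e\<in>I \<times> I. \<bar>?t s1 e-?t s0 e\<bar>) + real (card I)))"
 proof (rule cut_comparison[OF fin z])
 fix S T assume ST: "S \<subseteq> I" "T \<subseteq> I"
 have "(\<Sum>i\<in>S. \<Sum>j\<in>T. (?t s1 (i, j)-?t s0 (i, j))+(?t s1 (j, i)-?t s0 (j, i))) = (\<Sum>i\<in>S. \<Sum>j\<in>T. (s1 i j-s0 i j)/n)"
 proof (intro sum.cong refl)
 fix i j assume "i : S" "j : T"
 then have "s1 j i = s1 i j" "s0 j i = s0 i j" using ST s by (auto simp: unit_kernel_def subset_iff)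
 then show "(?t s1 (i, j)-?t s0 (i, j))+(?t s1 (j, i)-?t s0 (j, i)) = (s1 i j-s0 i j)/n" using n by (simp add: field_simps)
 qed
 also have "... = (\<Sum>i\<in>S. \<Sum>j\<in>T. s1 i j-s0 i j)/n" by (simp add: sum_divide_distrib)
 finally have eq: "(\<Sum>i\<in>S. \<Sum>j\<in>T. (?t s1 (i, j)-?t s0 (i, j))+(?t s1 (j, i)-?t s0 (j, i))) = (\<Sum>i\<in>S. \<Sum>j\<in>T. s1 i j-s0 i j)/n" .
 show "\<bar>\<Sum>i\<in>S. \<Sum>j\<in>T. (?t s1 (i, j)-?t s0 (i, j))+(?t s1 (j, i)-?t s0 (j, i))\<bar> <= c * n"
 unfolding eq using cut[OF ST] n by (simp add: abs_divide n_def[symmetric] pos_divide_le_eq power2_eq_square mult.assoc)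
 qed (use b s c n in auto)
 also have "... <= cut_const z*(c * n + sqrt (1/n)*(n + n))"
 proof -
 have "\<bar>?t s1 e-?t s0 e\<bar> <= 1/n" if "e : I \<times> I" for e using b[OF s(1) that] b[OF s(2) that] unfolding abs_le_iff by linarith
 then have "(\<Sum>e\<in>I \<times> I. \<bar>?t s1 e-?t s0 e\<bar>) <= (\<Sum>e\<in>I \<times> I. 1/n)" by (rule sum_mono)
 also have "... = n" using n by (simp add: card_cartesian_product n_def)
 finally show ?thesis using cut_const_nonneg[OF z] n by (intro mult_left_mono add_left_mono add_mono) (auto simp: n_def)
 qed
 also have "... = cut_const z*(c+2/sqrt n) * n"
 proof -
 have "sqrt (1/n)*(n + n) = 2/sqrt n * n" using n by (simp add: real_sqrt_divide)
 then show ?thesis by (simp add: algebra_simps)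
 qed
 finally have "cmod (mean_trace I z (?t s1)-mean_trace I z (?t s0)) <= cut_const z*(c+2/sqrt n) * n" .
 moreover have "cmod (scaled_trace I z s1-scaled_trace I z s0) = cmod (mean_trace I z (?t s1)-mean_trace I z (?t s0))/n"
 by (simp add: scaled_trace_def n_def diff_divide_distrib[symmetric] norm_divide)
 ultimately show ?thesis using n by (simp add: pos_divide_le_eq n_def)
qed

lemma scaled_trace_relabel:
 assumes "finite I" "Im z > 0" and h: "bij_betw h I J"
 shows "scaled_trace J z s = scaled_trace I z (%x y. s (h x) (h y))"
proof -
 have "card J = card I" using h by (simp add: bij_betw_same_card)
 then show ?thesis unfolding scaled_trace_def
 by (subst mean_trace_relabel[OF assms]) (auto intro!: arg_cong2[where f = "(/)"] mean_trace_cong)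
qed

lemma double_sum_fibers:
 fixes g :: "'b => 'b => real"
 assumes fin: "finite S" "finite T" "finite X" and f: "f ` S \<subseteq> X" "f ` T \<subseteq> X"
 shows "(\<Sum>x\<in>S. \<Sum>y\<in>T. g (f x) (f y)) = (\<Sum>a\<in>X. \<Sum>b\<in>X. g a b * real (card {x\<in>S. f x = a}) * real (card {y\<in>T. f y = b}))"
proof -
 have one: "(\<Sum>x\<in>S. u (f x)) = (\<Sum>a\<in>X. u a * real (card {x\<in>S. f x = a}))"
 if "finite S" "f ` S \<subseteq> X" for u :: "'b => real" and S
 proof -
 have "(\<Sum>x\<in>S. u (f x)) = (\<Sum>a\<in>X. \<Sum>x\<in>{x\<in>S. f x = a}. u (f x))" by (rule sum.group[OF that(1) fin(3) that(2), symmetric])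
 also have "... = (\<Sum>a\<in>X. u a * real (card {x\<in>S. f x = a}))" by (intro sum.cong refl) (simp add: mult.commute)
 finally show ?thesis .
 qed
 have "(\<Sum>x\<in>S. \<Sum>y\<in>T. g (f x) (f y)) = (\<Sum>x\<in>S. \<Sum>b\<in>X. g (f x) b * real (card {y\<in>T. f y = b}))"
 by (intro sum.cong refl one[OF fin(2) f(2)])
 also have "... = (\<Sum>a\<in>X. (\<Sum>b\<in>X. g a b * real (card {y\<in>T. f y = b})) * real (card {x\<in>S. f x = a}))"
 by (rule one[OF fin(1) f(1)])
 finally show ?thesis by (simp add: sum_distrib_left mult_ac)
qed

text \<open>Replaces s on I by a kernel on labelled copies that depends on the labels alone. Three
  comparisons are chained: s with its type average \<open>\<tau>\<close> by the cut norm,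
  \<open>\<tau>\<close> with its blow-up, and that blow-up with v read off the labels, again by the
  cut norm. The counting hypothesis bounds how often a label is overused relative to the fractional
  membership p, by at most one copy.\<close>

theorem blow_up_types:
 fixes I :: "'i set" and K :: "'k set" and T :: "'i \<times> nat => 'k"
 assumes fin: "finite I" "finite K" and ne: "I ~= {}" and z: "Im z > 0"
 and v: "unit_kernel K v" and s: "unit_kernel I s"
 and p: "!!i k. i : I ==> k : K ==> 0 <= p i k" "!!i. i : I ==> (\<Sum>k\<in>K. p i k) = 1"
 and c: "c >= 0"
 and cut: "!!S T. S \<subseteq> I \<times> K ==> T \<subseteq> I \<times> K ==>
 \<bar>\<Sum>x\<in>S. \<Sum>y\<in>T. (s (fst x) (fst y)-v (snd x) (snd y))*(p (fst x) (snd x) * p (fst y) (snd y))\<bar> <= c*(real (card I))^2"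
 and M: "M > 0" and T: "!!i a. i : I ==> a < M ==> T (i, a) : K"
 and count: "!!i k. i : I ==> k : K ==> real (card {a. a < M \<and> T (i, a) = k}) <= real M * p i k+1"
 shows "cmod (scaled_trace (I \<times> {..<M}) z (%x y. v (T x) (T y))-scaled_trace I z s)
 <= cut_const z*(3 * c+2 * real (card K)/real M+4/sqrt (real (card I)))
 + blow_const z*((real (card K))^2+1)/sqrt (real (card I))"
proof -
 define n where "n = real (card I)"
 have n: "n > 0" using fin ne by (simp add: n_def card_gt_0_iff)
 have Mp: "real M > 0" using M by simp
 define J where "J = I \<times> {..<M}"
 have finJ: "finite J" and neJ: "J ~= {}" and cardJ: "real (card J) = n * real M"
 using fin ne M by (auto simp: J_def n_def card_cartesian_product lessThan_empty_iff)
 define \<tau> where "\<tau> = (%i j. \<Sum>k\<in>K. \<Sum>l\<in>K. v k l*(p i k * p j l))"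
 have pp: "(\<Sum>k\<in>K. \<Sum>l\<in>K. p i k * p j l) = 1" if "i : I" "j : I" for i j
 using p(2) that by (simp add: sum_product[symmetric])
 have p1: "p i k <= 1" if "i : I" "k : K" for i k
 using member_le_sum[OF that(2), of "p i"] p fin that by auto
 have \<tau>: "unit_kernel I \<tau>" unfolding unit_kernel_def
 proof (intro ballI conjI)
 fix i j assume ij: "i : I" "j : I"
 show "0 <= \<tau> i j" unfolding \<tau>_def using ij p v by (auto intro!: sum_nonneg mult_nonneg_nonneg simp: unit_kernel_def)
 have "\<tau> i j <= (\<Sum>k\<in>K. \<Sum>l\<in>K. 1*(p i k * p j l))"
 unfolding \<tau>_def using ij p v by (intro sum_mono mult_right_mono) (auto simp: unit_kernel_def)
 then show "\<tau> i j <= 1" using pp[OF ij] by simp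
 have "\<tau> i j = (\<Sum>l\<in>K. \<Sum>k\<in>K. v k l*(p i k * p j l))" unfolding \<tau>_def by (rule sum.swap)
 also have "... = \<tau> j i" unfolding \<tau>_def using v by (intro sum.cong refl) (auto simp: unit_kernel_def mult_ac)
 finally show "\<tau> i j = \<tau> j i" .
 qed
 let ?C = "c * n^2"
 have cut1: "\<bar>\<Sum>i\<in>S. \<Sum>j\<in>T. s i j-\<tau> i j\<bar> <= ?C" if ST: "S \<subseteq> I" "T \<subseteq> I" for S T
 proof -
 \<comment> \<open>Testing the coupled cut bound on full fibres S x K and T x K sums out the
   types.\<close>
 have "(\<Sum>x\<in>S \<times> K. \<Sum>y\<in>T \<times> K. (s (fst x) (fst y)-v (snd x) (snd y))*(p (fst x) (snd x) * p (fst y) (snd y)))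
 = (\<Sum>i\<in>S. \<Sum>k\<in>K. \<Sum>j\<in>T. \<Sum>l\<in>K. (s i j-v k l)*(p i k * p j l))"
 by (simp add: sum.cartesian_product' case_prod_beta)
 also have "... = (\<Sum>i\<in>S. \<Sum>j\<in>T. \<Sum>k\<in>K. \<Sum>l\<in>K. (s i j-v k l)*(p i k * p j l))"
 by (intro sum.cong refl sum.swap)
 also have "... = (\<Sum>i\<in>S. \<Sum>j\<in>T. s i j-\<tau> i j)"
 proof (intro sum.cong refl)
 fix i j assume "i : S" "j : T"
 then have "(\<Sum>k\<in>K. \<Sum>l\<in>K. p i k * p j l) = 1" using pp ST by blast
 then show "(\<Sum>k\<in>K. \<Sum>l\<in>K. (s i j-v k l)*(p i k * p j l)) = s i j-\<tau> i j"
 by (simp add: \<tau>_def left_diff_distrib sum_subtractf sum_distrib_left[symmetric])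
 qed
 finally show ?thesis using cut[of "S \<times> K" "T \<times> K"] ST by (simp add: n_def Sigma_mono)
 qed
 have 1: "cmod (scaled_trace I z s-scaled_trace I z \<tau>) <= cut_const z*(c+2/sqrt n)"
 using scaled_trace_cut[OF fin(1) ne z \<tau> s c] cut1 by (simp add: n_def)
 have 2: "cmod (scaled_trace J z (%x y. \<tau> (fst x) (fst y))-scaled_trace I z \<tau>) <= blow_const z*((real (card K))^2+1)/sqrt n"
 proof -
 have "cmod (mean_trace (I \<times> {..<M}) z (%(x, y). \<tau> (fst x) (fst y)/(2*(real (card I) * real (card {..<M}))))
 -of_real (real (card {..<M})) * mean_trace I z (%(i, j). \<tau> i j/(2 * real (card I))))
 <= blow_const z*((real (card K))^2+1)*(real (card I) * real (card {..<M})/sqrt (real (card I)))"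
 proof (rule blow_up_comparison[where v = v and p = p])
 show "\<tau> i j = (\<Sum>k\<in>K. \<Sum>l\<in>K. v k l*(p i k * p j l))" for i j by (simp add: \<tau>_def)
 qed (use unit_kernelD[OF v] unit_kernelD[OF \<tau>] p p1 fin ne z M in \<open>auto simp: lessThan_empty_iff\<close>)
 then have "cmod (mean_trace J z (%(x, y). \<tau> (fst x) (fst y)/(2 * real (card J)))-of_real (real M) * mean_trace I z (%(i, j). \<tau> i j/(2 * n)))/(n * real M)
 <= blow_const z*((real (card K))^2+1)*(n * real M/sqrt n)/(n * real M)"
 unfolding cardJ J_def[symmetric] n_def[symmetric] card_lessThan using n Mp by (intro divide_right_mono) auto
 moreover have "scaled_trace J z (%x y. \<tau> (fst x) (fst y))-scaled_trace I z \<tau> =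
 (mean_trace J z (%(x, y). \<tau> (fst x) (fst y)/(2 * real (card J)))-of_real (real M) * mean_trace I z (%(i, j). \<tau> i j/(2 * n)))/of_real (n * real M)"
 proof -
 have "(of_nat (card J) :: complex) = of_real (n * real M)" using cardJ by (metis of_real_of_nat_eq)
 then show ?thesis unfolding scaled_trace_def n_def[symmetric] using n Mp by (simp add: diff_divide_distrib n_def)
 qed
 ultimately show ?thesis using n Mp by (simp add: norm_divide norm_mult)
 qed
 have TJ: "T ` J \<subseteq> K" using T by (auto simp: J_def)
 let ?X = "I \<times> K" and ?f = "%x. (fst x, T x)"
 have finX: "finite ?X" using fin by simp
 have fX: "?f ` S \<subseteq> ?X" "fst ` S \<subseteq> I" "finite S" if "S \<subseteq> J" for S using that TJ finJ finite_subset[OF that] by (auto simp: J_def)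
 have 3: "cmod (scaled_trace J z (%x y. v (T x) (T y))-scaled_trace J z (%x y. \<tau> (fst x) (fst y)))
 <= cut_const z*((2 * c+2 * real (card K)/real M)+2/sqrt (real (card J)))"
 proof (rule scaled_trace_cut[OF finJ neJ z])
 show "unit_kernel J (%x y. v (T x) (T y))" by (rule unit_kernel_comp[OF v TJ])
 show "unit_kernel J (%x y. \<tau> (fst x) (fst y))" by (rule unit_kernel_comp[OF \<tau>]) (auto simp: J_def)
 fix S S' assume S: "S \<subseteq> J" "S' \<subseteq> J"
 have fib: "real (card {x\<in>S. fst x = i}) <= real M" if "S \<subseteq> J" for S i
 proof -
 have "{x\<in>S. fst x = i} \<subseteq> Pair i ` {..<M}" using that by (auto simp: J_def image_iff)
 from card_mono[OF _ this] have "card {x\<in>S. fst x = i} <= card (Pair i ` {..<M})" by simp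
 also have "... <= M" using card_image_le[of "{..<M}" "Pair i"] by simp
 finally show ?thesis by simp
 qed
 \<comment> \<open>A set in the blow-up acts on I through its fibre sizes divided by M, which lie in
   [0, 1].\<close>
 have A: "\<bar>\<Sum>x\<in>S. \<Sum>y\<in>S'. s (fst x) (fst y)-\<tau> (fst x) (fst y)\<bar> <= ?C*(real M)^2"
 proof -
 have "(\<Sum>x\<in>S. \<Sum>y\<in>S'. s (fst x) (fst y)-\<tau> (fst x) (fst y))
 = (\<Sum>i\<in>I. \<Sum>j\<in>I. (s i j-\<tau> i j) * real (card {x\<in>S. fst x = i}) * real (card {x\<in>S'. fst x = j}))"
 by (rule double_sum_fibers[where g = "%i j. s i j-\<tau> i j" and f = fst]) (use fX S fin in auto)
 also have "... = (\<Sum>i\<in>I. \<Sum>j\<in>I. (s i j-\<tau> i j)*(real (card {x\<in>S. fst x = i})/real M)*(real (card {x\<in>S'. fst x = j})/real M))*(real M)^2"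
 unfolding sum_distrib_right using Mp by (intro sum.cong refl) (simp add: power2_eq_square)
 also have "\<bar>...\<bar> <= ?C*(real M)^2"
 unfolding abs_mult abs_power2 using fib S Mp by (intro mult_right_mono cut_bilinear_abs_unit fin cut1) auto
 finally show ?thesis .
 qed
 define num where "num = (%S x. real (card {y\<in>S. ?f y = x}))"
 define P where "P = (%x. p (fst x) (snd x))"
 have P: "P x >= 0" if "x : ?X" for x using that p by (auto simp: P_def)
 have num1: "num S x <= real M*P x+1" if S: "S \<subseteq> J" and x: "x : ?X" for S x
 proof -
 have "{y\<in>S. ?f y = x} \<subseteq> Pair (fst x) ` {a. a < M \<and> T (fst x, a) = snd x}" using S by (auto simp: J_def image_iff)
 from card_mono[OF _ this] have "card {y\<in>S. ?f y = x} <= card (Pair (fst x) ` {a. a < M \<and> T (fst x, a) = snd x})" by simp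
 also have "... <= card {a. a < M \<and> T (fst x, a) = snd x}" by (rule card_image_le) simp
 finally show ?thesis using count[of "fst x" "snd x"] x by (auto simp: num_def P_def)
 qed
 have num_sum: "(\<Sum>x\<in>?X. num S x) <= n * real M" if S: "S \<subseteq> J" for S
 proof -
 have "(\<Sum>x\<in>?X. num S x) = real (\<Sum>x\<in>?X. \<Sum>y\<in>{y\<in>S. ?f y = x}. 1)" by (simp add: num_def)
 also have "... = real (card S)" by (subst sum.group[OF fX(3)[OF S] finX fX(1)[OF S]]) simp
 also have "... <= n * real M" using card_mono[OF finJ S] unfolding cardJ[symmetric] by simp
 finally show ?thesis .
 qed
 \<comment> \<open>Counts may exceed M P x by one. The capped counts give admissible weights for the
   cut hypothesis, and the excess produces the error term with card K/M.\<close>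
 define alp where "alp = (%S x. min (num S x) (real M*P x))"
 define g where "g = (%x y. s (fst x) (fst y)-v (snd x) (snd y))"
 have g1: "\<bar>g x y\<bar> <= 1" if "x : ?X" "y : ?X" for x y
 proof -
 have "fst x : I" "fst y : I" "snd x : K" "snd y : K" using that by auto
 then show ?thesis unfolding g_def abs_le_iff
 using unit_kernelD(1,2)[OF s, of "fst x" "fst y"] unit_kernelD(1,2)[OF v, of "snd x" "snd y"] by linarith
 qed
 have num0: "0 <= num S x" for S x by (simp add: num_def)
 have alp: "0 <= alp S x" "alp S x <= num S x" "alp S x <= real M*P x" if "x : ?X" for S x
 using P[OF that] by (auto simp: alp_def num0)
 have alp1: "num S x-alp S x <= 1" if "S \<subseteq> J" "x : ?X" for S x using num1[OF that] by (auto simp: alp_def min_def)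
 have main: "\<bar>\<Sum>x\<in>?X. \<Sum>y\<in>?X. g x y*(alp S x * alp S' y)\<bar> <= ?C*(real M)^2"
 proof -
 \<comment> \<open>Where \<open>P\<close> vanishes the capped count vanishes too, so the quotient
   may be set to 0.\<close>
 define w where "w = (%S x. if P x = 0 then 0 else alp S x/(real M*P x))"
 have w: "0 <= w S x \<and> w S x <= 1" and walp: "alp S x = real M*(P x * w S x)" if "x : ?X" for S x
 using alp[OF that, of S] P[OF that] Mp by (auto simp: w_def pos_divide_le_eq)
 have "(\<Sum>x\<in>?X. \<Sum>y\<in>?X. g x y*(alp S x * alp S' y)) = (\<Sum>x\<in>?X. \<Sum>y\<in>?X. (g x y*(P x*P y)) * w S x * w S' y)*(real M)^2"
 unfolding sum_distrib_right by (intro sum.cong refl) (simp add: walp power2_eq_square mult_ac del: mem_Times_iff)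
 also have "\<bar>...\<bar> <= ?C*(real M)^2"
 unfolding abs_mult abs_power2 using w cut by (intro mult_right_mono cut_bilinear_abs_unit finX) (auto simp: g_def P_def n_def)
 finally show ?thesis .
 qed
 have rest: "\<bar>(\<Sum>x\<in>?X. \<Sum>y\<in>?X. g x y * num S x * num S' y)-(\<Sum>x\<in>?X. \<Sum>y\<in>?X. g x y*(alp S x * alp S' y))\<bar> <= 2 * n^2 * real (card K) * real M"
 proof -
 have "\<bar>(\<Sum>x\<in>?X. \<Sum>y\<in>?X. g x y * num S x * num S' y)-(\<Sum>x\<in>?X. \<Sum>y\<in>?X. g x y*(alp S x * alp S' y))\<bar>
 = \<bar>\<Sum>x\<in>?X. \<Sum>y\<in>?X. g x y*(num S x * num S' y-alp S x * alp S' y)\<bar>"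
 by (simp add: sum_subtractf[symmetric] algebra_simps)
 also have "... <= (\<Sum>x\<in>?X. \<Sum>y\<in>?X. 1 * num S' y + num S x*1)"
 proof (intro order_trans[OF sum_abs] sum_mono)
 fix x y assume xy: "x : ?X" "y : ?X"
 have "num S x * num S' y-alp S x * alp S' y = (num S x-alp S x) * num S' y + alp S x*(num S' y-alp S' y)" by (simp add: algebra_simps)
 also have "... <= 1 * num S' y + num S x*1"
 using alp[OF xy(1), of S] alp[OF xy(2), of S'] alp1[OF S(1) xy(1)] alp1[OF S(2) xy(2)] num0
 by (intro add_mono mult_mono) auto
 finally have u: "num S x * num S' y-alp S x * alp S' y <= 1 * num S' y + num S x*1" .
 have l: "alp S x * alp S' y <= num S x * num S' y"
 using alp[OF xy(1), of S] alp[OF xy(2), of S'] num0 by (intro mult_mono) auto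
 have "\<bar>g x y*(num S x * num S' y-alp S x * alp S' y)\<bar> <= 1*\<bar>num S x * num S' y-alp S x * alp S' y\<bar>"
 unfolding abs_mult by (intro mult_right_mono g1 xy) simp
 then show "\<bar>g x y*(num S x * num S' y-alp S x * alp S' y)\<bar> <= 1 * num S' y + num S x*1" using u l by simp
 qed
 also have "... = real (card ?X)*(\<Sum>y\<in>?X. num S' y) + real (card ?X)*(\<Sum>x\<in>?X. num S x)"
 by (simp add: sum.distrib sum_distrib_left)
 also have "... <= real (card ?X)*(n * real M) + real (card ?X)*(n * real M)"
 by (intro add_mono mult_left_mono num_sum S) auto
 also have "... = 2 * n^2 * real (card K) * real M" by (simp add: card_cartesian_product n_def power2_eq_square)
 finally show ?thesis .
 qed
 have B: "\<bar>\<Sum>x\<in>S. \<Sum>y\<in>S'. s (fst x) (fst y)-v (T x) (T y)\<bar> <= ?C*(real M)^2+2 * n^2 * real (card K) * real M"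
 proof -
 have "(\<Sum>x\<in>S. \<Sum>y\<in>S'. s (fst x) (fst y)-v (T x) (T y)) = (\<Sum>x\<in>S. \<Sum>y\<in>S'. g (?f x) (?f y))" by (simp add: g_def)
 also have "... = (\<Sum>x\<in>?X. \<Sum>y\<in>?X. g x y * num S x * num S' y)"
 unfolding num_def by (rule double_sum_fibers[where f = ?f and g = g]) (use fX S finX in auto)
 finally show ?thesis using main rest unfolding abs_le_iff by linarith
 qed
 have "(\<Sum>x\<in>S. \<Sum>y\<in>S'. v (T x) (T y)-\<tau> (fst x) (fst y))
 = (\<Sum>x\<in>S. \<Sum>y\<in>S'. s (fst x) (fst y)-\<tau> (fst x) (fst y))-(\<Sum>x\<in>S. \<Sum>y\<in>S'. s (fst x) (fst y)-v (T x) (T y))"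
 by (simp add: sum_subtractf[symmetric])
 then have "\<bar>\<Sum>x\<in>S. \<Sum>y\<in>S'. v (T x) (T y)-\<tau> (fst x) (fst y)\<bar> <= 2*?C*(real M)^2+2 * n^2 * real (card K) * real M"
 using A B unfolding abs_le_iff by linarith
 also have "... = (2 * c+2 * real (card K)/real M)*(real (card J))^2"
 unfolding cardJ using Mp by (simp add: field_simps power2_eq_square)
 finally show "\<bar>\<Sum>x\<in>S. \<Sum>y\<in>S'. v (T x) (T y)-\<tau> (fst x) (fst y)\<bar> <= (2 * c+2 * real (card K)/real M)*(real (card J))^2" .
 qed (use c in auto)
 have "2/sqrt (real (card J)) <= 2/sqrt n"
 unfolding cardJ using n M by (intro divide_left_mono) (auto intro!: mult_pos_pos)
 then have "cut_const z*((2 * c+2 * real (card K)/real M)+2/sqrt (real (card J)))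
 <= cut_const z*((2 * c+2 * real (card K)/real M)+2/sqrt n)"
 using cut_const_nonneg[OF z] by (intro mult_left_mono) auto
 with 3 have 3: "cmod (scaled_trace J z (%x y. v (T x) (T y))-scaled_trace J z (%x y. \<tau> (fst x) (fst y)))
 <= cut_const z*((2 * c+2 * real (card K)/real M)+2/sqrt n)" by linarith
 have tri: "cmod (a-d) <= cmod (a-b) + cmod (b-e) + cmod (d-e)" for a b d e :: complex
 using norm_triangle_ineq[of "(a-b)+(b-e)" "e-d"] norm_triangle_ineq[of "a-b" "b-e"] by (simp add: norm_minus_commute)
 have "cmod (scaled_trace J z (%x y. v (T x) (T y))-scaled_trace I z s)
 <= cut_const z*((2 * c+2 * real (card K)/real M)+2/sqrt n) + blow_const z*((real (card K))^2+1)/sqrt n + cut_const z*(c+2/sqrt n)"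
 using order_trans[OF tri add_mono[OF add_mono[OF 3 2] 1]] .
 also have "... = cut_const z*(3 * c+2 * real (card K)/real M+4/sqrt n) + blow_const z*((real (card K))^2+1)/sqrt n"
 by (simp add: algebra_simps add_divide_distrib[symmetric])
 finally show ?thesis by (simp add: J_def n_def)
qed

text \<open>Rounding down the partial sums of M * p, instead of its terms, makes the counts add up
  to exactly M while each stays within 1 of its target.\<close>

lemma integer_rounding:
 assumes p: "!!k. k : {1..kap} ==> 0 <= p k" and sum: "(\<Sum>k\<in>{1..kap}. p k) = (1 :: real)"
 obtains T :: "nat => nat" where "!!a. a < M ==> T a : {1..kap}"
 "!!k. k : {1..kap} ==> \<bar>real (card {a. a < M \<and> T a = k})-real M * p k\<bar> <= 1"
proof -
 \<comment> \<open>A monotone integer sequence starting at 0 is the cumulative count of a labelling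
   by consecutive blocks.\<close>
 have fibres: "\<exists>T. (\<forall>a<f kap. T a : {1..kap}) \<and> (\<forall>k\<in>{1..kap}. card {a. a < f kap \<and> T a = k} = f k-f (k-1))"
 if "mono_on {..kap} f" "f 0 = 0" for f :: "nat => nat" and kap :: nat
 using that
 proof (induction kap)
 case (Suc kap)
 have mono: "mono_on {..kap} f" "f kap <= f (Suc kap)" using Suc.prems(1) by (auto simp: mono_on_def)
 obtain T where T: "!!a. a < f kap ==> T a : {1..kap}" "!!k. k : {1..kap} ==> card {a. a < f kap \<and> T a = k} = f k-f (k-1)"
 using Suc.IH[OF mono(1) Suc.prems(2)] by blast
 define T' where "T' = (%a. if a < f kap then T a else Suc kap)"
 have "T' a : {1..Suc kap}" for a using T(1)[of a] by (auto simp: T'_def)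
 moreover have "card {a. a < f (Suc kap) \<and> T' a = k} = f k-f (k-1)" if k: "k : {1..Suc kap}" for k
 proof (cases "k = Suc kap")
 case True
 have "T a ~= Suc kap" if "a < f kap" for a using T(1)[OF that] by simp
 then have "{a. a < f (Suc kap) \<and> T' a = k} = {f kap..<f (Suc kap)}" using True by (auto simp: T'_def not_less)
 then show ?thesis using True by simp
 next
 case False
 have "{a. a < f (Suc kap) \<and> T' a = k} = {a. a < f kap \<and> T a = k}" using False mono(2) by (auto simp: T'_def split: if_splits)
 then show ?thesis using T(2)[of k] k False by simp
 qed
 ultimately show ?case by blast
 qed simp
 define F where "F = (%k. real M*(\<Sum>l\<in>{1..k}. p l))"
 define f where "f = (%k. nat \<lfloor>F k\<rfloor>)"
 have Fmono: "F k <= F l" if "k <= l" "l <= kap" for k l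
 unfolding F_def using that p by (intro mult_left_mono sum_mono2) auto
 have F0: "F k >= 0" if "k <= kap" for k using Fmono[of 0 k] that by (simp add: F_def)
 have "f kap = M" "f 0 = 0" using sum by (simp_all add: f_def F_def)
 moreover have "mono_on {..kap} f" unfolding f_def using Fmono by (auto intro!: mono_onI nat_mono floor_mono)
 ultimately obtain T where T: "!!a. a < M ==> T a : {1..kap}" "!!k. k : {1..kap} ==> card {a. a < M \<and> T a = k} = f k-f (k-1)"
 using fibres[of kap f] by metis
 show thesis
 proof (rule that[OF T(1)])
 fix k assume k: "k : {1..kap}"
 have "{1..k} = insert k {1..k-1}" using k by auto
 moreover have "k \<notin> {1..k-1}" using k by auto
 ultimately have "(\<Sum>l\<in>{1..k}. p l) = p k+(\<Sum>l\<in>{1..k-1}. p l)" by (metis sum.insert finite_atLeastAtMost)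
 then have d: "F k-F (k-1) = real M * p k" by (simp add: F_def distrib_left)
 have "F (k-1) <= F k" "0 <= F (k-1)" using k Fmono F0 by auto
 then have "real (f k-f (k-1)) = real_of_int (\<lfloor>F k\<rfloor>-\<lfloor>F (k-1)\<rfloor>)"
 unfolding f_def using floor_mono[of "F (k-1)" "F k"] by (simp add: nat_diff_distrib[symmetric])
 then show "\<bar>real (card {a. a < M \<and> T a = k})-real M * p k\<bar> <= 1"
 unfolding T(2)[OF k] d[symmetric] by linarith
 qed auto
qed

text \<open>Match as many vertices as possible inside each type, then join the leftovers, equally
  many on both sides, arbitrarily.\<close>

lemma matching_bijection:
 assumes fin: "finite J" "finite J'" "finite K" and card: "card J = card J'" and T: "T ` J \<subseteq> K" "T' ` J' \<subseteq> K"
 obtains h where "bij_betw h J J'"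
 "real (card {x\<in>J. T' (h x) ~= T x}) <= (\<Sum>k\<in>K. \<bar>real (card {x\<in>J. T x = k})-real (card {x\<in>J'. T' x = k})\<bar>)"
proof -
 let ?C = "%k. {x\<in>J. T x = k}" and ?C' = "%k. {x\<in>J'. T' x = k}"
 define m where "m = (%k. min (card (?C k)) (card (?C' k)))"
 have "\<exists>w. fst w \<subseteq> ?C k \<and> fst (snd w) \<subseteq> ?C' k \<and> card (fst w) = m k \<and> bij_betw (snd (snd w)) (fst w) (fst (snd w))" for k
 proof -
 obtain A where A: "A \<subseteq> ?C k" "card A = m k" "finite A" by (rule obtain_subset_with_card_n[of "m k" "?C k"]) (auto simp: m_def)
 obtain A' where A': "A' \<subseteq> ?C' k" "card A' = m k" "finite A'" by (rule obtain_subset_with_card_n[of "m k" "?C' k"]) (auto simp: m_def)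
 obtain g where "bij_betw g A A'" using finite_same_card_bij[of A A'] A A' by auto
 then show ?thesis using A A' by (intro exI[of _ "(A, A', g)"]) simp
 qed
 then have "\<exists>w. \<forall>k. fst (w k) \<subseteq> ?C k \<and> fst (snd (w k)) \<subseteq> ?C' k \<and> card (fst (w k)) = m k \<and> bij_betw (snd (snd (w k))) (fst (w k)) (fst (snd (w k)))"
 by (intro choice allI)
 then obtain w where w: "\<forall>k. fst (w k) \<subseteq> ?C k \<and> fst (snd (w k)) \<subseteq> ?C' k \<and> card (fst (w k)) = m k \<and> bij_betw (snd (snd (w k))) (fst (w k)) (fst (snd (w k)))" ..
 define A A' g where "A = (%k. fst (w k))" and "A' = (%k. fst (snd (w k)))" and "g = (%k. snd (snd (w k)))"
 have A: "A k \<subseteq> ?C k" "A' k \<subseteq> ?C' k" "card (A k) = m k" and g: "bij_betw (g k) (A k) (A' k)" for k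
 unfolding A_def A'_def g_def by (rule w[THEN spec, of k, THEN conjunct1] w[THEN spec, of k, THEN conjunct2, THEN conjunct1]
 w[THEN spec, of k, THEN conjunct2, THEN conjunct2, THEN conjunct1] w[THEN spec, of k, THEN conjunct2, THEN conjunct2, THEN conjunct2])+
 define U where "U = (\<Union>k\<in>K. A k)"
 define U' where "U' = (\<Union>k\<in>K. A' k)"
 have U: "U \<subseteq> J" "U' \<subseteq> J'" unfolding U_def U'_def using A(1,2) by blast+
 define h0 where "h0 = (%x. g (T x) x)"
 have inU: "x : A (T x)" if "x : U" for x using that A(1) by (auto simp: U_def)
 have h0: "h0 x : A' (T x)" "T' (h0 x) = T x" if "x : U" for x
 proof -
 show "h0 x : A' (T x)" unfolding h0_def using bij_betwE[OF g] inU[OF that] by blast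
 then show "T' (h0 x) = T x" using A(2) by blast
 qed
 have b0: "bij_betw h0 U U'" unfolding bij_betw_def
 proof
 show "inj_on h0 U"
 proof (rule inj_onI)
 fix x y assume xy: "x : U" "y : U" "h0 x = h0 y"
 then have e: "T x = T y" using h0(2) by metis
 then show "x = y" using xy inU bij_betw_imp_inj_on[OF g, of "T x"] by (metis h0_def inj_onD)
 qed
 show "h0 ` U = U'"
 proof
 show "h0 ` U \<subseteq> U'" using h0(1) U T unfolding U'_def by (force simp: image_subset_iff)
 show "U' \<subseteq> h0 ` U"
 proof
 fix y assume "y : U'"
 then obtain k where k: "k : K" "y : A' k" by (auto simp: U'_def)
 then obtain x where x: "x : A k" "y = g k x" using bij_betw_imp_surj_on[OF g, of k] by blast
 then have "T x = k" using A(1) by blast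
 then show "y : h0 ` U" using x k by (auto simp: h0_def U_def)
 qed
 qed
 qed
 have "card (J-U) = card (J'-U')"
 using U fin card bij_betw_same_card[OF b0] by (simp add: card_Diff_subset finite_subset)
 then have "\<exists>h. bij_betw h (J-U) (J'-U')" by (intro finite_same_card_bij finite_Diff fin)
 then obtain h1 where h1: "bij_betw h1 (J-U) (J'-U')" ..
 define h where "h = (%x. if x : U then h0 x else h1 x)"
 show thesis
 proof (rule that[of h])
 have "bij_betw h (U \<union> (J-U)) (U' \<union> (J'-U'))"
 proof (rule bij_betw_combine)
 have "bij_betw h U U' = bij_betw h0 U U'" by (rule bij_betw_cong) (simp add: h_def)
 then show "bij_betw h U U'" using b0 by simp
 have "bij_betw h (J-U) (J'-U') = bij_betw h1 (J-U) (J'-U')" by (rule bij_betw_cong) (simp add: h_def)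
 then show "bij_betw h (J-U) (J'-U')" using h1 by simp
 qed auto
 then show "bij_betw h J J'" using U by (simp add: Un_absorb1)
 have "{x\<in>J. T' (h x) ~= T x} \<subseteq> (\<Union>k\<in>K. ?C k-A k)"
 proof
 fix x assume x: "x : {x\<in>J. T' (h x) ~= T x}"
 have "x \<notin> U"
 proof
 assume "x : U"
 then have "T' (h x) = T x" using h0(2) by (simp only: h_def if_True)
 then show False using x by simp
 qed
 moreover have "T x : K" using x T(1) by blast
 ultimately have "x : ?C (T x)-A (T x)" using x unfolding U_def by blast
 then show "x : (\<Union>k\<in>K. ?C k-A k)" using \<open>T x \<in> K\<close> by blast
 qed
 then have "card {x\<in>J. T' (h x) ~= T x} <= card (\<Union>k\<in>K. ?C k-A k)" by (intro card_mono) (use fin in auto)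
 also have "... <= (\<Sum>k\<in>K. card (?C k-A k))" by (rule card_UN_le[OF fin(3)])
 finally have "real (card {x\<in>J. T' (h x) ~= T x}) <= real (\<Sum>k\<in>K. card (?C k-A k))" by (rule of_nat_mono)
 also have "... = (\<Sum>k\<in>K. real (card (?C k-A k)))" by (rule of_nat_sum)
 also have "... <= (\<Sum>k\<in>K. \<bar>real (card (?C k))-real (card (?C' k))\<bar>)"
 proof (rule sum_mono)
 fix k
 have "finite (A k)" using A(1)[of k] fin(1) by (auto intro: finite_subset)
 then have "card (?C k-A k) = card (?C k)-m k" using A(1)[of k] A(3)[of k] by (simp add: card_Diff_subset)
 then show "real (card (?C k-A k)) <= \<bar>real (card (?C k))-real (card (?C' k))\<bar>" by (auto simp: m_def min_def)
 qed
 finally show "real (card {x\<in>J. T' (h x) ~= T x}) <= (\<Sum>k\<in>K. \<bar>real (card (?C k))-real (card (?C' k))\<bar>)" .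
 qed
qed

text \<open>After relabelling along a nearly type-preserving bijection, the two kernels differ only
  in rows and columns of mismatched vertices, of which there are at most card K * d.\<close>

lemma scaled_trace_types:
 assumes fin: "finite J" "finite J'" "finite K" and card: "card J = card J'" and ne: "J ~= {}" and z: "Im z > 0"
 and T: "T ` J \<subseteq> K" "T' ` J' \<subseteq> K" and v: "unit_kernel K v" and d: "d >= 0"
 and count: "!!k. k : K ==> \<bar>real (card {x\<in>J. T x = k})-real (card {x\<in>J'. T' x = k})\<bar> <= d"
 shows "cmod (scaled_trace J z (%x y. v (T x) (T y))-scaled_trace J' z (%x y. v (T' x) (T' y)))
 <= cut_const z*(2 * real (card K) * d/real (card J)+2/sqrt (real (card J)))"
proof -
 obtain h where h: "bij_betw h J J'"
 and bad: "real (card {x\<in>J. T' (h x) ~= T x}) <= (\<Sum>k\<in>K. \<bar>real (card {x\<in>J. T x = k})-real (card {x\<in>J'. T' x = k})\<bar>)"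
 using matching_bijection[OF fin card T] .
 have L: "real (card J) > 0" using fin ne by (simp add: card_gt_0_iff)
 define b where "b = (%x. of_bool (T' (h x) ~= T x) :: real)"
 have "(\<Sum>x\<in>J. b x) = real (card {x\<in>J. T' (h x) ~= T x})" using fin(1) by (simp add: b_def Int_def)
 also have "... <= (\<Sum>k\<in>K. d)" using bad sum_mono[OF count] by (rule order_trans)
 finally have bs: "(\<Sum>x\<in>J. b x) <= real (card K) * d" by simp
 have hT: "(%x. T' (h x)) ` J \<subseteq> K" using T(2) bij_betwE[OF h] by auto
 have "cmod (scaled_trace J z (%x y. v (T x) (T y))-scaled_trace J z (%x y. v (T' (h x)) (T' (h y))))
 <= cut_const z*(2 * real (card K) * d/real (card J)+2/sqrt (real (card J)))"
 proof (rule scaled_trace_cut[OF fin(1) ne z])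
 show "unit_kernel J (%x y. v (T x) (T y))" by (rule unit_kernel_comp[OF v T(1)])
 show "unit_kernel J (%x y. v (T' (h x)) (T' (h y)))" by (rule unit_kernel_comp[OF v hT])
 fix S S' assume S: "S \<subseteq> J" "S' \<subseteq> J"
 have "\<bar>\<Sum>x\<in>S. \<Sum>y\<in>S'. v (T x) (T y)-v (T' (h x)) (T' (h y))\<bar> <= (\<Sum>x\<in>S. \<Sum>y\<in>S'. b x + b y)"
 proof (intro order_trans[OF sum_abs] sum_mono)
 fix x y assume "x : S" "y : S'"
 then have K: "T x : K" "T y : K" "T' (h x) : K" "T' (h y) : K" using S T(1) hT by blast+
 show "\<bar>v (T x) (T y)-v (T' (h x)) (T' (h y))\<bar> <= b x + b y"
 using unit_kernelD(1,2)[OF v K(1,2)] unit_kernelD(1,2)[OF v K(3,4)] by (auto simp: b_def abs_le_iff)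
 qed
 also have "... <= (\<Sum>x\<in>J. \<Sum>y\<in>S'. b x + b y)" using S fin by (intro sum_mono2 sum_nonneg) (auto simp: b_def)
 also have "... <= (\<Sum>x\<in>J. \<Sum>y\<in>J. b x + b y)" using S fin by (intro sum_mono sum_mono2) (auto simp: b_def)
 also have "... = 2 * real (card J)*(\<Sum>x\<in>J. b x)" by (simp add: sum.distrib sum_distrib_left sum_distrib_right mult_ac)
 also have "... <= 2 * real (card J)*(real (card K) * d)" using bs by (intro mult_left_mono) auto
 also have "... = 2 * real (card K) * d/real (card J)*(real (card J))^2" using L by (simp add: power2_eq_square)
 finally show "\<bar>\<Sum>x\<in>S. \<Sum>y\<in>S'. v (T x) (T y)-v (T' (h x)) (T' (h y))\<bar> <= 2 * real (card K) * d/real (card J)*(real (card J))^2" .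
 qed (use d L in auto)
 then show ?thesis unfolding scaled_trace_relabel[OF fin(1) z h] .
qed

lemma lim_const_over_sqrt: "(%n. c/sqrt (real n)) \<longlonglongrightarrow> 0"
 by (intro tendsto_divide_0[OF tendsto_const] filterlim_at_top_imp_at_infinity
 filterlim_compose[OF sqrt_at_top filterlim_real_sequentially])

text \<open>A fractional assignment of vertices to kap types: \<open>p i k\<close> is the share of
  vertex i in type k and q gives the type proportions. The last clause bounds the difference of s
  and v in cut norm on the coupled space I x {1..kap}; it replaces the measure preserving maps of
  graphon theory by finite data.\<close>

definition step_coupling :: "'i set => ('i => 'i => real) => nat => (nat => nat => real) => (nat => real) => real => ('i => nat => real) => bool" where
 "step_coupling I s kap v q c p \<longleftrightarrow> finite I \<and> I ~= {} \<and> unit_kernel I s \<and> unit_kernel {1..kap} v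
 \<and> (\<forall>i\<in>I. \<forall>k\<in>{1..kap}. 0 <= p i k) \<and> (\<forall>i\<in>I. (\<Sum>k\<in>{1..kap}. p i k) = 1)
 \<and> (\<forall>k\<in>{1..kap}. (\<Sum>i\<in>I. p i k) = real (card I) * q k)
 \<and> (\<forall>S T. S \<subseteq> I \<times> {1..kap} \<longrightarrow> T \<subseteq> I \<times> {1..kap} \<longrightarrow>
 \<bar>\<Sum>x\<in>S. \<Sum>y\<in>T. (s (fst x) (fst y)-v (snd x) (snd y))*(p (fst x) (snd x) * p (fst y) (snd y))\<bar> <= c*(real (card I))^2)"

lemma step_coupling_types:
 assumes C: "step_coupling I s kap v q c p" and z: "Im z > 0" and c: "c >= 0" and M: "M > 0"
 obtains T where "T ` (I \<times> {..<M}) \<subseteq> {1..kap}"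
 "!!k. k : {1..kap} ==> \<bar>real (card {x\<in>I \<times> {..<M}. T x = k})-real M*(real (card I) * q k)\<bar> <= real (card I)"
 "cmod (scaled_trace (I \<times> {..<M}) z (%x y. v (T x) (T y))-scaled_trace I z s)
 <= cut_const z*(3 * c+2 * real kap/real M+4/sqrt (real (card I))) + blow_const z*((real kap)^2+1)/sqrt (real (card I))"
proof -
 have fin: "finite I" "I ~= {}" and s: "unit_kernel I s" and v: "unit_kernel {1..kap} v"
 and p: "!!i k. i : I ==> k : {1..kap} ==> 0 <= p i k" "!!i. i : I ==> (\<Sum>k\<in>{1..kap}. p i k) = 1"
 and q: "!!k. k : {1..kap} ==> (\<Sum>i\<in>I. p i k) = real (card I) * q k"
 and cut: "!!S T. S \<subseteq> I \<times> {1..kap} ==> T \<subseteq> I \<times> {1..kap} ==>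
 \<bar>\<Sum>x\<in>S. \<Sum>y\<in>T. (s (fst x) (fst y)-v (snd x) (snd y))*(p (fst x) (snd x) * p (fst y) (snd y))\<bar> <= c*(real (card I))^2"
 using C unfolding step_coupling_def by blast+
 have "\<exists>T. (\<forall>a<M. T a : {1..kap}) \<and> (\<forall>k\<in>{1..kap}. \<bar>real (card {a. a < M \<and> T a = k})-real M * p i k\<bar> <= 1)" if "i : I" for i
 using integer_rounding[where p = "p i" and kap = kap and M = M, OF p[OF that]] by metis
 then obtain T where T: "!!i a. i : I ==> a < M ==> T i a : {1..kap}"
 "!!i k. i : I ==> k : {1..kap} ==> \<bar>real (card {a. a < M \<and> T i a = k})-real M * p i k\<bar> <= 1" by metis
 show thesis
 proof (rule that[of "%x. T (fst x) (snd x)"])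
 show "(%x. T (fst x) (snd x)) ` (I \<times> {..<M}) \<subseteq> {1..kap}" using T(1) by fastforce
 show "\<bar>real (card {x\<in>I \<times> {..<M}. T (fst x) (snd x) = k})-real M*(real (card I) * q k)\<bar> <= real (card I)" if k: "k : {1..kap}" for k
 proof -
 have "{x\<in>I \<times> {..<M}. T (fst x) (snd x) = k} = Sigma I (%i. {a. a < M \<and> T i a = k})" by auto
 then have "real (card {x\<in>I \<times> {..<M}. T (fst x) (snd x) = k}) = (\<Sum>i\<in>I. real (card {a. a < M \<and> T i a = k}))"
 using fin by (simp add: card_SigmaI)
 moreover have "real M*(real (card I) * q k) = (\<Sum>i\<in>I. real M * p i k)" unfolding q[OF k, symmetric] by (rule sum_distrib_left)
 ultimately have "\<bar>real (card {x\<in>I \<times> {..<M}. T (fst x) (snd x) = k})-real M*(real (card I) * q k)\<bar>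
 = \<bar>\<Sum>i\<in>I. real (card {a. a < M \<and> T i a = k})-real M * p i k\<bar>" by (simp add: sum_subtractf)
 also have "... <= (\<Sum>i\<in>I. 1)" using T(2) k by (intro order_trans[OF sum_abs] sum_mono) auto
 finally show ?thesis by simp
 qed
 have "cmod (scaled_trace (I \<times> {..<M}) z (%x y. v (T (fst x) (snd x)) (T (fst y) (snd y)))-scaled_trace I z s)
 <= cut_const z*(3 * c+2 * real (card {1..kap})/real M+4/sqrt (real (card I)))
 + blow_const z*((real (card {1..kap}))^2+1)/sqrt (real (card I))"
 proof (rule blow_up_types[where T = "%x. T (fst x) (snd x)", OF fin(1) _ fin(2) z v s p c cut M])
 fix i k assume "i : I" "k : {1..kap}"
 then show "real (card {a. a < M \<and> T (fst (i, a)) (snd (i, a)) = k}) <= real M * p i k+1"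
 using T(2)[of i k] by (simp add: abs_le_iff)
 qed (use T(1) in auto)
 then show "cmod (scaled_trace (I \<times> {..<M}) z (%x y. v (T (fst x) (snd x)) (T (fst y) (snd y)))-scaled_trace I z s)
 <= cut_const z*(3 * c+2 * real kap/real M+4/sqrt (real (card I))) + blow_const z*((real kap)^2+1)/sqrt (real (card I))"
 by simp
 qed
qed

text \<open>The numbers of copies n' m and n m give both sides n n' m vertices with almost equal
  type counts. The errors from rounding and matching vanish as m grows, while the other errors do
  not depend on m.\<close>

theorem scaled_trace_step_comparison:
 assumes C: "step_coupling I s kap v q c p" and C': "step_coupling I' s' kap v q c p'" and z: "Im z > 0" and c: "c >= 0"
 defines "E \<equiv> %n. cut_const z*(3 * c+4/sqrt n) + blow_const z*((real kap)^2+1)/sqrt n"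
 shows "cmod (scaled_trace I z s-scaled_trace I' z s') <= E (real (card I))+E (real (card I'))"
proof -
 define n n' where "n = card I" and "n' = card I'"
 have fin: "finite I" "I ~= {}" "finite I'" "I' ~= {}" and v: "unit_kernel {1..kap} v"
 using C C' unfolding step_coupling_def by blast+
 have n: "n > 0" "n' > 0" using fin by (auto simp: n_def n'_def card_gt_0_iff)
 let ?D = "%m. cut_const z*(2 * real kap/real n'+2 * real kap/real n+2 * real kap*(real n + real n')/(real n * real n'))/real m
 +(cut_const z*2/sqrt (real n * real n'))/sqrt (real m)"
 have step: "cmod (scaled_trace I z s-scaled_trace I' z s') <= (E (real n)+E (real n'))+?D m" if m: "m > 0" for m :: nat
 proof -
 let ?J = "I \<times> {..<n' * m}" and ?J' = "I' \<times> {..<n * m}"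
 obtain T where T: "T ` ?J \<subseteq> {1..kap}"
 "!!k. k : {1..kap} ==> \<bar>real (card {x\<in>?J. T x = k})-real (n' * m)*(real n * q k)\<bar> <= real n"
 "cmod (scaled_trace ?J z (%x y. v (T x) (T y))-scaled_trace I z s)
 <= cut_const z*(3 * c+2 * real kap/real (n' * m)+4/sqrt (real n)) + blow_const z*((real kap)^2+1)/sqrt (real n)"
 using step_coupling_types[OF C z c, of "n' * m"] n m unfolding n_def by auto
 obtain T' where T': "T' ` ?J' \<subseteq> {1..kap}"
 "!!k. k : {1..kap} ==> \<bar>real (card {x\<in>?J'. T' x = k})-real (n * m)*(real n' * q k)\<bar> <= real n'"
 "cmod (scaled_trace ?J' z (%x y. v (T' x) (T' y))-scaled_trace I' z s')
 <= cut_const z*(3 * c+2 * real kap/real (n * m)+4/sqrt (real n')) + blow_const z*((real kap)^2+1)/sqrt (real n')"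
 using step_coupling_types[OF C' z c, of "n * m"] n m unfolding n'_def by auto
 have cJ: "card ?J = n * n' * m" "card ?J' = n * n' * m" by (simp_all add: card_cartesian_product n_def n'_def mult_ac)
 have "cmod (scaled_trace ?J z (%x y. v (T x) (T y))-scaled_trace ?J' z (%x y. v (T' x) (T' y)))
 <= cut_const z*(2 * real (card {1..kap})*(real n + real n')/real (card ?J)+2/sqrt (real (card ?J)))"
 proof (rule scaled_trace_types[OF _ _ _ _ _ z T(1) T'(1) v])
 show "?J ~= {}" using fin n m by (auto simp: lessThan_empty_iff)
 fix k assume k: "k : {1..kap}"
 have "real (n' * m)*(real n * q k) = real (n * m)*(real n' * q k)" by simp
 then show "\<bar>real (card {x\<in>?J. T x = k})-real (card {x\<in>?J'. T' x = k})\<bar> <= real n + real n'"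
 using T(2)[OF k] T'(2)[OF k] unfolding abs_le_iff by linarith
 qed (use fin cJ in auto)
 then have mid: "cmod (scaled_trace ?J z (%x y. v (T x) (T y))-scaled_trace ?J' z (%x y. v (T' x) (T' y)))
 <= cut_const z*(2 * real kap*(real n + real n')/(real n * real n')/real m+2/sqrt (real n * real n')/sqrt (real m))"
 unfolding cJ by (simp add: real_sqrt_mult)
 have tri: "cmod (a-d) <= cmod (b-a) + cmod (b-e) + cmod (e-d)" for a b d e :: complex
 using norm_triangle_ineq[of "(a-b)+(b-e)" "e-d"] norm_triangle_ineq[of "a-b" "b-e"] by (simp add: norm_minus_commute)
 have "cmod (scaled_trace I z s-scaled_trace I' z s') \<le>
 (cut_const z*(3 * c+2 * real kap/real (n' * m)+4/sqrt (real n)) + blow_const z*((real kap)^2+1)/sqrt (real n))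
 + cut_const z*(2 * real kap*(real n + real n')/(real n * real n')/real m+2/sqrt (real n * real n')/sqrt (real m))
 +(cut_const z*(3 * c+2 * real kap/real (n * m)+4/sqrt (real n')) + blow_const z*((real kap)^2+1)/sqrt (real n'))"
 by (rule order_trans[OF tri add_mono[OF add_mono[OF T(3) mid] T'(3)]])
 also have "... = (E (real n)+E (real n'))+?D m"
 unfolding E_def of_nat_mult divide_divide_eq_left[symmetric] by (simp add: algebra_simps add_divide_distrib)
 finally show ?thesis .
 qed
 have "(%m. (E (real n)+E (real n'))+?D m) \<longlonglongrightarrow> (E (real n)+E (real n'))+(0+0)"
 by (intro tendsto_add tendsto_const lim_const_over_n lim_const_over_sqrt)
 then have "cmod (scaled_trace I z s-scaled_trace I' z s') <= (E (real n)+E (real n'))+(0+0)"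
 by (rule LIMSEQ_le_const) (use step in \<open>auto intro!: exI[of _ 1]\<close>)
 then show ?thesis by (simp add: n_def n'_def)
qed

section \<open>Graphons on the unit interval and labellings by vertices\<close>

abbreviation (input) "UI \<equiv> unit_interval_measure"

lemma space_UI [simp]: "space UI = {0..1}"
 by (simp add: unit_interval_measure_def space_restrict_space)

lemma sets_UI: "A : sets UI \<longleftrightarrow> A : sets borel \<and> A \<subseteq> {0..1}"
 unfolding unit_interval_measure_def by (subst sets_restrict_space_iff) auto

lemma emeasure_UI: "A : sets UI ==> emeasure UI A = emeasure lborel A"
 using sets_UI[of A] unfolding unit_interval_measure_def by (subst emeasure_restrict_space) auto

lemma prob_space_UI: "prob_space UI"
 by (rule prob_spaceI) (simp add: emeasure_UI sets_UI)

lemma measurable_UI: "f : borel_measurable borel ==> f : borel_measurable UI"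
 unfolding unit_interval_measure_def by (rule measurable_restrict_space1) simp

interpretation UI: prob_space "unit_interval_measure" by (rule prob_space_UI)
interpretation QI: pair_prob_space "unit_interval_measure" "unit_interval_measure" by unfold_locales

abbreviation (input) "QU \<equiv> unit_interval_measure \<Otimes>\<^sub>M unit_interval_measure"

lemma measurable_QU:
 assumes "f : borel_measurable (borel :: (real \<times> real) measure)"
 shows "f : borel_measurable QU"
proof -
 have id: "(%x. x) : UI \<rightarrow>\<^sub>M borel" by (rule measurable_UI) simp
 have "(%p. (fst p, snd p)) : QU \<rightarrow>\<^sub>M borel \<Otimes>\<^sub>M borel"
 by (intro measurable_Pair measurable_compose[OF measurable_fst id] measurable_compose[OF measurable_snd id])
 then have "(%p. p) : QU \<rightarrow>\<^sub>M borel" by (simp add: borel_prod)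
 from measurable_compose[OF this assms] show ?thesis .
qed

lemma integrable_QU:
 fixes f :: "real \<times> real => real"
 assumes "f : borel_measurable QU" "!!p. p : {0..1} \<times> {0..1} ==> \<bar>f p\<bar> <= B"
 shows "integrable QU f"
 using assms by (intro QI.P.integrable_const_bound[where B = B]) (auto simp: space_pair_measure intro!: AE_I2)

text \<open>The cut norm is defined by Lebesgue integrals in the plane. For product sets inside the
  unit square it can be computed on the probability space of two independent uniform points, where
  measure preserving maps act.\<close>

lemma set_integral_lborel_eq_QU:
 fixes f :: "real \<times> real => real"
 assumes f: "f : borel_measurable borel" and B: "!!p. p : {0..1} \<times> {0..1} ==> \<bar>f p\<bar> <= B"
 and S: "S : sets UI" "T : sets UI"
 shows "(LINT p:(S \<times> T)|lborel. f p) = (\<integral>p. indicator (S \<times> T) p * f p \<partial>QU)"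
proof -
 define h where "h = (%p. indicator (S \<times> T) p * f p)"
 have ST: "S \<times> T : sets (lborel \<Otimes>\<^sub>M lborel)" "S \<subseteq> {0..1}" "T \<subseteq> {0..1}" using S by (auto simp: sets_UI)
 have "S \<times> T : sets (borel \<Otimes>\<^sub>M borel)" using S by (auto simp: sets_UI)
 then have ST': "S \<times> T : sets borel" unfolding borel_prod .
 have hm: "h : borel_measurable borel" unfolding h_def using f ST' by measurable
 have hB: "\<bar>h p\<bar> <= B" if "p : {0..1} \<times> {0..1}" for p
 using B[OF that] order_trans[OF abs_ge_zero B[OF that]] by (auto simp: h_def indicator_def)
 have i1: "integrable (lborel \<Otimes>\<^sub>M lborel) h"
 proof (rule integrableI_bounded_set[where A = "{0..1} \<times> {0..1}" and B = B])
 show "h : borel_measurable (lborel \<Otimes>\<^sub>M lborel)" using hm by (simp add: lborel_prod)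
 show "emeasure (lborel \<Otimes>\<^sub>M lborel) ({0..1 :: real} \<times> {0..1 :: real}) < \<infinity>"
 by (subst lborel.emeasure_pair_measure_Times) auto
 show "AE x in lborel \<Otimes>\<^sub>M lborel. x \<notin> {0..1} \<times> {0..1} \<longrightarrow> h x = 0" using ST(2,3) by (intro AE_I2) (auto simp: h_def indicator_def)
 qed (use hB in auto)
 have i2: "integrable QU h" by (rule integrable_QU[OF measurable_QU[OF hm] hB])
 have single: "(\<integral>x. g x \<partial>UI) = (\<integral>x. g x \<partial>lborel)" if "!!x. x \<notin> {0..1} ==> g x = 0" for g :: "real => real"
 proof -
 have "(\<integral>x. g x \<partial>UI) = (\<integral>x. indicator {0..1} x *\<^sub>R g x \<partial>lborel)"
 unfolding unit_interval_measure_def by (rule integral_restrict_space) simp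
 also have "... = (\<integral>x. g x \<partial>lborel)" using that by (intro Bochner_Integration.integral_cong) (auto simp: indicator_def)
 finally show ?thesis .
 qed
 have h0: "h (x, y) = 0" if "x \<notin> {0..1} \<or> y \<notin> {0..1}" for x y using that ST by (auto simp: h_def indicator_def)
 have "(LINT p:(S \<times> T)|lborel. f p) = (\<integral>p. h p \<partial>(lborel \<Otimes>\<^sub>M lborel))" by (simp add: set_lebesgue_integral_def h_def lborel_prod)
 also have "... = (\<integral>x. (\<integral>y. h (x, y) \<partial>lborel) \<partial>lborel)" by (rule lborel_pair.integral_fst'[OF i1, symmetric])
 also have "... = (\<integral>x. (\<integral>y. h (x, y) \<partial>UI) \<partial>lborel)" using h0 by (intro Bochner_Integration.integral_cong single[symmetric] refl) auto
 also have "... = (\<integral>x. (\<integral>y. h (x, y) \<partial>UI) \<partial>UI)" using h0 by (intro single[symmetric]) simp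
 also have "... = (\<integral>p. h p \<partial>QU)" by (rule QI.integral_fst'[OF i2])
 finally show ?thesis by (simp add: h_def)
qed

lemma integral_QU_mp:
 fixes g :: "real \<times> real => real"
 assumes s: "mp_map s" and g: "g : borel_measurable QU"
 shows "(\<integral>p. g p \<partial>QU) = (\<integral>p. g (s (fst p), s (snd p)) \<partial>QU)"
proof -
 have m: "s : UI \<rightarrow>\<^sub>M UI" and d: "distr UI UI s = UI" using s by (auto simp: mp_map_def)
 have mm: "(%p. (s (fst p), s (snd p))) : QU \<rightarrow>\<^sub>M QU"
 by (intro measurable_Pair measurable_compose[OF measurable_fst m] measurable_compose[OF measurable_snd m])
 have "distr UI UI s \<Otimes>\<^sub>M distr UI UI s = distr QU QU (%(x, y). (s x, s y))"
 by (rule pair_measure_distr[OF m m]) (simp add: d UI.sigma_finite_measure_axioms)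
 then have "QU = distr QU QU (%p. (s (fst p), s (snd p)))" by (simp add: d case_prod_beta')
 then have "(\<integral>p. g p \<partial>QU) = (\<integral>p. g p \<partial>distr QU QU (%p. (s (fst p), s (snd p))))" by simp
 also have "... = (\<integral>p. g (s (fst p), s (snd p)) \<partial>QU)" by (rule integral_distr[OF mm g])
 finally show ?thesis .
qed

lemma measurable_block_index [measurable]: "block_index N : borel \<rightarrow>\<^sub>M count_space UNIV"
proof -
 have "(%x. nat \<lfloor>real N * x\<rfloor>+1) : borel \<rightarrow>\<^sub>M count_space UNIV"
 by (rule measurable_compose[where N = "count_space UNIV" and g = "%k. nat k+1"])
 (auto intro!: measurable_compose[OF _ measurable_real_floor])
 then show ?thesis unfolding block_index_def[abs_def] by measurable
qed

text \<open>The last block has to be treated apart: it is closed, and it receives the point 1 by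
  definition and not by the floor.\<close>

lemma block_index_fibre:
 assumes N: "N >= 1" and i: "i : {1..N}"
 shows "{x\<in>{0..1}. block_index N x = i} = (if i = N then {(real N-1)/real N..1} else {(real i-1)/real N..<real i/real N})"
proof -
 have bi: "block_index N x = i \<longleftrightarrow> real i-1 <= real N * x \<and> real N * x < real i" if "0 <= x" "x < 1" for x
 proof -
 have "block_index N x = i \<longleftrightarrow> nat \<lfloor>real N * x\<rfloor> = i-1" using that i by (auto simp: block_index_def)
 also have "... \<longleftrightarrow> \<lfloor>real N * x\<rfloor> = int (i-1)" using that by (auto simp: nat_eq_iff)
 also have "... \<longleftrightarrow> real i-1 <= real N * x \<and> real N * x < real i" using i by (simp add: floor_eq_iff of_nat_diff)
 finally show ?thesis .
 qed
 have N0: "real N > 0" using N by simp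
 have lo: "real i-1 <= real N * x \<longleftrightarrow> (real i-1)/real N <= x" and hi: "real N * x < real i \<longleftrightarrow> x < real i/real N" for x
 using N0 by (auto simp: pos_divide_le_eq pos_less_divide_eq mult.commute)
 have i0: "0 <= (real i-1)/real N" "real i/real N <= 1" "(real N-1)/real N <= 1" using i N0 by auto
 have key: "(0 <= x \<and> x <= 1 \<and> block_index N x = i) = ((real i-1)/real N <= x \<and> x < real i/real N)" if x1: "x ~= 1" for x
 proof
 assume h: "0 <= x \<and> x <= 1 \<and> block_index N x = i"
 then have "0 <= x" "x < 1" using x1 by auto
 from bi[OF this] show "(real i-1)/real N <= x \<and> x < real i/real N" using h lo[of x] hi[of x] by blast
 next
 assume h: "(real i-1)/real N <= x \<and> x < real i/real N"
 have x: "0 <= x" "x < 1" using h i0(1,2) by linarith+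
 from bi[OF this] have "block_index N x = i" using h lo[of x] hi[of x] by blast
 then show "0 <= x \<and> x <= 1 \<and> block_index N x = i" using x by simp
 qed
 show ?thesis
 proof (cases "i = N")
 case True
 have "{x\<in>{0..1}. block_index N x = i} = {(real N-1)/real N..1}"
 proof (rule Set.set_eqI)
 fix x
 show "x : {x\<in>{0..1}. block_index N x = i} \<longleftrightarrow> x : {(real N-1)/real N..1}"
 proof (cases "x = 1")
 case x: True
 have "block_index N 1 = i" using True by (simp add: block_index_def)
 then show ?thesis unfolding x using i0(3) by simp
 next
 case False
 have e1: "real i/real N = 1" using True N0 by simp
 have "(0 <= x \<and> x <= 1 \<and> block_index N x = i) = ((real N-1)/real N <= x \<and> x < 1)"
 using key[OF False] unfolding e1 unfolding True .
 moreover have "x < 1 \<longleftrightarrow> x <= 1" using False by linarith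
 ultimately show ?thesis by simp
 qed
 qed
 then show ?thesis unfolding if_P[OF True] .
 next
 case False
 have "{x\<in>{0..1}. block_index N x = i} = {(real i-1)/real N..<real i/real N}"
 proof (rule Set.set_eqI)
 fix x
 show "x : {x\<in>{0..1}. block_index N x = i} \<longleftrightarrow> x : {(real i-1)/real N..<real i/real N}"
 proof (cases "x = 1")
 case x: True
 have "block_index N 1 ~= i" using False by (simp add: block_index_def)
 then show ?thesis unfolding x using i0(2) by simp
 next
 case x: False
 show ?thesis using key[OF x] by simp
 qed
 qed
 then show ?thesis unfolding if_not_P[OF False] .
 qed
qed

lemma measure_block_index: "N >= 1 ==> i : {1..N} ==> measure UI {x\<in>{0..1}. block_index N x = i} = 1/real N"
proof -
 assume N: "N >= 1" "i : {1..N}"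
 let ?A = "{x\<in>{0..1}. block_index N x = i}"
 have "?A : sets borel" unfolding block_index_fibre[OF N] by auto
 then have "emeasure UI ?A = emeasure lborel ?A" by (intro emeasure_UI) (auto simp: sets_UI)
 then have "measure UI ?A = measure lborel ?A" by (simp add: measure_def)
 also have "... = 1/real N" unfolding block_index_fibre[OF N] using N by (auto simp: field_simps)
 finally show ?thesis .
qed

lemma block_index_range: "N >= 1 ==> x : {0..1} ==> block_index N x : {1..N}"
proof -
 assume N: "N >= 1" and x: "x : {0..1}"
 have "nat \<lfloor>real N * x\<rfloor> < N" if "x ~= 1"
 proof -
 have "real N * x < real N*1" using N x that by (intro mult_strict_left_mono) auto
 then have "\<lfloor>real N * x\<rfloor> < int N" by (simp add: floor_less_iff)
 then show ?thesis using N by linarith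
 qed
 then show ?thesis using N by (auto simp: block_index_def)
qed

text \<open>Ensures that the infimum in \<open>cut_dist\<close> runs over a nonempty set.\<close>

lemma mp_bij_id: "mp_bij (%x. x)"
proof -
 have i: "inv_into {0..1} (%x. x) x = x" if "x : {0..1 :: real}" for x using inv_into_f_f[of "%x. x" "{0..1}" x] that by simp
 have "mp_map (%x. x)" by (simp add: mp_map_def distr_id)
 moreover have "mp_map (inv_into {0..1} (%x. x)) = mp_map (%x. x)"
 proof -
 have "inv_into {0..1} (%x. x) : UI \<rightarrow>\<^sub>M UI \<longleftrightarrow> (%x. x) : UI \<rightarrow>\<^sub>M UI" by (rule measurable_cong) (simp add: i)
 moreover have "distr UI UI (inv_into {0..1} (%x. x)) = distr UI UI (%x. x)" by (rule distr_cong) (simp_all add: i)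
 ultimately show ?thesis unfolding mp_map_def by (simp only:)
 qed
 ultimately show ?thesis by (simp add: mp_bij_def bij_betw_id[unfolded id_def])
qed

text \<open>The rearrangement is moved from the graphon to the profile: a labels points of the
  interval by vertices, with equal masses, so that s read through a is cut-close to W itself.
  Different profiles then live on one space, and their labels can be paired pointwise.\<close>

definition fits :: "nat => (nat => nat => real) => (real \<times> real => real) => real => (real => nat) => bool" where
 "fits N s W eps a \<longleftrightarrow> a : UI \<rightarrow>\<^sub>M count_space UNIV \<and> (\<forall>x\<in>{0..1}. a x : {1..N})
 \<and> (\<forall>i\<in>{1..N}. measure UI {x\<in>{0..1}. a x = i} = 1/real N)
 \<and> (\<forall>S\<in>sets UI. \<forall>T\<in>sets UI. \<bar>\<integral>p. indicator (S \<times> T) p*(s (a (fst p)) (a (snd p))-W p) \<partial>QU\<bar> <= eps)"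

lemma measurable_step:
 assumes "a : M \<rightarrow>\<^sub>M count_space UNIV" "b : M \<rightarrow>\<^sub>M count_space UNIV"
 shows "(%p. (s :: nat => nat => real) (a p) (b p)) : borel_measurable M"
 by (rule measurable_compose_countable[OF measurable_compose_countable[OF _ assms(2)] assms(1)]) simp

lemma graphonD:
 assumes "graphon W" "p : {0..1} \<times> {0..1}"
 shows "0 <= W p" "W p <= 1"
 using assms by (auto simp: graphon_def)

text \<open>If W composed with f is close to the empirical graphon, then the block index composed
  with the inverse of f is a labelling that fits W; the test sets are pulled back along f.\<close>

theorem fits_exists:
 assumes N: "N >= 1" and s: "unit_kernel {1..N} s" and W: "graphon W" and d: "cut_dist (empirical_graphon N s) W < eps"
 obtains a where "fits N s W eps a"
proof -
 have Wm: "W : borel_measurable borel" using W by (simp add: graphon_def)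
 define c where "c = (%f. cut_norm_dist (empirical_graphon N s) (%(x, y). W (f x, f y)))"
 have "\<exists>f. mp_bij f \<and> c f < eps"
 proof (rule ccontr)
 assume "\<not> ?thesis"
 then have ge: "eps <= c f" if "mp_bij f" for f using that by (simp add: not_less)
 have "eps <= (INF f\<in>Collect mp_bij. c f)" by (rule cINF_greatest) (use mp_bij_id ge in auto)
 then show False using d unfolding cut_dist_def c_def by linarith
 qed
 then obtain f where fc: "mp_bij f \<and> c f < eps" ..
 have f: "mp_bij f" and lt: "cut_norm_dist (empirical_graphon N s) (%(x, y). W (f x, f y)) < eps"
 using fc unfolding c_def by simp_all
 define f' where "f' = inv_into {0..1} f"
 have bij: "bij_betw f {0..1} {0..1}" and mp: "mp_map f" "mp_map f'" using f by (auto simp: mp_bij_def f'_def)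
 have fm: "f : UI \<rightarrow>\<^sub>M UI" "f' : UI \<rightarrow>\<^sub>M UI" using mp by (auto simp: mp_map_def)
 have f': "f' (f x) = x" "f x : {0..1}" "f' x : {0..1}" if "x : {0..1}" for x
 using that bij bij_betw_inv_into_left[OF bij that] bij_betwE[OF bij] bij_betwE[OF bij_betw_inv_into[OF bij]] by (auto simp: f'_def)
 \<comment> \<open>f is only controlled on [0, 1]; extending it by 0 gives a Borel function on the
   line without changing integrals over the unit square.\<close>
 define g where "g = (%x. if x : {0..1} then f x else 0)"
 have gm: "g : borel_measurable borel"
 proof -
 have "f : borel_measurable (restrict_space lborel {0..1})"
 using measurable_compose[OF fm(1) measurable_UI[of "%x. x"]] by (simp add: unit_interval_measure_def)
 then have "(%x. indicator {0..1} x *\<^sub>R f x) : borel_measurable lborel"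
 by (subst (asm) borel_measurable_restrict_space_iff) auto
 moreover have "(%x. indicator {0..1} x *\<^sub>R f x) = g" by (auto simp: g_def indicator_def)
 ultimately show ?thesis by simp
 qed
 have em: "empirical_graphon N s : borel_measurable borel"
 proof -
 have "empirical_graphon N s = (%p. if fst p : {0..1} \<and> snd p : {0..1} then s (block_index N (fst p)) (block_index N (snd p)) else 0)"
 by (auto simp: empirical_graphon_def)
 moreover have "(%p. s (block_index N (fst p)) (block_index N (snd p))) : borel_measurable borel"
 by (intro measurable_step measurable_compose[OF _ measurable_block_index]) (simp_all add: borel_prod[symmetric])
 ultimately show ?thesis by (simp add: borel_prod[symmetric])
 qed
 define D where "D = (%p. empirical_graphon N s p-W (g (fst p), g (snd p)))"
 have Dm: "D : borel_measurable borel"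
 proof -
 have "(%p. (g (fst p), g (snd p))) : borel \<rightarrow>\<^sub>M borel \<Otimes>\<^sub>M borel"
 unfolding borel_prod[symmetric] by (intro measurable_Pair measurable_compose[OF measurable_fst gm] measurable_compose[OF measurable_snd gm])
 moreover have "W : borel_measurable (borel \<Otimes>\<^sub>M borel)" using Wm by (simp only: borel_prod)
 ultimately have "(%p. W (g (fst p), g (snd p))) : borel_measurable borel" by (rule measurable_compose)
 then show ?thesis unfolding D_def using em by simp
 qed
 have DB: "\<bar>D p\<bar> <= 1" if p: "p : {0..1} \<times> {0..1}" for p
 proof -
 have x: "fst p : {0..1}" "snd p : {0..1}" using p by auto
 have "0 <= W (g (fst p), g (snd p))" "W (g (fst p), g (snd p)) <= 1"
 using graphonD[OF W, of "(g (fst p), g (snd p))"] f'(2)[OF x(1)] f'(2)[OF x(2)] x by (auto simp: g_def)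
 moreover have "0 <= empirical_graphon N s p" "empirical_graphon N s p <= 1"
 using unit_kernelD(1,2)[OF s block_index_range[OF N x(1)] block_index_range[OF N x(2)]] x by (auto simp: empirical_graphon_def split: prod.splits)
 ultimately show ?thesis unfolding D_def by linarith
 qed
 have val: "(LINT p:(S \<times> T)|lborel. empirical_graphon N s p-(case p of (x, y) => W (f x, f y))) = (\<integral>p. indicator (S \<times> T) p*D p \<partial>QU)"
 if S: "S : sets UI" "T : sets UI" for S T
 proof -
 have "(LINT p:(S \<times> T)|lborel. empirical_graphon N s p-(case p of (x, y) => W (f x, f y))) = (LINT p:(S \<times> T)|lborel. D p)"
 unfolding set_lebesgue_integral_def using S
 by (intro Bochner_Integration.integral_cong refl) (auto simp: D_def g_def sets_UI indicator_def subset_iff)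
 then show ?thesis using set_integral_lborel_eq_QU[OF Dm DB S] by simp
 qed
 \<comment> \<open>Gives boundedness of the family behind the supremum in the cut norm, so that each
   member lies below the supremum.\<close>
 have le1: "\<bar>\<integral>p. indicator (S \<times> T) p*D p \<partial>QU\<bar> <= 1" if S: "S : sets UI" "T : sets UI" for S T
 proof -
 have "\<bar>\<integral>p. indicator (S \<times> T) p*D p \<partial>QU\<bar> <= (\<integral>p. \<bar>indicator (S \<times> T) p*D p\<bar> \<partial>QU)" by (rule integral_abs_bound)
 also have "... <= (\<integral>p. 1 \<partial>QU)"
 proof (rule integral_mono)
 have "(%p. indicator (S \<times> T) p*D p) : borel_measurable QU" using S measurable_QU[OF Dm] by measurable
 then show "integrable QU (%p. \<bar>indicator (S \<times> T) p*D p\<bar>)" using DB by (intro integrable_abs integrable_QU[where B = 1]) (auto simp: indicator_def)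
 qed (use DB in \<open>auto simp: space_pair_measure indicator_def\<close>)
 finally show ?thesis using QI.P.prob_space by simp
 qed
 have small: "\<bar>\<integral>p. indicator (S \<times> T) p*D p \<partial>QU\<bar> <= eps" if S: "S : sets UI" "T : sets UI" for S T
 proof -
 let ?ST = "{(S, T). S : sets borel \<and> S \<subseteq> {0..1} \<and> T : sets borel \<and> T \<subseteq> {0..1 :: real}}"
 let ?v = "%ST. \<bar>LINT p:(fst ST \<times> snd ST)|lborel. empirical_graphon N s p-(case p of (x, y) => W (f x, f y))\<bar>"
 have "?v (S, T) <= (SUP ST\<in>?ST. ?v ST)"
 proof (rule cSUP_upper)
 show "bdd_above (?v ` ?ST)" by (rule bdd_aboveI[of _ 1]) (auto simp: val sets_UI le1)
 qed (use S in \<open>auto simp: sets_UI\<close>)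
 then show ?thesis using lt val[OF S] unfolding cut_norm_dist_def by simp
 qed
 define a where "a = (%x. block_index N (f' x))"
 have am: "a : UI \<rightarrow>\<^sub>M count_space UNIV"
 proof -
 have "block_index N : UI \<rightarrow>\<^sub>M count_space UNIV" unfolding unit_interval_measure_def by (rule measurable_restrict_space1) simp
 then show ?thesis unfolding a_def by (rule measurable_compose[OF fm(2)])
 qed
 have "fits N s W eps a" unfolding fits_def
 proof (intro conjI ballI am)
 fix i assume i: "i : {1..N}"
 have "{x\<in>{0..1}. block_index N x = i} : sets borel" unfolding block_index_fibre[OF N i] by simp
 moreover have "{x\<in>{0..1}. block_index N x = i} \<subseteq> {0..1}" by (rule Collect_restrict)
 ultimately have "{x\<in>{0..1}. block_index N x = i} : sets UI" unfolding sets_UI by (rule conjI)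
 then have "measure (distr UI UI f') {x\<in>{0..1}. block_index N x = i} = measure UI (f' -` {x\<in>{0..1}. block_index N x = i} \<inter> {0..1})"
 using measure_distr[OF fm(2)] by simp
 moreover have "distr UI UI f' = UI" using mp by (simp add: mp_map_def)
 moreover have "f' -` {x\<in>{0..1}. block_index N x = i} \<inter> {0..1} = {x\<in>{0..1}. a x = i}"
 proof (rule Set.set_eqI)
 fix x
 show "x : f' -` {x\<in>{0..1}. block_index N x = i} \<inter> {0..1} \<longleftrightarrow> x : {x\<in>{0..1}. a x = i}"
 proof (cases "x : {0..1}")
 case True then show ?thesis using f'(3)[OF True] by (simp add: a_def)
 next
 case False then show ?thesis by blast
 qed
 qed
 ultimately show "measure UI {x\<in>{0..1}. a x = i} = 1/real N" using measure_block_index[OF N i] by simp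
 next
 fix S T assume S: "S : sets UI" "T : sets UI"
 define S0 T0 where "S0 = f -` S \<inter> {0..1}" and "T0 = f -` T \<inter> {0..1}"
 have S0: "S0 : sets UI" "T0 : sets UI" unfolding S0_def T0_def using measurable_sets[OF fm(1)] S by auto
 have "(%p. s (a (fst p)) (a (snd p))) : borel_measurable QU"
 by (intro measurable_step measurable_compose[OF measurable_fst am] measurable_compose[OF measurable_snd am])
 then have "(%p. indicator (S \<times> T) p*(s (a (fst p)) (a (snd p))-W p)) : borel_measurable QU"
 using S measurable_QU[OF Wm] by measurable
 from integral_QU_mp[OF mp(1) this]
 have "(\<integral>p. indicator (S \<times> T) p*(s (a (fst p)) (a (snd p))-W p) \<partial>QU)
 = (\<integral>p. indicator (S \<times> T) (f (fst p), f (snd p))*(s (a (f (fst p))) (a (f (snd p)))-W (f (fst p), f (snd p))) \<partial>QU)" by simp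
 also have "... = (\<integral>p. indicator (S0 \<times> T0) p*D p \<partial>QU)"
 proof (rule Bochner_Integration.integral_cong[OF refl])
 fix p assume "p : space QU"
 then obtain x y where p: "p = (x, y)" "x : {0..1}" "y : {0..1}" by (auto simp: space_pair_measure)
 then show "indicator (S \<times> T) (f (fst p), f (snd p))*(s (a (f (fst p))) (a (f (snd p)))-W (f (fst p), f (snd p))) = indicator (S0 \<times> T0) p*D p"
 using f'(1)[OF p(2)] f'(1)[OF p(3)] by (auto simp: indicator_def S0_def T0_def D_def a_def g_def empirical_graphon_def)
 qed
 finally show "\<bar>\<integral>p. indicator (S \<times> T) p*(s (a (fst p)) (a (snd p))-W p) \<partial>QU\<bar> <= eps" using small[OF S0] by simp
 qed (use f'(3) block_index_range[OF N] in \<open>auto simp: a_def\<close>)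
 then show thesis by (rule that)
qed

lemma integral_step_QU:
 assumes a: "a : UI \<rightarrow>\<^sub>M count_space UNIV" and fin: "finite S" "finite T"
 shows "(\<integral>p. indicator ({u\<in>{0..1}. a u : S} \<times> {u\<in>{0..1}. a u : T}) p * g (a (fst p)) (a (snd p)) \<partial>QU)
 = (\<Sum>x\<in>S. \<Sum>y\<in>T. g x y*(measure UI {u\<in>{0..1}. a u = x} * measure UI {u\<in>{0..1}. a u = y}))"
proof -
 define E where "E = (%x. {u\<in>{0..1}. a u = x})"
 have E: "E x : sets UI" for x
 using measurable_sets[OF a, of "{x}"] by (auto simp: E_def vimage_def Int_def conj_commute)
 have mE: "measure QU (E x \<times> E y) = measure UI (E x) * measure UI (E y)" for x y
 using UI.emeasure_pair_measure_Times[OF E E, of x y] by (simp add: measure_def enn2real_mult)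
 have "(\<integral>p. indicator ({u\<in>{0..1}. a u : S} \<times> {u\<in>{0..1}. a u : T}) p * g (a (fst p)) (a (snd p)) \<partial>QU)
 = (\<integral>p. (\<Sum>x\<in>S. \<Sum>y\<in>T. g x y * indicator (E x \<times> E y) p) \<partial>QU)"
 proof (rule Bochner_Integration.integral_cong[OF refl])
 fix p assume "p : space QU"
 then obtain u w where p: "p = (u, w)" "u : {0..1}" "w : {0..1}" by (auto simp: space_pair_measure)
 have "(\<Sum>x\<in>S. \<Sum>y\<in>T. g x y * indicator (E x \<times> E y) p) = (\<Sum>x\<in>S. if x = a u then (\<Sum>y\<in>T. if y = a w then g x y else 0) else 0)"
 using p by (intro sum.cong refl) (auto simp: E_def indicator_def intro!: sum.cong sum.neutral)
 also have "... = indicator ({u\<in>{0..1}. a u : S} \<times> {u\<in>{0..1}. a u : T}) p * g (a (fst p)) (a (snd p))"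
 using p fin by (simp add: sum.delta' sum.delta indicator_def)
 finally show "indicator ({u\<in>{0..1}. a u : S} \<times> {u\<in>{0..1}. a u : T}) p * g (a (fst p)) (a (snd p)) = (\<Sum>x\<in>S. \<Sum>y\<in>T. g x y * indicator (E x \<times> E y) p)" by simp
 qed
 also have "... = (\<Sum>x\<in>S. \<Sum>y\<in>T. g x y * measure QU (E x \<times> E y))"
 using E by (subst Bochner_Integration.integral_sum, simp_all add: QI.P.emeasure_eq_measure Int_absorb2 sets.sets_into_space)
 finally show ?thesis unfolding mE by (simp add: E_def)
qed

lemma fitsD:
 assumes "fits N s W eps a"
 shows "a : UI \<rightarrow>\<^sub>M count_space UNIV" "!!x. x : {0..1} ==> a x : {1..N}"
 "!!i. i : {1..N} ==> measure UI {x\<in>{0..1}. a x = i} = 1/real N"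
 "!!S T. S : sets UI ==> T : sets UI ==> \<bar>\<integral>p. indicator (S \<times> T) p*(s (a (fst p)) (a (snd p))-W p) \<partial>QU\<bar> <= eps"
 using assms unfolding fits_def by blast+

lemma sets_fibre:
 assumes "c : UI \<rightarrow>\<^sub>M count_space UNIV"
 shows "{u\<in>{0..1}. c u : A} : sets UI"
proof -
 have "c -` A \<inter> space UI : sets UI" by (rule measurable_sets[OF assms]) simp
 moreover have "c -` A \<inter> space UI = {u\<in>{0..1}. c u : A}" by auto
 ultimately show ?thesis by simp
qed

lemma sum_measure_fibres:
 assumes c: "c : UI \<rightarrow>\<^sub>M count_space UNIV" and fin: "finite K" and inj: "inj_on f K"
 shows "(\<Sum>k\<in>K. measure UI {u\<in>{0..1}. c u = f k}) = measure UI {u\<in>{0..1}. c u : f ` K}"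
proof -
 let ?A = "%k. {u\<in>{0..1}. c u = f k}"
 have "measure UI (\<Union>k\<in>K. ?A k) = (\<Sum>k\<in>K. measure UI (?A k))"
 proof (rule UI.finite_measure_finite_Union[OF fin])
 show "?A ` K \<subseteq> sets UI" using sets_fibre[OF c, of "{f k}" for k] by auto
 show "disjoint_family_on ?A K" using inj by (auto simp: disjoint_family_on_def inj_on_def)
 qed
 moreover have "(\<Union>k\<in>K. ?A k) = {u\<in>{0..1}. c u : f ` K}" by auto
 ultimately show ?thesis by simp
qed

lemma integrable_fit:
 assumes W: "graphon W" and s: "unit_kernel {1..N} s" and a: "fits N s W eps a" and S: "S : sets UI" "T : sets UI"
 shows "integrable QU (%p. indicator (S \<times> T) p*(s (a (fst p)) (a (snd p))-W p))"
 "integrable QU (%p. indicator (S \<times> T) p * s (a (fst p)) (a (snd p)))"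
 "integrable QU W"
proof -
 have sm: "(%p. s (a (fst p)) (a (snd p))) : borel_measurable QU"
 by (intro measurable_step measurable_compose[OF measurable_fst fitsD(1)[OF a]] measurable_compose[OF measurable_snd fitsD(1)[OF a]])
 have Wm: "W : borel_measurable QU" using W by (intro measurable_QU) (simp add: graphon_def)
 have ind: "indicator (S \<times> T) : borel_measurable QU" using S by (intro borel_measurable_indicator pair_measureI)
 have sb: "0 <= s (a (fst p)) (a (snd p))" "s (a (fst p)) (a (snd p)) <= 1" if "p : {0..1} \<times> {0..1}" for p
 using unit_kernelD(1,2)[OF s fitsD(2)[OF a, of "fst p"] fitsD(2)[OF a, of "snd p"]] that by auto
 show "integrable QU W" using graphonD[OF W] by (intro integrable_QU[where B = 1] Wm) (auto simp: abs_le_iff intro: order_trans)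
 show "integrable QU (%p. indicator (S \<times> T) p * s (a (fst p)) (a (snd p)))"
 proof (rule integrable_QU[where B = 1])
 show "(%p. indicator (S \<times> T) p * s (a (fst p)) (a (snd p))) : borel_measurable QU" by (rule borel_measurable_times[OF ind sm])
 show "\<bar>indicator (S \<times> T) p * s (a (fst p)) (a (snd p))\<bar> <= 1" if "p : {0..1} \<times> {0..1}" for p
 using sb[OF that] by (simp add: indicator_def)
 qed
 show "integrable QU (%p. indicator (S \<times> T) p*(s (a (fst p)) (a (snd p))-W p))"
 proof (rule integrable_QU[where B = 1])
 show "(%p. indicator (S \<times> T) p*(s (a (fst p)) (a (snd p))-W p)) : borel_measurable QU"
 by (rule borel_measurable_times[OF ind borel_measurable_diff[OF sm Wm]])
 show "\<bar>indicator (S \<times> T) p*(s (a (fst p)) (a (snd p))-W p)\<bar> <= 1" if "p : {0..1} \<times> {0..1}" for p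
 proof -
 have "\<bar>s (a (fst p)) (a (snd p))-W p\<bar> <= 1" using sb[OF that] graphonD[OF W that] unfolding abs_le_iff by linarith
 then show ?thesis by (simp add: indicator_def)
 qed
 qed
qed

text \<open>The joint law of the two labels of a uniform point is the coupling; multiplied by N it
  becomes the share of a vertex. Sets of label pairs pull back to subsets of the interval, on which
  both step functions are eps-close to W, so the triangle inequality through W gives 2 eps.\<close>

lemma step_coupling_of_fits:
 assumes N: "N >= 1" "kap >= 1" and s: "unit_kernel {1..N} s" and v: "unit_kernel {1..kap} v" and W: "graphon W"
 and a: "fits N s W eps a" and b: "fits kap v W eps b"
 obtains p where "step_coupling {1..N} s kap v (%_. 1/real kap) (2 * eps) p"
proof -
 define c where "c = (%u. (a u, b u))"
 have cm: "c : UI \<rightarrow>\<^sub>M count_space UNIV"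
 proof -
 have "c : UI \<rightarrow>\<^sub>M count_space UNIV \<Otimes>\<^sub>M count_space UNIV"
 unfolding c_def by (intro measurable_Pair fitsD(1)[OF a] fitsD(1)[OF b])
 then show ?thesis by (simp add: pair_measure_countable)
 qed
 define P where "P = (%x. measure UI {u\<in>{0..1}. c u = x})"
 have rowP: "(\<Sum>k\<in>{1..kap}. P (i, k)) = 1/real N" if i: "i : {1..N}" for i
 proof -
 have "(\<Sum>k\<in>{1..kap}. P (i, k)) = measure UI {u\<in>{0..1}. c u : Pair i ` {1..kap}}"
 unfolding P_def by (rule sum_measure_fibres[OF cm]) (auto simp: inj_on_def)
 also have "{u\<in>{0..1}. c u : Pair i ` {1..kap}} = {u\<in>{0..1}. a u = i}" using fitsD(2)[OF b] by (fastforce simp: c_def)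
 finally show ?thesis using fitsD(3)[OF a i] by simp
 qed
 have colP: "(\<Sum>i\<in>{1..N}. P (i, k)) = 1/real kap" if k: "k : {1..kap}" for k
 proof -
 have "(\<Sum>i\<in>{1..N}. P (i, k)) = measure UI {u\<in>{0..1}. c u : (%i. (i, k)) ` {1..N}}"
 unfolding P_def by (rule sum_measure_fibres[OF cm]) (auto simp: inj_on_def)
 also have "{u\<in>{0..1}. c u : (%i. (i, k)) ` {1..N}} = {u\<in>{0..1}. b u = k}" using fitsD(2)[OF a] by (fastforce simp: c_def)
 finally show ?thesis using fitsD(3)[OF b k] by simp
 qed
 have N0: "real N > 0" using N by simp
 show thesis
 proof (rule that, unfold step_coupling_def, intro conjI ballI allI impI s v)
 fix i assume i: "i : {1..N}"
 show "(\<Sum>k\<in>{1..kap}. real N*P (i, k)) = 1" unfolding sum_distrib_left[symmetric] rowP[OF i] using N0 by simp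
 next
 fix k assume k: "k : {1..kap}"
 show "(\<Sum>i\<in>{1..N}. real N*P (i, k)) = real (card {1..N})*(1/real kap)"
 unfolding sum_distrib_left[symmetric] colP[OF k] by simp
 next
 fix S T assume ST: "S \<subseteq> {1..N} \<times> {1..kap}" "T \<subseteq> {1..N} \<times> {1..kap}"
 have fin: "finite S" "finite T" using ST by (auto intro: finite_subset)
 let ?S = "{u\<in>{0..1}. c u : S}" and ?T = "{u\<in>{0..1}. c u : T}"
 have m: "?S : sets UI" "?T : sets UI" by (rule sets_fibre[OF cm])+
 let ?f = "%p. indicator (?S \<times> ?T) p*(s (a (fst p)) (a (snd p))-W p)" and ?h = "%p. indicator (?S \<times> ?T) p*(v (b (fst p)) (b (snd p))-W p)"
 define g where "g = (%x y. s (fst x) (fst y)-v (snd x) (snd y))"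
 have "(\<Sum>x\<in>S. \<Sum>y\<in>T. g x y*(P x*P y)) = (\<integral>p. indicator (?S \<times> ?T) p * g (c (fst p)) (c (snd p)) \<partial>QU)"
 unfolding P_def by (rule integral_step_QU[OF cm fin, symmetric])
 also have "... = (\<integral>p. ?f p-?h p \<partial>QU)" by (intro Bochner_Integration.integral_cong refl) (simp add: g_def c_def algebra_simps)
 also have "... = (\<integral>p. ?f p \<partial>QU)-(\<integral>p. ?h p \<partial>QU)"
 by (rule Bochner_Integration.integral_diff[OF integrable_fit(1)[OF W s a m] integrable_fit(1)[OF W v b m]])
 finally have le: "\<bar>\<Sum>x\<in>S. \<Sum>y\<in>T. g x y*(P x*P y)\<bar> <= 2 * eps"
 using fitsD(4)[OF a m] fitsD(4)[OF b m] unfolding abs_le_iff by linarith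
 have "(\<Sum>x\<in>S. \<Sum>y\<in>T. (s (fst x) (fst y)-v (snd x) (snd y))*(real N*P (fst x, snd x)*(real N*P (fst y, snd y))))
 = (\<Sum>x\<in>S. \<Sum>y\<in>T. g x y*(P x*P y))*(real N)^2"
 unfolding sum_distrib_right by (intro sum.cong refl) (simp add: g_def power2_eq_square)
 then show "\<bar>\<Sum>x\<in>S. \<Sum>y\<in>T. (s (fst x) (fst y)-v (snd x) (snd y))*(real N*P (fst x, snd x)*(real N*P (fst y, snd y)))\<bar> <= 2 * eps*(real (card {1..N}))^2"
 using mult_right_mono[OF le, of "(real N)^2"] by (simp add: abs_mult)
 qed (use N in \<open>auto simp: P_def\<close>)
qed

lemma density_of_fits:
 assumes N: "N >= 1" and s: "unit_kernel {1..N} s" and W: "graphon W" and a: "fits N s W eps a"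
 shows "\<bar>(\<Sum>i\<in>{1..N}. \<Sum>j\<in>{1..N}. s i j)/(real N)^2-(\<integral>p. W p \<partial>QU)\<bar> <= eps"
proof -
 let ?A = "{u\<in>{0..1}. a u : {1..N}}"
 have A: "?A = {0..1}" using fitsD(2)[OF a] by auto
 have U: "{0..1} : sets UI" by (simp add: sets_UI)
 have "(\<integral>p. indicator ({0..1} \<times> {0..1}) p * s (a (fst p)) (a (snd p)) \<partial>QU) =
 (\<Sum>x\<in>{1..N}. \<Sum>y\<in>{1..N}. s x y*(measure UI {u\<in>{0..1}. a u = x} * measure UI {u\<in>{0..1}. a u = y}))"
 using integral_step_QU[OF fitsD(1)[OF a], of "{1..N}" "{1..N}" s] unfolding A by simp
 also have "... = (\<Sum>i\<in>{1..N}. \<Sum>j\<in>{1..N}. s i j)/(real N)^2"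
 unfolding sum_divide_distrib by (intro sum.cong refl) (simp only: fitsD(3)[OF a], simp add: power2_eq_square)
 finally have eq: "(\<integral>p. indicator ({0..1} \<times> {0..1}) p * s (a (fst p)) (a (snd p)) \<partial>QU) = (\<Sum>i\<in>{1..N}. \<Sum>j\<in>{1..N}. s i j)/(real N)^2" .
 have "(\<integral>p. indicator ({0..1} \<times> {0..1}) p*(s (a (fst p)) (a (snd p))-W p) \<partial>QU)
 = (\<integral>p. indicator ({0..1} \<times> {0..1}) p * s (a (fst p)) (a (snd p))-W p \<partial>QU)"
 by (intro Bochner_Integration.integral_cong refl) (auto simp: space_pair_measure)
 also have "... = (\<Sum>i\<in>{1..N}. \<Sum>j\<in>{1..N}. s i j)/(real N)^2-(\<integral>p. W p \<partial>QU)"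
 unfolding eq[symmetric] by (rule Bochner_Integration.integral_diff[OF integrable_fit(2)[OF W s a U U] integrable_fit(3)[OF W s a U U]])
 finally show ?thesis using fitsD(4)[OF a U U] by simp
qed

text \<open>A nonempty open set contains an open rectangle of positive measure; a vanishing integral
  would force W to be zero almost everywhere on it.\<close>

lemma graphon_integral_pos:
 assumes W: "graphon W" and U: "open U" "U ~= {}" "U \<subseteq> unit_sq" "!!p. p : U ==> W p > 0"
 shows "(\<integral>p. W p \<partial>QU) > 0"
proof -
 have Wm: "W : borel_measurable QU" using W by (intro measurable_QU) (simp add: graphon_def)
 have Wi: "integrable QU W" using graphonD[OF W] by (intro integrable_QU[where B = 1] Wm) (auto simp: abs_le_iff intro: order_trans)
 have nn: "AE p in QU. 0 <= W p" using graphonD(1)[OF W] by (intro AE_I2) (simp add: space_pair_measure)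
 obtain q where "q : U" using U by blast
 then obtain A B where AB: "open A" "open B" "fst q : A" "snd q : B" "A \<times> B \<subseteq> U"
 using open_prod_elim[OF U(1)] by (metis mem_Times_iff)
 obtain e where e: "e > 0" "ball (fst q) e \<subseteq> A" using AB(1,3) openE by blast
 obtain d where d: "d > 0" "ball (snd q) d \<subseteq> B" using AB(2,4) openE by blast
 define A' B' where "A' = {fst q-e<..<fst q + e}" and "B' = {snd q-d<..<snd q + d}"
 have sub: "A' \<subseteq> A" "B' \<subseteq> B" using e d by (auto simp: A'_def B'_def ball_def dist_real_def subset_iff)
 have box: "A' \<times> B' \<subseteq> U" using sub AB(5) by blast
 have ne: "fst q : A'" "snd q : B'" using e d by (auto simp: A'_def B'_def)
 have "A' \<subseteq> {0..1}"
 proof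
 fix x assume "x : A'"
 then have "(x, snd q) : unit_sq" using box U(3) ne by blast
 then show "x : {0..1}" by (simp add: unit_sq_def)
 qed
 moreover have "B' \<subseteq> {0..1}"
 proof
 fix x assume "x : B'"
 then have "(fst q, x) : unit_sq" using box U(3) ne by blast
 then show "x : {0..1}" by (simp add: unit_sq_def)
 qed
 moreover have "A' : sets borel" "B' : sets borel" by (simp_all add: A'_def B'_def)
 ultimately have S: "A' : sets UI" "B' : sets UI" by (simp_all only: sets_UI simp_thms)
 have "emeasure QU (A' \<times> B') = emeasure UI A' * emeasure UI B'" by (rule UI.emeasure_pair_measure_Times[OF S])
 also have "... = ennreal (2 * e) * ennreal (2 * d)" unfolding emeasure_UI[OF S(1)] emeasure_UI[OF S(2)] using e d by (simp add: A'_def B'_def)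
 finally have pos: "emeasure QU (A' \<times> B') ~= 0" using e d by simp
 show ?thesis
 proof (rule ccontr)
 assume "\<not> ?thesis"
 then have "(\<integral>p. W p \<partial>QU) = 0" using integral_nonneg_AE[OF nn] by linarith
 then have "AE p in QU. W p = 0" using integral_nonneg_eq_0_iff_AE[OF Wi nn] by simp
 then have "AE p in QU. p \<notin> A' \<times> B'" by eventually_elim (use box U(4) in force)
 then have "emeasure QU (A' \<times> B') = 0" using S by (subst (asm) AE_iff_measurable[where N = "A' \<times> B'"]) (auto simp: space_pair_measure sets_UI)
 then show False using pos by simp
 qed
qed

section \<open>Convergence of the normalised traces\<close>

context
 fixes W :: "real \<times> real => real" and s :: "nat => nat => nat => real"
 assumes W: "graphon W" and s: "!!N. unit_kernel {1..N} (s N)"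
 and L3: "(%N. cut_dist (empirical_graphon N (s N)) W) \<longlonglongrightarrow> 0"
begin

lemma eventually_fits:
 assumes "eps > 0"
 obtains N0 where "N0 >= 1" "!!N. N >= N0 ==> \<exists>a. fits N (s N) W eps a"
proof -
 have "\<forall>\<^sub>F N in sequentially. cut_dist (empirical_graphon N (s N)) W < eps" using order_tendstoD(2)[OF L3 assms] .
 then obtain N1 where N1: "!!N. N >= N1 ==> cut_dist (empirical_graphon N (s N)) W < eps" unfolding eventually_sequentially by blast
 show thesis
 proof (rule that[of "max 1 N1"])
 fix N assume "N >= max 1 N1"
 then have "N >= 1" "cut_dist (empirical_graphon N (s N)) W < eps" using N1 by auto
 then show "\<exists>a. fits N (s N) W eps a" using fits_exists[OF _ s W] by metis
 qed simp
qed

lemma density_limit: "(%N. (\<Sum>i\<in>{1..N}. \<Sum>j\<in>{1..N}. s N i j)/(real N)^2) \<longlonglongrightarrow> (\<integral>p. W p \<partial>QU)"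
proof (rule LIMSEQ_I)
 fix r :: real assume r: "r > 0"
 then have r2: "r/2 > 0" by simp
 obtain N0 where N0: "N0 >= 1" "!!N. N >= N0 ==> \<exists>a. fits N (s N) W (r/2) a" using eventually_fits[OF r2] by blast
 show "\<exists>no. \<forall>N\<ge>no. norm ((\<Sum>i\<in>{1..N}. \<Sum>j\<in>{1..N}. s N i j)/(real N)^2-(\<integral>p. W p \<partial>QU)) < r"
 proof (intro exI[of _ N0] allI impI)
 fix N assume N: "N >= N0"
 then obtain a where a: "fits N (s N) W (r/2) a" using N0 by blast
 have "N >= 1" using N N0 by simp
 from density_of_fits[OF this s W a] show "norm ((\<Sum>i\<in>{1..N}. \<Sum>j\<in>{1..N}. s N i j)/(real N)^2-(\<integral>p. W p \<partial>QU)) < r" using r by simp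
 qed
qed

text \<open>The reference with kap types is the profile of size kap itself. It is fixed as soon as
  its cut error is small, and only then do the sizes m and n grow, so the factor kap^2 + 1 is
  divided by an unbounded square root.\<close>

theorem scaled_trace_convergent:
 assumes z: "Im z > 0"
 shows "convergent (%N. scaled_trace {1..N} z (s N))"
proof (rule Cauchy_convergent, rule metric_CauchyI)
 fix e :: real assume e: "e > 0"
 define C where "C = cut_const z"
 have C: "C >= 0" unfolding C_def by (rule cut_const_nonneg[OF z])
 \<comment> \<open>Two comparisons, in each of which the cut bound 2 eps enters three times, give 12
   C eps; C + 1 keeps the denominator positive.\<close>
 define eps where "eps = e/(24*(C+1))"
 have eps: "eps > 0" using e C by (simp add: eps_def)
 have Ceps: "12*(C * eps) <= e/2"
 proof -
 have "C * eps <= (C+1) * eps" using eps by (intro mult_right_mono) auto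
 also have "(C+1) * eps = e/24"
 proof -
 define h where "h = C+1"
 have "h ~= 0" using C by (simp add: h_def)
 then show ?thesis unfolding eps_def h_def[symmetric] by simp
 qed
 finally show ?thesis by simp
 qed
 obtain kap where kap: "kap >= 1" "!!N. N >= kap ==> \<exists>a. fits N (s N) W eps a" using eventually_fits[OF eps] by blast
 then obtain b where b: "fits kap (s kap) W eps b" by blast
 define D where "D = 4*C + blow_const z*((real kap)^2+1)"
 have "\<forall>\<^sub>F n in sequentially. D/sqrt (real n) < e/4" using e by (intro order_tendstoD(2)[OF lim_const_over_sqrt]) simp
 then obtain N1 where N1: "!!n. n >= N1 ==> D/sqrt (real n) < e/4" unfolding eventually_sequentially by blast
 show "\<exists>M. \<forall>m\<ge>M. \<forall>n\<ge>M. dist (scaled_trace {1..m} z (s m)) (scaled_trace {1..n} z (s n)) < e"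
 proof (intro exI[of _ "max kap N1"] allI impI)
 fix m n assume mn: "m >= max kap N1" "n >= max kap N1"
 have c: "\<exists>p. step_coupling {1..N} (s N) kap (s kap) (%_. 1/real kap) (2 * eps) p" if N: "N >= max kap N1" for N
 proof -
 obtain a where a: "fits N (s N) W eps a" using kap(2)[of N] N by auto
 have "N >= 1" using N kap(1) by simp
 from step_coupling_of_fits[OF this kap(1) s s W a b] show ?thesis by blast
 qed
 obtain p p' where p: "step_coupling {1..m} (s m) kap (s kap) (%_. 1/real kap) (2 * eps) p"
 "step_coupling {1..n} (s n) kap (s kap) (%_. 1/real kap) (2 * eps) p'" using c[OF mn(1)] c[OF mn(2)] by blast
 have E: "cut_const z*(3*(2 * eps)+4/sqrt x) + blow_const z*((real kap)^2+1)/sqrt x = 6*(C * eps)+D/sqrt x" for x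
 by (simp add: D_def C_def algebra_simps add_divide_distrib)
 have "cmod (scaled_trace {1..m} z (s m)-scaled_trace {1..n} z (s n)) <= (6*(C * eps)+D/sqrt (real m))+(6*(C * eps)+D/sqrt (real n))"
 using scaled_trace_step_comparison[OF p z] eps unfolding E by simp
 moreover have "D/sqrt (real m) < e/4" "D/sqrt (real n) < e/4" using N1 mn by auto
 ultimately show "dist (scaled_trace {1..m} z (s m)) (scaled_trace {1..n} z (s n)) < e" using Ceps unfolding dist_norm by linarith
 qed
qed

end

section \<open>Rates on the strict upper triangle\<close>

text \<open>The independent entries sit strictly above the diagonal, so each unordered pair uses one
  orientation with the full rate. Loops get rate 0, as diagonal entries of a matrix do not enter its
  Laplacian.\<close>

definition upper_rates :: "nat => (nat => nat => real) => nat \<times> nat => real" where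
 "upper_rates N s = (%(i, j). if i < j then s i j/real N else 0)"

lemma upper_rates_bounds:
 assumes "unit_kernel {1..N} s" "e : {1..N} \<times> {1..N}"
 shows "0 <= upper_rates N s e" "upper_rates N s e <= 1/real N"
 using unit_kernelD(1,2)[OF assms(1), of "fst e" "snd e"] assms(2)
 by (auto simp: upper_rates_def split: prod.splits intro!: divide_right_mono)

lemma upper_rates_row:
 assumes s: "unit_kernel {1..N} s" and i: "i : {1..N}"
 shows "(\<Sum>j\<in>{1..N}. upper_rates N s (i, j) + upper_rates N s (j, i)) <= 1"
proof -
 have N: "real N > 0" using i by simp
 have "(\<Sum>j\<in>{1..N}. upper_rates N s (i, j) + upper_rates N s (j, i)) <= (\<Sum>j\<in>{1..N}. 1/real N)"
 proof (rule sum_mono)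
 fix j assume j: "j : {1..N}"
 have "upper_rates N s (i, j) + upper_rates N s (j, i) <= s i j/real N"
 using unit_kernelD[OF s i j] by (auto simp: upper_rates_def)
 also have "... <= 1/real N" using unit_kernelD(2)[OF s i j] by (intro divide_right_mono) auto
 finally show "upper_rates N s (i, j) + upper_rates N s (j, i) <= 1/real N" .
 qed
 then show ?thesis using N by simp
qed

lemma upper_rates_sum:
 assumes s: "unit_kernel {1..N} s" and N: "N >= 1"
 shows "(\<Sum>e\<in>{1..N} \<times> {1..N}. upper_rates N s e) >= ((\<Sum>i\<in>{1..N}. \<Sum>j\<in>{1..N}. s i j)/real N-1)/2"
proof -
 let ?I = "{1..N}" and ?u = "upper_rates N s"
 have N0: "real N > 0" using N by simp
 have S: "(\<Sum>e\<in>?I \<times> ?I. ?u e) = (\<Sum>i\<in>?I. \<Sum>j\<in>?I. ?u (i, j))" by (simp add: sum.cartesian_product)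
 have S': "(\<Sum>i\<in>?I. \<Sum>j\<in>?I. ?u (j, i)) = (\<Sum>i\<in>?I. \<Sum>j\<in>?I. ?u (i, j))" by (rule sum.swap)
 have "(\<Sum>i\<in>?I. \<Sum>j\<in>?I. s i j)/real N-1 <= (\<Sum>i\<in>?I. \<Sum>j\<in>?I. ?u (i, j)+?u (j, i))"
 proof -
 have "(\<Sum>i\<in>?I. \<Sum>j\<in>?I. s i j/real N) <= (\<Sum>i\<in>?I. \<Sum>j\<in>?I. (?u (i, j)+?u (j, i))+1/real N * of_bool (j = i))"
 proof (intro sum_mono)
 fix i j assume ij: "i : ?I" "j : ?I"
 have "s i j/real N <= 1/real N" using unit_kernelD(2)[OF s ij] by (intro divide_right_mono) auto
 then show "s i j/real N <= (?u (i, j)+?u (j, i))+1/real N * of_bool (j = i)"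
 using unit_kernelD(3)[OF s ij] by (cases i j rule: linorder_cases) (auto simp: upper_rates_def)
 qed
 also have "... = (\<Sum>i\<in>?I. \<Sum>j\<in>?I. ?u (i, j)+?u (j, i))+(\<Sum>i\<in>?I. \<Sum>j\<in>?I. 1/real N * of_bool (j = i))"
 by (simp only: sum.distrib)
 also have "(\<Sum>i\<in>?I. \<Sum>j\<in>?I. 1/real N * of_bool (j = i)) = (\<Sum>i\<in>?I. 1/real N)"
 by (intro sum.cong refl sum_of_bool_mult_left(4)) auto
 also have "... = 1" using N0 by simp
 finally show ?thesis by (simp add: sum_divide_distrib)
 qed
 also have "... = 2*(\<Sum>e\<in>?I \<times> ?I. ?u e)" unfolding S using S' by (simp add: sum.distrib)
 finally show ?thesis by simp
qed

text \<open>\<open>cut_comparison\<close> sees only symmetrised rates in its cut term, and off the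
  diagonal these agree with the ones of the symmetric profile; the diagonal contributes at most
  1.\<close>

lemma mean_trace_upper_rates:
 assumes s: "unit_kernel {1..N} s" and N: "N >= 1" and z: "Im z > 0"
 shows "cmod (mean_trace {1..N} z (upper_rates N s)/of_nat N-scaled_trace {1..N} z s) <= cut_const z*(1/real N+2/sqrt (real N))"
proof -
 let ?I = "{1..N}" and ?u = "upper_rates N s" and ?t = "%(x, y). s x y/(2 * real N)"
 have N0: "real N > 0" using N by simp
 have tb: "0 <= ?t e \<and> ?t e <= 1/real N" if "e : ?I \<times> ?I" for e
 using unit_kernelD(1,2)[OF s, of "fst e" "snd e"] that N0 by (auto simp: field_simps)
 have ub: "0 <= ?u e \<and> ?u e <= 1/real N" if "e : ?I \<times> ?I" for e using upper_rates_bounds[OF s that] by simp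
 have "cmod (mean_trace ?I z ?u-mean_trace ?I z ?t) <= cut_const z*(1 + sqrt (1/real N)*((\<Sum>e\<in>?I \<times> ?I. \<bar>?u e-?t e\<bar>) + real (card ?I)))"
 proof (rule cut_comparison[OF _ z])
 fix S T assume ST: "S \<subseteq> ?I" "T \<subseteq> ?I"
 have "\<bar>\<Sum>i\<in>S. \<Sum>j\<in>T. (?u (i, j)-?t (i, j))+(?u (j, i)-?t (j, i))\<bar> <= (\<Sum>i\<in>S. \<Sum>j\<in>T. 1/real N * of_bool (j = i))"
 proof (intro order_trans[OF sum_abs] sum_mono)
 fix i j assume "i : S" "j : T"
 then have ij: "i : ?I" "j : ?I" using ST by auto
 have "s i j/real N <= 1/real N" "0 <= s i j/real N" using unit_kernelD(1,2)[OF s ij] by (auto intro!: divide_right_mono)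
 then show "\<bar>(?u (i, j)-?t (i, j))+(?u (j, i)-?t (j, i))\<bar> <= 1/real N * of_bool (j = i)"
 using unit_kernelD(3)[OF s ij] N0 by (cases i j rule: linorder_cases) (auto simp: upper_rates_def)
 qed
 also have "... <= (\<Sum>i\<in>?I. \<Sum>j\<in>?I. 1/real N * of_bool (j = i))"
 using ST by (intro order_trans[OF sum_mono[OF sum_mono2] sum_mono2] sum_nonneg) auto
 also have "... = (\<Sum>i\<in>?I. 1/real N)" by (intro sum.cong refl sum_of_bool_mult_left(4)) auto
 also have "... = 1" using N0 by simp
 finally show "\<bar>\<Sum>i\<in>S. \<Sum>j\<in>T. (?u (i, j)-?t (i, j))+(?u (j, i)-?t (j, i))\<bar> <= 1" .
 qed (use tb ub N0 in auto)
 also have "... <= cut_const z*(1 + sqrt (1/real N)*(real N + real N))"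
 proof -
 have "(\<Sum>e\<in>?I \<times> ?I. \<bar>?u e-?t e\<bar>) <= (\<Sum>e\<in>?I \<times> ?I. 1/real N)"
 proof (rule sum_mono)
 fix e assume e: "e : ?I \<times> ?I"
 show "\<bar>?u e-?t e\<bar> <= 1/real N" using tb[OF e] ub[OF e] unfolding abs_le_iff by linarith
 qed
 also have "... = real N" using N0 by (simp add: card_cartesian_product)
 finally show ?thesis using cut_const_nonneg[OF z] by (intro mult_left_mono add_left_mono add_mono) auto
 qed
 also have "... = cut_const z*(1/real N+2/sqrt (real N)) * real N"
 proof -
 have "sqrt (1/real N)*(real N + real N) = 2/sqrt (real N) * real N" by (simp add: real_sqrt_divide)
 then show ?thesis using N0 by (simp add: algebra_simps)
 qed
 finally have le: "cmod (mean_trace ?I z ?u-mean_trace ?I z ?t) <= cut_const z*(1/real N+2/sqrt (real N)) * real N" .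
 have "cmod (mean_trace ?I z ?u/of_nat N-scaled_trace ?I z s) = cmod (mean_trace ?I z ?u-mean_trace ?I z ?t)/real N"
 by (simp add: scaled_trace_def diff_divide_distrib[symmetric] norm_divide)
 then show ?thesis using le N0 by (simp add: pos_divide_le_eq)
qed

section \<open>Eigenvalues as roots of the characteristic polynomial\<close>

lemma proots_linear_list: "proots (\<Prod>a\<leftarrow>xs. [:- a, 1:]) = mset (xs :: real list)"
proof (induction xs)
 case (Cons a xs)
 have "(\<Prod>a\<leftarrow>xs. [:- a, 1:]) ~= 0" by (auto simp: prod_list_zero_iff)
 then have "proots ([:- a, 1:]*(\<Prod>a\<leftarrow>xs. [:- a, 1:])) = proots [:- a, 1:] + proots (\<Prod>a\<leftarrow>xs. [:- a, 1:])"
 by (intro proots_mult) auto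
 then show ?case unfolding list.map prod_list.Cons Cons proots_linear_factor by simp
qed simp

text \<open>The eigenvector matrix conjugates the given matrix to a diagonal one. The shifts by
  \<open>Suc\<close> come from \<open>to_mat\<close>, whose positions start at 0 while vertices
  start at 1.\<close>

lemma char_poly_spectral:
 assumes sp: "spectral {1..N} M lam u"
 shows "char_poly (to_mat N M) = (\<Prod>a\<leftarrow>map lam [1..<Suc N]. [:- a, 1:])"
proof -
 define Q where "Q = Matrix.mat N N (%(k, i). u (Suc k) (Suc i))"
 define P where "P = Matrix.mat N N (%(i, k). u (Suc k) (Suc i))"
 define D where "D = Matrix.mat N N (%(k, l). if k = l then lam (Suc k) else 0)"
 have c: "Q : carrier_mat N N" "P : carrier_mat N N" "D : carrier_mat N N" "to_mat N M : carrier_mat N N"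
 by (simp_all add: Q_def P_def D_def to_mat_def)
 have shift: "(\<Sum>k\<in>{0..<N}. f (Suc k)) = (\<Sum>k\<in>{1..N}. f k)" for f :: "nat => real"
 using sum.shift_bounds_Suc_ivl[of f 0 N] by (simp add: atLeastLessThanSuc_atLeastAtMost)
 have orth: "(\<Sum>i\<in>{1..N}. u k i * u l i) = of_bool (k = l)" "(\<Sum>k\<in>{1..N}. u k i * u k j) = of_bool (i = j)"
 "(\<Sum>j\<in>{1..N}. M i j * u k j) = lam k * u k i" if "k : {1..N}" "l : {1..N}" "i : {1..N}" "j : {1..N}" for k l i j
 using sp that unfolding spectral_def by blast+
 have QP: "Q*P = 1\<^sub>m N"
 proof (rule eq_matI)
 fix k l assume "k < dim_row (1\<^sub>m N)" "l < dim_col (1\<^sub>m N)"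
 then have kl: "k < N" "l < N" by simp_all
 have "(Q*P) $$ (k, l) = (\<Sum>i\<in>{0..<N}. u (Suc k) (Suc i) * u (Suc l) (Suc i))"
 using kl by (simp add: Q_def P_def scalar_prod_def)
 also have "... = (\<Sum>i\<in>{1..N}. u (Suc k) i * u (Suc l) i)" by (rule shift)
 also have "... = of_bool (Suc k = Suc l)" using kl by (intro orth(1)[of _ _ 1 1]) auto
 finally show "(Q*P) $$ (k, l) = 1\<^sub>m N $$ (k, l)" using kl by simp
 qed (simp_all add: Q_def P_def)
 have PQ: "P*Q = 1\<^sub>m N"
 proof (rule eq_matI)
 fix i j assume "i < dim_row (1\<^sub>m N)" "j < dim_col (1\<^sub>m N)"
 then have ij: "i < N" "j < N" by simp_all
 have "(P*Q) $$ (i, j) = (\<Sum>k\<in>{0..<N}. u (Suc k) (Suc i) * u (Suc k) (Suc j))"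
 using ij by (simp add: Q_def P_def scalar_prod_def)
 also have "... = (\<Sum>k\<in>{1..N}. u k (Suc i) * u k (Suc j))" by (rule shift)
 also have "... = of_bool (Suc i = Suc j)" using ij by (intro orth(2)[of 1 1]) auto
 finally show "(P*Q) $$ (i, j) = 1\<^sub>m N $$ (i, j)" using ij by simp
 qed (simp_all add: Q_def P_def)
 have AP: "to_mat N M*P = P*D"
 proof (rule eq_matI)
 fix i k assume "i < dim_row (P*D)" "k < dim_col (P*D)"
 then have ik: "i < N" "k < N" by (simp_all add: P_def D_def)
 have "(to_mat N M*P) $$ (i, k) = (\<Sum>j\<in>{0..<N}. M (Suc i) (Suc j) * u (Suc k) (Suc j))"
 using ik by (simp add: to_mat_def P_def scalar_prod_def)
 also have "... = (\<Sum>j\<in>{1..N}. M (Suc i) j * u (Suc k) j)" by (rule shift)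
 also have "... = lam (Suc k) * u (Suc k) (Suc i)" using ik by (intro orth(3)[of _ 1 _ 1]) auto
 also have "... = (P*D) $$ (i, k)"
 using ik by (simp add: P_def D_def scalar_prod_def if_distrib[where f = "%x. _ * x"] cong: if_cong)
 finally show "(to_mat N M*P) $$ (i, k) = (P*D) $$ (i, k)" .
 qed (simp_all add: P_def D_def to_mat_def)
 have "to_mat N M = to_mat N M*(P*Q)" unfolding PQ using c by simp
 also have "... = to_mat N M*P*Q" by (rule assoc_mult_mat[symmetric]) (use c in auto)
 also have "... = P*D*Q" unfolding AP ..
 finally have "to_mat N M = P*D*Q" .
 from similar_matI[OF _ PQ QP this] have "similar_mat (to_mat N M) D" using c by auto
 then have "char_poly (to_mat N M) = char_poly D" by (rule char_poly_similar)
 also have "... = (\<Prod>a\<leftarrow>diag_mat D. [:- a, 1:])"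
 by (rule char_poly_upper_triangular[OF c(3)]) (auto simp: D_def upper_triangular_def)
 also have "diag_mat D = map lam [1..<Suc N]"
 proof -
 have "diag_mat D = map (%k. lam (Suc k)) [0..<N]" by (auto simp: diag_mat_def D_def)
 also have "... = map lam [1..<Suc N]" by (simp only: map_Suc_upt[symmetric] map_map o_def One_nat_def)
 finally show ?thesis .
 qed
 finally show ?thesis .
qed

lemma integral_ESD:
 assumes N: "N >= 1" and sp: "spectral {1..N} M lam u"
 shows "(\<integral>x. g x \<partial>ESD N M) = (\<Sum>k\<in>{1..N}. g (lam k))/real N"
proof -
 have "eigenvalues_mset N M = mset (map lam [1..<Suc N])"
 unfolding eigenvalues_mset_def char_poly_spectral[OF sp] by (rule proots_linear_list)
 also have "... = image_mset lam (mset_set {1..N})"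
 by (metis mset_map mset_upt atLeastLessThanSuc_atLeastAtMost)
 finally have "ESD N M = measure_pmf (map_pmf lam (pmf_of_set {1..N}))"
 using N unfolding ESD_def by (subst map_pmf_of_set) auto
 then show ?thesis using N by (simp add: integral_pmf_of_set)
qed

section \<open>Matrix entries as independent coordinates on all ordered pairs\<close>

text \<open>Independence is available only on U, whereas the product measure runs over all of J.
  Coordinates that are constantly 0 extend the product formula: a box that misses 0 in such a
  coordinate has probability zero on both sides, and otherwise the coordinate imposes no
  condition.\<close>

lemma (in prob_space) distr_PiM_extend_const:
 fixes Y :: "'i => 'a => real"
 assumes fin: "finite J" and U: "U \<subseteq> J" and ind: "indep_vars (%_. borel) Y U"
 and const: "!!e w. e : J-U ==> Y e w = 0" and meas: "!!e. Y e : borel_measurable M"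
 shows "distr M (PiM J (%_. borel)) (%w. \<lambda>e\<in>J. Y e w) = PiM J (%e. distr M borel (Y e))"
proof -
 interpret D: product_prob_space "%e. distr M borel (Y e)" J by (intro product_prob_spaceI prob_space_distr meas)
 have m: "(%w. \<lambda>e\<in>J. Y e w) : M \<rightarrow>\<^sub>M PiM J (%_. borel)" by (intro measurable_restrict meas)
 show ?thesis
 proof (rule D.PiM_eqI[OF fin])
 show "sets (distr M (PiM J (%_. borel)) (%w. \<lambda>e\<in>J. Y e w)) = sets (PiM J (%e. distr M borel (Y e)))"
 by (simp cong: sets_PiM_cong)
 fix A assume A: "!!e. e : J ==> A e : sets (distr M borel (Y e))"
 then have A': "!!e. e : J ==> A e : sets borel" by simp
 have PA: "Pi\<^sub>E J A : sets (PiM J (%_. borel))" using A' fin by (intro sets_PiM_I_finite) auto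
 have pre: "(%w. \<lambda>e\<in>J. Y e w) -` Pi\<^sub>E J A \<inter> space M = {w\<in>space M. \<forall>e\<in>J. Y e w : A e}" by (auto simp: PiE_iff)
 have "prob {w\<in>space M. \<forall>e\<in>J. Y e w : A e} = (\<Prod>e\<in>J. prob (Y e -` A e \<inter> space M))"
 proof (cases "\<exists>e\<in>J-U. 0 \<notin> A e")
 case True
 then obtain e where e: "e : J" "e : J-U" "0 \<notin> A e" by blast
 have "Y e w \<notin> A e" for w unfolding const[OF e(2)] by (rule e(3))
 then have 1: "{w\<in>space M. \<forall>e\<in>J. Y e w : A e} = {}" using e(1) by blast
 have "Y e -` A e \<inter> space M = {}" using e const[OF e(2)] by auto
 then have "prob (Y e -` A e \<inter> space M) = 0" by simp
 then have "(\<Prod>e\<in>J. prob (Y e -` A e \<inter> space M)) = 0" using e(1) fin by (intro prod_zero) auto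
 then show ?thesis unfolding 1 by simp
 next
 case False
 have c1: "Y e -` A e \<inter> space M = space M" if "e : J-U" for e using False const[OF that] that by auto
 have "(\<Prod>e\<in>J. prob (Y e -` A e \<inter> space M)) = (\<Prod>e\<in>U. prob (Y e -` A e \<inter> space M))"
 using U fin c1 by (intro prod.mono_neutral_right) (auto simp: prob_space)
 also have "... = prob {w\<in>space M. \<forall>e\<in>U. Y e w : A e}"
 proof (cases "U = {}")
 case True then show ?thesis by (simp add: prob_space)
 next
 case ne: False
 have "finite U" using U fin by (rule finite_subset)
 then have "prob (\<Inter>e\<in>U. Y e -` A e \<inter> space M) = (\<Prod>e\<in>U. prob (Y e -` A e \<inter> space M))"
 using ne U A' by (intro indep_varsD_finite[OF ind]) auto
 moreover have "(\<Inter>e\<in>U. Y e -` A e \<inter> space M) = {w\<in>space M. \<forall>e\<in>U. Y e w : A e}" using ne by auto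
 ultimately show ?thesis by simp
 qed
 also have "{w\<in>space M. \<forall>e\<in>U. Y e w : A e} = {w\<in>space M. \<forall>e\<in>J. Y e w : A e}" using c1 U by blast
 finally show ?thesis by simp
 qed
 then show "emeasure (distr M (PiM J (%_. borel)) (%w. \<lambda>e\<in>J. Y e w)) (Pi\<^sub>E J A) = (\<Prod>e\<in>J. emeasure (distr M borel (Y e)) (A e))"
 unfolding emeasure_distr[OF m PA] pre using A'
 by (simp add: emeasure_distr[OF meas] emeasure_eq_measure prod_ennreal)
 qed
qed

locale wigner_laplacian = prob_space P for P :: "'a measure" +
 fixes N :: nat and X :: "nat => nat => 'a => real"
 assumes N: "N >= 1"
 and meas: "!!i j. 1 <= i ==> i <= j ==> j <= N ==> X i j : borel_measurable P"
 and indep: "indep_vars (%_. borel) (%(i, j). X i j) {(i, j). 1 <= i \<and> i <= j \<and> j <= N}"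
 and mean: "!!i j. 1 <= i ==> i <= j ==> j <= N ==> integrable P (X i j)"
 and var: "!!i j. 1 <= i ==> i <= j ==> j <= N ==> integrable P (%w. (X i j w)^2)"
begin

abbreviation "I \<equiv> {1..N}"
definition "Z i j w = X i j w-expectation (X i j)"
definition "s i j = variance (X (min i j) (max i j))"
text \<open>Placing the scaled centred entries on the strict upper triangle, and 0 elsewhere, makes
  \<open>Lap I (%e. Y e w)\<close> the centered Laplacian.\<close>

definition "Y e w = (if fst e < snd e \<and> e : I \<times> I then Z (fst e) (snd e) w/sqrt (real N) else 0)"

lemma N0: "real N > 0" using N by simp

lemma Z_props:
 assumes "1 <= i" "i <= j" "j <= N"
 shows "Z i j : borel_measurable P" "integrable P (Z i j)" "expectation (Z i j) = 0"
 "integrable P (%w. (Z i j w)^2)" "expectation (%w. (Z i j w)^2) = s i j"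
proof -
 note m = meas[OF assms] mean[OF assms] var[OF assms]
 show "Z i j : borel_measurable P" unfolding Z_def[abs_def] using m by simp
 show "integrable P (Z i j)" unfolding Z_def[abs_def] using m by simp
 show "expectation (Z i j) = 0" unfolding Z_def[abs_def] using m by (simp add: prob_space)
 have "(%w. (Z i j w)^2) = (%w. (X i j w)^2-2 * expectation (X i j)*X i j w+(expectation (X i j))^2)"
 by (auto simp: Z_def power2_eq_square algebra_simps)
 then show "integrable P (%w. (Z i j w)^2)" using m by simp
 show "expectation (%w. (Z i j w)^2) = s i j" using assms by (simp add: s_def Z_def min_def max_def)
qed

lemma Y_upper: "e : I \<times> I ==> fst e < snd e ==> Y e = (%w. Z (fst e) (snd e) w/sqrt (real N))"
 by (rule ext) (simp add: Y_def)

lemma Y_zero: "\<not> (e : I \<times> I \<and> fst e < snd e) ==> Y e = (%w. 0)"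
 by (rule ext) (auto simp: Y_def)

lemma Y_meas: "Y e : borel_measurable P"
proof (cases "e : I \<times> I \<and> fst e < snd e")
 case True
 then have "Z (fst e) (snd e) : borel_measurable P" by (intro Z_props) auto
 then show ?thesis using True by (simp add: Y_upper)
next
 case False then show ?thesis by (simp add: Y_zero)
qed

lemma Y_integrals:
 assumes e: "e : I \<times> I"
 shows "integrable P (Y e)" "expectation (Y e) = 0" "integrable P (%w. (Y e w)^2)" "expectation (%w. (Y e w)^2) = upper_rates N s e"
proof -
 have "integrable P (Y e) \<and> expectation (Y e) = 0 \<and> integrable P (%w. (Y e w)^2) \<and> expectation (%w. (Y e w)^2) = upper_rates N s e"
 proof (cases "fst e < snd e")
 case True
 then have ij: "1 <= fst e" "fst e <= snd e" "snd e <= N" using e by auto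
 show ?thesis unfolding Y_upper[OF e True] power_divide using Z_props[OF ij] True N0
 by (simp add: upper_rates_def case_prod_beta)
 next
 case False then show ?thesis by (simp add: Y_zero upper_rates_def case_prod_beta)
 qed
 then show "integrable P (Y e)" "expectation (Y e) = 0" "integrable P (%w. (Y e w)^2)" "expectation (%w. (Y e w)^2) = upper_rates N s e" by blast+
qed

lemma indep_Y: "indep_vars (%_. borel) Y {e : I \<times> I. fst e < snd e}"
proof -
 let ?U = "{e : I \<times> I. fst e < snd e}"
 have "indep_vars (%_. borel) (%(i, j). X i j) ?U" by (rule indep_vars_subset[OF indep]) auto
 then have "indep_vars (%_. borel) (%e w. (%x. (x-expectation (X (fst e) (snd e)))/sqrt (real N)) ((case e of (i, j) => X i j) w)) ?U"
 by (rule indep_vars_compose2) simp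
 then show ?thesis
 by (rule indep_vars_cong[THEN iffD1, rotated -1]) (auto simp: Y_def Z_def fun_eq_iff)
qed

definition "\<rho> e = distr P borel (Y e)"

sublocale edge: edge_family \<rho> I "upper_rates N s"
proof (intro edge_family.intro real_product_family.intro edge_family_axioms.intro)
 show "prob_space (\<rho> e)" for e unfolding \<rho>_def by (rule prob_space_distr[OF Y_meas])
 show "sets (\<rho> e) = sets borel" for e by (simp add: \<rho>_def)
 fix e assume e: "e : I \<times> I"
 show "integrable (\<rho> e) (%y. y^2)" unfolding \<rho>_def using Y_integrals[OF e] by (subst integrable_distr_eq[OF Y_meas]) auto
 show "(\<integral>y. y \<partial>\<rho> e) = 0" unfolding \<rho>_def using Y_integrals[OF e] by (subst integral_distr[OF Y_meas]) auto
 show "(\<integral>y. y^2 \<partial>\<rho> e) = upper_rates N s e" unfolding \<rho>_def using Y_integrals[OF e] by (subst integral_distr[OF Y_meas]) auto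
qed simp

lemma integral_PiM_Y:
 fixes F :: "(nat \<times> nat => real) => 'b :: {banach, second_countable_topology}"
 assumes F: "F : borel_measurable (PiM (I \<times> I) \<rho>)" and cong: "!!y y'. (!!e. e : I \<times> I ==> y e = y' e) ==> F y = F y'"
 shows "(\<integral>w. F w \<partial>PiM (I \<times> I) \<rho>) = (\<integral>w. F (%e. Y e w) \<partial>P)"
proof -
 have F': "F : borel_measurable (PiM (I \<times> I) (%_. borel))" using F edge.measurable_PiM_rho by metis
 have "PiM (I \<times> I) \<rho> = distr P (PiM (I \<times> I) (%_. borel)) (%w. \<lambda>e\<in>I \<times> I. Y e w)"
 unfolding \<rho>_def[abs_def]
 by (rule distr_PiM_extend_const[OF _ _ indep_Y, symmetric]) (auto simp: Y_meas Y_zero)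
 then have "(\<integral>w. F w \<partial>PiM (I \<times> I) \<rho>) = (\<integral>w. F (\<lambda>e\<in>I \<times> I. Y e w) \<partial>P)"
 using integral_distr[OF measurable_restrict[OF Y_meas] F'] by simp
 also have "... = (\<integral>w. F (%e. Y e w) \<partial>P)" by (intro Bochner_Integration.integral_cong refl cong) auto
 finally show ?thesis .
qed

text \<open>The Lindeberg sum at level \<eta>, without its normalisation 1/N^2.\<close>

definition "big \<eta> = (\<Sum>i\<in>I. \<Sum>j\<in>I. expectation (%w. let d = Z (min i j) (max i j) w in d^2*(if \<bar>d\<bar> >= \<eta> * sqrt (real N) then 1 else 0)))"

context
 assumes s1: "!!i j. i : I ==> j : I ==> s i j <= 1"
begin

lemma unit_kernel_s: "unit_kernel I s"
 unfolding unit_kernel_def using s1 by (auto simp: s_def min.commute max.commute)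

text \<open>Split at |Z| = \<eta> sqrt N: below this level the cubic term is at most \<eta> Y^2, and
  above it the quadratic term is the Lindeberg integrand divided by N.\<close>

lemma truncated_sum:
 assumes \<eta>: "\<eta> > 0"
 shows "(\<Sum>e\<in>I \<times> I. \<integral>y. min (y^2) (\<bar>y\<bar> ^ 3) \<partial>\<rho> e) <= \<eta> * real N + big \<eta>/real N"
proof -
 let ?b = "%d. d^2*(if \<bar>d\<bar> >= \<eta> * sqrt (real N) then 1 else 0 :: real)"
 have b0: "0 <= expectation (%w. ?b (Z i j w))" for i j by (intro integral_nonneg_AE AE_I2) auto
 have "(\<integral>y. min (y^2) (\<bar>y\<bar> ^ 3) \<partial>\<rho> e) <= \<eta>/real N + expectation (%w. ?b (Z (min (fst e) (snd e)) (max (fst e) (snd e)) w))/real N"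
 if e: "e : I \<times> I" for e
 proof -
 have eq: "(\<integral>y. min (y^2) (\<bar>y\<bar> ^ 3) \<partial>\<rho> e) = expectation (%w. min ((Y e w)^2) (\<bar>Y e w\<bar> ^ 3))"
 unfolding \<rho>_def by (rule integral_distr[OF Y_meas]) simp
 show ?thesis
 proof (cases "fst e < snd e")
 case True
 then have ij: "1 <= fst e" "fst e <= snd e" "snd e <= N" using e by auto
 let ?Z = "Z (fst e) (snd e)"
 have Zm: "?Z : borel_measurable P" and Zi: "integrable P (%w. (?Z w)^2)" using Z_props[OF ij] by auto
 have bi: "integrable P (%w. ?b (?Z w))"
 by (rule Bochner_Integration.integrable_bound[OF Zi]) (use Zm in \<open>auto intro!: AE_I2\<close>)
 have "expectation (%w. min ((Y e w)^2) (\<bar>Y e w\<bar> ^ 3)) <= expectation (%w. \<eta>*(Y e w)^2+?b (?Z w)/real N)"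
 proof (rule integral_mono)
 show "integrable P (%w. min ((Y e w)^2) (\<bar>Y e w\<bar> ^ 3))"
 by (rule Bochner_Integration.integrable_bound[OF Y_integrals(3)[OF e]]) (use Y_meas[of e] in \<open>auto intro!: AE_I2\<close>)
 show "integrable P (%w. \<eta>*(Y e w)^2+?b (?Z w)/real N)" using Y_integrals(3)[OF e] bi by simp
 fix w
 define d where "d = ?Z w"
 have Yd: "Y e w = d/sqrt (real N)" using Y_upper[OF e True] by (simp add: d_def)
 have sq: "(Y e w)^2 = d^2/real N" unfolding Yd power_divide using N0 by simp
 show "min ((Y e w)^2) (\<bar>Y e w\<bar> ^ 3) <= \<eta>*(Y e w)^2+?b (?Z w)/real N"
 proof (cases "\<bar>d\<bar> >= \<eta> * sqrt (real N)")
 case True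
 then have "?b (?Z w)/real N = (Y e w)^2" using sq by (simp add: d_def)
 moreover have "0 <= \<eta>*(Y e w)^2" using \<eta> by simp
 ultimately show ?thesis using min.cobounded1[of "(Y e w)^2" "\<bar>Y e w\<bar> ^ 3"] by linarith
 next
 case False
 then have "\<bar>Y e w\<bar> <= \<eta>" unfolding Yd using N0 by (simp add: abs_divide pos_divide_le_eq)
 then have "\<bar>Y e w\<bar>*(Y e w)^2 <= \<eta>*(Y e w)^2" by (intro mult_right_mono) auto
 moreover have "\<bar>Y e w\<bar> ^ 3 = \<bar>Y e w\<bar>*(Y e w)^2" by (simp add: power3_eq_cube power2_eq_square)
 moreover have "?b (?Z w)/real N = 0" using False by (simp add: d_def)
 ultimately show ?thesis using min.cobounded2[of "(Y e w)^2" "\<bar>Y e w\<bar> ^ 3"] by linarith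
 qed
 qed
 also have "... = \<eta> * upper_rates N s e + expectation (%w. ?b (?Z w))/real N"
 using Y_integrals(3,4)[OF e] bi by simp
 also have "... <= \<eta>*(1/real N) + expectation (%w. ?b (?Z w))/real N"
 using upper_rates_bounds[OF unit_kernel_s e] \<eta> by (intro add_right_mono mult_left_mono) auto
 finally show ?thesis unfolding eq using ij by (simp add: min_absorb1 max_absorb2)
 next
 case False
 have "0 <= \<eta>/real N + expectation (%w. ?b (Z (min (fst e) (snd e)) (max (fst e) (snd e)) w))/real N"
 using \<eta> N0 b0 by (intro add_nonneg_nonneg divide_nonneg_pos) auto
 then show ?thesis unfolding eq using False by (simp add: Y_zero)
 qed
 qed
 then have "(\<Sum>e\<in>I \<times> I. \<integral>y. min (y^2) (\<bar>y\<bar> ^ 3) \<partial>\<rho> e)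
 <= (\<Sum>e\<in>I \<times> I. \<eta>/real N + expectation (%w. ?b (Z (min (fst e) (snd e)) (max (fst e) (snd e)) w))/real N)" by (rule sum_mono)
 also have "... = \<eta> * real N + big \<eta>/real N"
 unfolding big_def Let_def using N0
 by (simp add: sum.distrib card_cartesian_product sum_divide_distrib sum.cartesian_product case_prod_beta)
 finally show ?thesis .
qed

text \<open>Three errors: the distance of the sign model from m, the Lindeberg exchange, and the
  fluctuation of the trace. The fluctuation has variance of order N and is of order 1/sqrt N after
  normalisation. The number m stays free; it becomes the kernel integral of the limit.\<close>

theorem kernel_concentration:
 assumes z: "Im z > 0" and \<eta>: "\<eta> > 0"
 defines "bet \<equiv> 1/Im z"
 shows "(\<integral>w. \<bar>spectral_mean I (%e. Y e w) (cauchy_kernel z)-m\<bar> \<partial>P) <= \<bar>Im (mean_trace I z (upper_rates N s))/real N-m\<bar>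
 +(1+8 * bet ^ 4)/sqrt (real N)+(24 * bet ^ 3+32 * bet ^ 4)*(\<eta> + big \<eta>/(real N)^2+1/sqrt (real N))"
proof -
 let ?u = "upper_rates N s" and ?f = "trace_res I z"
 let ?T = "%w. ?f (%e. Y e w)"
 define C where "C = 24 * bet ^ 3+32 * bet ^ 4"
 have bet: "bet > 0" and C: "C >= 0" using z by (simp_all add: bet_def C_def)
 have finI: "finite I" by simp
 have Tm: "?T : borel_measurable P" by (rule measurable_trace_res[OF finI z Y_meas])
 have fm: "?f : borel_measurable (PiM (I \<times> I) \<rho>)"
 unfolding edge.measurable_PiM_rho by (rule measurable_trace_res[OF finI z, where Y = "%e w. w e"]) auto
 define q where "q = (\<integral>w. ?f w \<partial>PiM (I \<times> I) \<rho>)"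
 have usum: "(\<Sum>e\<in>I \<times> I. ?u e) <= real N"
 proof -
 have "(\<Sum>e\<in>I \<times> I. ?u e) <= (\<Sum>e\<in>I \<times> I. 1/real N)" using upper_rates_bounds[OF unit_kernel_s] by (intro sum_mono) auto
 then show ?thesis using N0 by (simp add: card_cartesian_product)
 qed
 have bnd: "cmod (?T w-q) <= 2 * real N * bet" for w
 proof -
 have "cmod q <= real N * bet"
 proof -
 interpret PE: prob_space "PiM (I \<times> I) \<rho>" by (rule prob_space_PiM[OF edge.prob_rho])
 have "cmod q <= (\<integral>w. cmod (?f w) \<partial>PiM (I \<times> I) \<rho>)" unfolding q_def by (rule integral_norm_bound)
 also have "... <= (\<integral>w. real N * bet \<partial>PiM (I \<times> I) \<rho>)"
 proof (rule integral_mono)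
 show "integrable (PiM (I \<times> I) \<rho>) (%w. cmod (?f w))"
 by (rule PE.integrable_const_bound[where B = "real N * bet"]) (use fm trace_res_bound[OF finI z] in \<open>auto simp: bet_def\<close>)
 show "integrable (PiM (I \<times> I) \<rho>) (%w. real N * bet)" by (rule PE.integrable_const)
 qed (use trace_res_bound[OF finI z] in \<open>auto simp: bet_def\<close>)
 finally show ?thesis using PE.prob_space by simp
 qed
 then show ?thesis using norm_triangle_ineq4[of "?T w" q] trace_res_bound[OF finI z, of "%e. Y e w"] by (simp add: bet_def)
 qed
 have var: "(\<integral>w. (cmod (?T w-q))^2 \<partial>P) <= 8 * bet ^ 4 * real N"
 proof -
 have "(\<integral>w. (cmod (?T w-q))^2 \<partial>P) = (\<integral>w. (cmod (?f w-q))^2 \<partial>PiM (I \<times> I) \<rho>)"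
 proof (rule integral_PiM_Y[symmetric])
 show "(%w. (cmod (?f w-q))^2) : borel_measurable (PiM (I \<times> I) \<rho>)" using fm by simp
 show "(cmod (?f y-q))^2 = (cmod (?f y'-q))^2" if "!!e. e : I \<times> I ==> y e = y' e" for y y'
 using trace_res_cong[of I y y' z, OF that] by simp
 qed
 also have "... <= 8 * bet ^ 4*(\<Sum>e\<in>I \<times> I. ?u e)"
 using edge.trace_res_variance[OF z] unfolding q_def bet_def .
 also have "... <= 8 * bet ^ 4 * real N" using usum bet by (intro mult_left_mono) auto
 finally show ?thesis .
 qed
 have i2: "integrable P (%w. (cmod (?T w-q))^2)"
 using bnd Tm by (intro integrable_const_bound[where B = "(2 * real N * bet)^2"]) (auto intro!: AE_I2 power_mono)
 have bias: "cmod (q-mean_trace I z ?u) <= C*(\<eta> * real N + big \<eta>/real N + sqrt (real N))"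
 proof -
 have "cmod (q-mean_trace I z ?u) <= C*(\<Sum>e\<in>I \<times> I. (\<integral>y. min (y^2) (\<bar>y\<bar> ^ 3) \<partial>\<rho> e)+?u e * sqrt (?u e))"
 using edge.universality[OF z] unfolding q_def C_def bet_def .
 also have "... <= C*(\<eta> * real N + big \<eta>/real N + sqrt (real N))"
 proof (rule mult_left_mono[OF _ C])
 have "(\<Sum>e\<in>I \<times> I. ?u e * sqrt (?u e)) <= (\<Sum>e\<in>I \<times> I. ?u e*(1/sqrt (real N)))"
 proof (intro sum_mono mult_left_mono)
 fix e assume e: "e : I \<times> I"
 have "sqrt (?u e) <= sqrt (1/real N)" using upper_rates_bounds[OF unit_kernel_s e] by simp
 then show "sqrt (?u e) <= 1/sqrt (real N)" by (simp add: real_sqrt_divide)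
 show "0 <= ?u e" using upper_rates_bounds[OF unit_kernel_s e] by simp
 qed
 also have "... = (\<Sum>e\<in>I \<times> I. ?u e)/sqrt (real N)" by (simp add: sum_divide_distrib)
 also have "... <= real N/sqrt (real N)" using usum by (intro divide_right_mono) auto
 also have "... = sqrt (real N)" using N0 by (simp add: real_div_sqrt)
 finally show "(\<Sum>e\<in>I \<times> I. (\<integral>y. min (y^2) (\<bar>y\<bar> ^ 3) \<partial>\<rho> e)+?u e * sqrt (?u e)) <= \<eta> * real N + big \<eta>/real N + sqrt (real N)"
 using truncated_sum[OF \<eta>] by (simp add: sum.distrib)
 qed
 finally show ?thesis .
 qed
 define b where "b = \<bar>Im (mean_trace I z ?u)/real N-m\<bar>+C*(\<eta> * real N + big \<eta>/real N + sqrt (real N))/real N+1/sqrt (real N)"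
 have rN: "sqrt (real N) > 0" "sqrt (real N) * sqrt (real N) = real N" using N0 by auto
 have pw: "\<bar>spectral_mean I (%e. Y e w) (cauchy_kernel z)-m\<bar> <= b+(cmod (?T w-q))^2/(real N * sqrt (real N))" for w
 proof -
 define x where "x = cmod (?T w-q)"
 have "spectral_mean I (%e. Y e w) (cauchy_kernel z) = Im (?T w)/real N" unfolding spectral_mean_kernel[OF finI] by simp
 moreover have "\<bar>Im (?T w)/real N-Im q/real N\<bar> <= x/real N"
 using abs_Im_le_cmod[of "?T w-q"] N0 unfolding x_def by (simp add: diff_divide_distrib[symmetric] abs_divide divide_right_mono)
 moreover have "\<bar>Im q/real N-Im (mean_trace I z ?u)/real N\<bar> <= C*(\<eta> * real N + big \<eta>/real N + sqrt (real N))/real N"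
 using order_trans[OF abs_Im_le_cmod[of "q-mean_trace I z ?u"] bias] N0 by (simp add: diff_divide_distrib[symmetric] abs_divide divide_right_mono)
 \<comment> \<open>Trades the first moment of the deviation for its second moment, balanced at sqrt
   N.\<close>
 moreover have "x/real N <= 1/sqrt (real N) + x^2/(real N * sqrt (real N))"
 proof -
 have "x * sqrt (real N) <= real N + x^2"
 proof -
 have "2 * x * sqrt (real N) <= x^2+(sqrt (real N))^2" by (rule sum_squares_bound)
 moreover have "(sqrt (real N))^2 = real N" by simp
 moreover have "0 <= x^2" by simp
 ultimately show ?thesis using N0 by linarith
 qed
 then have "x * sqrt (real N)/(real N * sqrt (real N)) <= (real N + x^2)/(real N * sqrt (real N))"
 using rN N0 by (intro divide_right_mono) auto
 then show ?thesis using rN N0 by (simp add: add_divide_distrib)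
 qed
 ultimately show ?thesis unfolding b_def x_def by linarith
 qed
 have "(\<integral>w. \<bar>spectral_mean I (%e. Y e w) (cauchy_kernel z)-m\<bar> \<partial>P) <= (\<integral>w. b+(cmod (?T w-q))^2/(real N * sqrt (real N)) \<partial>P)"
 proof (rule integral_mono)
 have "(%w. spectral_mean I (%e. Y e w) (cauchy_kernel z)) : borel_measurable P"
 unfolding spectral_mean_kernel[OF finI] using Tm by simp
 moreover have "\<bar>spectral_mean I (%e. Y e w) (cauchy_kernel z)\<bar> <= bet" for w
 proof -
 have "\<bar>spectral_mean I (%e. Y e w) (cauchy_kernel z)\<bar> <= spectral_mean I (%e. Y e w) (%_. bet)"
 unfolding bet_def by (rule spectral_mean_abs_le[OF cauchy_kernel_bound[OF z]])
 also have "spectral_mean I (%e. Y e w) (%_. bet) = bet" by (rule spectral_mean_const[OF finI]) (use N in auto)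
 finally show ?thesis .
 qed
 ultimately have "integrable P (%w. spectral_mean I (%e. Y e w) (cauchy_kernel z))" by (intro integrable_const_bound[where B = bet]) auto
 then show "integrable P (%w. \<bar>spectral_mean I (%e. Y e w) (cauchy_kernel z)-m\<bar>)" by simp
 qed (use i2 pw in auto)
 also have "... = b+(\<integral>w. (cmod (?T w-q))^2 \<partial>P)/(real N * sqrt (real N))" using i2 by (simp add: prob_space)
 also have "... <= b+8 * bet ^ 4 * real N/(real N * sqrt (real N))" using var N0 by (intro add_left_mono divide_right_mono) auto
 also have "... = \<bar>Im (mean_trace I z ?u)/real N-m\<bar>+(1+8 * bet ^ 4)/sqrt (real N)+C*(\<eta> + big \<eta>/(real N)^2+1/sqrt (real N))"
 proof -
 have "(\<eta> * real N + big \<eta>/real N + sqrt (real N))/real N = \<eta> + big \<eta>/(real N)^2+1/sqrt (real N)"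
 using N0 rN by (simp add: add_divide_distrib power2_eq_square sqrt_divide_self_eq inverse_eq_divide)
 then have "C*(\<eta> * real N + big \<eta>/real N + sqrt (real N))/real N = C*(\<eta> + big \<eta>/(real N)^2+1/sqrt (real N))"
 by (metis times_divide_eq_right)
 moreover have "8 * bet ^ 4 * real N/(real N * sqrt (real N)) = 8 * bet ^ 4/sqrt (real N)" using N0 by simp
 ultimately show ?thesis unfolding b_def by (simp add: add_divide_distrib)
 qed
 finally show ?thesis unfolding C_def .
qed

end

lemma Lap_row_sum: "i : I ==> (\<Sum>j\<in>I. Lap I y i j) = 0"
proof -
 assume i: "i : I"
 have e0: "(\<Sum>j\<in>I. edge e j) = 0" if "e : I \<times> I" for e
 proof -
 have "(\<Sum>j\<in>I. edge e j) = (\<Sum>j\<in>I. 1 * of_bool (fst e = j))-(\<Sum>j\<in>I. 1 * of_bool (snd e = j))" by (simp add: edge_def sum_subtractf)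
 also have "... = 0" using sum_of_bool_mult_left(3)[of I "fst e" "%_. 1 :: real"] sum_of_bool_mult_left(3)[of I "snd e" "%_. 1 :: real"] that
 by (simp add: mem_Times_iff)
 finally show ?thesis .
 qed
 have "(\<Sum>j\<in>I. Lap I y i j) =-(\<Sum>e\<in>I \<times> I. \<Sum>j\<in>I. y e*(edge e i * edge e j))"
 unfolding Lap_def sum_negf by (subst sum.swap) simp
 also have "(\<Sum>e\<in>I \<times> I. \<Sum>j\<in>I. y e*(edge e i * edge e j)) = (\<Sum>e\<in>I \<times> I. y e * edge e i*(\<Sum>j\<in>I. edge e j))"
 by (simp add: sum_distrib_left mult.assoc)
 also have "... = 0" using e0 by (intro sum.neutral ballI) simp
 finally show ?thesis by simp
qed

lemma Lap_off_diag:
 assumes ij: "i : I" "j : I" "i ~= j"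
 shows "Lap I y i j = y (i, j) + y (j, i)"
proof -
 have "(\<Sum>e\<in>I \<times> I. y e*(edge e i * edge e j)) = (\<Sum>e\<in>{(i, j), (j, i)}. y e*(edge e i * edge e j))"
 using ij by (intro sum.mono_neutral_right) (auto simp: edge_def)
 also have "... =-(y (i, j) + y (j, i))" using ij by (simp add: edge_def)
 finally show ?thesis by (simp add: Lap_def)
qed

lemma Lap_Y_off:
 assumes ij: "i : I" "j : I" "i ~= j"
 shows "Lap I (%e. Y e w) i j = Z (min i j) (max i j) w/sqrt (real N)"
 unfolding Lap_off_diag[OF ij] using ij by (cases i j rule: linorder_cases) (auto simp: Y_def min_def max_def)

end

context wigner_laplacian
begin

text \<open>Off the diagonal this is the definition of \<open>Y\<close>; on it, both sides are minus
  the sum of the rest of the row. The family \<open>X'\<close> over all sizes appears because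
  \<open>centered_laplacian\<close> takes one, while the locale fixes a single size.\<close>

lemma centered_laplacian_eq:
 assumes X': "X' N = X" and ij: "i : I" "j : I"
 shows "centered_laplacian P X' N w i j = Lap I (%e. Y e w) i j"
proof -
 have Xi: "integrable P (X (min i k) (max i k))" if "i : I" "k : I" for i k using that by (intro mean) auto
 have off: "centered_laplacian P X' N w i k = Lap I (%e. Y e w) i k" if "i : I" "k : I" "i ~= k" for i k
 unfolding Lap_Y_off[OF that] using that
 by (simp add: centered_laplacian_def exp_laplacian_def laplacian_def wigner_def X' Z_def)
 show ?thesis
 proof (cases "i = j")
 case False then show ?thesis using off ij by simp
 next
 case True
 have "laplacian N (wigner X' N w) i i-exp_laplacian P X' N i i =-(\<Sum>k\<in>I - {i}. Z (min i k) (max i k) w)"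
 proof -
 have "exp_laplacian P X' N i i =-(\<Sum>k\<in>I - {i}. expectation (X (min i k) (max i k)))"
 unfolding exp_laplacian_def laplacian_def wigner_def X' using Xi ij
 by (simp add: Bochner_Integration.integral_sum)
 then show ?thesis by (simp add: laplacian_def wigner_def X' Z_def sum_subtractf)
 qed
 then have "centered_laplacian P X' N w i i =-(\<Sum>k\<in>I - {i}. Z (min i k) (max i k) w/sqrt (real N))"
 unfolding centered_laplacian_def by (simp add: sum_divide_distrib)
 also have "(\<Sum>k\<in>I - {i}. Z (min i k) (max i k) w/sqrt (real N)) = (\<Sum>k\<in>I - {i}. Lap I (%e. Y e w) i k)"
 using ij by (intro sum.cong refl Lap_Y_off[symmetric]) auto
 also have "- ... = Lap I (%e. Y e w) i i"
 using Lap_row_sum[OF ij(1), of "%e. Y e w"] sum.remove[of I i "Lap I (%e. Y e w) i"] ij by simp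
 finally show ?thesis using True by simp
 qed
qed

lemma integral_ESD_centered:
 assumes X': "X' N = X"
 shows "(\<integral>x. g x \<partial>ESD N (centered_laplacian P X' N w)) = spectral_mean I (%e. Y e w) g"
proof -
 let ?L = "Lap I (%e. Y e w)"
 have "spectral I ?L (eigval I ?L) (eigvec I ?L)" by (rule spectral_eig) simp_all
 then have "spectral I (centered_laplacian P X' N w) (eigval I ?L) (eigvec I ?L)"
 proof (rule spectral_cong)
 fix i j assume "i : I" "j : I"
 then show "?L i j = centered_laplacian P X' N w i j" by (rule centered_laplacian_eq[where X' = X', OF X', symmetric])
 qed
 from integral_ESD[OF N this] show ?thesis by (simp add: spectral_mean_def)
qed

end

text \<open>At size 0 the spectral measure does not depend on the outcome. This settles
  measurability there, which \<open>weakly_in_probability\<close> demands for every N.\<close>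

lemma ESD_0: "ESD 0 M = ESD 0 M'"
proof -
 have "to_mat 0 M = to_mat 0 M'" by (rule eq_matI) (auto simp: to_mat_def)
 then show ?thesis by (simp add: ESD_def eigenvalues_mset_def)
qed

text \<open>If two limits gave different integrals of g, every outcome would be far from one of
  them. The two exceptional events would then cover the space, although both probabilities tend to
  0.\<close>

lemma weak_limit_unique:
 assumes P: "!!N. prob_space (P N)" and \<nu>: "real_distribution \<nu>" "real_distribution \<nu>'"
 and w: "weakly_in_probability P m \<nu>" "weakly_in_probability P m \<nu>'"
 shows "\<nu> = \<nu>'"
proof (rule real_distribution_eqI[OF \<nu>])
 fix g :: "real => real" assume g: "continuous_on UNIV g" "bounded (range g)"
 define a b where "a = (\<integral>x. g x \<partial>\<nu>)" and "b = (\<integral>x. g x \<partial>\<nu>')"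
 show "(\<integral>x. g x \<partial>\<nu>) = (\<integral>x. g x \<partial>\<nu>')"
 proof (rule ccontr)
 assume "\<not> ?thesis"
 then have ab: "\<bar>a-b\<bar> > 0" by (simp add: a_def b_def)
 define eps where "eps = \<bar>a-b\<bar>/3"
 have eps: "eps > 0" using ab by (simp add: eps_def)
 define A where "A = (%N c. {\<omega> : space (P N). \<bar>(\<integral>x. g x \<partial>m N \<omega>)-c\<bar> > eps})"
 have sets: "A N a : sets (P N)" "A N b : sets (P N)" for N
 using w g eps unfolding weakly_in_probability_def A_def a_def b_def by blast+
 have lim: "(%N. measure (P N) (A N a)) \<longlonglongrightarrow> 0" "(%N. measure (P N) (A N b)) \<longlonglongrightarrow> 0"
 using w g eps unfolding weakly_in_probability_def A_def a_def b_def by blast+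
 have "1 <= measure (P N) (A N a) + measure (P N) (A N b)" for N
 proof -
 interpret prob_space "P N" by (rule P)
 have "space (P N) \<subseteq> A N a \<union> A N b"
 proof
 fix w assume w: "w : space (P N)"
 have "\<bar>(\<integral>x. g x \<partial>m N w)-a\<bar> > eps \<or> \<bar>(\<integral>x. g x \<partial>m N w)-b\<bar> > eps"
 proof (rule ccontr)
 assume "\<not> ?thesis"
 then have "\<bar>(\<integral>x. g x \<partial>m N w)-a\<bar> <= eps" "\<bar>(\<integral>x. g x \<partial>m N w)-b\<bar> <= eps" by auto
 then have "\<bar>a-b\<bar> <= eps + eps" by linarith
 moreover have "\<bar>a-b\<bar> = 3 * eps" by (simp add: eps_def)
 ultimately have "3 * eps <= eps + eps" by metis
 then show False using eps by linarith
 qed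
 then show "w : A N a \<union> A N b" using w by (auto simp: A_def)
 qed
 then have "prob (space (P N)) <= prob (A N a \<union> A N b)" using sets by (intro finite_measure_mono) auto
 also have "... <= prob (A N a) + prob (A N b)" by (rule measure_Un_le[OF sets])
 finally show ?thesis by (simp add: prob_space)
 qed
 then have "1 <= (0+0 :: real)" using tendsto_add[OF lim] by (intro LIMSEQ_le_const) auto
 then show False by simp
 qed
qed

section \<open>Identification of the limit, convergence in probability and support\<close>

theorem mainTheorem1:
  fixes P :: "nat \<Rightarrow> 'a measure"
    and X :: "nat \<Rightarrow> nat \<Rightarrow> nat \<Rightarrow> 'a \<Rightarrow> real"
    and W :: "real \<times> real \<Rightarrow> real"
  assumes prob: "\<And>N. prob_space (P N)"
    and meas: "\<And>N i j. 1 \<le> i \<Longrightarrow> i \<le> j \<Longrightarrow> j \<le> N \<Longrightarrow> X N i j \<in> borel_measurable (P N)"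
    and indep: "\<And>N. prob_space.indep_vars (P N) (\<lambda>_. borel) (\<lambda>(i, j). X N i j)
                       {(i, j). 1 \<le> i \<and> i \<le> j \<and> j \<le> N}"
    and mean: "\<And>N i j. 1 \<le> i \<Longrightarrow> i \<le> j \<Longrightarrow> j \<le> N \<Longrightarrow> integrable (P N) (X N i j)"
    and var: "\<And>N i j. 1 \<le> i \<Longrightarrow> i \<le> j \<Longrightarrow> j \<le> N \<Longrightarrow> integrable (P N) (\<lambda>\<omega>. (X N i j \<omega>)\<^sup>2)"
    and L1: "\<And>N i j. 1 \<le> N \<Longrightarrow> i \<in> {1..N} \<Longrightarrow> j \<in> {1..N} \<Longrightarrow> var_profile (P N) X N i j \<le> 1"
    and L2: "\<And>\<eta>. \<eta> > 0 \<Longrightarrow>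
      (\<lambda>N. (1 / (real N)\<^sup>2) * (\<Sum>i\<in>{1..N}. \<Sum>j\<in>{1..N}.
         \<integral>\<omega>. (let d = X N (min i j) (max i j) \<omega> - (\<integral>\<omega>'. X N (min i j) (max i j) \<omega>' \<partial>P N)
               in d\<^sup>2 * (if \<bar>d\<bar> \<ge> \<eta> * sqrt (real N) then 1 else 0)) \<partial>P N))
      \<longlonglongrightarrow> 0"
    and L3_graphon: "graphon W"
    and L3: "(\<lambda>N. cut_dist (empirical_graphon N (var_profile (P N) X N)) W) \<longlonglongrightarrow> 0"
  shows "(\<exists>!\<nu>. real_distribution \<nu> \<and> symmetric_measure \<nu> \<and> moment_determinate \<nu> \<and>
            weakly_in_probability P (\<lambda>N \<omega>. ESD N (centered_laplacian (P N) X N \<omega>)) \<nu>)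
       \<and> (\<forall>\<nu>. real_distribution \<nu> \<and> symmetric_measure \<nu> \<and> moment_determinate \<nu> \<and>
            weakly_in_probability P (\<lambda>N \<omega>. ESD N (centered_laplacian (P N) X N \<omega>)) \<nu> \<longrightarrow>
            (\<forall>U. open U \<and> U \<noteq> {} \<and> U \<subseteq> unit_sq \<and> (\<forall>p\<in>U. W p > 0) \<longrightarrow>
                 \<not> bounded (measure_support \<nu>)))"
proof -
 have wl: "wigner_laplacian (P N) N (X N)" if "N >= 1" for N
 by (intro wigner_laplacian.intro wigner_laplacian_axioms.intro prob meas indep mean var that)
 define s where "s = (%N. var_profile (P N) X N)"
 have s_eq: "wigner_laplacian.s (P N) (X N) = s N" if "N >= 1" for N
 proof -
 interpret w: wigner_laplacian "P N" N "X N" by (rule wl[OF that])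
 show ?thesis by (intro ext) (simp add: s_def w.s_def var_profile_def)
 qed
 have uk: "unit_kernel {1..N} (s N)" for N
 proof (cases "N >= 1")
 case True
 interpret w: wigner_laplacian "P N" N "X N" by (rule wl[OF True])
 have "wigner_laplacian.s (P N) (X N) i j <= 1" if "i : {1..N}" "j : {1..N}" for i j
 unfolding s_eq[OF True] s_def by (rule L1[OF True that])
 then have "unit_kernel {1..N} (wigner_laplacian.s (P N) (X N))" by (rule w.unit_kernel_s)
 then show ?thesis unfolding s_eq[OF True] .
 qed (simp add: unit_kernel_def)
 define t where "t = (%N. upper_rates N (s N))"
 interpret ps: profile_sequence t
 by standard (use upper_rates_bounds[OF uk] upper_rates_row[OF uk] in \<open>auto simp: t_def\<close>)
 obtain \<nu> and r :: "nat => nat" where \<nu>: "real_distribution \<nu>" and r: "strict_mono r" and \<nu>_sym: "symmetric_measure \<nu>"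
 and \<nu>_cosh: "!!c. integrable \<nu> (%x. cosh (c * x))" and \<nu>_det: "moment_determinate \<nu>"
 and conv: "!!g :: real => real. continuous_on UNIV g ==> bounded (range g) ==> (%n. \<integral>x. g x \<partial>ps.mu (r n)) \<longlonglongrightarrow> (\<integral>x. g x \<partial>\<nu>)"
 using ps.limit_exists by metis
 have \<nu>2: "integrable \<nu> (%x. x^2)" using \<nu>_det unfolding moment_determinate_def by blast
 have s3: "(%N. cut_dist (empirical_graphon N (s N)) W) \<longlonglongrightarrow> 0" using L3 by (simp add: s_def)
 \<comment> \<open>Traces converge along all sizes, and the subsequence r only identifies their
   limit as a kernel integral against \<open>\<nu>\<close>. This removes the subsequence from
   everything that follows.\<close>
 have trace_lim: "(%n. Im (mean_trace {1..Suc n} z (t (Suc n)))/real (Suc n)) \<longlonglongrightarrow> (\<integral>x. cauchy_kernel z x \<partial>\<nu>)"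
 if z: "Im z > 0" for z
 proof -
 obtain L where L: "(%N. scaled_trace {1..N} z (s N)) \<longlonglongrightarrow> L"
 using scaled_trace_convergent[OF L3_graphon uk s3 z] unfolding convergent_def by blast
 have "(%n. mean_trace {1..Suc n} z (t (Suc n))/of_nat (Suc n)-scaled_trace {1..Suc n} z (s (Suc n))) \<longlonglongrightarrow> 0"
 proof (rule Lim_null_comparison)
 show "\<forall>\<^sub>F n in sequentially. norm (mean_trace {1..Suc n} z (t (Suc n))/of_nat (Suc n)-scaled_trace {1..Suc n} z (s (Suc n)))
 <= cut_const z*(1/real (Suc n)+2/sqrt (real (Suc n)))"
 unfolding t_def by (intro always_eventually allI mean_trace_upper_rates[OF uk _ z]) simp
 have "(%n. cut_const z*(1/real (Suc n)+2/sqrt (real (Suc n)))) \<longlonglongrightarrow> cut_const z*(0+0)"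
 by (intro tendsto_mult tendsto_add tendsto_const LIMSEQ_Suc[OF lim_const_over_n] LIMSEQ_Suc[OF lim_const_over_sqrt])
 then show "(%n. cut_const z*(1/real (Suc n)+2/sqrt (real (Suc n)))) \<longlonglongrightarrow> 0" by simp
 qed
 from tendsto_add[OF this LIMSEQ_Suc[OF L]]
 have "(%n. mean_trace {1..Suc n} z (t (Suc n))/of_nat (Suc n)) \<longlonglongrightarrow> L" by simp
 then have lim: "(%n. Im (mean_trace {1..Suc n} z (t (Suc n))/of_nat (Suc n))) \<longlonglongrightarrow> Im L" by (rule tendsto_Im)
 have eq: "Im (mean_trace {1..Suc n} z (t (Suc n))/of_nat (Suc n)) = Im (mean_trace {1..Suc n} z (t (Suc n)))/real (Suc n)" for n
 by (rule Im_divide_of_nat)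
 have mu: "(\<integral>x. cauchy_kernel z x \<partial>ps.mu n) = Im (mean_trace {1..Suc n} z (t (Suc n)))/real (Suc n)" for n
 unfolding ps.mu_def by (subst integral_cauchy_kernel_mean_esd) (use z in auto)
 have "(%n. \<integral>x. cauchy_kernel z x \<partial>ps.mu (r n)) \<longlonglongrightarrow> Im L"
 unfolding mu using LIMSEQ_subseq_LIMSEQ[OF lim[unfolded eq] r] by (simp add: o_def)
 moreover have "(%n. \<integral>x. cauchy_kernel z x \<partial>ps.mu (r n)) \<longlonglongrightarrow> (\<integral>x. cauchy_kernel z x \<partial>\<nu>)"
 using cauchy_kernel_bound[OF z] by (intro conv continuous_cauchy_kernel[OF z]) (auto simp: bounded_iff)
 ultimately have "Im L = (\<integral>x. cauchy_kernel z x \<partial>\<nu>)" by (rule LIMSEQ_unique)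
 then show ?thesis using lim unfolding eq by simp
 qed
 define Y where "Y = (%N. wigner_laplacian.Y (P N) N (X N))"
 \<comment> \<open>Sizes are written as \<open>Suc n\<close>, since size 0 has an empty vertex set;
   the shift is undone once the probabilities converge.\<close>
 have kernel: "(%n. \<integral>w. \<bar>spectral_mean {1..Suc n} (%e. Y (Suc n) e w) (cauchy_kernel z)-(\<integral>x. cauchy_kernel z x \<partial>\<nu>)\<bar> \<partial>P (Suc n)) \<longlonglongrightarrow> 0"
 if z: "Im z > 0" for z
 proof (rule LIMSEQ_I)
 fix e :: real assume e: "e > 0"
 define bet where "bet = 1/Im z"
 define C where "C = 24 * bet ^ 3+32 * bet ^ 4"
 have C: "C >= 0" using z by (simp add: C_def bet_def)
 \<comment> \<open>The term C \<eta> does not vanish with N, so it is given half of e.\<close>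
 define \<eta> where "\<eta> = e/(2*(C+1))"
 have \<eta>: "\<eta> > 0" using e C by (simp add: \<eta>_def)
 have C\<eta>: "C*\<eta> <= e/2"
 proof -
 have "C*\<eta> <= (C+1)*\<eta>" using \<eta> by (intro mult_right_mono) auto
 also have "(C+1)*\<eta> = e/2"
 proof -
 define h where "h = C+1"
 have "h ~= 0" using C by (simp add: h_def)
 then show ?thesis unfolding \<eta>_def h_def[symmetric] by simp
 qed
 finally show ?thesis .
 qed
 define m where "m = (\<integral>x. cauchy_kernel z x \<partial>\<nu>)"
 define B where "B = (%N. wigner_laplacian.big (P N) N (X N) \<eta>)"
 let ?R = "%N. \<bar>Im (mean_trace {1..N} z (t N))/real N-m\<bar>+(1+8 * bet ^ 4)/sqrt (real N)+C*(\<eta>+B N/(real N)^2+1/sqrt (real N))"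
 have le: "(\<integral>w. \<bar>spectral_mean {1..N} (%e. Y N e w) (cauchy_kernel z)-m\<bar> \<partial>P N) <= ?R N" if N: "N >= 1" for N
 proof -
 interpret w: wigner_laplacian "P N" N "X N" by (rule wl[OF N])
 have "wigner_laplacian.s (P N) (X N) i j <= 1" if "i : {1..N}" "j : {1..N}" for i j
 unfolding s_eq[OF N] s_def by (rule L1[OF N that])
 from w.kernel_concentration[OF this z \<eta>, of m] show ?thesis
 by (simp only: Y_def B_def t_def C_def bet_def s_eq[OF N])
 qed
 have BL: "(%N. B N/(real N)^2) \<longlonglongrightarrow> 0"
 proof (rule Lim_transform_eventually[OF L2[OF \<eta>]])
 show "\<forall>\<^sub>F N in sequentially. (1/(real N)^2)*(\<Sum>i\<in>{1..N}. \<Sum>j\<in>{1..N}.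
 \<integral>\<omega>. (let d = X N (min i j) (max i j) \<omega>-(\<integral>\<omega>'. X N (min i j) (max i j) \<omega>' \<partial>P N)
 in d^2*(if \<bar>d\<bar> >= \<eta> * sqrt (real N) then 1 else 0)) \<partial>P N) = B N/(real N)^2"
 using eventually_ge_at_top[of 1]
 proof eventually_elim
 fix N :: nat assume N: "N >= 1"
 interpret w: wigner_laplacian "P N" N "X N" by (rule wl[OF N])
 show "(1/(real N)^2)*(\<Sum>i\<in>{1..N}. \<Sum>j\<in>{1..N}.
 \<integral>\<omega>. (let d = X N (min i j) (max i j) \<omega>-(\<integral>\<omega>'. X N (min i j) (max i j) \<omega>' \<partial>P N)
 in d^2*(if \<bar>d\<bar> >= \<eta> * sqrt (real N) then 1 else 0)) \<partial>P N) = B N/(real N)^2"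
 unfolding B_def w.big_def w.Z_def by simp
 qed
 qed
 have "(%n. ?R (Suc n)) \<longlonglongrightarrow> \<bar>m-m\<bar>+0+C*(\<eta>+0+0)"
 using trace_lim[OF z, folded m_def]
 by (intro tendsto_add tendsto_mult tendsto_const tendsto_rabs tendsto_diff LIMSEQ_Suc[OF BL] LIMSEQ_Suc[OF lim_const_over_sqrt])
 then have "\<forall>\<^sub>F n in sequentially. ?R (Suc n) < e" by (rule order_tendstoD(2)) (use C\<eta> e in simp)
 then obtain n0 where n0: "!!n. n >= n0 ==> ?R (Suc n) < e" unfolding eventually_sequentially by blast
 show "\<exists>no. \<forall>n\<ge>no. norm ((\<integral>w. \<bar>spectral_mean {1..Suc n} (%e. Y (Suc n) e w) (cauchy_kernel z)-(\<integral>x. cauchy_kernel z x \<partial>\<nu>)\<bar> \<partial>P (Suc n))-0) < e"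
 proof (intro exI[of _ n0] allI impI)
 fix n assume n: "n >= n0"
 have "0 <= (\<integral>w. \<bar>spectral_mean {1..Suc n} (%e. Y (Suc n) e w) (cauchy_kernel z)-m\<bar> \<partial>P (Suc n))" by (intro integral_nonneg_AE AE_I2) simp
 then show "norm ((\<integral>w. \<bar>spectral_mean {1..Suc n} (%e. Y (Suc n) e w) (cauchy_kernel z)-(\<integral>x. cauchy_kernel z x \<partial>\<nu>)\<bar> \<partial>P (Suc n))-0) < e"
 using order_le_less_trans[OF le[of "Suc n"] n0[OF n]] unfolding m_def[symmetric] by simp
 qed
 qed
 have Ym: "Y (Suc n) e : borel_measurable (P (Suc n))" for n e
 proof -
 interpret w: wigner_laplacian "P (Suc n)" "Suc n" "X (Suc n)" by (rule wl) simp
 show ?thesis unfolding Y_def by (rule w.Y_meas)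
 qed
 have L1conv: "(%n. \<integral>w. \<bar>spectral_mean {1..Suc n} (%e. Y (Suc n) e w) g-(\<integral>x. g x \<partial>\<nu>)\<bar> \<partial>P (Suc n)) \<longlonglongrightarrow> 0"
 if g: "continuous_on UNIV g" "bounded (range g)" for g :: "real => real"
 by (rule mean_convergence_from_kernels[where P = "%n. P (Suc n)" and I = "%n. {1..Suc n}" and Y = "%n. Y (Suc n)", OF prob _ _ Ym \<nu> \<nu>2 kernel g]) auto
 have esd: "(\<integral>x. g x \<partial>ESD (Suc n) (centered_laplacian (P (Suc n)) X (Suc n) w)) = spectral_mean {1..Suc n} (%e. Y (Suc n) e w) g"
 for g :: "real => real" and n w
 proof -
 interpret w: wigner_laplacian "P (Suc n)" "Suc n" "X (Suc n)" by (rule wl) simp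
 show ?thesis unfolding Y_def by (rule w.integral_ESD_centered) (rule refl)
 qed
 let ?E = "%N \<omega>. ESD N (centered_laplacian (P N) X N \<omega>)"
 have main: "weakly_in_probability P ?E \<nu>" unfolding weakly_in_probability_def
 proof (intro allI impI, elim conjE)
 fix g :: "real => real" and eps :: real assume g: "continuous_on UNIV g" "bounded (range g)" and eps: "eps > 0"
 let ?c = "\<integral>x. g x \<partial>\<nu>"
 let ?A = "%N. {\<omega> : space (P N). \<bar>(\<integral>x. g x \<partial>?E N \<omega>)-?c\<bar> > eps}"
 obtain G where G: "!!x. \<bar>g x\<bar> <= G" using g(2) unfolding bounded_iff by (metis rangeI real_norm_def)
 have Sm: "(%w. spectral_mean {1..Suc n} (%e. Y (Suc n) e w) g) : borel_measurable (P (Suc n))" for n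
 by (rule spectral_mean_measurable[OF _ _ Ym g]) auto
 have A_eq: "?A (Suc n) = {w : space (P (Suc n)). \<bar>spectral_mean {1..Suc n} (%e. Y (Suc n) e w) g-?c\<bar> > eps}" for n
 by (simp only: esd)
 have sets: "?A N : sets (P N)" for N
 proof (cases N)
 case 0
 \<comment> \<open>By \<open>ESD_0\<close> the event is the same for all outcomes, hence empty or
   the whole space.\<close>
 have "?A 0 = {} \<or> ?A 0 = space (P 0)" using ESD_0 by (auto; metis)
 then have "?A 0 : sets (P 0)"
 proof
 assume "?A 0 = {}"
 then show ?thesis by (rule ssubst) (rule sets.empty_sets)
 next
 assume "?A 0 = space (P 0)"
 then show ?thesis by (rule ssubst) (rule sets.top)
 qed
 then show ?thesis unfolding 0 .
 next
 case (Suc n)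
 show ?thesis unfolding Suc A_eq using Sm[of n] by measurable
 qed
 have "(%n. measure (P (Suc n)) (?A (Suc n))) \<longlonglongrightarrow> 0"
 proof (rule Lim_null_comparison)
 let ?D = "%n. \<integral>w. \<bar>spectral_mean {1..Suc n} (%e. Y (Suc n) e w) g-?c\<bar> \<partial>P (Suc n)"
 show "\<forall>\<^sub>F n in sequentially. norm (measure (P (Suc n)) (?A (Suc n))) <= ?D n/eps"
 proof (intro always_eventually allI)
 fix n
 interpret prob_space "P (Suc n)" by (rule prob)
 let ?S = "%w. spectral_mean {1..Suc n} (%e. Y (Suc n) e w) g"
 have "\<bar>?S w\<bar> <= G" for w
 using spectral_mean_abs_le[of g "%_. G" "{1..Suc n}" "%e. Y (Suc n) e w", OF G] spectral_mean_const[of "{1..Suc n}" _ G] by simp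
 then have "integrable (P (Suc n)) ?S" using Sm[of n] by (intro integrable_const_bound[where B = G]) auto
 then have i: "integrable (P (Suc n)) (%w. \<bar>?S w-?c\<bar>)" by simp
 have "prob (?A (Suc n)) <= prob {w : space (P (Suc n)). \<bar>?S w-?c\<bar> >= eps}"
 unfolding A_eq using Sm[of n] by (intro finite_measure_mono) auto
 also have "... <= ?D n/eps"
 by (rule integral_Markov_inequality_measure[OF i, where A = "{}"]) (use eps in auto)
 finally show "norm (measure (P (Suc n)) (?A (Suc n))) <= ?D n/eps" by simp
 qed
 show "(%n. ?D n/eps) \<longlonglongrightarrow> 0" using tendsto_divide[OF L1conv[OF g] tendsto_const[of eps]] eps by simp
 qed
 then show "(\<forall>N. ?A N : sets (P N)) \<and> (%N. measure (P N) (?A N)) \<longlonglongrightarrow> 0"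
 using sets by (intro conjI allI) (auto intro: LIMSEQ_imp_Suc)
 qed
 have unique: "\<nu>' = \<nu>" if "real_distribution \<nu>'" "weakly_in_probability P ?E \<nu>'" for \<nu>'
 by (rule weak_limit_unique[OF prob that(1) \<nu> that(2) main])
 have unbounded: "\<not> bounded (measure_support \<nu>)"
 if U: "open U" "U ~= {}" "U \<subseteq> unit_sq" "!!p. p : U ==> W p > 0" for U
 proof -
 define w where "w = (\<integral>p. W p \<partial>(unit_interval_measure \<Otimes>\<^sub>M unit_interval_measure))"
 have w: "w > 0" unfolding w_def by (rule graphon_integral_pos[OF L3_graphon U])
 have "\<forall>\<^sub>F N in sequentially. w/2 < (\<Sum>i\<in>{1..N}. \<Sum>j\<in>{1..N}. s N i j)/(real N)^2"
 using density_limit[OF L3_graphon uk s3, folded w_def] w by (intro order_tendstoD(1)) auto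
 moreover have "\<forall>\<^sub>F N in sequentially. 4/w <= real N"
 using filterlim_real_sequentially unfolding filterlim_at_top by blast
 \<comment> \<open>A density above w/2 leaves at least (N w/2 - 1)/2 on the strict upper triangle,
   and N >= 4/w makes this at least N w/8.\<close>
 ultimately have "\<forall>\<^sub>F N in sequentially. (\<Sum>e\<in>{1..N} \<times> {1..N}. t N e) >= w/8 * real N"
 using eventually_ge_at_top[of 1]
 proof eventually_elim
 fix N :: nat assume d: "w/2 < (\<Sum>i\<in>{1..N}. \<Sum>j\<in>{1..N}. s N i j)/(real N)^2" and N4: "4/w <= real N" and N: "1 <= N"
 have "w/2 * real N <= (\<Sum>i\<in>{1..N}. \<Sum>j\<in>{1..N}. s N i j)/real N"
 using mult_right_mono[OF less_imp_le[OF d], of "real N"] N by (simp add: power2_eq_square)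
 moreover have "4 <= real N * w" using N4 w by (simp add: pos_divide_le_eq)
 moreover have "(\<Sum>e\<in>{1..N} \<times> {1..N}. t N e) >= ((\<Sum>i\<in>{1..N}. \<Sum>j\<in>{1..N}. s N i j)/real N-1)/2"
 unfolding t_def by (rule upper_rates_sum[OF uk N])
 ultimately show "(\<Sum>e\<in>{1..N} \<times> {1..N}. t N e) >= w/8 * real N" by (simp add: algebra_simps)
 qed
 then show ?thesis
 using w upper_rates_bounds[OF uk] by (intro ps.unbounded_support[OF \<nu> r conv, where w = "w/8"]) (auto simp: t_def upper_rates_def)
 qed
 show ?thesis
 proof (intro conjI allI impI)
 show "\<exists>!\<nu>. real_distribution \<nu> \<and> symmetric_measure \<nu> \<and> moment_determinate \<nu> \<and> weakly_in_probability P ?E \<nu>"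
 proof (rule ex1I[of _ \<nu>])
 show "real_distribution \<nu> \<and> symmetric_measure \<nu> \<and> moment_determinate \<nu> \<and> weakly_in_probability P ?E \<nu>"
 by (intro conjI \<nu> \<nu>_sym \<nu>_det main)
 next
 fix \<nu>'
 assume "real_distribution \<nu>' \<and> symmetric_measure \<nu>' \<and> moment_determinate \<nu>' \<and> weakly_in_probability P ?E \<nu>'"
 then show "\<nu>' = \<nu>" by (elim conjE) (rule unique)
 qed
 next
 fix \<nu>' U
 assume "real_distribution \<nu>' \<and> symmetric_measure \<nu>' \<and> moment_determinate \<nu>' \<and> weakly_in_probability P ?E \<nu>'"
 and U: "open U \<and> U ~= {} \<and> U \<subseteq> unit_sq \<and> (\<forall>p\<in>U. W p > 0)"
 then have "\<nu>' = \<nu>" using unique by blast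
 then show "\<not> bounded (measure_support \<nu>')" using unbounded[of U] U by blast
 qed
qed

end
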